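(* Let $0\le v\le u$ be integers and let $D$ be a disk with coordinates $z_1,\dots,z_u$: either the formal disk over a field $k$ of characteristic zero, or a complex analytic disk ($k=\mathbb{C}$), or a smooth real disk ($k=\mathbb{R}$). Let $L_s=\{z_s=0\}\subset D$ for $1\le s\le v$. For $m\ge 0$ and $n_1,\dots,n_m\ge0$ let $\mathcal{Z}_{n_1,\dots,n_m}$ be the $k$-vector space of closed differential forms in $D^m$ of degree $n_t$ with respect to the $t$-th group of variables for every $1\le t\le m$, with logarithmic singularities along the hyperplanes $D^t\times L_s\times D^{m-t-1}$ ($0\le t\le m-1$, $1\le s\le v$). Consider the positive quasi-algebra $\mathcal{Z}$ with these components, whose quasi-multiplications are the pull-backs along $\mathrm{Id}_D^{t-1}\times\Delta_D\times\mathrm{Id}_D^{m-t-1}\colon D^{m-1}\to D^m$, where $\Delta_D\colon D\to D\times D$ is the diagonal. Then the quasi-algebra $\mathcal{Z}$ is Koszul. Moreover, its quadratic dual quasi-coalgebra $\mathcal{C}$ is Koszul, too.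
   Context: Forms. On $D^m$ (which in the formal case means the formal disk with the $mu$ coordinates $z^{(t)}_s$, $1\le t\le m$, $1\le s\le u$), a form with logarithmic singularities is a linear combination, with coefficients regular functions on $D^m$ (formal power series, holomorphic functions, or real $C^\infty$ functions, respectively), of exterior products of the $1$-forms $dz^{(t)}_s/z^{(t)}_s$ ($s\le v$) and $dz^{(t)}_r$ ($r>v$). The degree with respect to the $t$-th group of variables counts factors with superscript $(t)$. For $m=0$, $\mathcal{Z}_\varnothing=k$. Quasi-algebras. A (quasi-associative graded) quasi-algebra over a field $k$ is a family of vector spaces $\mathcal{Z}_{n_1,\dots,n_m}$ ($m\ge0$, $n_t\in\mathbb{Z}$), with $\mathcal{Z}_\varnothing=k$, endowed with quasi-multiplication maps $\mathcal{Z}_{n_1,\dots,n_m}\to\mathcal{Z}_{n_1,\dots,n_{t-1},n_t+n_{t+1},n_{t+2},\dots,n_m}$ and quasi-unit maps $\mathcal{Z}_{n_1,\dots,n_m}\to\mathcal{Z}_{n_1,\dots,n_t,0,n_{t+1},\dots,n_m}$ satisfying the identities that hold for the multiplication and unit maps between the tensor products $Z_{n_1}\otimes_k\dots\otimes_k Z_{n_m}$ of the components of a graded associative unital algebra $Z$ (merging two disjoint adjacent pairs in either order agrees; merging three consecutive indices in either order agrees; quasi-units commute with quasi-multiplications; inserting $0$ and then adding it to a neighboring index is the identity). It is nonnegative if $\mathcal{Z}_{n_1,\dots,n_m}=0$ whenever some $n_t<0$, and positive if moreover all quasi-unit maps are isomorphisms. In the quasi-algebra of closed forms, the quasi-units are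 the pull-backs along the projections $D^{m+1}\to D^m$. Koszul quasi-algebras. For a positive quasi-algebra $\mathcal{Z}$ and $n_1,\dots,n_m\ge0$, let $\mathcal{B}_{n_1,\dots,n_m}$ be the complex whose term in homological degree $r$ is the direct sum of $\mathcal{Z}_{c}$ over all sequences $c$ of $r$ positive integers obtained by concatenating compositions (ordered partitions into positive parts) of $n_1$, of $n_2$, ..., of $n_m$ (a composition of $0$ is empty), with differential the alternating sum, with sign $(-1)^j$, of the quasi-multiplications merging the $j$-th and $(j+1)$-th entries of $c$ whenever these belong to the composition of the same $n_t$. (For a graded algebra, this is the tensor product of the components of degrees $n_1,\dots,n_m$ of the reduced bar-complex.) $\mathcal{Z}$ is Koszul if every complex $\mathcal{B}_{n_1,\dots,n_m}$ has no homology except in homological degree $n_1+\dots+n_m$. Quasi-coalgebras. Quasi-coalgebras and positive quasi-coalgebras are defined by inverting all arrows: there are quasi-comultiplications $\mathcal{C}_{n_1,\dots,n_{t-1},n_t+n_{t+1},n_{t+2},\dots,n_m}\to\mathcal{C}_{n_1,\dots,n_m}$ and quasi-counits $\mathcal{C}_{n_1,\dots,n_t,0,n_{t+1},\dots,n_m}\to\mathcal{C}_{n_1,\dots,n_m}$ (isomorphisms in the positive case). A positive quasi-coalgebra is Koszul if all the cobar-type complexes defined dually (same direct sums of components $\mathcal{C}_c$ over concatenated compositions of $n_1,\dots,n_m$, placed in cohomological degree equal to the number of entries of $c$, with differential the alternating sum of quasi-comultiplications splitting one entry of $c$ into two positive entries) have no cohomology except in degree $n_1+\dots+n_m$. The quadratic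 dual $\mathcal{C}$ of $\mathcal{Z}$ is the positive quasi-coalgebra with components $\mathcal{C}_{n_1,\dots,n_m}=H_{n_1+\dots+n_m}(\mathcal{B}_{n_1,\dots,n_m})$ and quasi-comultiplications induced by the natural surjections of complexes $\mathcal{B}_{n_1,\dots,n_t+n_{t+1},\dots,n_m}\to\mathcal{B}_{n_1,\dots,n_m}$ (projection onto the summands indexed by those compositions of $n_t+n_{t+1}$ that are concatenations of compositions of $n_t$ and $n_{t+1}$). In particular, here $\mathcal{C}_n$ is the space of closed forms in $D^n$ of degree $1$ with respect to each group of variables, with logarithmic singularities along the hyperplanes $D^t\times L_s\times D^{n-t-1}$ ($0\le t\le n-1$, $1\le s\le v$), with vanishing pull-backs under the maps $\mathrm{Id}_D^{t-1}\times\Delta_D\times\mathrm{Id}_D^{n-t-1}\colon D^{n-1}\to D^n$. *)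

theory Defs
  imports
    "HOL-Analysis.Analysis"
    "HOL-Library.Function_Algebras"
    "HOL-Library.Poly_Mapping"
begin

text \<open>
  All positions are counted from 0, so position \<open>i\<close> here is position \<open>i + 1\<close> of the informal
  \<open>1, \<dots>, m\<close>.
\<close>

section \<open>Quasi-algebras and quasi-coalgebras\<close>

definition merge_at :: "nat \<Rightarrow> int list \<Rightarrow> int list" where
  "merge_at i ns = take i ns @ [ns ! i + ns ! Suc i] @ drop (Suc (Suc i)) ns"

definition insert_zero :: "nat \<Rightarrow> int list \<Rightarrow> int list" where
  "insert_zero i ns = take i ns @ [0] @ drop i ns"

text \<open>
  The family of vector spaces \<open>qcomp Z ns\<close> is a family of subspaces of one ambient vector space.
  For a quasi-algebra, \<open>qmult Z i ns\<close> maps the component \<open>ns\<close> to the component \<open>merge_at i ns\<close>,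
  and \<open>qunit Z i ns\<close> maps the component \<open>ns\<close> to the component \<open>insert_zero i ns\<close>.
  The element \<open>qone Z\<close> is the image of 1 under the identification of the ground field with
  the component of the empty index.
\<close>

record ('k, 'a) quasi_alg =
  qscale :: "'k \<Rightarrow> 'a \<Rightarrow> 'a"
  qcomp :: "int list \<Rightarrow> 'a set"
  qone :: 'a
  qmult :: "nat \<Rightarrow> int list \<Rightarrow> 'a \<Rightarrow> 'a"
  qunit :: "nat \<Rightarrow> int list \<Rightarrow> 'a \<Rightarrow> 'a"

text \<open>
  With the arrows inverted, \<open>qcomult C i ns\<close> maps the component \<open>merge_at i ns\<close> to the
  component \<open>ns\<close>, and \<open>qcounit C i ns\<close> maps the component \<open>insert_zero i ns\<close> to the component \<open>ns\<close>.
\<close>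

record ('k, 'a) quasi_coalg =
  cscale :: "'k \<Rightarrow> 'a \<Rightarrow> 'a"
  ccomp :: "int list \<Rightarrow> 'a set"
  cone :: 'a
  qcomult :: "nat \<Rightarrow> int list \<Rightarrow> 'a \<Rightarrow> 'a"
  qcounit :: "nat \<Rightarrow> int list \<Rightarrow> 'a \<Rightarrow> 'a"

definition linear_between ::
    "('k \<Rightarrow> 'a \<Rightarrow> 'a::ab_group_add) \<Rightarrow> 'a set \<Rightarrow> 'a set \<Rightarrow> ('a \<Rightarrow> 'a) \<Rightarrow> bool" where
  "linear_between sc A B f \<longleftrightarrow>
     f ` A \<subseteq> B \<and> (\<forall>x\<in>A. \<forall>y\<in>A. f (x + y) = f x + f y) \<and> (\<forall>a. \<forall>x\<in>A. f (sc a x) = sc a (f x))"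

locale quasi_algebra = vector_space "qscale Z"
  for Z :: "('k::field, 'a::ab_group_add) quasi_alg" +
  assumes comp_subspace: "subspace (qcomp Z ns)"
    and comp_Nil: "bij_betw (\<lambda>a. qscale Z a (qone Z)) UNIV (qcomp Z [])"
    and mult_linear: "Suc i < length ns \<Longrightarrow>
      linear_between (qscale Z) (qcomp Z ns) (qcomp Z (merge_at i ns)) (qmult Z i ns)"
    and unit_linear: "i \<le> length ns \<Longrightarrow>
      linear_between (qscale Z) (qcomp Z ns) (qcomp Z (insert_zero i ns)) (qunit Z i ns)"
    \<comment> \<open>\<open>j = i + 1\<close> merges three consecutive indices, \<open>j > i + 1\<close> two disjoint pairs\<close>
    and mult_mult: "i < j \<Longrightarrow> Suc j < length ns \<Longrightarrow> x \<in> qcomp Z ns \<Longrightarrow>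
      qmult Z i (merge_at j ns) (qmult Z j ns x)
        = qmult Z (j - 1) (merge_at i ns) (qmult Z i ns x)"
    and unit_unit: "i \<le> j \<Longrightarrow> j \<le> length ns \<Longrightarrow> x \<in> qcomp Z ns \<Longrightarrow>
      qunit Z i (insert_zero j ns) (qunit Z j ns x)
        = qunit Z (Suc j) (insert_zero i ns) (qunit Z i ns x)"
    and mult_unit_below: "Suc i < j \<Longrightarrow> j \<le> length ns \<Longrightarrow> x \<in> qcomp Z ns \<Longrightarrow>
      qmult Z i (insert_zero j ns) (qunit Z j ns x)
        = qunit Z (j - 1) (merge_at i ns) (qmult Z i ns x)"
    and mult_unit_above: "j < i \<Longrightarrow> i < length ns \<Longrightarrow> x \<in> qcomp Z ns \<Longrightarrow>
      qmult Z i (insert_zero j ns) (qunit Z j ns x)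
        = qunit Z j (merge_at (i - 1) ns) (qmult Z (i - 1) ns x)"
    and left_unit: "i < length ns \<Longrightarrow> x \<in> qcomp Z ns \<Longrightarrow>
      qmult Z i (insert_zero i ns) (qunit Z i ns x) = x"
    and right_unit: "i < length ns \<Longrightarrow> x \<in> qcomp Z ns \<Longrightarrow>
      qmult Z i (insert_zero (Suc i) ns) (qunit Z (Suc i) ns x) = x"

locale quasi_coalgebra = vector_space "cscale C"
  for C :: "('k::field, 'a::ab_group_add) quasi_coalg" +
  assumes comp_subspace: "subspace (ccomp C ns)"
    and comp_Nil: "bij_betw (\<lambda>a. cscale C a (cone C)) UNIV (ccomp C [])"
    and comult_linear: "Suc i < length ns \<Longrightarrow>
      linear_between (cscale C) (ccomp C (merge_at i ns)) (ccomp C ns) (qcomult C i ns)"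
    and counit_linear: "i \<le> length ns \<Longrightarrow>
      linear_between (cscale C) (ccomp C (insert_zero i ns)) (ccomp C ns) (qcounit C i ns)"
    and comult_comult: "i < j \<Longrightarrow> Suc j < length ns \<Longrightarrow>
      x \<in> ccomp C (merge_at i (merge_at j ns)) \<Longrightarrow>
      qcomult C j ns (qcomult C i (merge_at j ns) x)
        = qcomult C i ns (qcomult C (j - 1) (merge_at i ns) x)"
    and counit_counit: "i \<le> j \<Longrightarrow> j \<le> length ns \<Longrightarrow>
      x \<in> ccomp C (insert_zero i (insert_zero j ns)) \<Longrightarrow>
      qcounit C j ns (qcounit C i (insert_zero j ns) x)
        = qcounit C i ns (qcounit C (Suc j) (insert_zero i ns) x)"
    and comult_counit_below: "Suc i < j \<Longrightarrow> j \<le> length ns \<Longrightarrow>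
      x \<in> ccomp C (merge_at i (insert_zero j ns)) \<Longrightarrow>
      qcounit C j ns (qcomult C i (insert_zero j ns) x)
        = qcomult C i ns (qcounit C (j - 1) (merge_at i ns) x)"
    and comult_counit_above: "j < i \<Longrightarrow> i < length ns \<Longrightarrow>
      x \<in> ccomp C (merge_at i (insert_zero j ns)) \<Longrightarrow>
      qcounit C j ns (qcomult C i (insert_zero j ns) x)
        = qcomult C (i - 1) ns (qcounit C j (merge_at (i - 1) ns) x)"
    and left_counit: "i < length ns \<Longrightarrow> x \<in> ccomp C ns \<Longrightarrow>
      qcounit C i ns (qcomult C i (insert_zero i ns) x) = x"
    and right_counit: "i < length ns \<Longrightarrow> x \<in> ccomp C ns \<Longrightarrow>
      qcounit C (Suc i) ns (qcomult C i (insert_zero (Suc i) ns) x) = x"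

locale nonnegative_quasi_algebra = quasi_algebra +
  assumes negative_zero: "n \<in> set ns \<Longrightarrow> n < 0 \<Longrightarrow> qcomp Z ns = {0}"

locale positive_quasi_algebra = nonnegative_quasi_algebra +
  assumes unit_iso: "i \<le> length ns \<Longrightarrow>
    bij_betw (qunit Z i ns) (qcomp Z ns) (qcomp Z (insert_zero i ns))"

locale nonnegative_quasi_coalgebra = quasi_coalgebra +
  assumes negative_zero: "n \<in> set ns \<Longrightarrow> n < 0 \<Longrightarrow> ccomp C ns = {0}"

locale positive_quasi_coalgebra = nonnegative_quasi_coalgebra +
  assumes counit_iso: "i \<le> length ns \<Longrightarrow>
    bij_betw (qcounit C i ns) (ccomp C (insert_zero i ns)) (ccomp C ns)"


section \<open>Bar and cobar complexes, Koszulness, quadratic duality\<close>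

definition compositions :: "int \<Rightarrow> int list set" where
  "compositions n = {c. (\<forall>k\<in>set c. 0 < k) \<and> sum_list c = n}"

definition bar_index :: "int list \<Rightarrow> int list set" where
  "bar_index ns = {concat cs |cs. list_all2 (\<lambda>n b. b \<in> compositions n) ns cs}"

text \<open>The entries at \<open>j\<close> and \<open>j + 1\<close> of \<open>c\<close> belong to the composition of the same \<open>ns ! t\<close>.\<close>

definition same_part :: "int list \<Rightarrow> int list \<Rightarrow> nat \<Rightarrow> bool" where
  "same_part ns c j \<longleftrightarrow>
     (\<exists>cs t. list_all2 (\<lambda>n b. b \<in> compositions n) ns cs \<and> c = concat cs \<and> t < length ns \<and>
        length (concat (take t cs)) \<le> j \<and> Suc j < length (concat (take (Suc t) cs)))"

definition signed :: "nat \<Rightarrow> 'a \<Rightarrow> 'a::ab_group_add" where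
  "signed n x = (if even n then x else - x)"

text \<open>The direct sum of \<open>K c\<close> over the index sequences \<open>c\<close> of length \<open>r\<close>; these are finitely many.\<close>

definition bar_sum :: "(int list \<Rightarrow> 'a::ab_group_add set) \<Rightarrow> int list \<Rightarrow> nat \<Rightarrow> (int list \<Rightarrow> 'a) set" where
  "bar_sum K ns r =
     {x. \<forall>c. if c \<in> bar_index ns \<and> length c = r then x c \<in> K c else x c = 0}"

definition bar_diff ::
    "('k, 'a::ab_group_add) quasi_alg \<Rightarrow> int list \<Rightarrow> (int list \<Rightarrow> 'a) \<Rightarrow> int list \<Rightarrow> 'a" where
  "bar_diff Z ns x = (\<lambda>c'.
     \<Sum>(c, j) \<in> {(c, j). c \<in> bar_index ns \<and> same_part ns c j \<and> merge_at j c = c'}.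
       signed (Suc j) (qmult Z j c (x c)))"

definition bar_cycles :: "('k, 'a::ab_group_add) quasi_alg \<Rightarrow> int list \<Rightarrow> nat \<Rightarrow> (int list \<Rightarrow> 'a) set" where
  "bar_cycles Z ns r = {x \<in> bar_sum (qcomp Z) ns r. bar_diff Z ns x = 0}"

definition bar_boundaries :: "('k, 'a::ab_group_add) quasi_alg \<Rightarrow> int list \<Rightarrow> nat \<Rightarrow> (int list \<Rightarrow> 'a) set" where
  "bar_boundaries Z ns r = bar_diff Z ns ` bar_sum (qcomp Z) ns (Suc r)"

locale koszul_quasi_algebra = positive_quasi_algebra +
  assumes bar_acyclic: "\<forall>n\<in>set ns. 0 \<le> n \<Longrightarrow> int r \<noteq> sum_list ns \<Longrightarrow>
    bar_cycles Z ns r = bar_boundaries Z ns r"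

definition cobar_diff ::
    "('k, 'a::ab_group_add) quasi_coalg \<Rightarrow> int list \<Rightarrow> (int list \<Rightarrow> 'a) \<Rightarrow> int list \<Rightarrow> 'a" where
  "cobar_diff C ns x = (\<lambda>c.
     \<Sum>j \<in> {j. c \<in> bar_index ns \<and> same_part ns c j}.
       signed (Suc j) (qcomult C j c (x (merge_at j c))))"

definition cobar_cocycles ::
    "('k, 'a::ab_group_add) quasi_coalg \<Rightarrow> int list \<Rightarrow> nat \<Rightarrow> (int list \<Rightarrow> 'a) set" where
  "cobar_cocycles C ns r = {x \<in> bar_sum (ccomp C) ns r. cobar_diff C ns x = 0}"

definition cobar_coboundaries ::
    "('k, 'a::ab_group_add) quasi_coalg \<Rightarrow> int list \<Rightarrow> nat \<Rightarrow> (int list \<Rightarrow> 'a) set" where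
  "cobar_coboundaries C ns r =
     (if r = 0 then {0} else cobar_diff C ns ` bar_sum (ccomp C) ns (r - 1))"

locale koszul_quasi_coalgebra = positive_quasi_coalgebra +
  assumes cobar_acyclic: "\<forall>n\<in>set ns. 0 \<le> n \<Longrightarrow> int r \<noteq> sum_list ns \<Longrightarrow>
    cobar_cocycles C ns r = cobar_coboundaries C ns r"

text \<open>
  The homology of the bar complex in the degree \<open>sum_list ns\<close> is the space of cycles, since the
  boundaries vanish in this degree (\<open>bar_boundaries_top\<close> below). The quasi-comultiplication
  is the projection of the bar complex of \<open>merge_at i ns\<close> onto the summands indexed by
  \<open>bar_index ns\<close>. The bar complexes of \<open>insert_zero i ns\<close> and of \<open>ns\<close> coincide, the only
  composition of 0 being empty, so that the quasi-counits are identity maps.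
\<close>

definition quadratic_dual :: "('k, 'a::ab_group_add) quasi_alg \<Rightarrow> ('k, int list \<Rightarrow> 'a) quasi_coalg" where
  "quadratic_dual Z =
     \<lparr>cscale = (\<lambda>a x c. qscale Z a (x c)),
      ccomp = (\<lambda>ns. bar_cycles Z ns (nat (sum_list ns))),
      cone = (\<lambda>c. if c = [] then qone Z else 0),
      qcomult = (\<lambda>i ns x c. if c \<in> bar_index ns then x c else 0),
      qcounit = (\<lambda>i ns x. x)\<rparr>"

lemma length_le_sum_list_pos:
  assumes "\<forall>k\<in>set c. (0::int) < k"
  shows "int (length c) \<le> sum_list c"
  using assms by (induction c) auto

lemma length_bar_index:
  assumes "c \<in> bar_index ns"
  shows "int (length c) \<le> sum_list ns"
proof -
  obtain cs where cs: "list_all2 (\<lambda>n b. b \<in> compositions n) ns cs" and c: "c = concat cs"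
    using assms by (auto simp: bar_index_def)
  from cs have "int (length (concat cs)) \<le> sum_list ns"
  proof (induction rule: list_all2_induct)
    case (Cons n ns b cs)
    then show ?case
      using length_le_sum_list_pos[of b] by (auto simp: compositions_def)
  qed auto
  then show ?thesis using c by simp
qed

lemma same_part_length:
  assumes "same_part ns c j"
  shows "Suc j < length c"
proof -
  obtain cs t where c: "c = concat cs" and j: "Suc j < length (concat (take (Suc t) cs))"
    using assms unfolding same_part_def by blast
  have "concat cs = concat (take (Suc t) cs) @ concat (drop (Suc t) cs)"
    by (metis append_take_drop_id concat_append)
  then have "length (concat (take (Suc t) cs)) \<le> length c"
    using c by simp
  with j show ?thesis by linarith
qed

lemma (in quasi_algebra) bar_boundaries_top:
  "bar_boundaries Z ns (nat (sum_list ns)) = {0}"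
proof -
  have len: "\<not> (c \<in> bar_index ns \<and> length c = Suc (nat (sum_list ns)))" for c
    using length_bar_index[of c ns] by linarith
  have sum: "bar_sum (qcomp Z) ns (Suc (nat (sum_list ns))) = {0}"
  proof (intro set_eqI)
    fix x show "x \<in> bar_sum (qcomp Z) ns (Suc (nat (sum_list ns))) \<longleftrightarrow> x \<in> {0}"
      unfolding bar_sum_def mem_Collect_eq singleton_iff fun_eq_iff zero_fun_def
      using len by (simp only: if_False)
  qed
  have zero: "qmult Z j c 0 = 0" if "Suc j < length c" for j c
  proof -
    have "0 \<in> qcomp Z c" using comp_subspace subspace_0 by blast
    then have "qmult Z j c (0 + 0) = qmult Z j c 0 + qmult Z j c 0"
      using mult_linear[OF that] unfolding linear_between_def by blast
    then show ?thesis by simp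
  qed
  have "bar_diff Z ns 0 c' = 0" for c'
    unfolding bar_diff_def
    by (rule sum.neutral) (auto simp: signed_def zero dest!: same_part_length)
  then have "bar_diff Z ns 0 = 0" by (simp add: fun_eq_iff)
  then show ?thesis by (simp add: bar_boundaries_def sum)
qed


section \<open>Regular functions on the powers of a disk\<close>

text \<open>
  The pair \<open>(t, s)\<close> stands for the coordinate number \<open>s\<close> on the factor number \<open>t\<close> of the power
  of the disk.
\<close>

definition vars :: "nat \<Rightarrow> nat \<Rightarrow> (nat \<times> nat) set" where
  "vars u m = {..<m} \<times> {..<u}"

definition move :: "(nat \<Rightarrow> nat) \<Rightarrow> nat \<times> nat \<Rightarrow> nat \<times> nat" where
  "move \<pi> = (\<lambda>(t, s). (\<pi> t, s))"

text \<open>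
  A map \<open>\<pi>\<close> from \<open>{..<m}\<close> to \<open>{..<m'}\<close> induces the map from the \<open>m'\<close>-th to the \<open>m\<close>-th power
  that sends \<open>x\<close> to \<open>(x (\<pi> 0), \<dots>, x (\<pi> (m - 1)))\<close>; \<open>fun_pull F m m' \<pi>\<close> is the pull-back
  of functions along it.
\<close>

record ('k, 'f) disk_functions =
  ddim :: nat
  fun_scale :: "'k \<Rightarrow> 'f \<Rightarrow> 'f"
  regular :: "nat \<Rightarrow> 'f set"
  fun_one :: "nat \<Rightarrow> 'f"
  coord_mult :: "nat \<times> nat \<Rightarrow> 'f \<Rightarrow> 'f"
  partial :: "nat \<Rightarrow> nat \<times> nat \<Rightarrow> 'f \<Rightarrow> 'f"
  fun_pull :: "nat \<Rightarrow> nat \<Rightarrow> (nat \<Rightarrow> nat) \<Rightarrow> 'f \<Rightarrow> 'f"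

subsection \<open>Formal disk\<close>

text \<open>A formal power series is given by its coefficients at the exponent vectors.\<close>

type_synonym 'k mfps = "((nat \<times> nat) \<Rightarrow>\<^sub>0 nat) \<Rightarrow> 'k"

definition move_exponent :: "(nat \<Rightarrow> nat) \<Rightarrow> ((nat \<times> nat) \<Rightarrow>\<^sub>0 nat) \<Rightarrow> ((nat \<times> nat) \<Rightarrow>\<^sub>0 nat)" where
  "move_exponent \<pi> e = (\<Sum>p\<in>Poly_Mapping.keys e.
     Poly_Mapping.single (move \<pi> p) (Poly_Mapping.lookup e p))"

definition formal_disk :: "nat \<Rightarrow> ('k::field_char_0, 'k mfps) disk_functions" where
  "formal_disk u =
     \<lparr>ddim = u,
      fun_scale = (\<lambda>a f e. a * f e),
      regular = (\<lambda>m. {f. \<forall>e. f e \<noteq> 0 \<longrightarrow> Poly_Mapping.keys e \<subseteq> vars u m}),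
      fun_one = (\<lambda>m e. if e = 0 then 1 else 0),
      coord_mult = (\<lambda>p f e. if Poly_Mapping.lookup e p = 0 then 0
                            else f (e - Poly_Mapping.single p 1)),
      partial = (\<lambda>m p f e. of_nat (Suc (Poly_Mapping.lookup e p)) * f (e + Poly_Mapping.single p 1)),
      fun_pull = (\<lambda>m m' \<pi> f e.
        \<Sum>e' \<in> {e'. Poly_Mapping.keys e' \<subseteq> vars u m \<and> move_exponent \<pi> e' = e}. f e')\<rparr>"

subsection \<open>Analytic and smooth disks\<close>

text \<open>
  A point of the \<open>u\<close>-dimensional space is a function vanishing from \<open>u\<close> on, a point of the
  \<open>m\<close>-th power of a disk is a function vanishing outside \<open>vars u m\<close>, and functions on this power
  are extended by zero to all arguments.
\<close>

definition polydisk :: "nat \<Rightarrow> (nat \<Rightarrow> real) \<Rightarrow> (nat \<Rightarrow> 'k::real_normed_field) set" where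
  "polydisk u \<rho> = {y. (\<forall>s<u. norm (y s) < \<rho> s) \<and> (\<forall>s\<ge>u. y s = 0)}"

definition round_disk :: "nat \<Rightarrow> real \<Rightarrow> (nat \<Rightarrow> 'k::real_normed_field) set" where
  "round_disk u \<rho> = {y. (\<Sum>s<u. (norm (y s))\<^sup>2) < \<rho>\<^sup>2 \<and> (\<forall>s\<ge>u. y s = 0)}"

definition is_disk :: "nat \<Rightarrow> (nat \<Rightarrow> 'k::real_normed_field) set \<Rightarrow> bool" where
  "is_disk u D \<longleftrightarrow>
     (\<exists>\<rho>. (\<forall>s<u. 0 < \<rho> s) \<and> D = polydisk u \<rho>) \<or> (\<exists>\<rho>>0. D = round_disk u \<rho>)"

definition disk_power :: "(nat \<Rightarrow> 'k::real_normed_field) set \<Rightarrow> nat \<Rightarrow> (nat \<times> nat \<Rightarrow> 'k) set" where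
  "disk_power D m = {x. (\<forall>t<m. (\<lambda>s. x (t, s)) \<in> D) \<and> (\<forall>t\<ge>m. \<forall>s. x (t, s) = 0)}"

definition partial_on ::
    "(nat \<times> nat \<Rightarrow> 'k::real_normed_field) set \<Rightarrow> nat \<times> nat \<Rightarrow>
     ((nat \<times> nat \<Rightarrow> 'k) \<Rightarrow> 'k) \<Rightarrow> (nat \<times> nat \<Rightarrow> 'k) \<Rightarrow> 'k" where
  "partial_on X p f = (\<lambda>x. if x \<in> X then deriv (\<lambda>w. f (x(p := w))) (x p) else 0)"

definition has_partials_on ::
    "(nat \<times> nat \<Rightarrow> 'k::real_normed_field) set \<Rightarrow> (nat \<times> nat) set \<Rightarrow>
     ((nat \<times> nat \<Rightarrow> 'k) \<Rightarrow> 'k) \<Rightarrow> bool" where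
  "has_partials_on X P f \<longleftrightarrow>
     (\<forall>x\<in>X. \<forall>p\<in>P. (\<lambda>w. f (x(p := w))) field_differentiable at (x p))"

text \<open>Holomorphic in several variables: continuous and holomorphic in each variable.\<close>

definition holomorphic_functions ::
    "nat \<Rightarrow> (nat \<Rightarrow> complex) set \<Rightarrow> nat \<Rightarrow> ((nat \<times> nat \<Rightarrow> complex) \<Rightarrow> complex) set" where
  "holomorphic_functions u D m =
     {f. continuous_on (disk_power D m) f \<and> has_partials_on (disk_power D m) (vars u m) f \<and>
         (\<forall>x. x \<notin> disk_power D m \<longrightarrow> f x = 0)}"

fun C_k_on :: "nat \<Rightarrow> (nat \<times> nat \<Rightarrow> real) set \<Rightarrow> (nat \<times> nat) set \<Rightarrow>
    ((nat \<times> nat \<Rightarrow> real) \<Rightarrow> real) \<Rightarrow> bool" where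
  "C_k_on 0 X P f \<longleftrightarrow> continuous_on X f"
| "C_k_on (Suc k) X P f \<longleftrightarrow>
     continuous_on X f \<and> has_partials_on X P f \<and> (\<forall>p\<in>P. C_k_on k X P (partial_on X p f))"

definition smooth_functions ::
    "nat \<Rightarrow> (nat \<Rightarrow> real) set \<Rightarrow> nat \<Rightarrow> ((nat \<times> nat \<Rightarrow> real) \<Rightarrow> real) set" where
  "smooth_functions u D m =
     {f. (\<forall>k. C_k_on k (disk_power D m) (vars u m) f) \<and>
         (\<forall>x. x \<notin> disk_power D m \<longrightarrow> f x = 0)}"

definition disk_with ::
    "nat \<Rightarrow> (nat \<Rightarrow> 'k::real_normed_field) set \<Rightarrow> (nat \<Rightarrow> ((nat \<times> nat \<Rightarrow> 'k) \<Rightarrow> 'k) set) \<Rightarrow>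
     ('k, (nat \<times> nat \<Rightarrow> 'k) \<Rightarrow> 'k) disk_functions" where
  "disk_with u D reg =
     \<lparr>ddim = u,
      fun_scale = (\<lambda>a f x. a * f x),
      regular = reg,
      fun_one = (\<lambda>m x. if x \<in> disk_power D m then 1 else 0),
      coord_mult = (\<lambda>p f x. x p * f x),
      partial = (\<lambda>m. partial_on (disk_power D m)),
      fun_pull = (\<lambda>m m' \<pi> f x. if x \<in> disk_power D m'
        then f (\<lambda>(t, s). if t < m then x (\<pi> t, s) else 0) else 0)\<rparr>"

definition analytic_disk ::
    "nat \<Rightarrow> (nat \<Rightarrow> complex) set \<Rightarrow> (complex, (nat \<times> nat \<Rightarrow> complex) \<Rightarrow> complex) disk_functions" where
  "analytic_disk u D = disk_with u D (holomorphic_functions u D)"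

definition smooth_disk ::
    "nat \<Rightarrow> (nat \<Rightarrow> real) set \<Rightarrow> (real, (nat \<times> nat \<Rightarrow> real) \<Rightarrow> real) disk_functions" where
  "smooth_disk u D = disk_with u D (smooth_functions u D)"


section \<open>Forms with logarithmic singularities\<close>

text \<open>
  For \<open>p = (t, s)\<close> let \<open>\<eta> p\<close> be \<open>dz p / z p\<close> if \<open>s < v\<close> and \<open>dz p\<close> otherwise. The form with
  the coefficient family \<open>\<omega>\<close> is the sum of \<open>\<omega> I\<close> times the exterior product of the \<open>\<eta> p\<close>,
  \<open>p \<in> I\<close>, taken in the lexicographic order, over all sets \<open>I\<close> of coordinates. These exterior
  products are linearly independent over the regular functions.
\<close>

type_synonym 'f form = "(nat \<times> nat) set \<Rightarrow> 'f"

definition lex_less :: "nat \<times> nat \<Rightarrow> nat \<times> nat \<Rightarrow> bool" where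
  "lex_less p q \<longleftrightarrow> fst p < fst q \<or> fst p = fst q \<and> snd p < snd q"

definition log_forms :: "('k, 'f::ab_group_add) disk_functions \<Rightarrow> nat \<Rightarrow> 'f form set" where
  "log_forms F m =
     {\<omega>. \<forall>I. if I \<subseteq> vars (ddim F) m then \<omega> I \<in> regular F m else \<omega> I = 0}"

text \<open>Since \<open>dz p = z p \<cdot> (dz p / z p)\<close>, the coefficient of \<open>\<eta> p\<close> in \<open>df\<close> is as follows.\<close>

definition log_partial ::
    "('k, 'f) disk_functions \<Rightarrow> nat \<Rightarrow> nat \<Rightarrow> nat \<times> nat \<Rightarrow> 'f \<Rightarrow> 'f" where
  "log_partial F v m p f =
     (if snd p < v then coord_mult F p (partial F m p f) else partial F m p f)"

definition ext_deriv ::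
    "('k, 'f::ab_group_add) disk_functions \<Rightarrow> nat \<Rightarrow> nat \<Rightarrow> 'f form \<Rightarrow> 'f form" where
  "ext_deriv F v m \<omega> = (\<lambda>J. if J \<subseteq> vars (ddim F) m
     then \<Sum>p\<in>J. signed (card {q \<in> J. lex_less q p}) (log_partial F v m p (\<omega> (J - {p})))
     else 0)"

text \<open>
  The pull-back along the map induced by \<open>\<pi>\<close> sends \<open>\<eta> p\<close> to \<open>\<eta> (move \<pi> p)\<close>; the product of
  these forms over \<open>I\<close> is zero if they are not distinct, and is sorted with the sign of
  the number of inversions otherwise.
\<close>

definition form_pull ::
    "('k, 'f::ab_group_add) disk_functions \<Rightarrow> nat \<Rightarrow> nat \<Rightarrow> (nat \<Rightarrow> nat) \<Rightarrow> 'f form \<Rightarrow> 'f form" where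
  "form_pull F m m' \<pi> \<omega> = (\<lambda>J.
     \<Sum>I \<in> {I. I \<subseteq> vars (ddim F) m \<and> inj_on (move \<pi>) I \<and> move \<pi> ` I = J}.
       signed (card {(p, q). p \<in> I \<and> q \<in> I \<and> lex_less p q \<and> lex_less (move \<pi> q) (move \<pi> p)})
         (fun_pull F m m' \<pi> (\<omega> I)))"

definition has_multidegree :: "int list \<Rightarrow> ('f::zero) form \<Rightarrow> bool" where
  "has_multidegree ns \<omega> \<longleftrightarrow>
     (\<forall>I. \<omega> I \<noteq> 0 \<longrightarrow> (\<forall>t<length ns. int (card {s. (t, s) \<in> I}) = ns ! t))"

definition closed_log_forms ::
    "('k, 'f::ab_group_add) disk_functions \<Rightarrow> nat \<Rightarrow> int list \<Rightarrow> 'f form set" where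
  "closed_log_forms F v ns =
     {\<omega> \<in> log_forms F (length ns). has_multidegree ns \<omega> \<and> ext_deriv F v (length ns) \<omega> = 0}"

text \<open>
  The quasi-multiplications are the pull-backs along the diagonals
  \<open>x \<mapsto> (x 0, \<dots>, x i, x i, \<dots>, x (m - 2))\<close>, the quasi-units are the pull-backs along the
  projections forgetting the factor number \<open>i\<close>.
\<close>

definition form_quasi_algebra ::
    "('k, 'f::ab_group_add) disk_functions \<Rightarrow> nat \<Rightarrow> ('k, 'f form) quasi_alg" where
  "form_quasi_algebra F v =
     \<lparr>qscale = (\<lambda>a \<omega> I. fun_scale F a (\<omega> I)),
      qcomp = closed_log_forms F v,
      qone = (\<lambda>I. if I = {} then fun_one F 0 else 0),
      qmult = (\<lambda>i ns. form_pull F (length ns) (length ns - 1) (\<lambda>k. if k \<le> i then k else k - 1)),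
      qunit = (\<lambda>i ns. form_pull F (length ns) (length ns + 1) (\<lambda>k. if k < i then k else k + 1))\<rparr>"

end

theory Submission
  imports Defs "HOL-Complex_Analysis.Cauchy_Integral_Formula"
begin

text \<open>
 Compositions of \<open>n\<close> correspond to sets of gaps between consecutive units, so that the bar complex of
 \<open>n\<close> is the total complex of a cube, with vertices the spaces of closed forms on the powers of \<open>D\<close> and
 edges the merges. Closed forms of degree 1 in every group of variables are spanned by forms whose
 types are words in finitely many letters, as in a Poincare-Birkhoff-Witt basis: the merges are
 injective on the words that are normal at the merged gaps, and elsewhere a word is rewritten by
 smaller ones. A leading word argument then contracts all these cubes, which gives the Koszulness of
 the quasi-algebra. The cobar complexes consist of the intersections of the kernels of the merges; they
 are exact by a double complex argument on the cubes of all sets of gaps.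

 The words come from the Poincare lemma, in a frame where the last logarithmic derivation is the Euler
 field \<open>\<Sum>s<v. z s d/dz s\<close>. The functions enter only through the axioms of a locale, in which
 \<open>f\<close> has a primitive along \<open>z s\<close>, and along the Euler field if \<open>f\<close> vanishes where all
 logarithmic coordinates do.
\<close>

text \<open>The components are not tensor products, since a function on a power of \<open>D\<close>
  need not be a finite sum of products of functions on the factors. A word therefore carries a whole
  space of forms instead of a line, and a letter is split off by an additive projection in one group
  of variables that commutes with the operations in the others. One can work group by group because
  a homogeneous form is closed iff it is closed in each group separately (\<open>cf_gc\<close>).

  The Euler field enters because \<open>z d/dz\<close> along a single logarithmic coordinate has
  primitives only for functions that vanish on its own hyperplane, and a function vanishing at the
  origin need not vanish on any hyperplane. Along the Euler field all functions vanishing on the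
  intersection of the hyperplanes have primitives, so that among the logarithmic directions only
  this one has letters with nonconstant coefficients.

  In a normal block all letters but the last are constant, and the indices strictly increase. Its
  product can be split again at the greatest index, and this splitting \<open>sect\<close> is the
  common source of generation, injectivity and rewriting.\<close>

notation (input) iff (infixr "<->" 25)

section \<open>Cube complexes\<close>

lemma signed_zero [simp]: "signed k 0 = 0" by (simp add: signed_def)

lemma signed_add: "signed k (x + y) = signed k x + signed k y" by (simp add: signed_def)

lemma signed_uminus: "signed k (- x) = - signed k x" by (simp add: signed_def)

lemma signed_diff: "signed k (x - y) = signed k x - signed k y" by (simp add: signed_def)

lemma signed_sum: "signed k (sum f A) = (SUM a:A. signed k (f a))"
 by (simp add: signed_def sum_negf)

lemma signed_signed: "signed k (signed l x) = signed (k + l) x" by (auto simp: signed_def)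

lemma signed_Suc: "signed (Suc k) x = - signed k x" by (simp add: signed_def)

lemma signed_parity: "even k <-> even l ==> signed k x = signed l x" by (simp add: signed_def)

lemma signed_odd: "even k <-> odd l ==> signed k x = - signed l x" by (auto simp: signed_def)

text \<open>
 \<open>pos S g\<close> is the index of the entry that contains the unit \<open>g\<close> once the units on both sides of
 each gap in \<open>S\<close> are merged.
\<close>

definition pos :: "nat set => nat => nat" where
 "pos S g = card {h. h < g & h ~: S}"

text \<open>Entries are counted from 0 here, and the shift by one gives the sign
  \<open>(-1)^j\<close> for entries counted from 1.\<close>

abbreviation "sgp S g \<equiv> signed (Suc (pos S g))"

lemma pos_insert_less: "g < h ==> g ~: S ==> Suc (pos (insert g S) h) = pos S h"
proof -
 assume a: "g < h" "g ~: S"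
 have "{k. k < h & k ~: S} = insert g {k. k < h & k ~: insert g S}" using a by auto
 thus ?thesis by (simp add: pos_def)
qed

lemma pos_insert_ge: "h <= g ==> pos (insert g S) h = pos S h"
 unfolding pos_def by (rule arg_cong[of _ _ card]) auto

text \<open>Merging at the smaller gap lowers the index of the larger one by one, while merging at
  the larger gap leaves the smaller index alone. The two orders thus differ in parity, which makes
  the differentials square to zero.\<close>

lemma pos_swap: assumes "g ~= h" "g ~: S" "h ~: S"
 shows "even (pos S g + pos (insert g S) h) <-> odd (pos S h + pos (insert h S) g)"
proof (cases "g < h")
 case True hence "Suc (pos (insert g S) h) = pos S h" "pos (insert h S) g = pos S g"
  using pos_insert_less pos_insert_ge[of g h S] assms by auto
 thus ?thesis by presburger
next case False hence "h < g" using assms by simp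
 hence "Suc (pos (insert h S) g) = pos S g" "pos (insert g S) h = pos S h"
  using pos_insert_less pos_insert_ge[of h g S] assms by auto
 thus ?thesis by presburger
qed


lemma signed_pos_swap: assumes "g ~= h" "g ~: S" "h ~: S" shows "sgp (insert g S) h (sgp S g x)
   = - sgp (insert h S) g (sgp S h x)"
 unfolding signed_signed by (rule signed_odd) (use pos_swap[OF assms] in presburger)

text \<open>The same parity, rearranged for signs that belong to two different paths, as they meet
  in the contracting homotopies.\<close>

lemma signed_pos_swap':
 assumes "g ~= h" "g ~: S" "h ~: S" shows "sgp (insert g S) h (sgp (insert h S) g x)
   = - sgp S g (sgp S h x)"
 unfolding signed_signed by (rule signed_odd) (use pos_swap[OF assms] in presburger)

lemma signed_signed_same [simp]: "signed k (signed k x) = x" by (simp add: signed_def)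

text \<open>Exactness is a matter of abelian groups. The groups are subsets of one type, so
  additivity of a map is relative to such a subset.\<close>

definition add_closed :: "'a::ab_group_add set => bool" where
 "add_closed A <-> 0 : A & (ALL x:A. ALL y:A. x + y : A) & (ALL x:A. - x : A)"

lemma acD: assumes "add_closed A" shows "0 : A" "x : A ==> y : A ==> x + y : A" "x : A ==> - x : A"
  "x : A ==> y : A ==> x - y : A"
  "x : A ==> signed k x : A" "(!!i. i : I ==> f i : A) ==> sum f I : A"
proof -
 show z: "0 : A" and p: "!!x y. x : A ==> y : A ==> x + y : A" and m: "!!x. x : A ==> - x : A"
  using assms unfolding add_closed_def by blast+
 show "x : A ==> y : A ==> x - y : A" using p[OF _ m, of x y] by simp
 show "x : A ==> signed k x : A" using m by (simp add: signed_def)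
 show "(!!i. i : I ==> f i : A) ==> sum f I : A"
  using z p by (induction I rule: infinite_finite_induct) auto
qed

definition additive_on :: "'a::ab_group_add set => ('a => 'b::ab_group_add) => bool" where
 "additive_on A f <-> (ALL x:A. ALL y:A. f (x + y) = f x + f y)"

lemma addD: assumes "additive_on A f" "add_closed A"
 shows "x : A ==> y : A ==> f (x + y) = f x + f y" "f 0 = 0" "x : A ==> f (- x) = - f x"
  "x : A ==> y : A ==> f (x - y) = f x - f y" "x : A ==> f (signed k x) = signed k (f x)"
  "(!!i. i : I ==> h i : A) ==> f (sum h I) = (SUM i:I. f (h i))"
proof -
 note A = acD[OF assms(2)]
 show p: "!!x y. x : A ==> y : A ==> f (x + y) = f x + f y"
  using assms(1) unfolding additive_on_def by blast
 show z: "f 0 = 0" using p[OF A(1) A(1)] by simp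
 show m: "!!x. x : A ==> f (- x) = - f x" using p A(3) z by (metis add.right_inverse minus_unique)
 show "x : A ==> y : A ==> f (x - y) = f x - f y" using p[OF _ A(3), of x y] m by simp
 show "x : A ==> f (signed k x) = signed k (f x)" using m by (simp add: signed_def)
 show "(!!i. i : I ==> h i : A) ==> f (sum h I) = (SUM i:I. f (h i))"
 proof (induction I rule: infinite_finite_induct)
  case (insert i I)
  thus ?case using p[of "h i" "sum h I"] A(6)[of I h] by simp
 qed (use z in auto)
qed

text \<open>Each unordered pair contributes \<open>t g h + t h g = 0\<close>. The diagonal is left
  out of the sum, so no division by 2 occurs.\<close>

lemma antisym_sum_zero: fixes t :: "nat => nat => 'a::ab_group_add"
 assumes fT: "finite T" and anti: "!!g h. g : T ==> h : T ==> g ~= h ==> t h g = - t g h"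
 shows "(SUM g:T. SUM h:T - {g}. t g h) = 0"
proof -
 have "(SUM g:T. SUM h:T - {g}. t g h) = (SUM g:T. SUM h:T. if h < g then t g h + t h g else 0)"
 proof -
  have "(SUM g:T. SUM h:T - {g}. t g h)
    = (SUM g:T. SUM h:T. (if h < g then t g h else 0) + (if g < h then t g h else 0))"
  proof (rule sum.cong[OF refl])
   fix g assume "g : T"
   show "(SUM h:T - {g}. t g h) = (SUM h:T. (if h < g then t g h else 0) + (if g < h then t g h else 0))"
    by (rule sum.mono_neutral_cong_left) (use fT in auto)
  qed
  also have "... = (SUM g:T. SUM h:T. if h < g then t g h else 0) + (SUM g:T. SUM h:T. if g < h then t g h else 0)"
   by (simp add: sum.distrib)
  also have "(SUM g:T. SUM h:T. if g < h then t g h else 0) = (SUM h:T. SUM g:T. if g < h then t g h else 0)"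
   by (rule sum.swap)
  also have "(SUM g:T. SUM h:T. if h < g then t g h else 0) + (SUM h:T. SUM g:T. if g < h then t g h else 0)
    = (SUM g:T. SUM h:T. (if h < g then t g h else 0) + (if h < g then t h g else 0))"
   by (simp only: sum.distrib)
  also have "... = (SUM g:T. SUM h:T. if h < g then t g h + t h g else 0)"
   by (intro sum.cong refl) simp
  finally show ?thesis .
 qed
 also have "... = 0"
 proof (intro sum.neutral ballI)
  fix g h assume "g : T" "h : T"
  thus "(if h < g then t g h + t h g else 0) = 0" using anti[of g h] by simp
 qed
 finally show ?thesis .
qed

text \<open>
 A commutative cube of abelian groups over the subsets of \<open>U\<close>: the vertex \<open>S\<close> is meant to be the
 component obtained by merging at the gaps in \<open>S\<close>.
\<close>

locale cube =
 fixes U :: "nat set" and V :: "nat set => 'a::ab_group_add set"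
  and mu :: "nat set => nat => 'a => 'a"
 assumes finite_U: "finite U" and V_closed: "S <= U ==> add_closed (V S)"
  and mu_in: "S <= U ==> g : U - S ==> x : V S ==> mu S g x : V (insert g S)"
  and mu_add: "S <= U ==> g : U - S ==> additive_on (V S) (mu S g)"
  and mu_mu: "S <= U ==> g : U - S ==> h : U - S ==> g ~= h ==> x : V S ==>
   mu (insert g S) h (mu S g x) = mu (insert h S) g (mu S h x)"
begin

text \<open>The degree is the number of merged gaps: for \<open>n\<close> units, degree
  \<open>l\<close> is homological degree \<open>n - l\<close> of the bar complex.\<close>

definition fam :: "nat set => nat => (nat set => 'a) set" where
 "fam G l = {x. ALL S. if S <= G & card S = l then x S : V S else x S = 0}"

definition bd :: "nat set => (nat set => 'a) => nat set => 'a" where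
 "bd G x T = (if T <= G
   then SUM g:T. sgp (T - {g}) g (mu (T - {g}) g (x (T - {g}))) else 0)"

text \<open>The statement concerns degree \<open>Suc l\<close>, never degree 0: the vertex without
  merges carries the homology that forms the quadratic dual.\<close>

definition exact_at :: "nat set => nat => bool" where
 "exact_at G l <-> (ALL x:fam G (Suc l). bd G x = (%_. 0) --> (EX y:fam G l. bd G y = x))"

lemma fam_in: "x : fam G l ==> G <= U ==> S <= G ==> x S : V S"
 using acD(1)[OF V_closed, of S] unfolding fam_def mem_Collect_eq by (metis order_trans)

lemma fam_zero: "x : fam G l ==> ~ (S <= G & card S = l) ==> x S = 0" unfolding fam_def by force

lemma fam_diff: "G <= U ==> x : fam G l ==> y : fam G l ==> (%S. x S - y S) : fam G l"
 unfolding fam_def using V_closed[THEN acD(4)] by (auto 0 3)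

lemma fam_add: "G <= U ==> x : fam G l ==> y : fam G l ==> (%S. x S + y S) : fam G l"
 unfolding fam_def using V_closed[THEN acD(2)] by (auto 0 3)

lemma mu_zero: "S <= U ==> g : U - S ==> mu S g 0 = 0" using addD(2)[OF mu_add V_closed] .

lemma bd_fam:
 assumes "G <= U" "x : fam G l" shows "bd G x : fam G (Suc l)" unfolding fam_def mem_Collect_eq
proof (intro allI)
 fix T
 show "if T <= G & card T = Suc l then bd G x T : V T else bd G x T = 0"
 proof (cases "T <= G")
  case T: True have fT: "finite T" using T assms(1) finite_U finite_subset by (meson order_trans)
  have t: "T - {g} <= U" "g : U - (T - {g})" "insert g (T - {g}) = T" if "g : T" for g
   using that T assms(1) by auto
  have in_V: "mu (T - {g}) g (x (T - {g})) : V T" if "g : T" for g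
   using mu_in[of "T - {g}" g "x (T - {g})"] t[OF that] fam_in[OF assms(2,1), of "T - {g}"] T
   by auto
  have "bd G x T : V T" unfolding bd_def using T assms(1) in_V
   by (auto intro!: acD(5,6)[OF V_closed])
  moreover have "bd G x T = 0" if "card T ~= Suc l"
  proof -
   have "mu (T - {g}) g (x (T - {g})) = 0" if "g : T" for g
   proof -
    have "card (T - {g}) ~= l" using \<open>card T ~= Suc l\<close> that fT by (metis card.remove)
    hence "x (T - {g}) = 0" using fam_zero[OF assms(2)] by blast
    thus ?thesis using mu_zero t[OF that] by simp
   qed
   thus ?thesis unfolding bd_def by simp
  qed
  ultimately show ?thesis using T by auto
 qed (simp add: bd_def)
qed

lemma bd_diff: assumes "G <= U" "x : fam G l" "y : fam G l"
 shows "bd G (%S. x S - y S) = (%T. bd G x T - bd G y T)"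
proof
 fix T
 show "bd G (%S. x S - y S) T = bd G x T - bd G y T"
 proof (cases "T <= G")
  case T: True have "mu (T - {g}) g (x (T - {g}) - y (T - {g}))
    = mu (T - {g}) g (x (T - {g})) - mu (T - {g}) g (y (T - {g}))" if "g : T" for g
  proof (rule addD(4)[OF mu_add V_closed])
   show "T - {g} <= U" "T - {g} <= U" "g : U - (T - {g})" using T assms(1) that by auto
   show "x (T - {g}) : V (T - {g})" "y (T - {g}) : V (T - {g})"
    using fam_in assms T by (meson Diff_subset order_trans)+
  qed
  thus ?thesis using T by (simp add: bd_def signed_diff sum_subtractf)
 qed (simp add: bd_def)
qed

lemma bd_bd: assumes "G <= U" "x : fam G l" shows "bd G (bd G x) = (%_. 0)"
proof
 fix T
 show "bd G (bd G x) T = 0"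
 proof (cases "T <= G")
  case T: True have fT: "finite T" using T assms(1) finite_U finite_subset by (meson order_trans)
  define t where "t g h = sgp (T - {g}) g (sgp (T - {g} - {h}) h
    (mu (T - {g}) g (mu (T - {g} - {h}) h (x (T - {g} - {h})))))" for g h
  have eq: "bd G (bd G x) T = (SUM g:T. SUM h:T - {g}. t g h)"
   unfolding bd_def[of G "bd G x"] using T
  proof (simp, intro sum.cong refl)
   fix g assume g: "g : T"
   have gU: "T - {g} <= U" "g : U - (T - {g})" using g T assms(1) by auto
   have in_V: "mu (T - {g} - {h}) h (x (T - {g} - {h})) : V (T - {g})" if "h : T - {g}" for h
   proof -
    have "T - {g} - {h} <= U" "h : U - (T - {g} - {h})" "insert h (T - {g} - {h}) = T - {g}"
     using that T assms(1) by auto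
    thus ?thesis using mu_in[of "T - {g} - {h}" h "x (T - {g} - {h})"]
      fam_in[OF assms(2,1), of "T - {g} - {h}"] T by auto
   qed
   note ad = addD[OF mu_add[OF gU] V_closed[OF gU(1)]]
   have "mu (T - {g}) g (bd G x (T - {g})) = (SUM h:T - {g}. mu (T - {g}) g
     (sgp (T - {g} - {h}) h (mu (T - {g} - {h}) h (x (T - {g} - {h})))))" unfolding bd_def using T
    by (auto intro!: ad(6) acD(5)[OF V_closed[OF gU(1)]] in_V)
   also have "... = (SUM h:T - {g}. (sgp (T - {g} - {h}) h
     (mu (T - {g}) g (mu (T - {g} - {h}) h (x (T - {g} - {h}))))))"
    by (intro sum.cong refl ad(5) in_V)
   finally show "sgp (T - {g}) g (mu (T - {g}) g (bd G x (T - {g}))) = sum (t g) (T - {g})"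
    by (simp add: signed_sum t_def)
  qed
  have anti: "t h g = - t g h" if "g : T" "h : T" "g ~= h" for g h
  proof -
   define S where "S = T - {g} - {h}"
   have S: "T - {g} = insert h S" "T - {h} = insert g S" "T - {g} - {h} = S" "T - {h} - {g} = S"
    "insert g S - {g} = S" "insert h S - {h} = S" using that by (auto simp: S_def)
   have h: "S <= U" "g : U - S" "h : U - S" using that T assms(1) by (auto simp: S_def)
   have "x S : V S" using fam_in[OF assms(2,1), of S] T S_def by blast
   from mu_mu[OF h that(3) this] show ?thesis
    unfolding t_def S using signed_pos_swap[of g h S] h that(3) by auto
  qed
  show ?thesis unfolding eq by (rule antisym_sum_zero[OF fT anti])
 qed (simp add: bd_def)
qed

end

section \<open>The double complex of all subcubes\<close>

context cube
begin

text \<open>For each \<open>S\<close> this is a chain of the subcube over \<open>S\<close>. The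
  outer index \<open>S\<close> runs in the cobar direction, the inner index \<open>T\<close> in the
  bar direction.\<close>

definition dfam :: "nat set => nat => nat => (nat set => nat set => 'a) set" where
 "dfam G k l = {x. ALL S. if S <= G & card S = k then x S : fam S l else x S = (%_. 0)}"

text \<open>For fixed \<open>T\<close> this is the augmented simplicial boundary on the sets between
  \<open>T\<close> and \<open>G\<close>, that is, on a simplex with the vertices
  \<open>G - T\<close> and coefficients in \<open>V T\<close>.\<close>

definition cob :: "nat set => (nat set => nat set => 'a) => nat set => nat set => 'a" where
 "cob G x S T = (if S <= G & T <= S
   then SUM g:G - S. sgp S g (x (insert g S) T) else 0)"

lemma dfamD: assumes "x : dfam G k l"
 shows "S <= G ==> card S = k ==> x S : fam S l" "~ (S <= G & card S = k) ==> x S T = 0"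
  "G <= U ==> S <= G ==> T <= S ==> x S T : V T" "~ T <= S ==> x S T = 0"
  "card T ~= l ==> x S T = 0"
proof -
 show *: "S <= G ==> card S = k ==> x S : fam S l" for S using assms unfolding dfam_def by force
 show z: "~ (S <= G & card S = k) ==> x S T = 0" for S T using assms unfolding dfam_def by force
 show "x S T : V T" if "G <= U" "S <= G" "T <= S"
 proof (cases "card S = k")
  case True thus ?thesis using fam_in[OF *] that by simp
 next case False thus ?thesis using z[of S T] acD(1)[OF V_closed, of T] that by simp
 qed
 show "~ T <= S ==> x S T = 0" "card T ~= l ==> x S T = 0"
  using fam_zero[OF *, of S T] z[of S T] by blast+
qed

lemma dfamI: assumes "!!S T. S <= G ==> card S = k ==> T <= S ==> card T = l ==> x S T : V T"
  and "!!S T. ~ (S <= G & card S = k & T <= S & card T = l) ==> x S T = 0" shows "x : dfam G k l"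
 unfolding dfam_def fam_def mem_Collect_eq by (metis assms)

lemma cob_dfam: assumes G: "G <= U" and x: "x : dfam G (Suc k) l" shows "cob G x : dfam G k l"
proof (rule dfamI)
 fix S T assume "S <= G" "card S = k" "T <= S" "card T = l"
 moreover hence "x (insert g S) T : V T" if "g : G - S" for g
  using that by (intro dfamD(3)[OF x G]) auto
 moreover have "T <= U" using calculation G by blast
 note T = acD[OF V_closed[OF this]]
 ultimately show "cob G x S T : V T" unfolding cob_def by (auto intro!: T(5,6))
next fix S T assume *: "~ (S <= G & card S = k & T <= S & card T = l)"
 have fG: "finite G" using G finite_U finite_subset by blast
 show "cob G x S T = 0"
 proof (cases "S <= G & T <= S")
  case True have "x (insert g S) T = 0" if "g : G - S" for g
  proof (cases "card T = l")
   case t: True have "card (insert g S) = Suc (card S)"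
    using that True fG by (intro card_insert_disjoint) (auto intro: finite_subset)
   hence "card (insert g S) ~= Suc k" using * True t by simp
   thus ?thesis using dfamD(2)[OF x] by blast
  next case False thus ?thesis using dfamD(5)[OF x] by blast
  qed
  thus ?thesis by (simp add: cob_def)
 qed (auto simp: cob_def)
qed

lemma cob_cob: assumes G: "G <= U" shows "cob G (cob G x) = (%_ _. 0)"
proof (intro ext)
 fix S T
 have fG: "finite (G - S)" using G finite_U finite_subset by blast
 show "cob G (cob G x) S T = 0"
 proof (cases "S <= G & T <= S")
  case True let ?t = "%g h. sgp S g (sgp (insert g S) h (x (insert h (insert g S)) T))"
  have "cob G (cob G x) S T = (SUM g:G - S. SUM h:G - S - {g}. ?t g h)"
   unfolding cob_def[of G "cob G x"] using True
  by (auto simp: cob_def signed_sum intro!: sum.cong refl)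
  also have "... = 0"
  proof (rule antisym_sum_zero[OF fG])
   fix g h assume "g : G - S" "h : G - S" "g ~= h"
   thus "?t h g = - ?t g h" using signed_pos_swap[of h g S "x (insert h (insert g S)) T"]
    unfolding signed_signed by (simp add: insert_commute add.commute)
  qed
  finally show ?thesis .
 qed (auto simp: cob_def)
qed

lemma cob_diff: "cob G (%S T. x S T - y S T) = (%S T. cob G x S T - cob G y S T)"
 by (auto simp: fun_eq_iff cob_def signed_diff sum_subtractf)

text \<open>The signs of \<open>cob\<close> depend only on the outer set and those of
  \<open>bd\<close> only on the inner one, so the two differentials commute instead of
  anticommuting.\<close>

lemma bd_cob: assumes G: "G <= U" and x: "x : dfam G (Suc k) l" and SG: "S <= G"
 shows "bd S (cob G x S) = cob G (%S. bd S (x S)) S"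
proof
 fix T
 show "bd S (cob G x S) T = cob G (%S. bd S (x S)) S T"
 proof (cases "T <= S")
  case t: True hence True: "S <= G & T <= S" using SG by simp
  have "bd S (cob G x S) T = (SUM g:T. SUM h:G - S. sgp (T - {g}) g
    (sgp S h (mu (T - {g}) g (x (insert h S) (T - {g})))))" unfolding bd_def using True
  proof (simp, intro sum.cong refl)
   fix g assume g: "g : T"
   have gU: "T - {g} <= U" "g : U - (T - {g})" and sub: "T - {g} <= S" using g True G by auto
   note ad = addD[OF mu_add[OF gU] V_closed[OF gU(1)]]
   have in_V: "x (insert h S) (T - {g}) : V (T - {g})" if "h : G - S" for h
    using that True by (intro dfamD(3)[OF x G]) auto
   have "mu (T - {g}) g (cob G x S (T - {g}))
     = (SUM h:G - S. mu (T - {g}) g (sgp S h (x (insert h S) (T - {g}))))"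
    unfolding cob_def using True by (auto intro!: ad(6) acD(5)[OF V_closed[OF gU(1)]] in_V)
   also have "... = (SUM h:G - S. sgp S h (mu (T - {g}) g (x (insert h S) (T - {g}))))"
    by (intro sum.cong refl ad(5) in_V)
   finally show "sgp (T - {g}) g (mu (T - {g}) g (cob G x S (T - {g})))
    = (SUM h:G - S. sgp (T - {g}) g (sgp S h (mu (T - {g}) g (x (insert h S) (T - {g})))))"
    by (simp add: signed_sum)
  qed
  also have "... = (SUM h:G - S. SUM g:T. sgp S h (sgp (T - {g}) g
    (mu (T - {g}) g (x (insert h S) (T - {g})))))"
   by (subst sum.swap) (simp add: signed_signed add.commute)
  also have "... = cob G (%S. bd S (x S)) S T"
   unfolding cob_def using True by (simp add: bd_def signed_sum subset_insertI2)
  finally show ?thesis .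
 qed (auto simp: cob_def bd_def)
qed

text \<open>A simplex with at least one vertex is contracted by the cone over a chosen vertex
  \<open>g0 T\<close> outside \<open>T\<close>. Such a vertex exists because \<open>l < k\<close>
  leaves room between \<open>T\<close> and any \<open>S\<close> of size \<open>k\<close>.\<close>

lemma cob_exact:
 assumes G: "G <= U" and x: "x : dfam G k l" and kl: "l < k" and cyc: "cob G x = (%_ _. 0)"
 shows "EX y:dfam G (Suc k) l. cob G y = x"
proof -
 have fG: "finite G" using G finite_U finite_subset by blast
 define g0 where "g0 T = (SOME g. g : G - T)" for T
 have g0: "g0 T : G - T" if "T <= G" "card T = l" "card T < card G" for T
  by (metis that Diff_eq_empty_iff all_not_in_conv antisym order_less_irrefl g0_def someI_ex)
 define y where "y S T = (if S <= G & card S = Suc k & T <= S & card T = l & g0 T : S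
  then sgp (S - {g0 T}) (g0 T) (x (S - {g0 T}) T) else 0)" for S T
 have card_G: "l < card G" if "S <= G" "card S = k" for S
  using card_mono[OF fG that(1)] that kl by simp
 have y: "y : dfam G (Suc k) l"
 proof (rule dfamI)
  fix S T assume *: "S <= G" "card S = Suc k" "T <= S" "card T = l"
  have "T <= U" using * G by blast
  note T = acD[OF V_closed[OF this]]
  have "x (S - {g0 T}) T : V T" by (smt (verit) dfamD x G T)
  thus "y S T : V T" unfolding y_def using T(1,5) by auto
 qed (auto simp: y_def)
 have "cob G y S T = x S T" for S T
 proof (cases "S <= G & card S = k & T <= S & card T = l")
  case False
  have "x S T = 0" using False dfamD(2)[OF x, of S T] dfamD(4)[OF x, of T S] dfamD(5)[OF x, of T S] by blast
  moreover have "cob G y S T = 0"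
   using False dfamD(2)[OF cob_dfam[OF G y], of S T] dfamD(4)[OF cob_dfam[OF G y], of T S]
    dfamD(5)[OF cob_dfam[OF G y], of T S] by blast
  ultimately show ?thesis by simp
 next case True hence g0T: "g0 T : G - T" using g0[of T] card_G[of S] by auto
  have ins: "card (insert g S) = Suc k" if "g : G - S" for g
   using that True fG by (subst card_insert_disjoint) (auto intro: finite_subset)
  show ?thesis
  proof (cases "g0 T : S")
   case out: False
   have "cob G y S T = (SUM g:G - S. if g = g0 T then x S T else 0)" unfolding cob_def using True
  using ins out by (auto simp: y_def intro!: sum.cong refl)
   also have "... = x S T" using fG g0T out by auto
   finally show ?thesis .
  \<comment> \<open>If \<open>S\<close> contains the apex, its value is recovered from the cycle
    condition at \<open>S\<close> without the apex.\<close>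
  next case inn: True define S0 where "S0 = S - {g0 T}"
   have S0: "S = insert (g0 T) S0" "g0 T ~: S0" "G - S0 = insert (g0 T) (G - S)" "S0 <= G" "T <= S0"
    "g0 T ~: G - S" using inn True g0T by (auto simp: S0_def)
   have "0 = cob G x S0 T" using cyc by simp
   also have "... = (SUM g:G - S0. sgp S0 g (x (insert g S0) T))"
    using S0(4,5) by (simp add: cob_def)
   also have "... = sgp S0 (g0 T) (x S T)
      + (SUM g:G - S. sgp S0 g (x (insert g S0) T))"
    unfolding S0(3) using fG S0(6) by (subst sum.insert) (auto simp: S0(1)[symmetric])
   finally have "- sgp S0 (g0 T) (x S T) = (SUM g:G - S. sgp S0 g (x (insert g S0) T))"
    by (intro minus_unique) (rule sym)
   hence "- sgp S0 (g0 T) (- sgp S0 (g0 T) (x S T))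
     = - sgp S0 (g0 T) (SUM g:G - S. sgp S0 g (x (insert g S0) T))" by simp
   hence e: "x S T = (SUM g:G - S. - sgp S0 (g0 T) (sgp S0 g (x (insert g S0) T)))"
    by (simp add: signed_uminus signed_sum sum_negf)
   have "cob G y S T = (SUM g:G - S. sgp S g (y (insert g S) T))" using True by (simp add: cob_def)
   also have "... = x S T" unfolding e
   proof (intro sum.cong refl)
    fix g assume g: "g : G - S"
    hence gn: "g ~= g0 T" "g ~: S0" using S0 by auto
    have "insert g S - {g0 T} = insert g S0" using S0 gn by auto
    hence "y (insert g S) T = sgp (insert g S0) (g0 T) (x (insert g S0) T)"
     using True ins[OF g] g inn by (auto simp: y_def)
    thus "sgp S g (y (insert g S) T) = - sgp S0 (g0 T) (sgp S0 g (x (insert g S0) T))"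
     using signed_pos_swap'[of "g0 T" g S0] gn S0 by simp
   qed
   finally show ?thesis .
  qed qed
 thus ?thesis using y by blast
qed

lemma bd_cong: "(!!T. T <= S ==> x T = y T) ==> bd G x S = bd G y S" unfolding bd_def by auto

lemma bd_zero: "S <= U ==> bd S (%_. 0) = (%_. 0)"
proof
 fix T assume S: "S <= U"
 have "mu (T - {g}) g 0 = 0" if "T <= S" "g : T" for g using that S by (intro mu_zero) auto
 thus "bd S (%_. 0) T = 0" by (simp add: bd_def)
qed

lemma dfam_0: "G <= U ==> (%_ _. 0) : dfam G k l"
 using V_closed[THEN acD(1)] by (intro dfamI) (auto intro: subset_trans)

lemma cob_0: "cob G (%_ _. 0) = (%_ _. 0)" by (auto simp: cob_def fun_eq_iff)

lemma dfam_large: assumes "G <= U" "x : dfam G k l" "card G < k" shows "x = (%_ _. 0)"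
proof (intro ext)
 fix S T
 have "finite G" using assms finite_U finite_subset by blast
 hence "~ (S <= G & card S = k)" using assms(3) card_mono[of G S] by auto
 thus "x S T = 0" using dfamD(2)[OF assms(2)] by blast
qed

text \<open>Diagonal chase: a \<open>cob\<close>-primitive \<open>y0\<close> of \<open>x\<close>
  fails to be a \<open>bd\<close>-cycle by an element of bidegree \<open>(k + 1, l + 1)\<close>,
  which is removed by the induction hypothesis and the exactness of the subcubes. The induction ends
  when \<open>k\<close> exceeds the size of \<open>G\<close>.\<close>

lemma double_exact: assumes G: "G <= U" and ex: "!!G l. G <= U ==> exact_at G l"
  and x: "x : dfam G k l" and kl: "l < k"
  and cyc: "cob G x = (%_ _. 0)" "!!S. S <= G ==> bd S (x S) = (%_. 0)"
 shows "EX y:dfam G (Suc k) l. cob G y = x & (ALL S<=G. bd S (y S) = (%_. 0))" using x kl cyc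
proof (induction "Suc (card G) - k" arbitrary: x k l rule: less_induct)
 case less have GU: "S <= G ==> S <= U" for S using G by blast
 show ?case
 proof (cases "card G < k")
  case True hence "x = (%_ _. 0)" using dfam_large[OF G less.prems(1)] by blast
  thus ?thesis using dfam_0[OF G] cob_0 bd_zero GU by (intro bexI[of _ "%_ _. 0"]) auto
 next case False obtain y0 where y0: "y0 : dfam G (Suc k) l" "cob G y0 = x"
   using cob_exact[OF G less.prems(1-3)] by blast
  define x' where "x' S = (if S <= G then bd S (y0 S) else (%_. 0))" for S
  have x': "x' : dfam G (Suc k) (Suc l)" unfolding dfam_def mem_Collect_eq
  proof (intro allI)
   fix S
   have "bd S (y0 S) : fam S (Suc l)" if "S <= G" "card S = Suc k"
    using bd_fam[OF GU dfamD(1)[OF y0(1)]] that by blast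
   moreover have "bd S (y0 S) = (%_. 0)" if "S <= G" "card S ~= Suc k"
  by (metis dfamD y0 that bd_zero GU fun_eq_iff)
   ultimately show "if S <= G & card S = Suc k then x' S : fam S (Suc l) else x' S = (%_. 0)"
    by (simp add: x'_def)
  qed
  have c1: "cob G x' = (%_ _. 0)"
  proof (intro ext)
   fix S T
   show "cob G x' S T = 0"
   proof (cases "S <= G")
    case True
    have "cob G x' S = cob G (%S. bd S (y0 S)) S" by (auto simp: cob_def x'_def fun_eq_iff)
    thus ?thesis using bd_cob[OF G y0(1) True] y0(2) less.prems(4)[OF True]
     by (simp add: fun_eq_iff)
   qed (simp add: cob_def)
  qed
  have c2: "bd S (x' S) = (%_. 0)" if "S <= G" for S
  proof (cases "card S = Suc k")
   case True
   thus ?thesis unfolding x'_def using bd_bd[OF GU[OF that] dfamD(1)[OF y0(1) that]] that by simp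
  next case F: False hence "x' S = (%_. 0)" using dfamD(2)[OF x'] by auto
   thus ?thesis using bd_zero GU that by simp
  qed
  have "Suc (card G) - Suc k < Suc (card G) - k" using False by arith
  from less.hyps[OF this x' _ c1 c2] less.prems(2)
  obtain z where z: "z : dfam G (Suc (Suc k)) (Suc l)" "cob G z = x'"
   "!!S. S <= G ==> bd S (z S) = (%_. 0)" by auto
  have "EX u. u : fam S l & bd S u = z S" if "S <= G" "card S = Suc (Suc k)" for S
   using ex[OF GU] dfamD(1)[OF z(1) that] z(3) that unfolding exact_at_def by blast
  then obtain u0 where u0: "!!S. S <= G ==> card S = Suc (Suc k) ==> u0 S : fam S l & bd S (u0 S) = z S"
   by metis
  define u where "u S = (if S <= G & card S = Suc (Suc k) then u0 S else (%_. 0))" for S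
  have u: "u : dfam G (Suc (Suc k)) l" unfolding dfam_def u_def using u0 by auto
  have bu: "bd S (u S) = z S" if "S <= G" for S
   using u0[of S] dfamD(2)[OF z(1), of S] bd_zero[of S] GU that unfolding u_def by auto
  have cu: "cob G u : dfam G (Suc k) l" using cob_dfam[OF G u] .
  \<comment> \<open>Subtracting \<open>cob G u\<close> does not change the \<open>cob\<close> of
    \<open>y0\<close>, and its \<open>bd\<close> is \<open>cob G z\<close>, which is exactly the
    defect of \<open>y0\<close>.\<close>
  define y where "y S T = y0 S T - cob G u S T" for S T
  have y: "y : dfam G (Suc k) l"
  proof (rule dfamI)
   fix S T assume "S <= G" "card S = Suc k" "T <= S" "card T = l"
   thus "y S T : V T" unfolding y_def
    using G by (intro acD(4)[OF V_closed] dfamD(3)[OF y0(1) G] dfamD(3)[OF cu G]) auto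
  next fix S T assume "~ (S <= G & card S = Suc k & T <= S & card T = l)"
   hence "y0 S T = 0" "cob G u S T = 0"
    using dfamD(2)[OF y0(1), of S T] dfamD(4)[OF y0(1), of T S] dfamD(5)[OF y0(1), of T S]
     dfamD(2)[OF cu, of S T] dfamD(4)[OF cu, of T S] dfamD(5)[OF cu, of T S] by blast+
   thus "y S T = 0" by (simp add: y_def)
  qed
  moreover have "cob G y = x" unfolding y_def cob_diff using y0(2) cob_cob[OF G, of u] by simp
  moreover have "bd S (y S) = (%_. 0)" if "S <= G" for S
  proof (cases "card S = Suc k")
   case True have "bd S (y S) = (%T. bd S (y0 S) T - bd S (cob G u S) T)"
    unfolding y_def using True that GU dfamD(1)[OF y0(1)] dfamD(1)[OF cu] by (intro bd_diff) auto
   also have "bd S (cob G u S) = cob G (%S. bd S (u S)) S" by (rule bd_cob[OF G u that])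
   also have "... = cob G z S" using bu that by (auto simp: cob_def)
   finally show ?thesis using z(2) that by (simp add: x'_def)
  next case F: False hence "y S = (%_. 0)" using dfamD(2)[OF y] by auto
   thus ?thesis using bd_zero GU that by simp
  qed
  ultimately show ?thesis by blast
 qed qed

text \<open>For the cube of a quasi-algebra this is the component of the quadratic dual at the
  composition with the merged gaps \<open>S\<close>.\<close>

definition ker :: "nat set => 'a set" where
 "ker S = {w : V {}. ALL g:S. mu {} g w = 0}"

text \<open>The row \<open>l = 0\<close> of the double complex: an element of \<open>V {}\<close> is
  a \<open>bd\<close>-cycle of the subcube over \<open>S\<close> iff it lies in
  \<open>ker S\<close>. The condition \<open>0 < k\<close> is the condition \<open>l < k\<close> of
  the chase and leaves out the top cobar degree.\<close>

lemma cobar_exact: assumes G: "G <= U" and ex: "!!G l. G <= U ==> exact_at G l" and k: "0 < k"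
  and w: "!!S. S <= G ==> card S = k ==> w S : ker S"
  and w0: "!!S. ~ (S <= G & card S = k) ==> w S = 0"
  and cyc: "!!S. S <= G ==> (SUM g:G - S. sgp S g (w (insert g S))) = 0"
 shows "EX y. (ALL S. (S <= G & card S = Suc k --> y S : ker S) & (~ (S <= G & card S = Suc k) --> y S = 0))
   & (ALL S. S <= G --> (SUM g:G - S. sgp S g (y (insert g S))) = w S)"
proof -
 define x where "x S T = (if T = {} then w S else 0)" for S T :: "nat set"
 have V0: "w S : V {}" for S using w[of S] w0[of S] acD(1)[OF V_closed, of "{}"]
  by (cases "S <= G & card S = k") (auto simp: ker_def)
 have fG: "finite G" using G finite_U finite_subset by blast
 have x: "x : dfam G k 0"
 proof (rule dfamI)
  fix S T assume *: "S <= G" "card S = k" "T <= S" "card T = 0"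
  hence "T = {}" using fG finite_subset by (metis card_0_eq)
  thus "x S T : V T" using V0 by (simp add: x_def)
 next fix S T assume "~ (S <= G & card S = k & T <= S & card T = 0)"
  thus "x S T = 0" using w0[of S] by (auto simp: x_def)
 qed
 have bx: "bd S (x S) = (%_. 0)" if S: "S <= G" for S
 proof
  fix T
  show "bd S (x S) T = 0"
  proof (cases "T <= S")
   case True have TU: "T <= U" using True S G by blast
   have "mu (T - {g}) g (x S (T - {g})) = 0" if g: "g : T" for g
   proof (cases "T - {g} = {}")
    case e: True have "mu {} g (w S) = 0"
     using w[OF S] w0[of S] mu_zero[of "{}" g] g True TU by (cases "card S = k") (auto simp: ker_def)
    thus ?thesis unfolding e x_def by simp
   next case False thus ?thesis using mu_zero[of "T - {g}" g] g TU by (auto simp: x_def)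
   qed
   thus ?thesis by (simp add: bd_def)
  qed (simp add: bd_def)
 qed
 have cx: "cob G x = (%_ _. 0)"
 proof (intro ext)
  fix S T
  show "cob G x S T = 0" using cyc[of S] by (cases "T = {}") (auto simp: cob_def x_def)
 qed
 obtain y where y: "y : dfam G (Suc k) 0" "cob G y = x" "!!S. S <= G ==> bd S (y S) = (%_. 0)"
  using double_exact[OF G ex x k cx bx] by blast
 have "y S {} : ker S" if S: "S <= G" for S unfolding ker_def
 proof (intro CollectI conjI ballI)
  show "y S {} : V {}" by (rule dfamD(3)[OF y(1) G S]) simp
  fix g assume g: "g : S"
  have "0 = bd S (y S) {g}" using y(3)[OF S] by simp
  also have "... = sgp {} g (mu {} g (y S {}))" using g by (simp add: bd_def)
  finally show "mu {} g (y S {}) = 0" by (metis signed_signed_same signed_zero)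
 qed
 moreover have "y S {} = 0" if "~ (S <= G & card S = Suc k)" for S using dfamD(2)[OF y(1) that] .
 moreover have "(SUM g:G - S. sgp S g (y (insert g S) {})) = w S" if "S <= G" for S
  using fun_cong[OF fun_cong[OF y(2), of S], of "{}"] that by (simp add: cob_def x_def)
 ultimately show ?thesis by (intro exI[of _ "%S. y S {}"]) blast
qed

end

section \<open>Leading words\<close>

text \<open>
 \<open>Y ta\<close> is the part of \<open>V {}\<close> of the type \<open>ta\<close>, and \<open>N ta\<close> the set of the gaps at which the word
 \<open>ta\<close> is normal, as in a Poincare-Birkhoff-Witt basis; \<open>M S\<close> merges at all the gaps in \<open>S\<close>.
\<close>

locale pbw_cube = cube +
 fixes Wd :: "'w set" and Y :: "'w => 'a set" and N :: "'w => nat set" and nu :: "'w => nat"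
  and M :: "nat set => 'a => 'a"
 assumes finite_Wd: "finite Wd" and Y_sub: "ta : Wd ==> Y ta <= V {}"
  and Y_closed: "ta : Wd ==> add_closed (Y ta)" and M_in: "S <= U ==> w : V {} ==> M S w : V S"
  and M_add: "S <= U ==> additive_on (V {}) (M S)" and M_empty: "w : V {} ==> M {} w = w"
  and mu_M: "S <= U ==> g : U - S ==> w : V {} ==> mu S g (M S w) = M (insert g S) w"
  and generate: "S <= U ==> z : V S ==> EX y. (ALL ta:Wd. y ta : Y ta) & z = M S (SUM ta:Wd. y ta)"
  and normal_inj: "S <= U ==> (!!ta. ta : Wd ==> S <= N ta ==> y ta : Y ta) ==>
   (SUM ta:{ta:Wd. S <= N ta}. M S (y ta)) = 0 ==> ta : Wd ==> S <= N ta ==> y ta = 0"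
  and rewrite_word: "ta : Wd ==> g : U - N ta ==> w : Y ta ==>
   EX y. (ALL si:Wd. y si : Y si & (y si ~= 0 --> nu si < nu ta)) & mu {} g w = mu {} g (SUM si:Wd. y si)"
begin

text \<open>The merges in \<open>S\<close> can be performed in any order, in particular with the one
  at \<open>g\<close> first.\<close>

lemma M_cong: assumes S: "S <= U" "g : S" and w: "w : V {}" "w' : V {}" "mu {} g w = mu {} g w'"
 shows "M S w = M S w'"
proof -
 have "finite (S - {g})" using S finite_U finite_subset by blast
 hence "S - {g} <= U - {g} ==> M (insert g (S - {g})) w = M (insert g (S - {g})) w'"
 proof (induction "S - {g}" arbitrary: S rule: finite_induct)
  case empty have "g : U" using assms by blast
  thus ?case using mu_M[of "{}" g w] mu_M[of "{}" g w'] M_empty w empty by (metis Diff_empty empty_subsetI)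
 next case (insert h T)
  have T: "T - {g} = T" "S - {g} = insert h T" using insert.hyps by auto
  hence "T <= U - {g}" "h : U" "h ~= g" using insert.prems by auto
  hence IH: "M (insert g T) w = M (insert g T) w'" using insert.hyps(3)[of T] T by simp
  have "insert g T <= U" "h : U - insert g T"
   using \<open>T <= U - {g}\<close> \<open>h : U\<close> \<open>h ~= g\<close> insert.hyps(2) assms by auto
  from mu_M[OF this w(1)] mu_M[OF this w(2)] IH
  show ?case unfolding T(2) by (simp add: insert_commute)
 qed
 moreover have "insert g (S - {g}) = S" using S by blast
 ultimately show ?thesis using S by auto
qed

definition reduced :: "nat set => nat => ('w => 'a) => bool" where
 "reduced S k y <-> (ALL ta:Wd. y ta : Y ta & (y ta ~= 0 --> nu ta < k & S <= N ta))"

text \<open>The bound \<open>k\<close> on the weights is the induction parameter of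
  \<open>bar_exact_reducible\<close>.\<close>

definition reducible :: "nat set => nat => 'a => bool" where
 "reducible S k w <-> w : V {} & (EX y. reduced S k y & M S w = M S (SUM ta:Wd. y ta))"

lemma sum_Y: "(!!ta. ta : Wd ==> y ta : Y ta) ==> sum y A : V {}" if "A <= Wd"
 by (rule acD(6)[OF V_closed]) (use that Y_sub in auto)

lemma Y0: "ta : Wd ==> 0 : Y ta" using acD(1)[OF Y_closed] .

lemmas M_D = addD(1,4,2,5,6)[OF M_add V_closed[OF empty_subsetI]]

lemma reducible_0: "reducible S k 0"
 unfolding reducible_def reduced_def using Y0 V_closed[of "{}", THEN acD(1)]
 by (intro conjI exI[of _ "%_. 0"]) auto

lemma reducible_add:
 assumes "S <= U" "reducible S k w" "reducible S k w'" shows "reducible S k (w + w')"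
proof -
 obtain y y' where y: "reduced S k y" "M S w = M S (sum y Wd)"
  and y': "reduced S k y'" "M S w' = M S (sum y' Wd)" and w: "w : V {}" "w' : V {}"
  using assms(2,3) unfolding reducible_def by auto
 have "reduced S k (%ta. y ta + y' ta)" unfolding reduced_def
 proof (intro ballI conjI impI)
  fix ta assume t: "ta : Wd"
  thus "y ta + y' ta : Y ta"
   using y(1) y'(1) by (intro acD(2)[OF Y_closed]) (auto simp: reduced_def)
  assume "y ta + y' ta ~= 0"
  hence "y ta ~= 0 | y' ta ~= 0" by auto
  thus "nu ta < k" "S <= N ta" using y(1) y'(1) t by (auto simp: reduced_def)
 qed
 moreover have sy: "sum y Wd : V {}" "sum y' Wd : V {}"
  using y(1) y'(1) by (auto simp: reduced_def intro!: sum_Y)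
 moreover have "w + w' : V {}" using w acD(2)[OF V_closed[of "{}"]] by simp
 moreover have "M S (w + w') = M S (SUM ta:Wd. y ta + y' ta)"
  using y(2) y'(2) by (simp add: sum.distrib M_D(1)[OF assms(1)] w sy)
 ultimately show ?thesis unfolding reducible_def by blast
qed

lemma reducible_sum:
 assumes "S <= U" "!!i. i : I ==> reducible S k (w i)" shows "reducible S k (sum w I)"
 using assms(2)
 by (induction I rule: infinite_finite_induct) (auto intro!: reducible_0 reducible_add assms(1))

lemma reducible_mono: "reducible S k w ==> k <= l ==> reducible S l w"
 unfolding reducible_def reduced_def using order_less_le_trans[of _ k l] by blast

lemma reducible_normal: assumes "ta : Wd" "w : Y ta" "S <= N ta" "nu ta < k" shows "reducible S k w"
proof -
 have "(SUM si:Wd. if si = ta then w else 0) = w" using finite_Wd assms(1) by auto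
 moreover have "reduced S k (%si. if si = ta then w else 0)"
  using assms Y0 by (auto simp: reduced_def)
 ultimately show ?thesis using Y_sub assms(1,2) unfolding reducible_def by auto
qed

text \<open>Rewriting at a gap of \<open>S\<close> where the word is not normal terminates by
  induction on the weight. The strict bound for such words keeps them out of the leading
  terms.\<close>

lemma reducible_Y: assumes "S <= U" "ta : Wd" "w : Y ta"
 shows "reducible S (Suc (nu ta)) w & (~ S <= N ta --> reducible S (nu ta) w)" using assms(2,3)
proof (induction "nu ta" arbitrary: ta w rule: less_induct)
 case less show ?case
 proof (cases "S <= N ta")
  case True thus ?thesis using reducible_normal less.prems by simp
 next case False then obtain g where g: "g : S" "g : U - N ta" using assms(1) by blast
  obtain y where y: "!!si. si : Wd ==> y si : Y si" "!!si. si : Wd ==> y si ~= 0 ==> nu si < nu ta"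
   "mu {} g w = mu {} g (sum y Wd)" using rewrite_word[OF less.prems(1) g(2) less.prems(2)] by blast
  have w: "w : V {}" "sum y Wd : V {}" using Y_sub less.prems y(1) sum_Y[of Wd y] by auto
  have "reducible S (nu ta) (y si)" if "si : Wd" for si
  by (metis less.hyps y that reducible_mono Suc_leI reducible_0)
  hence "reducible S (nu ta) (sum y Wd)" using reducible_sum assms(1) by blast
  moreover have "M S w = M S (sum y Wd)" using M_cong[OF assms(1) g(1) w y(3)] .
  ultimately have "reducible S (nu ta) w" unfolding reducible_def using w by simp
  thus ?thesis using reducible_mono[of S "nu ta" w "Suc (nu ta)"] by simp
 qed qed


lemma reducibleE: assumes "reducible S k w" obtains y where "!!ta. ta : Wd ==> y ta : Y ta"
  "!!ta. ta : Wd ==> y ta ~= 0 ==> nu ta < k" "!!ta. ta : Wd ==> y ta ~= 0 ==> S <= N ta"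
  "M S w = M S (sum y Wd)" using assms unfolding reducible_def reduced_def by blast

text \<open>The coefficients of a word of maximal weight form a cycle of the simplex on
  \<open>N ta Int G\<close>, since \<open>normal_inj\<close> separates this word from the other
  normal words and everything else rewrites to smaller weight. Contracting these simplices and
  subtracting the boundary so obtained lowers the maximal weight.\<close>

lemma bar_exact_reducible:
 assumes G: "G <= U" and x: "x : fam G (Suc l)" and cyc: "bd G x = (%_. 0)"
  and red: "!!S. S <= G ==> card S = Suc l ==> EX w. reducible S k w & x S = M S w"
 shows "EX y:fam G l. bd G y = x" using x cyc red
proof (induction k arbitrary: x)
 case 0 have "x S = 0" for S
 proof (cases "S <= G & card S = Suc l")
  case True then obtain w where "reducible S 0 w" "x S = M S w" using 0(3) by blast
  then obtain y where y: "!!ta. ta : Wd ==> y ta ~= 0 ==> nu ta < 0" "x S = M S (sum y Wd)"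
   by (auto elim!: reducibleE)
  hence "!!ta. ta : Wd ==> y ta = 0" by auto
  hence "sum y Wd = 0" by auto
  thus ?thesis using y(2) M_D(3)[of S] True G by auto
 next case False thus ?thesis using fam_zero[OF 0(1)] by blast
 qed
 moreover have "(%_. 0) : fam G l" using V_closed[THEN acD(1)] G by (auto simp: fam_def)
 ultimately show ?case using bd_zero[OF G] by auto
next case (Suc k)
 note GU = subset_trans[OF _ G]
 have fin: "finite S" if "S <= G" for S using that G finite_U finite_subset by meson
 have "EX y. (ALL ta:Wd. y ta : Y ta & (y ta ~= 0 --> nu ta < Suc k & S <= N ta)) & x S = M S (sum y Wd)"
  if S: "S <= G" "card S = Suc l" for S by (metis Suc.prems S reducible_def reduced_def)
 then obtain a0 where a0: "!!S ta. S <= G ==> card S = Suc l ==> ta : Wd ==>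
   a0 S ta : Y ta & (a0 S ta ~= 0 --> nu ta < Suc k & S <= N ta)"
  "!!S. S <= G ==> card S = Suc l ==> x S = M S (sum (a0 S) Wd)" by metis
 define a where "a S ta = (if S <= G & card S = Suc l then a0 S ta else 0)" for S ta
 have aY: "a S ta : Y ta" if "ta : Wd" for S ta using a0(1) Y0 that by (auto simp: a_def)
 have aV: "a S ta : V {}" if "ta : Wd" for S ta using aY[OF that] Y_sub that by blast
 have anz: "nu ta < Suc k & S <= N ta" if "ta : Wd" "a S ta ~= 0" for S ta
  using a0(1)[of S ta] that by (auto simp: a_def split: if_splits)
 have xa: "x S = M S (sum (a S) Wd)" if "S <= G" for S
  using a0(2)[OF that] fam_zero[OF Suc.prems(1), of S] M_D(3)[OF GU[OF that]] that
  by (cases "card S = Suc l") (auto simp: a_def)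
 have saV: "sum (a S) A : V {}" if "A <= Wd" for S A using that aY by (intro sum_Y) auto
 \<comment> \<open>The coefficient of \<open>ta\<close> in the boundary of \<open>x\<close>, before
   any rewriting.\<close>
 define c where "c S ta = (SUM g:S. sgp (S - {g}) g (a (S - {g}) ta))" for S ta
 have cY: "c S ta : Y ta" if "ta : Wd" for S ta
  unfolding c_def using aY[OF that] by (intro acD(5,6)[OF Y_closed[OF that]])
 have bd_M: "bd G (%S. M S (sum (b S) A)) S = M S (SUM ta:A. SUM g:S. sgp (S - {g}) g (b (S - {g}) ta))"
  if S: "S <= G" and bV: "!!S ta. ta : A ==> b S ta : V {}" for S A and b :: "nat set => 'b => 'a"
 proof -
  have sV: "sum (b S) A : V {}" for S using bV by (intro acD(6)[OF V_closed]) auto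
  have "bd G (%S. M S (sum (b S) A)) S = (SUM g:S. M S (sgp (S - {g}) g (sum (b (S - {g})) A)))"
   unfolding bd_def using S
  proof (simp, intro sum.cong refl)
   fix g assume g: "g : S"
   have "insert g (S - {g}) = S" using g by blast
   hence "mu (S - {g}) g (M (S - {g}) (sum (b (S - {g})) A)) = M S (sum (b (S - {g})) A)"
    using mu_M[of "S - {g}" g "sum (b (S - {g})) A"] GU[OF S] sV by auto
   thus "sgp (S - {g}) g (mu (S - {g}) g (M (S - {g}) (sum (b (S - {g})) A)))
     = M S (sgp (S - {g}) g (sum (b (S - {g})) A))" using M_D(4)[OF GU[OF S] sV] by simp
  qed
  also have "... = M S (SUM g:S. sgp (S - {g}) g (sum (b (S - {g})) A))"
   using acD(5)[OF V_closed sV] by (intro M_D(5)[symmetric] GU S) auto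
  also have "(SUM g:S. sgp (S - {g}) g (sum (b (S - {g})) A))
    = (SUM ta:A. SUM g:S. sgp (S - {g}) g (b (S - {g}) ta))" unfolding signed_sum by (rule sum.swap)
  finally show ?thesis .
 qed
 have c0: "c S ta = 0" if t: "ta : Wd" "nu ta = k" and S: "S <= G" "S <= N ta" for S ta
 proof -
  let ?A = "{ta:Wd. S <= N ta}" and ?B = "{ta:Wd. ~ S <= N ta}"
  have "0 = bd G x S" using Suc.prems(2) by simp
  also have "... = bd G (%S. M S (sum (a S) Wd)) S" by (rule bd_cong) (use xa S(1) in blast)
  also have "... = M S (sum (c S) Wd)" using bd_M[OF S(1), of Wd a] aV by (simp add: c_def)
  finally have z: "M S (sum (c S) Wd) = 0" by simp
  \<comment> \<open>Words that are not normal at all of \<open>S\<close> rewrite to weights below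
    \<open>k\<close> and cannot cancel a normal word of weight \<open>k\<close>.\<close>
  have "reducible S k (c S si)" if "si : ?B" for si
  proof (cases "nu si < Suc k")
   case True thus ?thesis using reducible_Y[OF GU[OF S(1)], of si "c S si"] cY that
     reducible_mono[of S "nu si" "c S si" k] by auto
  next case False hence "!!S. a S si = 0" using anz that by blast
   thus ?thesis by (simp add: c_def reducible_0)
  qed
  hence "reducible S k (sum (c S) ?B)" by (intro reducible_sum GU S(1)) auto
  then obtain y where y: "!!ta. ta : Wd ==> y ta : Y ta" "!!ta. ta : Wd ==> y ta ~= 0 ==> nu ta < k"
   "!!ta. ta : Wd ==> y ta ~= 0 ==> S <= N ta" "M S (sum (c S) ?B) = M S (sum y Wd)"
   by (rule reducibleE) blast
  have "sum y Wd = sum y ?A" by (rule sum.mono_neutral_right) (use finite_Wd y(3) in auto)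
  have "Wd = ?A Un ?B" "?A Int ?B = {}" by auto
  hence "sum (c S) Wd = sum (c S) ?A + sum (c S) ?B"
   using finite_Wd by (metis (no_types, lifting) finite_Un sum.union_disjoint)
  hence "0 = M S (sum (c S) ?A + sum (c S) ?B)" using z by simp
  also have "... = M S (sum (c S) ?A) + M S (sum (c S) ?B)"
   using cY by (intro M_D(1) GU S(1) sum_Y) auto
  also have "... = M S (sum (c S) ?A) + M S (sum y ?A)" using y(4) \<open>sum y Wd = sum y ?A\<close> by simp
  also have "... = M S (SUM ta:?A. c S ta + y ta)"
   using cY y(1) by (simp add: sum.distrib) (intro M_D(1)[symmetric] GU S(1) sum_Y, auto)
  also have "... = (SUM ta:?A. M S (c S ta + y ta))"
  proof (intro M_D(5) GU S(1))
   fix i assume "i : ?A"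
   thus "c S i + y i : V {}"
    using subsetD[OF Y_sub] cY y(1) by (intro acD(2)[OF V_closed]) auto
  qed
  finally have "(SUM ta:?A. M S (c S ta + y ta)) = 0" by simp
  hence "c S ta + y ta = 0" using cY y(1) t S acD(2)[OF Y_closed]
   by (intro normal_inj[of S "%ta. c S ta + y ta"] GU) auto
  moreover have "y ta = 0" using y(2)[of ta] t by auto
  ultimately show ?thesis by simp
 qed
 \<comment> \<open>The apex of the cone contracting the simplex on \<open>N ta Int G\<close>. That
   set is nonempty wherever it is used, because it contains some \<open>S\<close> of positive
   size.\<close>
 define g0 where "g0 ta = (SOME g. g : N ta Int G)" for ta
 have g0: "g0 ta : N ta Int G" if "g : N ta Int G" for ta g unfolding g0_def using that by (rule someI)
 define v where "v T ta = (if T <= N ta Int G & card T = l & g0 ta ~: T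
   then sgp T (g0 ta) (a (insert (g0 ta) T) ta) else 0)" for T ta
 have vY: "v T ta : Y ta" if "ta : Wd" for T ta
  unfolding v_def using acD(1,5)[OF Y_closed[OF that]] aY[OF that] by auto
 have vV: "v T ta : V {}" if "ta : Wd" for T ta using vY[OF that] Y_sub that by blast
 define b where "b S ta = (SUM g:S. sgp (S - {g}) g (v (S - {g}) ta))" for S ta
 have bY: "b S ta : Y ta" if "ta : Wd" for S ta
  unfolding b_def using vY[OF that] by (intro acD(5,6)[OF Y_closed[OF that]])
 have ba: "b S ta = a S ta" if t: "ta : Wd" "nu ta = k" and S: "S <= N ta Int G" "card S = Suc l" for S ta
 proof -
  have fS: "finite S" using S fin by blast
  obtain g1 where g1: "g1 : S" using S(2) by fastforce
  have g0G: "g0 ta : N ta Int G" using g0 g1 S by blast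
  have cr: "card (S - {g}) = l" if "g : S" for g using that S(2) by simp
  show ?thesis
  proof (cases "g0 ta : S")
   case True have "b S ta = (SUM g:S. if g = g0 ta then a S ta else 0)" unfolding b_def
  using True S cr by (auto simp: v_def insert_absorb intro!: sum.cong)
   thus ?thesis using fS True by (simp add: sum.delta)
  next case False let ?S = "insert (g0 ta) S"
   have "0 = c ?S ta" using c0[OF t, of ?S] g0G S by auto
   also have "... = sgp S (g0 ta) (a S ta)
     + (SUM g:S. sgp (?S - {g}) g (a (?S - {g}) ta))" unfolding c_def using False fS by auto
   finally have "- sgp S (g0 ta) (a S ta) = (SUM g:S. sgp (?S - {g}) g (a (?S - {g}) ta))"
    by (intro minus_unique) (rule sym)
   hence "- sgp S (g0 ta) (- sgp S (g0 ta) (a S ta))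
     = - sgp S (g0 ta) (SUM g:S. sgp (?S - {g}) g (a (?S - {g}) ta))" by simp
   hence e: "a S ta = (SUM g:S. - sgp S (g0 ta) (sgp (?S - {g}) g (a (?S - {g}) ta)))"
    by (simp add: signed_uminus signed_sum sum_negf)
   show ?thesis unfolding e b_def
   proof (intro sum.cong refl)
    fix g assume g: "g : S"
    define T where "T = S - {g}"
    have T: "S = insert g T" "g ~: T" "g0 ta ~: T" "g ~= g0 ta" "?S - {g} = insert (g0 ta) T"
     "S - {g} = T" using g False by (auto simp: T_def)
    have "v T ta = sgp T (g0 ta) (a (insert (g0 ta) T) ta)" using cr[OF g] S T by (auto simp: v_def)
    thus "sgp (S - {g}) g (v (S - {g}) ta) = - sgp S (g0 ta) (sgp (?S - {g}) g (a (?S - {g}) ta))"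
     unfolding T(5,6) using signed_pos_swap'[of g "g0 ta" T "a (insert (g0 ta) T) ta"] T by simp
   qed qed qed
 let ?K = "{ta:Wd. nu ta = k}"
 define z where "z T = (if T <= G then M T (sum (v T) ?K) else 0)" for T
 have svV: "sum (v T) ?K : V {}" for T using vY by (intro sum_Y) auto
 have z: "z : fam G l" unfolding fam_def mem_Collect_eq
 proof (intro allI)
  fix T
  have "sum (v T) ?K = 0" if "card T ~= l" using that by (intro sum.neutral) (auto simp: v_def)
  thus "if T <= G & card T = l then z T : V T else z T = 0"
   using M_in[OF GU svV, of T T] M_D(3)[OF GU, of T] by (auto simp: z_def)
 qed
 have bz: "bd G z S = M S (sum (b S) ?K)" if S: "S <= G" for S
 proof -
  have "bd G z S = bd G (%S. M S (sum (v S) ?K)) S" by (rule bd_cong) (use S in "auto simp: z_def")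
  thus ?thesis using bd_M[OF S, of ?K v] vV by (simp add: b_def)
 qed
 define x' where "x' S = x S - bd G z S" for S
 have x': "x' : fam G (Suc l)" unfolding x'_def by (rule fam_diff[OF G Suc.prems(1) bd_fam[OF G z]])
 moreover have "bd G x' = (%_. 0)"
  unfolding x'_def using bd_diff[OF G Suc.prems(1) bd_fam[OF G z]] Suc.prems(2) bd_bd[OF G z] by auto
 moreover have "EX w. reducible S k w & x' S = M S w" if S: "S <= G" "card S = Suc l" for S
 proof (intro exI conjI)
  \<comment> \<open>At words of weight \<open>k\<close> normal on \<open>S\<close> the two terms
    cancel. At the other words of weight \<open>k\<close> the difference is still a form of that
    word and rewrites to smaller weight.\<close>
  define w where "w = (SUM ta:Wd. if nu ta = k then a S ta - b S ta else a S ta)"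
  have e: "w = sum (a S) Wd - sum (b S) ?K"
  proof -
   have "sum (b S) ?K = (SUM ta:Wd. if nu ta = k then b S ta else 0)"
    using finite_Wd by (simp add: sum.inter_filter)
   thus ?thesis unfolding w_def by (simp add: sum_subtractf[symmetric]) (intro sum.cong, auto)
  qed
  have "sum (b S) ?K : V {}" using bY by (intro sum_Y) auto
  thus "x' S = M S w"
   unfolding x'_def e using xa[OF S(1)] bz[OF S(1)] M_D(2)[OF GU[OF S(1)] saV[of Wd S]] by simp
  show "reducible S k w" unfolding w_def
  proof (intro reducible_sum GU S(1))
   fix ta assume t: "ta : Wd"
   consider "nu ta = k" "S <= N ta" | "nu ta = k" "~ S <= N ta" | "nu ta < k" | "nu ta > k" by linarith
   thus "reducible S k (if nu ta = k then a S ta - b S ta else a S ta)"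
   proof cases
    case 1 thus ?thesis using ba[OF t _ _ S(2)] S(1) by (simp add: reducible_0)
   next case 2
    thus ?thesis using reducible_Y[OF GU[OF S(1)] t acD(4)[OF Y_closed[OF t] aY bY]] t by simp
   next case 3 thus ?thesis using reducible_Y[OF GU[OF S(1)] t aY[OF t, of S]]
      reducible_mono[of S "Suc (nu ta)" "a S ta" k] by simp
   next case 4 hence "a S ta = 0" using anz[OF t, of S] by auto
    thus ?thesis using 4 by (simp add: reducible_0)
   qed qed qed
 ultimately obtain y where y: "y : fam G l" "bd G y = x'" using Suc.IH[of x'] by blast
 have "bd G (%S. (y S + z S) - z S) = (%T. bd G (%S. y S + z S) T - bd G z T)"
  by (rule bd_diff[OF G fam_add[OF G y(1) z] z])
 hence "bd G (%S. y S + z S) = x" using y(2) by (simp add: fun_eq_iff x'_def)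
 thus ?case using fam_add[OF G y(1) z] by blast
qed

theorem bar_exact: "G <= U ==> exact_at G l" unfolding exact_at_def
proof (intro ballI impI)
 fix x assume G: "G <= U" and x: "x : fam G (Suc l)" "bd G x = (%_. 0)"
 define k where "k = Suc (SUM ta:Wd. nu ta)"
 show "EX y:fam G l. bd G y = x"
 proof (rule bar_exact_reducible[OF G x, of k])
  fix S assume S: "S <= G" "card S = Suc l"
  have SU: "S <= U" using S G by blast
  have "x S : V S" using fam_in[OF x(1) G S(1)] .
  from generate[OF SU this] obtain y where y: "ALL ta:Wd. y ta : Y ta" "x S = M S (sum y Wd)" by blast
  have "reducible S k (sum y Wd)"
  proof (intro reducible_sum SU)
   fix ta assume t: "ta : Wd"
   hence "nu ta < k" unfolding k_def using member_le_sum[OF t, of nu] finite_Wd by simp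
   thus "reducible S k (y ta)"
    using reducible_Y[OF SU t, of "y ta"] y(1) t reducible_mono[of S "Suc (nu ta)" "y ta" k] by simp
  qed
  thus "EX w. reducible S k w & x S = M S w" using y(2) by blast
 qed qed

end

section \<open>Compositions and sets of gaps\<close>

text \<open>
 A composition of \<open>n\<close> is given by the set of the gaps between consecutive units of \<open>n\<close> at which the
 units are merged; the gap \<open>g\<close> lies between the units \<open>g\<close> and \<open>g + 1\<close>.
\<close>

definition gaps :: "nat => nat set" where
 "gaps n = {g. Suc g < n}"

text \<open>Recursion on the last unit, which is either glued to the last entry or starts a new one;
  among \<open>n + 2\<close> units the last gap has the number \<open>n\<close>.\<close>

fun parts :: "nat => nat set => int list" where
 "parts 0 S = []"
| "parts (Suc 0) S = [1]"
| "parts (Suc (Suc n)) S = (if n : S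
   then butlast (parts (Suc n) S) @ [last (parts (Suc n) S) + 1] else parts (Suc n) S @ [1])"

lemma finite_gaps [simp]: "finite (gaps n)"
 by (rule finite_subset[of _ "{..<n}"]) (auto simp: gaps_def)

lemma pos_0 [simp]: "pos S 0 = 0" by (simp add: pos_def)

lemma pos_Suc: "pos S (Suc n) = (if n : S then pos S n else Suc (pos S n))"
proof -
 have "{h. h < Suc n & h ~: S} = (if n : S then {h. h < n & h ~: S} else insert n {h. h < n & h ~: S})"
  by (auto simp: less_Suc_eq)
 thus ?thesis by (simp add: pos_def)
qed

lemma pos_mono: "g <= h ==> pos S g <= pos S h"
 by (induction h rule: dec_induct) (auto simp: pos_Suc)

lemma pos_inj: assumes "pos S g = pos S h" "g ~: S" "h ~: S" shows "g = h"
proof (rule ccontr)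
 assume "g ~= h"
 then consider "Suc g <= h" | "Suc h <= g" by linarith
 thus False
  using pos_mono[of "Suc g" h S] pos_mono[of "Suc h" g S] assms by cases (auto simp: pos_Suc)
qed

lemma parts_cong: "(!!g. Suc g < n ==> g : S <-> g : S') ==> parts n S = parts n S'"
 by (induction n S rule: parts.induct) auto

lemma length_parts: "length (parts (Suc n) S) = Suc (pos S n)"
proof (induction n)
 case (Suc n)
 hence "parts (Suc n) S ~= []" by auto
 with Suc show ?case by (auto simp: pos_Suc)
qed simp

lemma parts_ne: "parts (Suc n) S ~= []" using length_parts[of n S] by auto

lemma parts_pos: "k : set (parts n S) ==> 0 < k"
proof (induction n S arbitrary: k rule: parts.induct)
 case (3 n S)
 thus ?case using last_in_set[OF parts_ne, of n S]
  by (fastforce split: if_splits dest: in_set_butlastD)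
qed auto

lemma sum_parts: "sum_list (parts n S) = int n"
proof (induction n S rule: parts.induct)
 case (3 n S)
 have "sum_list (parts (Suc n) S) = sum_list (butlast (parts (Suc n) S)) + last (parts (Suc n) S)"
  using parts_ne[of n S] by (metis append_butlast_last_id sum_list.append sum_list.Cons sum_list.Nil add.right_neutral)
 thus ?case using 3 by auto
qed auto

lemma merge_at_append: "Suc j < length xs ==> merge_at j (xs @ ys) = merge_at j xs @ ys"
 by (simp add: merge_at_def nth_append)

lemma merge_at_last: "merge_at (length xs) (xs @ [a, b]) = xs @ [a + b]"
 by (simp add: merge_at_def nth_append)

lemma merge_at_bump: assumes "Suc j < length P"
 shows "merge_at j (butlast P @ [last P + 1]) = butlast (merge_at j P) @ [last (merge_at j P) + 1]"
proof -
 obtain Q l where P: "P = Q @ [l]" using assms by (cases P rule: rev_cases) auto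
 show ?thesis
 proof (cases "Suc j < length Q")
  case True thus ?thesis by (simp add: P merge_at_append)
 next case False hence "Suc j = length Q" using assms P by simp
  then obtain Q' a where Q: "Q = Q' @ [a]" "j = length Q'" by (cases Q rule: rev_cases) auto
  show ?thesis unfolding P Q using merge_at_last[of Q' a l] merge_at_last[of Q' a "l + 1"] by (simp add: butlast_append)
 qed qed

text \<open>A gap outside \<open>S\<close> is the right end of the entry number
  \<open>pos S g\<close>, so filling it merges this entry with the next one.\<close>

lemma merge_parts:
 assumes "g ~: S" "Suc g < n" shows "parts n (insert g S) = merge_at (pos S g) (parts n S)"
 using assms
proof (induction n S rule: parts.induct)
 case (3 n S)
 have len: "length (parts (Suc n) S) = Suc (pos S n)" by (rule length_parts)
 show ?case
 proof (cases "g = n")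
  case True let ?P = "parts (Suc n) S"
  have c: "parts (Suc n) (insert g S) = ?P" using True by (intro parts_cong) auto
  have P: "?P = butlast ?P @ [last ?P]" using parts_ne by simp
  have "merge_at (pos S g) (?P @ [1]) = butlast ?P @ [last ?P + 1]"
   using merge_at_last[of "butlast ?P" "last ?P" 1] P len True
   by (metis append.assoc append_Cons append_Nil diff_Suc_1 length_butlast)
  thus ?thesis using True 3(4) c by simp
 next case False hence g: "g < n" using 3(5) by simp
  have "Suc (pos S g) <= pos S n" using pos_mono[of "Suc g" n S] g 3(4) by (simp add: pos_Suc)
  hence j: "Suc (pos S g) < length (parts (Suc n) S)" using len by simp
  have IH: "parts (Suc n) (insert g S) = merge_at (pos S g) (parts (Suc n) S)"
   using 3(1-4) g by (cases "n : S") auto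
  show ?thesis using IH merge_at_bump[OF j] merge_at_append[OF j] False by auto
 qed qed auto

lemma Suc_pos_length: assumes "g ~: S" "Suc g < n" shows "Suc (pos S g) < length (parts n S)"
proof -
 obtain m where m: "n = Suc m" "Suc g <= m" using assms(2) by (cases n) auto
 thus ?thesis using length_parts[of m S] pos_mono[OF m(2), of S] assms(1) by (simp add: pos_Suc)
qed

text \<open>The last entry is 1 exactly when the last gap is open, so the set can be read off from
  the right.\<close>

lemma parts_inj: assumes "parts n S = parts n S'" "Suc g < n" shows "g : S <-> g : S'" using assms
proof (induction n S rule: parts.induct)
 case (3 n S)
 have p: "0 < last (parts (Suc n) S)" "0 < last (parts (Suc n) S')"
  using parts_pos[OF last_in_set[OF parts_ne]] by auto
 have l: "last (parts (Suc (Suc n)) S) = 1 <-> n ~: S" "last (parts (Suc (Suc n)) S') = 1 <-> n ~: S'"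
  using p by auto
 have "n ~: S <-> n ~: S'" unfolding l[symmetric] 3(4) ..
 hence n: "n : S <-> n : S'" by blast
 show ?case
 proof (cases "g = n")
  case False
  have b: "P = Q" if "P ~= []" "Q ~= []" "butlast P = butlast Q & last P = last Q" for P Q :: "int list"
   using that append_butlast_last_id by metis
  have "parts (Suc n) S = parts (Suc n) S'"
   using 3(4) n parts_ne[of n S] parts_ne[of n S'] by (auto intro: b)
  thus ?thesis using 3(1-3,5) False by (cases "n : S") auto
 qed (use n in simp)
qed auto

lemma card_gaps_pos: assumes "S <= gaps n" shows "length (parts n S) + card S = n"
proof (cases n)
 case (Suc m)
 have "{h. h < m & h ~: S} = {..<m} - S" "S <= {..<m}" using assms Suc by (auto simp: gaps_def)
 hence "pos S m = m - card S" "card S <= m"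
  using card_mono[of "{..<m}" S] by (auto simp: pos_def card_Diff_subset finite_subset)
 thus ?thesis using Suc length_parts[of m S] by simp
qed (use assms in "auto simp: gaps_def")

subsection \<open>Index sequences of the bar complexes\<close>

lemma compositions_append:
 "b : compositions n ==> b' : compositions n' ==> b @ b' : compositions (n + n')"
 by (auto simp: compositions_def)

lemma compositions_0: "compositions 0 = {[]}"
  using length_le_sum_list_pos by (force simp: compositions_def)

lemma compositions_neg: "n < 0 ==> compositions n = {}"
 using length_le_sum_list_pos by (fastforce simp: compositions_def)

lemma compositions_1: "compositions 1 = {[1]}"
proof -
 have "c = [1]" if c: "ALL k:set c. (0::int) < k" "sum_list c = 1" for c
 proof -
  have "int (length c) <= 1" using length_le_sum_list_pos[OF c(1)] c(2) by simp
  moreover have "c ~= []" using c(2) by auto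
  ultimately have "length c = 1" by (cases c) auto
  thus ?thesis using c(2) by (auto simp: length_Suc_conv)
 qed
 thus ?thesis by (auto simp: compositions_def)
qed

lemma compositions_Suc: assumes "0 < l"
 shows "compositions (l + 1) = (%b. b @ [1]) ` compositions l Un (%b. butlast b @ [last b + 1]) ` compositions l"
  (is "_ = ?R")
proof
 show "?R <= compositions (l + 1)"
 proof
  fix c assume "c : ?R"
  then obtain b where b: "b : compositions l" "c = b @ [1] | c = butlast b @ [last b + 1]" by blast
  have "b ~= []" using b(1) assms by (auto simp: compositions_def)
  then obtain b' k where "b = b' @ [k]" by (metis rev_exhaust)
  thus "c : compositions (l + 1)" using b by (auto simp: compositions_def)
 qed
next show "compositions (l + 1) <= ?R"
 proof
  fix c assume c: "c : compositions (l + 1)"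
  hence "c ~= []" using assms by (auto simp: compositions_def)
  then obtain b k where bk: "c = b @ [k]" by (metis rev_exhaust)
  show "c : ?R"
  proof (cases "k = 1")
   case True thus ?thesis using c bk by (auto simp: compositions_def)
  next case False have "0 < k" using c bk by (simp add: compositions_def)
   hence "b @ [k - 1] : compositions l" using c bk False by (auto simp: compositions_def)
   moreover have "c = (%b. butlast b @ [last b + 1]) (b @ [k - 1])" using bk by simp
   ultimately show ?thesis by blast
  qed qed qed

lemma bar_index_Nil [simp]: "bar_index [] = {[]}" by (auto simp: bar_index_def)

abbreviation "compos \<equiv> list_all2 (%n b. b : compositions n)"

lemma bar_index_append:
 "bar_index (ns @ ns') = {c @ c' |c c'. c : bar_index ns & c' : bar_index ns'}" (is "_ = ?R")
proof
 show "bar_index (ns @ ns') <= ?R" by (force simp: bar_index_def list_all2_append1)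
 show "?R <= bar_index (ns @ ns')"
 proof
  fix c assume "c : ?R"
  then obtain us vs where "compos ns us"
    "compos ns' vs" "c = concat us @ concat vs"
   by (auto simp: bar_index_def)
  thus "c : bar_index (ns @ ns')" unfolding bar_index_def
   by (auto intro!: exI[of _ "us @ vs"] list_all2_appendI)
 qed qed

lemma bar_index_single: "bar_index [n] = compositions n"
 by (force simp: bar_index_def list_all2_Cons1)

lemma bar_index_insert_zero: "bar_index (insert_zero i ns) = bar_index ns"
proof -
 have "bar_index (take i ns @ [0] @ drop i ns) = bar_index (take i ns @ drop i ns)"
  unfolding bar_index_append bar_index_single compositions_0 by auto
 thus ?thesis by (simp add: insert_zero_def)
qed

lemma bar_index_neg: "n : set ns ==> n < 0 ==> bar_index ns = {}"
 by (auto simp: bar_index_def list_all2_conv_all_nth in_set_conv_nth compositions_neg)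

lemma bar_index_merge_subset:
 assumes "Suc i < length ns" shows "bar_index ns <= bar_index (merge_at i ns)"
proof -
 have ns: "ns = take i ns @ [ns ! i] @ [ns ! Suc i] @ drop (Suc (Suc i)) ns"
  using assms by (simp add: Cons_nth_drop_Suc)
 have "bar_index (take i ns @ [ns ! i] @ [ns ! Suc i] @ drop (Suc (Suc i)) ns)
   <= bar_index (take i ns @ [ns ! i + ns ! Suc i] @ drop (Suc (Suc i)) ns)"
 proof
  fix c assume "c : bar_index (take i ns @ [ns ! i] @ [ns ! Suc i] @ drop (Suc (Suc i)) ns)"
  then obtain c1 c2 c3 c4 where c: "c = c1 @ (c2 @ c3) @ c4" "c1 : bar_index (take i ns)"
    "c2 : compositions (ns ! i)" "c3 : compositions (ns ! Suc i)" "c4 : bar_index (drop (Suc (Suc i)) ns)"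
   unfolding bar_index_append[of _ "_ @ _"] bar_index_append[of "[_]"] bar_index_single by auto
  hence "c2 @ c3 : compositions (ns ! i + ns ! Suc i)" using compositions_append by blast
  thus "c : bar_index (take i ns @ [ns ! i + ns ! Suc i] @ drop (Suc (Suc i)) ns)"
   unfolding bar_index_append[of _ "_ @ _"] bar_index_append[of "[_]"] bar_index_single
   using c by blast
 qed
 thus ?thesis using ns unfolding merge_at_def by simp
qed

lemma bar_index_snoc_Suc:
 "bar_index (ns @ [int (Suc (Suc l))]) = (%c. c @ [1]) ` bar_index (ns @ [int (Suc l)])
   Un (%c. butlast c @ [last c + 1]) ` bar_index (ns @ [int (Suc l)])" (is "?A = ?R")
proof -
 let ?C = "compositions (int (Suc l))"
 have C: "compositions (int (Suc (Suc l))) = (%b. b @ [1]) ` ?C Un (%b. butlast b @ [last b + 1]) ` ?C"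
  using compositions_Suc[of "int (Suc l)"] by auto
 have ne: "b ~= []" if "b : ?C" for b using that by (auto simp: compositions_def)
 show ?thesis unfolding bar_index_append bar_index_single C
 proof (intro set_eqI iffI)
  fix c assume "c : {c @ c' |c c'. c : bar_index ns & c' : (%b. b @ [1]) ` ?C Un (%b. butlast b @ [last b + 1]) ` ?C}"
  then obtain a b where ab: "a : bar_index ns" "b : ?C" "c = (a @ b) @ [1] | c = butlast (a @ b) @ [last (a @ b) + 1]"
   using ne by (fastforce simp: butlast_append)
  thus "c : (%c. c @ [1]) ` {c @ c' |c c'. c : bar_index ns & c' : ?C}
    Un (%c. butlast c @ [last c + 1]) ` {c @ c' |c c'. c : bar_index ns & c' : ?C}" by blast
 qed (use ne in "fastforce simp: butlast_append")
qed

text \<open>Concatenated compositions of the entries of \<open>ns\<close> are the refinements of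
  \<open>ns\<close>, that is, the compositions whose filled gaps are among those of
  \<open>ns\<close>. Zero entries leave no trace in them, hence the filter.\<close>

lemma bar_index_parts: assumes "ALL n:set ns. 0 <= n"
 shows "EX S0. S0 <= gaps (nat (sum_list ns)) & parts (nat (sum_list ns)) S0 = filter (%n. n ~= 0) ns
  & bar_index ns = {parts (nat (sum_list ns)) S |S. S <= S0}" using assms
proof (induction ns rule: rev_induct)
 case Nil thus ?case by auto
next case (snoc k ns)
 define n where "n = nat (sum_list ns)"
 obtain S0 where S0: "S0 <= gaps n" "parts n S0 = filter (%n. n ~= 0) ns"
  "bar_index ns = {parts n S |S. S <= S0}" using snoc unfolding n_def by auto
 have sn: "0 <= sum_list ns" "0 <= k" using snoc.prems by (auto intro: sum_list_nonneg)
 \<comment> \<open>The last entry grows by one unit at a time, in parallel with the recursion of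
   \<open>parts\<close>.\<close>
 have step: "EX S1. S1 <= gaps (n + Suc l) & parts (n + Suc l) S1 = filter (%n. n ~= 0) ns @ [int (Suc l)]
  & bar_index (ns @ [int (Suc l)]) = {parts (n + Suc l) S |S. S <= S1}" for l
 proof (induction l)
  case 0 have p: "parts (Suc n) S = parts n S @ [1]" if "S <= S0" for S
   using that S0(1) by (cases n) (auto simp: gaps_def)
  have "bar_index (ns @ [1]) = (%c. c @ [1]) ` bar_index ns"
   unfolding bar_index_append bar_index_single compositions_1 by auto
  also have "... = {parts (Suc n) S |S. S <= S0}"
   unfolding S0(3) setcompr_eq_image image_image by (rule image_cong) (auto simp: p)
  finally show ?case using S0(1,2) p[OF order_refl] by (intro exI[of _ S0]) (auto simp: gaps_def)
 next case (Suc l)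
  then obtain S1 where S1: "S1 <= gaps (n + Suc l)"
    "parts (n + Suc l) S1 = filter (%n. n ~= 0) ns @ [int (Suc l)]"
    "bar_index (ns @ [int (Suc l)]) = {parts (n + Suc l) S |S. S <= S1}" by blast
  let ?m = "n + l" and ?N = "n + Suc (Suc l)"
  have m: "?m ~: S1" using S1(1) by (auto simp: gaps_def)
  have p: "parts ?N S = parts (n + Suc l) S @ [1]"
   "parts ?N (insert ?m S) = butlast (parts (n + Suc l) S) @ [last (parts (n + Suc l) S) + 1]" if "S <= S1" for S
   using that m parts_cong[of "n + Suc l" "insert ?m S" S] by auto
  have "parts ?N (insert ?m S1) = filter (%n. n ~= 0) ns @ [int (Suc (Suc l))]"
   using p(2)[OF order_refl] S1(2) by simp
  moreover have "bar_index (ns @ [int (Suc (Suc l))]) = parts ?N ` Pow (insert ?m S1)"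
   unfolding bar_index_snoc_Suc S1(3) Pow_insert image_Un image_image setcompr_eq_image unfolding Pow_def
   by (intro arg_cong2[of _ _ _ _ "(Un)"] image_cong refl; rule p[symmetric]; simp)
  hence "bar_index (ns @ [int (Suc (Suc l))]) = {parts ?N S |S. S <= insert ?m S1}" by auto
  moreover have "insert ?m S1 <= gaps (n + Suc (Suc l))" using S1(1) by (auto simp: gaps_def)
  ultimately show ?case by blast
 qed
 show ?case
 proof (cases "k = 0")
  case True have "bar_index (ns @ [k]) = bar_index ns"
   unfolding bar_index_append bar_index_single True compositions_0 by auto
  thus ?thesis using S0 True unfolding n_def by auto
 next case False
  obtain l where l: "k = int (Suc l)" using False sn(2) by (metis nonneg_int_cases not0_implies_Suc of_nat_0)
  have "nat (sum_list (ns @ [k])) = n + Suc l" using sn l by (simp add: n_def)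
  moreover have "filter (%n. n ~= 0) (ns @ [k]) = filter (%n. n ~= 0) ns @ [int (Suc l)]" using l by simp
  ultimately show ?thesis using step[of l] l by simp
 qed qed

subsection \<open>Merges within one part\<close>

lemma concat_locate: assumes "j < length (concat cs)"
 obtains t i where "t < length cs" "i < length (cs ! t)" "j = length (concat (take t cs)) + i"
 using assms
proof (induction cs arbitrary: j thesis)
 case (Cons b cs)
 show ?case
 proof (cases "j < length b")
  case True thus ?thesis using Cons.prems(1)[of 0 j] by simp
 next case False hence "j - length b < length (concat cs)" using Cons.prems(2) by simp
  then obtain t i where "t < length cs" "i < length (cs ! t)" "j - length b = length (concat (take t cs)) + i"
   using Cons.IH by blast
  thus ?thesis using Cons.prems(1)[of "Suc t" i] False by simp
 qed qed simp

lemma concat_split: "t < length cs ==> concat cs = concat (take t cs) @ cs ! t @ concat (drop (Suc t) cs)"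
 by (metis concat.simps(2) concat_append id_take_nth_drop)

lemma concat_update: "t < length cs ==>
  concat (cs[t := b]) = concat (take t cs) @ b @ concat (drop (Suc t) cs)"
 using concat_split[of t "cs[t := b]"] by simp

lemma compositions_merge: "b : compositions n ==> Suc i < length b ==> merge_at i b : compositions n"
proof -
 assume b: "b : compositions n" and i: "Suc i < length b"
 hence e: "b = take i b @ [b ! i, b ! Suc i] @ drop (Suc (Suc i)) b"
  by (simp add: Cons_nth_drop_Suc)
 have "0 < b ! i" "0 < b ! Suc i" using b i by (auto simp: compositions_def)
 moreover have "sum_list b = sum_list (take i b) + (b ! i + b ! Suc i) + sum_list (drop (Suc (Suc i)) b)"
  by (subst e) simp
 ultimately show ?thesis using b
  by (auto simp: compositions_def merge_at_def dest: in_set_takeD in_set_dropD)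
qed

lemma merge_at_middle:
 assumes "Suc i < length b" shows "merge_at (length a + i) (a @ b @ c) = a @ merge_at i b @ c"
 using assms by (simp add: merge_at_def nth_append)

lemma same_part_merge: assumes "same_part ns c j" shows "merge_at j c : bar_index ns"
proof -
 obtain cs t where cs: "compos ns cs" "c = concat cs" and t: "t < length ns"
  and j: "length (concat (take t cs)) <= j" "Suc j < length (concat (take (Suc t) cs))"
  using assms unfolding same_part_def by blast
 have tl: "t < length cs" using cs(1) t list_all2_lengthD by metis
 define i where "i = j - length (concat (take t cs))"
 have i: "j = length (concat (take t cs)) + i" "Suc i < length (cs ! t)"
  using j tl by (auto simp: i_def take_Suc_conv_app_nth)
 have "merge_at j c = concat (cs[t := merge_at i (cs ! t)])"
  unfolding cs(2) concat_update[OF tl] concat_split[OF tl] i(1) by (rule merge_at_middle[OF i(2)])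
 moreover have "compos ns (cs[t := merge_at i (cs ! t)])"
  using cs(1) compositions_merge[OF _ i(2)] t by (auto simp: list_all2_conv_all_nth nth_list_update)
 ultimately show ?thesis by (auto simp: bar_index_def)
qed

text \<open>Splitting the entry number \<open>j\<close> of the merged sequence back into two
  positive numbers gives a decomposition of \<open>c\<close> in which both numbers lie in one
  composition. So the side condition of the differential just says that the merge stays in the index
  set.\<close>

lemma same_partI:
 assumes m: "merge_at j c : bar_index ns" and j: "Suc j < length c" and pos: "ALL k:set c. 0 < k"
 shows "same_part ns c j"
proof -
 obtain cs where cs: "compos ns cs" "merge_at j c = concat cs"
  using m by (auto simp: bar_index_def)
 have "j < length (concat cs)" using j unfolding cs(2)[symmetric] by (simp add: merge_at_def)
 then obtain t i where t: "t < length cs" and i: "i < length (cs ! t)" "j = length (concat (take t cs)) + i"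
  by (rule concat_locate)
 let ?b = "cs ! t"
 define b' where "b' = take i ?b @ [c ! j, c ! Suc j] @ drop (Suc i) ?b"
 have spl: "take j c @ [c ! j + c ! Suc j] @ drop (Suc (Suc j)) c
   = (concat (take t cs) @ take i ?b) @ [?b ! i] @ drop (Suc i) ?b @ concat (drop (Suc t) cs)"
  using cs(2) unfolding merge_at_def concat_split[OF t] using i(1) by (simp add: Cons_nth_drop_Suc)
 have "length (take j c) = length (concat (take t cs) @ take i ?b)" using i j by simp
 from iffD1[OF append_eq_append_conv[OF disjI1[OF this]] spl] have s: "take j c = concat (take t cs) @ take i ?b" "c ! j + c ! Suc j = ?b ! i"
  "drop (Suc (Suc j)) c = drop (Suc i) ?b @ concat (drop (Suc t) cs)" by auto
 have c: "c = concat (cs[t := b'])"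
 proof -
  have "c = take j c @ [c ! j, c ! Suc j] @ drop (Suc (Suc j)) c"
   using j by (simp add: Cons_nth_drop_Suc)
  thus ?thesis unfolding concat_update[OF t] b'_def s(1,3) by simp
 qed
 have bt: "?b : compositions (ns ! t)" using cs(1) t by (auto simp: list_all2_conv_all_nth)
 have "sum_list ?b = sum_list (take i ?b) + ?b ! i + sum_list (drop (Suc i) ?b)"
  using i(1) by (metis add.assoc id_take_nth_drop sum_list.Cons sum_list.append)
 hence "b' : compositions (ns ! t)"
  using bt s(2) j pos by (auto simp: compositions_def b'_def dest: in_set_takeD in_set_dropD)
 hence l: "compos ns (cs[t := b'])"
  using cs(1) t by (auto simp: list_all2_conv_all_nth nth_list_update)
 have "length (concat (take t (cs[t := b']))) <= j" using i(2) by simp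
 moreover have "Suc j < length (concat (take (Suc t) (cs[t := b'])))"
  using t i by (simp add: take_Suc_conv_app_nth b'_def)
 moreover have "t < length ns" using l t by (auto simp: list_all2_conv_all_nth)
 ultimately show ?thesis unfolding same_part_def using l c by blast
qed

text \<open>The admissible merges are at the gaps that are open in \<open>S\<close> but interior to
  the blocks of \<open>ns\<close>.\<close>

lemma same_part_parts:
 assumes S0: "S0 <= gaps n" "bar_index ns = {parts n S |S. S <= S0}" and S: "S <= S0"
 shows "same_part ns (parts n S) j <-> (EX g:S0 - S. j = pos S g)"
proof
 assume sp: "same_part ns (parts n S) j"
 have j: "Suc j < length (parts n S)" by (rule same_part_length[OF sp])
 then obtain m where m: "n = Suc m" by (cases n) auto
 hence "Suc j <= pos S m" using j length_parts[of m S] by simp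
 hence "EX g<m. g ~: S & pos S g = j"
 proof (induction m)
  case (Suc m)
  thus ?case by (cases "j = pos S m & m ~: S") (auto simp: pos_Suc less_Suc_eq split: if_splits)
 qed simp
 then obtain g where g: "g < m" "g ~: S" "pos S g = j" by blast
 have "parts n (insert g S) : bar_index ns"
  using same_part_merge[OF sp] merge_parts[of g S n] g m by simp
 then obtain S' where S': "S' <= S0" "parts n (insert g S) = parts n S'" using S0(2) by auto
 have "g : S'" using parts_inj[OF S'(2), of g] g m by simp
 thus "EX g:S0 - S. j = pos S g" using S' g by blast
next assume "EX g:S0 - S. j = pos S g"
 then obtain g where g: "g : S0" "g ~: S" "j = pos S g" by blast
 hence gn: "Suc g < n" using S0(1) by (auto simp: gaps_def)
 have "insert g S <= S0" using g S by blast
 moreover have "merge_at j (parts n S) = parts n (insert g S)"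
  using merge_parts[OF g(2) gn] g(3) by simp
 ultimately have "merge_at j (parts n S) : bar_index ns" unfolding S0(2) by blast
 thus "same_part ns (parts n S) j"
  using Suc_pos_length[OF g(2) gn] g(3) parts_pos by (intro same_partI) auto
qed

section \<open>From cubes to Koszulness\<close>

lemma bar_index_pos: "c : bar_index ns ==> k : set c ==> 0 < k"
proof -
 assume "c : bar_index ns" and k: "k : set c"
 then obtain cs where cs: "compos ns cs" "c = concat cs"
  by (auto simp: bar_index_def)
 then obtain b where b: "b : set cs" "k : set b" using k by auto
 then obtain i where "i < length cs" "b = cs ! i" by (auto simp: in_set_conv_nth)
 hence "b : compositions (ns ! i)" using cs(1) by (simp add: list_all2_conv_all_nth)
 thus "0 < k" using b by (simp add: compositions_def)
qed

lemma same_part_iff: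
 "same_part ns c j <-> Suc j < length c & (ALL k:set c. 0 < k) & merge_at j c : bar_index ns"
  using same_part_length same_part_merge bar_index_pos same_partI same_part_def bar_index_def by blast

lemma parts_subset_inj: "parts n S = parts n S' ==> S <= gaps n ==> S' <= gaps n ==> S = S'"
 using parts_inj[of n S S'] by (auto simp: gaps_def)

lemma bar_index_parts_parts:
 assumes "S0 <= gaps n" shows "bar_index (parts n S0) = {parts n S |S. S <= S0}"
proof -
 have "ALL k:set (parts n S0). 0 <= k" using parts_pos by fastforce
 from bar_index_parts[OF this] obtain S1 where S1: "S1 <= gaps n"
  "parts n S1 = filter (%k. k ~= 0) (parts n S0)" "bar_index (parts n S0) = {parts n S |S. S <= S1}"
  by (auto simp: sum_parts)
 have "filter (%k. k ~= 0) (parts n S0) = parts n S0" using parts_pos by (fastforce intro: filter_True)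
 hence "S1 = S0" using S1 assms parts_subset_inj by simp
 thus ?thesis using S1 by simp
qed

lemma sum_list_merge_at: "Suc i < length ns ==> sum_list (merge_at i ns) = sum_list ns"
proof -
 assume i: "Suc i < length ns"
 have "ns = take i ns @ [ns ! i, ns ! Suc i] @ drop (Suc (Suc i)) ns"
  using i by (simp add: Cons_nth_drop_Suc)
 hence "sum_list ns = sum_list (take i ns @ [ns ! i, ns ! Suc i] @ drop (Suc (Suc i)) ns)" by simp
 thus ?thesis by (simp add: merge_at_def)
qed

lemma sum_list_insert_zero: "sum_list (insert_zero i ns) = sum_list ns"
proof -
 have "sum_list (take i ns) + sum_list (drop i ns) = sum_list ns"
  unfolding sum_list.append[symmetric] append_take_drop_id ..
 thus ?thesis by (simp add: insert_zero_def)
qed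

lemma signed_fun: "signed k f x = signed k (f x)" by (simp add: signed_def)

context quasi_algebra
begin

lemma comp_closed: "add_closed (qcomp Z ns)" unfolding add_closed_def
 using subspace_0[OF comp_subspace] subspace_add[OF comp_subspace] subspace_neg[OF comp_subspace] by blast

lemma mult_in: "Suc i < length ns ==> x : qcomp Z ns ==> qmult Z i ns x : qcomp Z (merge_at i ns)"
 using mult_linear[of i ns] unfolding linear_between_def by blast

lemma mult_additive: "Suc i < length ns ==> additive_on (qcomp Z ns) (qmult Z i ns)"
 using mult_linear[of i ns] unfolding linear_between_def additive_on_def by blast

lemma mult_scale: "Suc i < length ns ==> x : qcomp Z ns ==>
  qmult Z i ns (qscale Z a x) = qscale Z a (qmult Z i ns x)"
 using mult_linear[of i ns] unfolding linear_between_def by blast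

lemma signed_scale: "qscale Z a (signed k x) = signed k (qscale Z a x)" by (simp add: signed_def)

text \<open>Commutativity is \<open>mult_mult\<close>: the \<open>j - 1\<close> there is the drop of
  \<open>pos\<close> at the larger gap after merging at the smaller one.\<close>

lemma cube_parts:
 "cube (gaps n) (%S. qcomp Z (parts n S)) (%S g. qmult Z (pos S g) (parts n S))"
proof
 fix S g x assume S: "S <= gaps n" and g: "g : gaps n - S"
 hence gn: "g ~: S" "Suc g < n" by (auto simp: gaps_def)
 note len = Suc_pos_length[OF gn]
 show "additive_on (qcomp Z (parts n S)) (qmult Z (pos S g) (parts n S))"
  by (rule mult_additive[OF len])
 assume x: "x : qcomp Z (parts n S)"
 show "qmult Z (pos S g) (parts n S) x : qcomp Z (parts n (insert g S))"
  unfolding merge_parts[OF gn] by (rule mult_in[OF len x])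
 fix h assume h: "h : gaps n - S" "g ~= h"
 have *: "qmult Z (pos (insert g S) h) (parts n (insert g S)) (qmult Z (pos S g) (parts n S) x)
   = qmult Z (pos (insert h S) g) (parts n (insert h S)) (qmult Z (pos S h) (parts n S) x)"
  if gh: "g < h" "g ~: S" "Suc g < n" "h ~: S" "Suc h < n" for g h
 proof -
  have p: "pos (insert h S) g = pos S g" "Suc (pos (insert g S) h) = pos S h"
   using pos_insert_ge[of g h S] pos_insert_less[of g h S] gh by auto
  have "pos S g < pos S h" using pos_mono[of "Suc g" h S] gh by (simp add: pos_Suc)
  from mult_mult[OF this Suc_pos_length[OF gh(4,5)] x]
  show ?thesis unfolding merge_parts[OF gh(2,3)] merge_parts[OF gh(4,5)] p(1)
   using p(2) by (metis diff_Suc_1)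
 qed
 have hn: "h ~: S" "Suc h < n" using h by (auto simp: gaps_def)
 show "qmult Z (pos (insert g S) h) (parts n (insert g S)) (qmult Z (pos S g) (parts n S) x)
   = qmult Z (pos (insert h S) g) (parts n (insert h S)) (qmult Z (pos S h) (parts n S) x)"
  using *[of g h] *[of h g] gn hn h(2) by (cases "g < h") auto
qed (auto simp: comp_closed)

lemma bar_sum_zero: "x : bar_sum K ns r ==> ~ (c : bar_index ns & length c = r) ==> x c = 0"
 unfolding bar_sum_def by auto

lemma bar_sum_in: "x : bar_sum (qcomp Z) ns r ==> x c : qcomp Z c"
 using acD(1)[OF comp_closed, of c] unfolding bar_sum_def mem_Collect_eq by metis

lemma bar_diff_0: "bar_diff Z ns 0 = 0"
proof
 fix c'
 have "qmult Z j c 0 = 0" if "Suc j < length c" for j c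
  using addD(2)[OF mult_additive[OF that] comp_closed] .
 thus "bar_diff Z ns 0 c' = 0 c'"
  unfolding bar_diff_def by (auto intro!: sum.neutral dest!: same_part_length)
qed

lemma bar_diff_add: assumes "x : bar_sum (qcomp Z) ns r" "y : bar_sum (qcomp Z) ns r"
 shows "bar_diff Z ns (x + y) = bar_diff Z ns x + bar_diff Z ns y"
proof
 fix c'
 have "qmult Z j c (x c + y c) = qmult Z j c (x c) + qmult Z j c (y c)" if "same_part ns c j" for j c
  using addD(1)[OF mult_additive[OF same_part_length[OF that]] comp_closed]
   bar_sum_in[OF assms(1)] bar_sum_in[OF assms(2)] by blast
 hence "bar_diff Z ns (x + y) c' = (SUM (c, j):{(c, j). c : bar_index ns & same_part ns c j & merge_at j c = c'}.
   signed (Suc j) (qmult Z j c (x c)) + signed (Suc j) (qmult Z j c (y c)))"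
  unfolding bar_diff_def by (intro sum.cong refl) (auto simp: signed_add)
 thus "bar_diff Z ns (x + y) c' = (bar_diff Z ns x + bar_diff Z ns y) c'"
  unfolding bar_diff_def by (simp add: sum.distrib case_prod_unfold)
qed

lemma bar_diff_scale: assumes "x : bar_sum (qcomp Z) ns r"
 shows "bar_diff Z ns (%c. qscale Z a (x c)) = (%c. qscale Z a (bar_diff Z ns x c))"
proof
 fix c'
 have "qmult Z j c (qscale Z a (x c)) = qscale Z a (qmult Z j c (x c))" if "same_part ns c j" for j c
  using mult_scale[OF same_part_length[OF that] bar_sum_in[OF assms]] .
 thus "bar_diff Z ns (%c. qscale Z a (x c)) c' = qscale Z a (bar_diff Z ns x c')"
  unfolding bar_diff_def scale_sum_right by (intro sum.cong refl) (auto simp: signed_scale)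
qed

context
 fixes ns :: "int list" and n :: nat and S0 :: "nat set"
 assumes ns: "S0 <= gaps n" "bar_index ns = {parts n S |S. S <= S0}"
begin

interpretation cube "gaps n" "%S. qcomp Z (parts n S)" "%S g. qmult Z (pos S g) (parts n S)"
 by (rule cube_parts)

text \<open>The pairs \<open>(c, j)\<close> that contribute at the composition of \<open>T\<close>
  correspond to the gap of \<open>T\<close> that is filled last.\<close>

lemma bar_diff_parts:
 assumes T: "T <= S0" shows "bar_diff Z ns x (parts n T) = bd S0 (%S. x (parts n S)) T"
proof -
 let ?f = "%g. (parts n (T - {g}), pos (T - {g}) g)"
 have inj: "inj_on ?f T"
 proof (rule inj_onI)
  fix g h assume gh: "g : T" "h : T" "?f g = ?f h"
  hence "T - {g} = T - {h}" using parts_subset_inj[of n "T - {g}" "T - {h}"] T ns(1) by auto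
  thus "g = h" using gh by blast
 qed
 have "{(c, j). c : bar_index ns & same_part ns c j & merge_at j c = parts n T} = ?f ` T"
 proof (intro set_eqI iffI)
  fix p assume "p : {(c, j). c : bar_index ns & same_part ns c j & merge_at j c = parts n T}"
  then obtain c j where p: "p = (c, j)" "c : bar_index ns" "same_part ns c j" "merge_at j c = parts n T"
   by auto
  then obtain S where S: "S <= S0" "c = parts n S" using ns(2) by auto
  then obtain g where g: "g : S0 - S" "j = pos S g" using same_part_parts[OF ns S(1)] p(3) by auto
  hence gn: "g ~: S" "Suc g < n" using ns(1) by (auto simp: gaps_def)
  have "parts n (insert g S) = parts n T" using merge_parts[OF gn] p(4) S(2) g(2) by simp
  hence "insert g S = T" using parts_subset_inj[of n "insert g S" T] S(1) g(1) T ns(1) by blast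
  hence "g : T" "T - {g} = S" using gn by auto
  thus "p : ?f ` T" using p(1) S(2) g(2) by (intro image_eqI[of _ _ g]) auto
 next fix p assume "p : ?f ` T"
  then obtain g where g: "g : T" "p = ?f g" by blast
  define S where "S = T - {g}"
  have S: "S <= S0" "g : S0 - S" "insert g S = T" using g T by (auto simp: S_def)
  hence gn: "g ~: S" "Suc g < n" using ns(1) by (auto simp: gaps_def)
  have "same_part ns (parts n S) (pos S g)" using same_part_parts[OF ns S(1)] S(2) by blast
  moreover have "merge_at (pos S g) (parts n S) = parts n T" using merge_parts[OF gn] S(3) by simp
  moreover have "parts n S : bar_index ns" using ns(2) S(1) by blast
  ultimately show "p : {(c, j). c : bar_index ns & same_part ns c j & merge_at j c = parts n T}"
   using g(2) unfolding S_def by simp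
 qed
 hence "bar_diff Z ns x (parts n T)
   = (SUM g:T. sgp (T - {g}) g (qmult Z (pos (T - {g}) g) (parts n (T - {g})) (x (parts n (T - {g})))))"
  unfolding bar_diff_def by (simp add: sum.reindex[OF inj])
 thus ?thesis using T by (simp add: bd_def)
qed

lemma bar_diff_outside: "c ~: bar_index ns ==> bar_diff Z ns x c = 0"
 unfolding bar_diff_def by (rule sum.neutral) (auto dest: same_part_merge)

lemma bar_index_length: "S <= S0 ==> length (parts n S) + card S = n"
 using card_gaps_pos ns(1) by blast

lemma fam_bar_sum: assumes "x : bar_sum (qcomp Z) ns r" "r + l = n"
 shows "(%S. if S <= S0 then x (parts n S) else 0) : fam S0 l" unfolding fam_def mem_Collect_eq
proof (intro allI)
 fix S
 show "if S <= S0 & card S = l then (if S <= S0 then x (parts n S) else 0) : qcomp Z (parts n S)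
  else (if S <= S0 then x (parts n S) else 0) = 0"
  using bar_sum_in[OF assms(1)] bar_sum_zero[OF assms(1), of "parts n S"] bar_index_length[of S] assms(2)
  by auto
qed

text \<open>Translates a family over sets of gaps back into one over index sequences; inverse to
  composition with \<open>parts n\<close>.\<close>

definition of_fam :: "(nat set => 'b) => int list => 'b::zero" where
 "of_fam X c = (if c : bar_index ns then X (THE S. S <= S0 & c = parts n S) else 0)"

lemma of_fam_parts: "S <= S0 ==> of_fam X (parts n S) = X S"
proof -
 assume S: "S <= S0"
 have "(THE S'. S' <= S0 & parts n S = parts n S') = S"
 proof (intro the_equality conjI refl S)
  fix S' assume "S' <= S0 & parts n S = parts n S'"
  thus "S' = S" using parts_subset_inj[of n S' S] S ns(1) by auto
 qed
 thus ?thesis using S ns(2) by (auto simp: of_fam_def)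
qed

lemma of_fam_bar_sum:
 assumes "!!S. S <= S0 ==> card S = l ==> X S : K (parts n S)" "!!S. S <= S0 ==> card S ~= l ==> X S = 0"
  "r + l = n" shows "of_fam X : bar_sum K ns r" unfolding bar_sum_def mem_Collect_eq
proof (intro allI)
 fix c
 show "if c : bar_index ns & length c = r then of_fam X c : K c else of_fam X c = 0"
 proof (cases "c : bar_index ns")
  case True then obtain S where S: "S <= S0" "c = parts n S" using ns(2) by auto
  thus ?thesis using assms of_fam_parts[OF S(1), of X] bar_index_length[OF S(1)] True
   by (cases "card S = l") auto
 qed (simp add: of_fam_def)
qed

lemma bar_ext: assumes "!!c. c ~: bar_index ns ==> x c = 0" "!!c. c ~: bar_index ns ==> y c = 0"
  "!!S. S <= S0 ==> x (parts n S) = y (parts n S)" shows "x = y"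
proof
 fix c show "x c = y c" using assms ns(2) by (cases "c : bar_index ns") auto
qed

lemma bd_restrict: "bd S0 (%S. if S <= S0 then x S else 0) T = bd S0 x T"
 unfolding bd_def by (auto intro!: sum.cong)

text \<open>Homological degree \<open>r\<close> is cube degree \<open>n - r\<close>. Above
  \<open>n\<close> there are no index sequences; below \<open>n\<close> the cube degree is positive,
  where the cube over \<open>S0\<close> is exact.\<close>

lemma bar_acyclic_of_exact: assumes ex: "!!G l. G <= gaps n ==> exact_at G l" and r: "r ~= n"
 shows "bar_cycles Z ns r = bar_boundaries Z ns r"
proof (cases "r < n")
 case False have "~ (c : bar_index ns & length c = q)" if "n < q" for q c
 proof
  assume c: "c : bar_index ns & length c = q"
  then obtain S where "S <= S0" "c = parts n S" using ns(2) by auto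
  thus False using bar_index_length[of S] c that by simp
 qed
 hence z: "bar_sum (qcomp Z) ns q = {0}" if "n < q" for q
  using that by (auto simp: bar_sum_def fun_eq_iff)
 have "n < r" using False r by simp
 thus ?thesis unfolding bar_cycles_def bar_boundaries_def
  using z[of r] z[of "Suc r"] bar_diff_0 by auto
next case True then obtain l where l: "r + Suc l = n" by (metis add_Suc_right less_imp_Suc_add)
 show ?thesis
 proof
  show "bar_cycles Z ns r <= bar_boundaries Z ns r"
  proof
   fix x assume "x : bar_cycles Z ns r"
   hence x: "x : bar_sum (qcomp Z) ns r" "bar_diff Z ns x = 0" by (auto simp: bar_cycles_def)
   let ?X = "%S. if S <= S0 then x (parts n S) else 0"
   have X: "?X : fam S0 (Suc l)" by (rule fam_bar_sum[OF x(1) l])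
   have "bd S0 ?X T = 0" for T
    using bar_diff_parts[of T x] x(2) unfolding bd_restrict by (cases "T <= S0") (auto simp: bd_def)
   then obtain Y where Y: "Y : fam S0 l" "bd S0 Y = ?X"
    using ex[OF ns(1), of l] X unfolding exact_at_def by blast
   have y: "of_fam Y : bar_sum (qcomp Z) ns (Suc r)"
    using l fam_in[OF Y(1) ns(1)] fam_zero[OF Y(1)] by (intro of_fam_bar_sum[of l]) auto
   have "bar_diff Z ns (of_fam Y) = x"
   proof (rule bar_ext)
    fix S assume S: "S <= S0"
    have "bar_diff Z ns (of_fam Y) (parts n S) = bd S0 Y S"
     unfolding bar_diff_parts[OF S] by (rule bd_cong) (use S in "auto simp: of_fam_parts")
    thus "bar_diff Z ns (of_fam Y) (parts n S) = x (parts n S)" using Y(2) S by simp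
   qed (use bar_sum_zero[OF x(1)] bar_diff_outside in auto)
   thus "x : bar_boundaries Z ns r" using y unfolding bar_boundaries_def by blast
  qed
  show "bar_boundaries Z ns r <= bar_cycles Z ns r"
  proof
   fix x assume "x : bar_boundaries Z ns r"
   then obtain y where y: "y : bar_sum (qcomp Z) ns (Suc r)" "x = bar_diff Z ns y"
    by (auto simp: bar_boundaries_def)
   let ?Y = "%S. if S <= S0 then y (parts n S) else 0"
   have Y: "?Y : fam S0 l" by (rule fam_bar_sum[OF y(1)]) (use l in simp)
   have xY: "x (parts n S) = bd S0 ?Y S" if "S <= S0" for S
    unfolding y(2) bar_diff_parts[OF that] bd_restrict by simp
   have B: "bd S0 ?Y : fam S0 (Suc l)" by (rule bd_fam[OF ns(1) Y])
   have "x = of_fam (bd S0 ?Y)"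
  by (smt (verit) bar_ext bar_diff_outside of_fam_def y of_fam_parts xY)
   moreover have "of_fam (bd S0 ?Y) : bar_sum (qcomp Z) ns r"
    using l fam_in[OF B ns(1)] fam_zero[OF B] by (intro of_fam_bar_sum[of "Suc l"]) auto
   moreover have "bar_diff Z ns x = 0"
   proof (rule bar_ext)
    fix S assume S: "S <= S0"
    have "bar_diff Z ns x (parts n S) = bd S0 (bd S0 ?Y) S"
     unfolding bar_diff_parts[OF S] by (rule bd_cong) (use S xY in auto)
    thus "bar_diff Z ns x (parts n S) = 0 (parts n S)" using bd_bd[OF ns(1) Y] by simp
   qed (simp_all add: bar_diff_outside)
   ultimately show "x : bar_cycles Z ns r" by (simp add: bar_cycles_def)
  qed qed qed

text \<open>Only the composition into units has length \<open>n\<close>, and its boundary has one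
  component for each gap of \<open>S0\<close>, namely the merge there.\<close>

lemma bar_cycles_top:
 "x : bar_cycles Z ns n <-> (ALL c. c ~= parts n {} --> x c = 0) & x (parts n {}) : ker S0"
proof -
 have len: "c : bar_index ns & length c = n <-> c = parts n {}" for c
 proof
  assume "c : bar_index ns & length c = n"
  then obtain S where S: "S <= S0" "c = parts n S" "length c = n" using ns(2) by auto
  hence "card S = 0" using bar_index_length[OF S(1)] by simp
  moreover have "finite S" by (rule finite_subset[OF subset_trans[OF S(1) ns(1)] finite_gaps])
  ultimately show "c = parts n {}" using S by simp
 next assume "c = parts n {}"
  thus "c : bar_index ns & length c = n" using bar_index_length[of "{}"] ns(2) by auto
 qed
 have bs: "x : bar_sum (qcomp Z) ns n <-> (ALL c. c ~= parts n {} --> x c = 0) & x (parts n {}) : qcomp Z (parts n {})"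
  unfolding bar_sum_def mem_Collect_eq len by auto
 have "bar_diff Z ns x = 0 <-> (ALL g:S0. qmult Z (pos {} g) (parts n {}) (x (parts n {})) = 0)"
  if x: "ALL c. c ~= parts n {} --> x c = 0" "x (parts n {}) : qcomp Z (parts n {})"
 proof
  assume d: "bar_diff Z ns x = 0"
  show "ALL g:S0. qmult Z (pos {} g) (parts n {}) (x (parts n {})) = 0"
  proof
   fix g assume g: "g : S0"
   have "0 = bar_diff Z ns x (parts n {g})" using d by simp
   also have "... = sgp {} g (qmult Z (pos {} g) (parts n {}) (x (parts n {})))"
    using g by (simp add: bar_diff_parts bd_def)
   finally show "qmult Z (pos {} g) (parts n {}) (x (parts n {})) = 0"
    by (metis signed_signed_same signed_zero)
  qed
 next assume k: "ALL g:S0. qmult Z (pos {} g) (parts n {}) (x (parts n {})) = 0"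
  show "bar_diff Z ns x = 0"
  proof (rule bar_ext)
   fix T assume T: "T <= S0"
   have "qmult Z (pos (T - {g}) g) (parts n (T - {g})) (x (parts n (T - {g}))) = 0" if g: "g : T" for g
   proof (cases "T - {g} = {}")
    case True have "g : S0" using g T by blast
    thus ?thesis unfolding True using k by blast
   next case False hence "parts n (T - {g}) ~= parts n {}"
     using parts_subset_inj[of n "T - {g}" "{}"] T ns(1) by auto
    hence "x (parts n (T - {g})) = 0" using x(1) by simp
    thus ?thesis using mu_zero[of "T - {g}" g] g T ns(1) by auto
   qed
   thus "bar_diff Z ns x (parts n T) = 0 (parts n T)"
    unfolding bar_diff_parts[OF T] by (simp add: bd_def)
  qed (simp_all add: bar_diff_outside)
 qed
 thus ?thesis unfolding bar_cycles_def mem_Collect_eq bs ker_def by auto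
qed

end

end

lemma sum_fun_apply: "(SUM i:I. f i) x = (SUM i:I. f i x :: 'a::ab_group_add)"
 by (induction I rule: infinite_finite_induct) auto

section \<open>The quadratic dual and its cobar complexes\<close>

context quasi_algebra
begin

abbreviation "QD \<equiv> quadratic_dual Z"

lemma dual_sel [simp]:
 "cscale QD = (%a x c. qscale Z a (x c))"
 "ccomp QD = (%ns. bar_cycles Z ns (nat (sum_list ns)))"
 "cone QD = (%c. if c = [] then qone Z else 0)"
 "qcomult QD = (%i ns x c. if c : bar_index ns then x c else 0)"
 "qcounit QD = (%i ns x. x)" by (simp_all add: quadratic_dual_def)

lemma bar_cycles_outside: "x : bar_cycles Z ns r ==> c ~: bar_index ns ==> x c = 0"
 unfolding bar_cycles_def using bar_sum_zero by blast

lemma bar_cycles_0: "0 : bar_cycles Z ns r"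
 unfolding bar_cycles_def bar_sum_def using bar_diff_0 acD(1)[OF comp_closed] by simp

lemma bar_cycles_add:
 assumes "x : bar_cycles Z ns r" "y : bar_cycles Z ns r" shows "x + y : bar_cycles Z ns r"
proof -
 have x: "x : bar_sum (qcomp Z) ns r" and y: "y : bar_sum (qcomp Z) ns r"
  using assms by (auto simp: bar_cycles_def)
 have "x + y : bar_sum (qcomp Z) ns r" unfolding bar_sum_def mem_Collect_eq
  using bar_sum_in[OF x] bar_sum_in[OF y] bar_sum_zero[OF x] bar_sum_zero[OF y]
   acD(2)[OF comp_closed] by simp
 thus ?thesis using bar_diff_add[OF x y] assms by (simp add: bar_cycles_def)
qed

lemma bar_cycles_scale:
 assumes "x : bar_cycles Z ns r" shows "(%c. qscale Z a (x c)) : bar_cycles Z ns r"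
  using assms bar_sum_in bar_sum_zero subspace_scale comp_subspace bar_diff_scale by (auto simp: bar_cycles_def fun_eq_iff bar_sum_def mem_Collect_eq)

lemma bar_cycles_neg: assumes "n : set ns" "n < 0" shows "bar_cycles Z ns r = {0}"
 using bar_cycles_0 bar_cycles_outside[of _ ns r] bar_index_neg[OF assms] by auto

lemma bar_cycles_insert_zero: "bar_cycles Z (insert_zero i ns) r = bar_cycles Z ns r"
  using same_part_iff by (auto simp: bar_diff_def bar_index_insert_zero bar_cycles_def bar_sum_def)

text \<open>Splitting an entry opens a gap and thus removes vanishing conditions from the single top
  coefficient: \<open>ker S1\<close> is contained in \<open>ker S0\<close>. If an entry of
  \<open>ns\<close> is negative, the index set is empty and the restriction is 0.\<close>

lemma bar_cycles_comult:
 assumes i: "Suc i < length ns" and x: "x : bar_cycles Z (merge_at i ns) (nat (sum_list ns))"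
 shows "(%c. if c : bar_index ns then x c else 0) : bar_cycles Z ns (nat (sum_list ns))"
proof (cases "ALL k:set ns. 0 <= k")
 case False then obtain k where "k : set ns" "k < 0" by force
 hence "bar_index ns = {}" by (rule bar_index_neg)
 thus ?thesis using bar_cycles_0[of ns "nat (sum_list ns)"] by (simp add: zero_fun_def)
next case nonneg: True define n where "n = nat (sum_list ns)"
 have "0 <= ns ! i" "0 <= ns ! Suc i" using nonneg i by auto
 hence "ALL k:set (merge_at i ns). 0 <= k"
  using nonneg by (auto simp: merge_at_def dest: in_set_takeD in_set_dropD)
 from bar_index_parts[OF this] obtain S1 where S1: "S1 <= gaps n"
   "bar_index (merge_at i ns) = {parts n S |S. S <= S1}"
  unfolding sum_list_merge_at[OF i] n_def by blast
 from bar_index_parts[OF nonneg] obtain S0 where S0: "S0 <= gaps n"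
   "bar_index ns = {parts n S |S. S <= S0}" unfolding n_def by blast
 interpret cube "gaps n" "%S. qcomp Z (parts n S)" "%S g. qmult Z (pos S g) (parts n S)"
  by (rule cube_parts)
 have "S0 <= S1"
 proof -
  have "parts n S0 : bar_index (merge_at i ns)" using bar_index_merge_subset[OF i] S0(2) by blast
  then obtain S where "S <= S1" "parts n S0 = parts n S" using S1(2) by blast
  thus ?thesis using parts_subset_inj[of n S0 S] S0(1) S1(1) by auto
 qed
 moreover have "parts n {} : bar_index ns" using S0(2) by blast
 ultimately show ?thesis
  using x unfolding n_def[symmetric] bar_cycles_top[OF S0] bar_cycles_top[OF S1] ker_def by auto
qed

lemma dual_vector_space: "vector_space (cscale QD)"
  by (auto simp: fun_eq_iff scale_right_distrib scale_left_distrib intro!: vector_space.intro)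

text \<open>All structure maps restrict functions on index sequences, so the identities reduce to
  inclusions of index sets.\<close>

lemma quasi_coalgebra_dual: "quasi_coalgebra QD"
proof -
 interpret D: vector_space "cscale QD" by (rule dual_vector_space)
 have sub: "D.subspace (bar_cycles Z ns r)" for ns r
  unfolding D.subspace_def using bar_cycles_0 bar_cycles_add bar_cycles_scale by simp
 have restr: "bar_index ns <= bar_index (merge_at i ns)" if "Suc i < length ns" for i ns
  using bar_index_merge_subset[OF that] .
 show ?thesis
 proof
  fix ns :: "int list" and i :: nat
  show "D.subspace (ccomp QD ns)" using sub by simp
  assume i: "Suc i < length ns"
  show "linear_between (cscale QD) (ccomp QD (merge_at i ns)) (ccomp QD ns) (qcomult QD i ns)"
   unfolding linear_between_def using bar_cycles_comult[OF i] by (auto simp: sum_list_merge_at[OF i])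
 next fix ns :: "int list" and i :: nat
  show "linear_between (cscale QD) (ccomp QD (insert_zero i ns)) (ccomp QD ns) (qcounit QD i ns)"
   unfolding linear_between_def by (auto simp: sum_list_insert_zero bar_cycles_insert_zero)
 next have cyc: "x : bar_cycles Z [] 0 <-> x [] : qcomp Z [] & (ALL c. c ~= [] --> x c = 0)" for x
  proof -
   have "bar_diff Z [] x = 0" for x unfolding bar_diff_def zero_fun_def
    by (intro ext sum.neutral) (auto dest: same_part_length)
   thus ?thesis unfolding bar_cycles_def bar_sum_def by auto
  qed
  show "bij_betw (%a. cscale QD a (cone QD)) UNIV (ccomp QD [])" unfolding bij_betw_def
  proof
   show "inj (%a. cscale QD a (cone QD))"
  using injI spec comp_Nil by (auto simp: fun_eq_iff bij_betw_def inj_def)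
   show "range (%a. cscale QD a (cone QD)) = ccomp QD []"
   proof (intro set_eqI iffI)
    fix x assume "x : range (%a. cscale QD a (cone QD))"
    thus "x : ccomp QD []" using comp_Nil by (auto simp: cyc bij_betw_def)
   next fix x assume "x : ccomp QD []"
    hence x: "x [] : qcomp Z []" "ALL c. c ~= [] --> x c = 0" by (auto simp: cyc)
    then obtain a where "x [] = qscale Z a (qone Z)" using comp_Nil by (auto simp: bij_betw_def)
    hence "x = cscale QD a (cone QD)" using x(2) by auto
    thus "x : range (%a. cscale QD a (cone QD))" by blast
   qed qed
 next fix i j :: nat and ns :: "int list" and x
  assume ij: "i < j" "Suc j < length ns"
  have "bar_index ns <= bar_index (merge_at j ns)" "bar_index ns <= bar_index (merge_at i ns)"
   using restr ij by auto
  thus "qcomult QD j ns (qcomult QD i (merge_at j ns) x)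
    = qcomult QD i ns (qcomult QD (j - 1) (merge_at i ns) x)" by (auto simp: fun_eq_iff)
 next fix i :: nat and ns :: "int list" and x
  assume "x : ccomp QD ns"
  hence "x c = 0" if "c ~: bar_index ns" for c using bar_cycles_outside that by simp
  thus "qcounit QD i ns (qcomult QD i (insert_zero i ns) x) = x"
   "qcounit QD (Suc i) ns (qcomult QD i (insert_zero (Suc i) ns) x) = x"
   by (auto simp: bar_index_insert_zero)
 qed (simp_all add: bar_index_insert_zero)
qed

lemma bar_cycles_top_nonneg: assumes "ALL k:set ns. 0 <= k"
 obtains S0 where "S0 <= gaps (nat (sum_list ns))" "bar_index ns = {parts (nat (sum_list ns)) S |S. S <= S0}"
 using bar_index_parts[OF assms] by blast

context
 fixes ns :: "int list" and n :: nat and S0 :: "nat set"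
 assumes ns: "S0 <= gaps n" "bar_index ns = {parts n S |S. S <= S0}"
begin

interpretation cube "gaps n" "%S. qcomp Z (parts n S)" "%S g. qmult Z (pos S g) (parts n S)"
 by (rule cube_parts)

text \<open>Every component is concentrated at the composition into units, so the cobar complex of
  \<open>ns\<close> is made of the groups \<open>ker S\<close> with \<open>S <= S0\<close>.\<close>

lemma dual_comp_parts: assumes "S <= S0" shows "x : ccomp QD (parts n S) <->
  (ALL c. c ~= parts n {} --> x c = 0) & x (parts n {}) : ker S"
  using assms ns bar_cycles_top bar_index_parts_parts by (auto simp: sum_parts)

lemma cobar_diff_parts: assumes T: "T <= S0" shows "cobar_diff QD ns x (parts n T) d
  = (SUM g:S0 - T. sgp T g (if d : bar_index (parts n T) then x (parts n (insert g T)) d else 0))"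
proof -
 have inj: "inj_on (pos T) (S0 - T)" by (rule inj_onI) (auto intro: pos_inj)
 have "{j. parts n T : bar_index ns & same_part ns (parts n T) j} = pos T ` (S0 - T)"
  using same_part_parts[OF ns T] ns(2) T by blast
 hence "cobar_diff QD ns x (parts n T) = (SUM g:S0 - T. sgp T g (%d. if d : bar_index (parts n T)
      then x (merge_at (pos T g) (parts n T)) d else 0))"
  unfolding cobar_diff_def by (simp add: sum.reindex[OF inj])
 also have "... = (SUM g:S0 - T. sgp T g (%d. if d : bar_index (parts n T)
      then x (parts n (insert g T)) d else 0))"
 proof (rule sum.cong[OF refl])
  fix g assume "g : S0 - T"
  hence "g ~: T" "Suc g < n" using ns(1) by (auto simp: gaps_def)
  show "sgp T g (%d. if d : bar_index (parts n T) then x (merge_at (pos T g) (parts n T)) d else 0)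
    = sgp T g (%d. if d : bar_index (parts n T) then x (parts n (insert g T)) d else 0)"
   unfolding merge_parts[OF \<open>g ~: T\<close> \<open>Suc g < n\<close>] ..
 qed
 finally show ?thesis by (simp add: sum_fun_apply signed_fun)
qed

lemma cobar_diff_outside: "c ~: bar_index ns ==> cobar_diff QD ns x c = 0"
 by (simp add: cobar_diff_def)

lemma units_index: "T <= S0 ==> parts n {} : bar_index (parts n T)"
 using bar_index_parts_parts[of T n] ns(1) by blast

lemma ker_mono: "S <= T ==> ker T <= ker S" by (auto simp: ker_def)

lemma ker_closed: "S <= S0 ==> add_closed (ker S)"
proof -
 assume S: "S <= S0"
 have ad: "additive_on (qcomp Z (parts n {})) (qmult Z (pos {} g) (parts n {}))" if "g : S" for g
  using mu_add[of "{}" g] that S ns(1) by auto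
 note A = acD[OF comp_closed[of "parts n {}"]]
 note B = addD[OF ad comp_closed[of "parts n {}"]]
 show ?thesis unfolding add_closed_def ker_def by (auto simp: A(1-3) B(1-3))
qed

text \<open>Cohomological degree \<open>r\<close> belongs to sets of \<open>k = n - r\<close> gaps.
  There are no terms above \<open>n\<close>, nor in degree 0 for positive \<open>n\<close>; in
  between this is \<open>cobar_exact\<close>, read at the coefficient of the composition into
  units.\<close>

lemma cobar_acyclic_of_exact:
 assumes ex: "!!G l. G <= gaps n ==> exact_at G l" and r: "r ~= n" and sn: "sum_list ns = int n"
 shows "cobar_cocycles QD ns r = cobar_coboundaries QD ns r"
proof -
 let ?C = "ccomp QD" and ?u = "parts n {}"
 have bs0: "x c = 0" if "x : bar_sum ?C ns q" "~ (c : bar_index ns & length c = q)" for x q c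
  using that unfolding bar_sum_def by auto
 have d0: "cobar_diff QD ns (%_. 0) = (%_. 0)"
  unfolding cobar_diff_def by (auto simp: signed_fun fun_eq_iff sum_fun_apply)
 have z0: "(%_. 0) : bar_sum ?C ns q" for q using bar_cycles_0 unfolding bar_sum_def by simp
 have ne: "bar_sum ?C ns q = {%_. 0}" if "!!c. ~ (c : bar_index ns & length c = q)" for q
  using bs0[of _ q] that z0[of q] by auto
 have len: "length (parts n S) + card S = n" if "S <= S0" for S
  by (rule bar_index_length[OF ns that])
 have w_in: "x (parts n S) ?u : ker S" "c ~= ?u ==> x (parts n S) c = 0"
  if x: "x : bar_sum ?C ns q" and S: "S <= S0" for x q S c
 proof -
  have "x (parts n S) : ?C (parts n S)"
  proof (cases "length (parts n S) = q")
   case True have "parts n S : bar_index ns" using S ns(2) by blast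
   thus ?thesis using x True unfolding bar_sum_def by (auto split: if_splits)
  next case False hence "x (parts n S) = 0" using bs0[OF x] by blast
   thus ?thesis using bar_cycles_0 by simp
  qed
  thus "x (parts n S) ?u : ker S" "c ~= ?u ==> x (parts n S) c = 0"
   using dual_comp_parts[OF S] by blast+
 qed
 show ?thesis
 proof (cases "r < n")
  case False have "~ (c : bar_index ns & length c = r)" for c
  proof
   assume c: "c : bar_index ns & length c = r"
   then obtain S where "S <= S0" "c = parts n S" using ns(2) by auto
   thus False using len[of S] c False r by simp
  qed
  hence z: "bar_sum ?C ns r = {%_. 0}" using ne by blast
  have "0 < r" using False r by simp
  have "cobar_diff QD ns x = (%_. 0)" if x: "x : bar_sum ?C ns (r - 1)" for x
  proof
   fix c
   show "cobar_diff QD ns x c = 0"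
   proof (cases "c : bar_index ns")
    case True then obtain T where T: "T <= S0" "c = parts n T" using ns(2) by auto
    have "x (parts n (insert g T)) = 0" if g: "g : S0 - T" for g
    proof -
     have "finite T" by (rule finite_subset[OF subset_trans[OF T(1) ns(1)] finite_gaps])
     hence "length (parts n (insert g T)) + Suc (card T) = n" using len[of "insert g T"] g T(1) by auto
     hence "length (parts n (insert g T)) ~= r - 1" using False r by arith
     thus ?thesis using bs0[OF x] by blast
    qed
    hence "cobar_diff QD ns x c d = 0" for d
     unfolding T(2) cobar_diff_parts[OF T(1)] by (intro sum.neutral) auto
    thus ?thesis by auto
   qed (rule cobar_diff_outside)
  qed
  hence "cobar_coboundaries QD ns r = {%_. 0}"
   unfolding cobar_coboundaries_def using z0[of "r - 1"] by force
  thus ?thesis unfolding cobar_cocycles_def z using d0 by auto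
 next case rn: True show ?thesis
  proof (cases "r = 0")
   case True have "~ (c : bar_index ns & length c = r)" for c
   proof
    assume c: "c : bar_index ns & length c = r"
    then obtain S where S: "S <= S0" "c = parts n S" using ns(2) by auto
    have "sum_list c = int n" using S by (simp add: sum_parts)
    thus False using c True rn by simp
   qed
   hence z: "bar_sum ?C ns r = {%_. 0}" using ne by blast
   show ?thesis unfolding cobar_cocycles_def z cobar_coboundaries_def using d0 True by (auto simp: zero_fun_def)
  next case r0: False define k where "k = n - r"
   have k: "r + k = n" "0 < k" "r - 1 + Suc k = n" using rn r0 by (auto simp: k_def)
   show ?thesis
   proof
    show "cobar_cocycles QD ns r <= cobar_coboundaries QD ns r"
    proof
     fix x assume "x : cobar_cocycles QD ns r"
     hence x: "x : bar_sum ?C ns r" "cobar_diff QD ns x = 0" by (auto simp: cobar_cocycles_def)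
     define w where "w S = (if S <= S0 then x (parts n S) ?u else 0)" for S
     have "EX y. (ALL S. (S <= S0 & card S = Suc k --> y S : ker S) & (~ (S <= S0 & card S = Suc k) --> y S = 0))
      & (ALL S. S <= S0 --> (SUM g:S0 - S. sgp S g (y (insert g S))) = w S)"
     proof (rule cobar_exact[OF ns(1) ex k(2)])
      show "w S : ker S" if "S <= S0" "card S = k" for S using w_in(1)[OF x(1)] that by (simp add: w_def)
      show "w S = 0" if "~ (S <= S0 & card S = k)" for S
      proof (cases "S <= S0")
       case True hence "length (parts n S) ~= r" using len[of S] that k(1) by auto
       thus ?thesis using bs0[OF x(1)] by (simp add: w_def)
      qed (simp add: w_def)
      fix S assume S: "S <= S0"
      have "0 = cobar_diff QD ns x (parts n S) ?u" using x(2) by simp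
      also have "... = (SUM g:S0 - S. sgp S g (w (insert g S)))"
       unfolding cobar_diff_parts[OF S] using S units_index[OF S]
       by (intro sum.cong refl) (auto simp: w_def)
      finally show "(SUM g:S0 - S. sgp S g (w (insert g S))) = 0" by simp
     qed
     then obtain y where y: "!!S. S <= S0 ==> card S = Suc k ==> y S : ker S"
      "!!S. ~ (S <= S0 & card S = Suc k) ==> y S = 0"
      "!!S. S <= S0 ==> (SUM g:S0 - S. sgp S g (y (insert g S))) = w S" by blast
     define Y where "Y S c = (if c = ?u then y S else 0)" for S c
     let ?y = "of_fam ns n S0 Y"
     have "?y : bar_sum ?C ns (r - 1)"
     proof (rule of_fam_bar_sum[OF ns _ _ k(3)])
      show "Y S : ?C (parts n S)" if "S <= S0" "card S = Suc k" for S
       using dual_comp_parts[OF that(1)] y(1)[OF that] by (simp add: Y_def)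
      show "Y S = 0" if "S <= S0" "card S ~= Suc k" for S
       using y(2)[of S] that by (simp add: Y_def fun_eq_iff)
     qed
     moreover have "cobar_diff QD ns ?y = x"
     proof (rule bar_ext[OF ns])
      fix S assume S: "S <= S0"
      have *: "cobar_diff QD ns ?y (parts n S) c
       = (SUM g:S0 - S. sgp S g (if c = ?u then y (insert g S) else 0))" for c
       unfolding cobar_diff_parts[OF S] using S units_index[OF S]
       by (intro sum.cong refl) (auto simp: of_fam_parts[OF ns] Y_def)
      show "cobar_diff QD ns ?y (parts n S) = x (parts n S)"
      proof
       fix c
       show "cobar_diff QD ns ?y (parts n S) c = x (parts n S) c"
        unfolding * using y(3)[OF S] w_in(2)[OF x(1) S, of c] S by (cases "c = ?u") (auto simp: w_def)
      qed qed (use bs0[OF x(1)] cobar_diff_outside in auto)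
     ultimately show "x : cobar_coboundaries QD ns r"
      using r0 unfolding cobar_coboundaries_def by auto
    qed
   next show "cobar_coboundaries QD ns r <= cobar_cocycles QD ns r"
    proof
     fix x assume "x : cobar_coboundaries QD ns r"
     then obtain y where y: "y : bar_sum ?C ns (r - 1)" "x = cobar_diff QD ns y"
      using r0 unfolding cobar_coboundaries_def by auto
     define w where "w S = (SUM g:S0 - S. sgp S g (y (parts n (insert g S)) ?u))" for S
     have xw: "x (parts n S) c = (if c = ?u then w S else 0)" if S: "S <= S0" for S c
     proof (cases "c = ?u")
      case True
      thus ?thesis unfolding y(2) cobar_diff_parts[OF S] w_def using units_index[OF S] by simp
     next case False have "insert g S <= S0" if "g : S0 - S" for g using that S by blast
      thus ?thesis unfolding y(2) cobar_diff_parts[OF S]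
       using False w_in(2)[OF y(1)] by (auto intro!: sum.neutral)
     qed
     have wk: "w S : ker S" if S: "S <= S0" for S unfolding w_def
     proof (intro acD(5,6)[OF ker_closed[OF S]])
      fix g assume "g : S0 - S"
      hence "y (parts n (insert g S)) ?u : ker (insert g S)" using w_in(1)[OF y(1)] S by simp
      thus "y (parts n (insert g S)) ?u : ker S" using ker_mono[of S "insert g S"] by blast
     qed
     have X: "x = of_fam ns n S0 (%S c. if c = ?u then w S else 0)"
     proof (rule bar_ext[OF ns])
      show "x (parts n S) = of_fam ns n S0 (%S c. if c = ?u then w S else 0) (parts n S)"
       if "S <= S0" for S unfolding of_fam_parts[OF ns that] using xw[OF that] by auto
     qed (auto simp: y(2) cobar_diff_outside of_fam_def[OF ns])
     have "x : bar_sum ?C ns r" unfolding X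
     proof (rule of_fam_bar_sum[OF ns _ _ k(1)])
      fix S assume S: "S <= S0"
      show "(%c. if c = ?u then w S else 0) : ?C (parts n S)"
       using dual_comp_parts[OF S] wk[OF S] by simp
      assume "card S ~= k"
      have "y (parts n (insert g S)) = 0" if g: "g : S0 - S" for g
      proof -
       have "finite S" by (rule finite_subset[OF subset_trans[OF S ns(1)] finite_gaps])
       hence "length (parts n (insert g S)) + Suc (card S) = n" using len[of "insert g S"] g S by auto
       hence "length (parts n (insert g S)) ~= r - 1" using \<open>card S ~= k\<close> k by arith
       thus ?thesis using bs0[OF y(1)] by blast
      qed
      hence "w S = 0" unfolding w_def by (intro sum.neutral) simp
      thus "(%c. if c = ?u then w S else 0) = 0" by auto
     qed
     moreover have "cobar_diff QD ns x = 0"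
     proof (rule bar_ext[OF ns])
      fix S assume S: "S <= S0"
      \<comment> \<open>The square of the cobar differential is that of the outer differential of
        the double complex, taken at \<open>T = {}\<close>.\<close>
      have "(SUM g:S0 - S. sgp S g (w (insert g S)))
       = cob S0 (cob S0 (%S T. y (parts n S) ?u)) S {}"
       unfolding cob_def[of _ "cob _ _"] using S by (simp, intro sum.cong refl) (auto simp: cob_def w_def)
      hence s: "(SUM g:S0 - S. sgp S g (w (insert g S))) = 0" using cob_cob[OF ns(1)] by simp
      have "cobar_diff QD ns x (parts n S) c = 0" for c
      proof -
       have "cobar_diff QD ns x (parts n S) c
        = (SUM g:S0 - S. sgp S g (if c = ?u then w (insert g S) else 0))"
        unfolding cobar_diff_parts[OF S] using S units_index[OF S]
        by (intro sum.cong refl) (auto simp: xw)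
       thus ?thesis using s by (cases "c = ?u") auto
      qed
      thus "cobar_diff QD ns x (parts n S) = 0 (parts n S)" by auto
     qed (auto simp: cobar_diff_outside)
     ultimately show "x : cobar_cocycles QD ns r" by (simp add: cobar_cocycles_def)
    qed qed qed qed qed

end

end

context positive_quasi_algebra
begin

text \<open>Exactness is assumed for every set of gaps, because the cobar complexes involve all
  subcubes of the cube over \<open>S0\<close>, whereas the bar complexes involve this cube
  alone.\<close>

theorem koszul_of_exact: assumes ex: "!!n G l. G <= gaps n ==>
  cube.exact_at (%S. qcomp Z (parts n S)) (%S g. qmult Z (pos S g) (parts n S)) G l"
 shows "koszul_quasi_algebra Z & koszul_quasi_coalgebra QD"
proof
 show "koszul_quasi_algebra Z"
 proof
  fix ns :: "int list" and r
  assume nonneg: "ALL n:set ns. 0 <= n" and r: "int r ~= sum_list ns"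
  from nonneg obtain S0 where S0: "S0 <= gaps (nat (sum_list ns))"
   "bar_index ns = {parts (nat (sum_list ns)) S |S. S <= S0}" by (rule bar_cycles_top_nonneg)
  have "0 <= sum_list ns" using nonneg by (auto intro: sum_list_nonneg)
  hence "r ~= nat (sum_list ns)" using r by auto
  thus "bar_cycles Z ns r = bar_boundaries Z ns r" using bar_acyclic_of_exact[OF S0 ex] by blast
 qed
 interpret D: quasi_coalgebra QD by (rule quasi_coalgebra_dual)
 show "koszul_quasi_coalgebra QD"
 proof
  fix n :: int and ns assume "n : set ns" "n < 0"
  thus "ccomp QD ns = {0}" using bar_cycles_neg by simp
 next fix i :: nat and ns :: "int list"
  show "bij_betw (qcounit QD i ns) (ccomp QD (insert_zero i ns)) (ccomp QD ns)"
   by (simp add: sum_list_insert_zero bar_cycles_insert_zero bij_betw_def)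
 next fix ns :: "int list" and r
  assume nonneg: "ALL n:set ns. 0 <= n" and r: "int r ~= sum_list ns"
  from nonneg obtain S0 where S0: "S0 <= gaps (nat (sum_list ns))"
   "bar_index ns = {parts (nat (sum_list ns)) S |S. S <= S0}" by (rule bar_cycles_top_nonneg)
  have "0 <= sum_list ns" using nonneg by (auto intro: sum_list_nonneg)
  hence "r ~= nat (sum_list ns)" "sum_list ns = int (nat (sum_list ns))" using r by auto
  thus "cobar_cocycles QD ns r = cobar_coboundaries QD ns r"
   using cobar_acyclic_of_exact[OF S0 ex] by blast
 qed qed

end

lemma signed_0_left [simp]: "signed 0 x = x" by (simp add: signed_def)

abbreviation "mdeg \<equiv> has_multidegree"

section \<open>Exterior algebra of logarithmic forms\<close>

lemma lex_less_irrefl [simp]: "~ lex_less p p" by (simp add: lex_less_def)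

lemma lex_less_asym: "lex_less p q ==> ~ lex_less q p" by (auto simp: lex_less_def)

lemma lex_less_total: "p ~= q ==> lex_less p q | lex_less q p"
 by (auto simp: lex_less_def prod_eq_iff)

lemma finite_vars [simp]: "finite (vars u m)" by (simp add: vars_def)

lemma in_vars [simp]: "(t, s) : vars u m <-> t < m & s < u" by (auto simp: vars_def)

lemma finite_sub_vars: "J <= vars u m ==> finite J" by (rule finite_subset[OF _ finite_vars])

lemma move_simp [simp]: "move p0 (t, s) = (p0 t, s)" by (simp add: move_def)

lemma move_snd: "snd (move p0 p) = snd p" by (simp add: move_def split_beta)

definition sg :: "(nat * nat) set => nat * nat => nat" where
 "sg J p = card {q : J. lex_less q p}"

text \<open>Left exterior multiplication by the basic 1-form with the index \<open>p\<close>, which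
  has to pass \<open>sg J p\<close> factors to reach its place.\<close>

definition eps :: "nat * nat => 'f::ab_group_add form => 'f form" where
 "eps p w = (%J. if p : J then signed (sg J p) (w (J - {p})) else 0)"

lemma sg_remove: assumes "finite J" "p : J"
 shows "sg J q = (if lex_less p q then Suc (sg (J - {p}) q) else sg (J - {p}) q)"
proof -
 have "{r : J. lex_less r q} = (if lex_less p q then insert p {r : J - {p}. lex_less r q}
   else {r : J - {p}. lex_less r q})" using assms by auto
 thus ?thesis using assms by (auto simp: sg_def)
qed

lemma eps_eps: assumes "finite J" shows "eps p (eps q w) J = - eps q (eps p w) J"
proof (cases "p : J & q : J & p ~= q")
 case True have J: "J - {p} - {q} = J - {q} - {p}" by blast
 have P: "even (sg J p + sg (J - {p}) q) <-> odd (sg J q + sg (J - {q}) p)"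
  using sg_remove[OF assms, of p q] sg_remove[OF assms, of q p] lex_less_total[of p q]
   lex_less_asym[of p q] True by (cases "lex_less p q") auto
 have "q ~= p" using True by blast
 with J signed_odd[OF P, of "w (J - {p} - {q})"] True show ?thesis
  by (simp add: eps_def signed_signed)
qed (auto simp: eps_def)

definition inversions :: "(nat => nat) => (nat * nat) set => nat" where
 "inversions p0 I = card {(p, q). p : I & q : I & lex_less p q & lex_less (move p0 q) (move p0 p)}"

text \<open>The new inversions are the elements whose order relative to \<open>p\<close> is
  reversed, counted by \<open>B\<close> and \<open>C\<close>. The numbers of predecessors of
  \<open>p\<close> before and after the map are \<open>card A + card B\<close> and
  \<open>card A + card C\<close>, so the parities agree.\<close>

lemma inversions_insert:
 assumes fin: "finite I" and p: "p ~: I" and inj: "inj_on (move p0) (insert p I)"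
 shows "even (inversions p0 (insert p I) + sg (insert p I) p)
   <-> even (inversions p0 I + sg (move p0 ` insert p I) (move p0 p))"
proof -
 define A where "A = {q : I. lex_less q p & lex_less (move p0 q) (move p0 p)}"
 define B where "B = {q : I. lex_less q p & lex_less (move p0 p) (move p0 q)}"
 define C where "C = {q : I. lex_less p q & lex_less (move p0 q) (move p0 p)}"
 define V where "V = {(p, q). p : I & q : I & lex_less p q & lex_less (move p0 q) (move p0 p)}"
 have f: "finite A" "finite B" "finite C" using fin by (auto simp: A_def B_def C_def)
 have fV: "finite V" by (rule finite_subset[of _ "I \<times> I"]) (auto simp: V_def fin)
 have ne: "move p0 q ~= move p0 p" "q ~= p" if "q : I" for q
  using inj p that by (auto simp: inj_on_def)
 have "{(p', q). p' : insert p I & q : insert p I & lex_less p' q & lex_less (move p0 q) (move p0 p')}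
   = V Un (%q. (p, q)) ` C Un (%q. (q, p)) ` B" unfolding V_def B_def C_def by auto
 moreover have "card (V Un (%q. (p, q)) ` C Un (%q. (q, p)) ` B) = card V + card C + card B"
 proof -
  have "V Int (%q. (p, q)) ` C = {}" "(V Un (%q. (p, q)) ` C) Int (%q. (q, p)) ` B = {}"
   using p by (auto simp: V_def C_def)
  thus ?thesis using f fV by (simp add: card_Un_disjoint card_image inj_on_def)
 qed
 ultimately have i: "inversions p0 (insert p I) = inversions p0 I + card C + card B"
  by (simp add: inversions_def V_def)
 have tot: "lex_less (move p0 q) (move p0 p) <-> ~ lex_less (move p0 p) (move p0 q)"
  "lex_less q p <-> ~ lex_less p q" if "q : I" for q
  using lex_less_total[OF ne(1)[OF that]] lex_less_total[OF ne(2)[OF that]]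
   lex_less_asym[of q p] lex_less_asym[of "move p0 q" "move p0 p"] by blast+
 have "{q : insert p I. lex_less q p} = A Un B" "A Int B = {}"
  using tot unfolding A_def B_def by auto
 hence s: "sg (insert p I) p = card A + card B" using f by (simp add: sg_def card_Un_disjoint)
 have "{q : move p0 ` insert p I. lex_less q (move p0 p)} = move p0 ` (A Un C)" "A Int C = {}"
  using tot unfolding A_def C_def by auto
 moreover have "inj_on (move p0) (A Un C)" by (rule inj_on_subset[OF inj]) (auto simp: A_def C_def)
 ultimately have "sg (move p0 ` insert p I) (move p0 p) = card A + card C"
  using f by (simp add: sg_def card_image card_Un_disjoint)
 thus ?thesis using i s by presburger
qed

definition fibre :: "nat => nat => (nat => nat) => (nat * nat) set => (nat * nat) set set" where
 "fibre u m p0 J = {I. I <= vars u m & inj_on (move p0) I & move p0 ` I = J}"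

lemma finite_fibre [simp]: "finite (fibre u m p0 J)"
 by (rule finite_subset[of _ "Pow (vars u m)"]) (auto simp: fibre_def)

text \<open>The action on coefficients is a parameter, so that composites can be computed before
  they are recognized as pull-backs of functions.\<close>

definition pullf :: "nat => nat => (nat => nat) => ('f => 'g) => 'f form => 'g::ab_group_add form" where
 "pullf u m p0 h w = (%J. SUM I:fibre u m p0 J. signed (inversions p0 I) (h (w I)))"

lemma FP_pullf: "form_pull F m m' p0 w = pullf (ddim F) m p0 (fun_pull F m m' p0) w"
 unfolding form_pull_def pullf_def fibre_def inversions_def ..

text \<open>Adding \<open>p\<close> maps the fibre over \<open>J\<close> without the image of
  \<open>p\<close> bijectively onto those members of the fibre over \<open>J\<close> that contain
  \<open>p\<close>, and the signs match by \<open>inversions_insert\<close>.\<close>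

lemma pullf_eps:
 assumes p: "p : vars u m" and h: "h 0 = 0" "!!k I. h (signed k (w I)) = signed k (h (w I))"
 shows "pullf u m p0 h (eps p w) = eps (move p0 p) (pullf u m p0 h w)"
proof
 fix J
 have z: "signed (inversions p0 I) (h (eps p w I)) = 0" if "p ~: I" for I
  using that h(1) by (simp add: eps_def)
 show "pullf u m p0 h (eps p w) J = eps (move p0 p) (pullf u m p0 h w) J"
 proof (cases "move p0 p : J")
  case False hence "p ~: I" if "I : fibre u m p0 J" for I using that by (auto simp: fibre_def)
  hence "pullf u m p0 h (eps p w) J = 0" unfolding pullf_def using z by (intro sum.neutral) auto
  thus ?thesis using False by (simp add: eps_def)
 next case True let ?J = "J - {move p0 p}"
  have notin: "p ~: I" if "I : fibre u m p0 ?J" for I using that by (auto simp: fibre_def)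
  have bij: "bij_betw (insert p) (fibre u m p0 ?J) {I : fibre u m p0 J. p : I}"
  proof (rule bij_betw_byWitness[where f' = "%I. I - {p}"])
   show "ALL I:fibre u m p0 ?J. insert p I - {p} = I" using notin by auto
   show "insert p ` fibre u m p0 ?J <= {I : fibre u m p0 J. p : I}"
    using p True by (auto simp: fibre_def)
   show "(%I. I - {p}) ` {I : fibre u m p0 J. p : I} <= fibre u m p0 ?J"
   proof
    fix K assume "K : (%I. I - {p}) ` {I : fibre u m p0 J. p : I}"
    then obtain I where I: "K = I - {p}" "I <= vars u m" "inj_on (move p0) I" "move p0 ` I = J" "p : I"
     by (auto simp: fibre_def)
    moreover have "move p0 ` (I - {p}) = ?J" using I by (subst inj_on_image_set_diff[OF I(3)]) auto
    ultimately show "K : fibre u m p0 ?J" by (auto simp: fibre_def inj_on_diff)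
   qed qed auto
  have "pullf u m p0 h (eps p w) J = (SUM I:{I : fibre u m p0 J. p : I}. signed (inversions p0 I) (h (eps p w I)))"
   unfolding pullf_def by (rule sum.mono_neutral_right) (use z in auto)
  also have "... = (SUM I:fibre u m p0 ?J. signed (inversions p0 (insert p I)) (h (eps p w (insert p I))))"
   by (rule sum.reindex_bij_betw[OF bij, symmetric])
  also have "... = (SUM I:fibre u m p0 ?J. signed (sg J (move p0 p)) (signed (inversions p0 I) (h (w I))))"
  proof (rule sum.cong[OF refl])
   fix I assume I: "I : fibre u m p0 ?J"
   hence IJ: "move p0 ` insert p I = J" "inj_on (move p0) (insert p I)" "finite I"
    using True by (auto simp: fibre_def intro: finite_sub_vars)
   have P: "even (inversions p0 (insert p I) + sg (insert p I) p) <-> even (sg J (move p0 p) + inversions p0 I)"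
    using inversions_insert[OF IJ(3) notin[OF I] IJ(2)] unfolding IJ(1) by auto
   show "signed (inversions p0 (insert p I)) (h (eps p w (insert p I)))
     = signed (sg J (move p0 p)) (signed (inversions p0 I) (h (w I)))"
    using notin[OF I] signed_parity[OF P, of "h (w I)"] by (simp add: eps_def h(2) signed_signed)
  qed
  also have "... = eps (move p0 p) (pullf u m p0 h w) J"
   using True by (simp add: eps_def pullf_def signed_sum)
  finally show ?thesis .
 qed qed

definition basic :: "(nat * nat) set => 'f::zero => 'f form" where
 "basic I f = (%J. if J = I then f else 0)"

lemma eps_basic:
 assumes "p ~: I" shows "eps p (basic I f) = basic (insert p I) (signed (sg (insert p I) p) f)"
  using assms by (auto simp: eps_def basic_def)

lemma pullf_basic_empty: assumes "h 0 = 0" shows "pullf u m p0 h (basic {} f) = basic {} (h f)"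
proof
 fix J
 show "pullf u m p0 h (basic {} f) J = basic {} (h f) J"
 proof (cases "J = {}")
  case True have "fibre u m p0 {} = {{}}" by (auto simp: fibre_def)
  thus ?thesis using True by (simp add: pullf_def basic_def inversions_def)
 next case False have "basic {} f I = 0" if "I : fibre u m p0 J" for I
   using that False by (auto simp: fibre_def basic_def)
  thus ?thesis using False assms by (simp add: pullf_def basic_def)
 qed qed

text \<open>Forms arise from functions by sums and multiplications by basic 1-forms. The
  coefficients are kept in a subgroup \<open>R\<close>, because the maps of functions are additive
  only there.\<close>

lemma form_induct: fixes R :: "'f::ab_group_add set"
 assumes R: "add_closed R" and w: "!!I. I <= vars u m ==> w I : R" "!!I. ~ I <= vars u m ==> w I = 0"
  and base: "!!f. f : R ==> P (basic {} f)"
  and step: "!!p w. p : vars u m ==> (!!I. w I : R) ==> (!!I. ~ I <= vars u m ==> w I = 0) ==> P w ==> P (eps p w)"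
  and add: "!!w w'. (!!I. w I : R) ==> (!!I. w' I : R) ==> (!!I. ~ I <= vars u m ==> w I = 0) ==>
   (!!I. ~ I <= vars u m ==> w' I = 0) ==> P w ==> P w' ==> P (%I. w I + w' I)" shows "P w"
proof -
 note Rc = acD[OF R]
 have b: "P (basic I f)" if "I <= vars u m" "f : R" for I f
 proof -
  have "finite I" using that(1) by (rule finite_sub_vars)
  thus ?thesis using that
  proof (induction I arbitrary: f rule: finite_induct)
   case (insert p I)
   let ?f = "signed (sg (insert p I) p) f"
   have f: "?f : R" using Rc(5) insert.prems by blast
   have "P (eps p (basic I ?f))"
    using insert.prems f insert.IH[OF _ f] Rc(1) by (intro step) (auto simp: basic_def)
   thus ?case using eps_basic[OF insert.hyps(2), of ?f] by simp
  qed (use base in simp)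
 qed
 have "P (%J. if J : X then w J else 0)" if "finite X" "X <= Pow (vars u m)" for X using that
 proof (induction X rule: finite_induct)
  case empty have "basic {} 0 = (%J. 0 :: 'f)" by (simp add: basic_def)
  thus ?case using base[OF Rc(1)] by simp
 next case (insert I X)
  have "(%J. if J : insert I X then w J else 0) = (%J. (if J : X then w J else 0) + basic I (w I) J)"
   using insert.hyps by (auto simp: basic_def)
  moreover have "P (%J. (if J : X then w J else 0) + basic I (w I) J)"
   using insert Rc(1) w b[of I "w I"] by (intro add) (auto simp: basic_def)
  ultimately show ?case by simp
 qed
 from this[of "Pow (vars u m)"] have "P (%J. if J : Pow (vars u m) then w J else 0)" by simp
 moreover have "(%J. if J : Pow (vars u m) then w J else 0) = w" using w(2) by auto
 ultimately show ?thesis by simp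
qed

lemma pullf_add: assumes "!!I. h (w I + w' I) = h (w I) + h (w' I)"
 shows "pullf u m p0 h (%I. w I + w' I) = (%J. pullf u m p0 h w J + pullf u m p0 h w' J)"
 unfolding pullf_def by (simp add: assms signed_add sum.distrib)

lemma eps_add: "eps p (%I. w I + w' I) = (%J. eps p w J + eps p w' J)"
 by (auto simp: eps_def signed_add)

lemma eps_diff: "eps p (%I. w I - w' I) = (%J. eps p w J - eps p w' J)"
 by (auto simp: eps_def signed_diff)

lemma eps_sum: "eps p (%I. SUM i:A. w i I) J = (SUM i:A. eps p (w i) J)"
 by (auto simp: eps_def signed_sum)

lemma eps_support: "p : vars u m ==> (!!I. ~ I <= vars u m ==> w I = 0) ==> ~ J <= vars u m ==> eps p w J = 0"
 unfolding eps_def using signed_zero by (metis Diff_subset_conv insert_subset insert_is_Un Diff_insert_absorb insert_Diff)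

text \<open>A map of forms is determined by its values on the functions and the way in which it commutes
 with the multiplications by the basic 1-forms.\<close>

lemma pullf_pullf:
 assumes R: "add_closed R" and R': "add_closed R'" and w: "!!I. I <= vars u m ==> w I : R" "!!I. ~ I <= vars u m ==> w I = 0"
  and h: "additive_on R h" "h ` R <= R'" and h': "additive_on R' h'"
  and p0: "!!t. t < m ==> p0 t < m'"
 shows "pullf u m' p0' h' (pullf u m p0 h w) = pullf u m (p0' o p0) (%f. h' (h f)) w"
proof (rule form_induct[where P = "%w. pullf u m' p0' h' (pullf u m p0 h w) = pullf u m (p0' o p0) (%f. h' (h f)) w", OF R w])
 note A = addD[OF h(1) R] addD[OF h' R']
 have hR: "h f : R'" if "f : R" for f using h(2) that by blast
 have pR: "pullf u m p0 h w I : R'" if "!!I. w I : R" for w I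
  unfolding pullf_def by (auto intro!: acD(5,6)[OF R'] hR that)
 fix f show "pullf u m' p0' h' (pullf u m p0 h (basic {} f)) = pullf u m (p0' o p0) (%f. h' (h f)) (basic {} f)"
  by (simp add: pullf_basic_empty A)
next note A = addD[OF h(1) R] addD[OF h' R']
 have hR: "h f : R'" if "f : R" for f using h(2) that by blast
 have pR: "pullf u m p0 h w I : R'" if "!!I. w I : R" for w I
  unfolding pullf_def by (auto intro!: acD(5,6)[OF R'] hR that)
 {
  fix p and w :: "'a form"
  assume *: "p : vars u m" "!!I. w I : R"
   "pullf u m' p0' h' (pullf u m p0 h w) = pullf u m (p0' o p0) (%f. h' (h f)) w"
  have mp: "move p0 p : vars u m'" using *(1) p0 by (cases p) auto
  have "pullf u m' p0' h' (pullf u m p0 h (eps p w)) = pullf u m' p0' h' (eps (move p0 p) (pullf u m p0 h w))"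
   using * A by (simp add: pullf_eps)
  also have "... = eps (move p0' (move p0 p)) (pullf u m' p0' h' (pullf u m p0 h w))"
   using mp A pR[OF *(2)] by (simp add: pullf_eps)
  also have "move p0' (move p0 p) = move (p0' o p0) p" by (cases p) simp
  also have "eps (move (p0' o p0) p) (pullf u m' p0' h' (pullf u m p0 h w)) = pullf u m (p0' o p0) (%f. h' (h f)) (eps p w)"
   unfolding *(3) using *(1,2) A hR by (subst pullf_eps) auto
  finally show "pullf u m' p0' h' (pullf u m p0 h (eps p w)) = pullf u m (p0' o p0) (%f. h' (h f)) (eps p w)" .
 next fix w w' :: "'a form"
  assume *: "!!I. w I : R" "!!I. w' I : R"
   "pullf u m' p0' h' (pullf u m p0 h w) = pullf u m (p0' o p0) (%f. h' (h f)) w"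
   "pullf u m' p0' h' (pullf u m p0 h w') = pullf u m (p0' o p0) (%f. h' (h f)) w'"
  have "pullf u m p0 h (%I. w I + w' I) = (%J. pullf u m p0 h w J + pullf u m p0 h w' J)"
   using * A by (intro pullf_add) auto
  moreover have "pullf u m' p0' h' (%J. pullf u m p0 h w J + pullf u m p0 h w' J)
    = (%J. pullf u m' p0' h' (pullf u m p0 h w) J + pullf u m' p0' h' (pullf u m p0 h w') J)"
   using A pR[OF *(1)] pR[OF *(2)] by (intro pullf_add) auto
  moreover have "pullf u m (p0' o p0) (%f. h' (h f)) (%I. w I + w' I)
    = (%J. pullf u m (p0' o p0) (%f. h' (h f)) w J + pullf u m (p0' o p0) (%f. h' (h f)) w' J)"
   using A * hR by (intro pullf_add) auto
  ultimately show "pullf u m' p0' h' (pullf u m p0 h (%I. w I + w' I)) = pullf u m (p0' o p0) (%f. h' (h f)) (%I. w I + w' I)"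
   using *(3,4) by simp
 }
qed

section \<open>Function theory on the powers of a disk\<close>

text \<open>A coordinate set to zero has no target factor, so even \<open>m' = 0\<close> is possible
  when all coordinates are set to zero; this is the restriction to the origin.\<close>

definition valid_sub :: "nat => nat => nat => (nat => nat) => (nat * nat) set => bool" where
 "valid_sub u m m' r A <-> (ALL t<m. ALL s<u. (t, s) ~: A --> r t < m')"

text \<open>
 \<open>sub m m' r A\<close> sets the coordinates in \<open>A\<close> to zero and then pulls back along \<open>r\<close>. Closed forms
 are recovered from their restrictions by the last two groups of axioms: \<open>dz\<close>-primitives along a
 coordinate that is not logarithmic, and primitives for the Euler field of the logarithmic ones.
\<close>

locale log_disk = vector_space "fun_scale F"
 for F :: "('k::field, 'f::ab_group_add) disk_functions" +
 fixes v :: nat and sub :: "nat => nat => (nat => nat) => (nat * nat) set => 'f => 'f"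
 assumes v_le: "v <= ddim F" and reg_subspace: "subspace (regular F m)"
  and reg_0: "bij_betw (%a. fun_scale F a (fun_one F 0)) UNIV (regular F 0)"
  and D_reg: "p : vars (ddim F) m ==> f : regular F m ==> log_partial F v m p f : regular F m"
  and D_additive: "p : vars (ddim F) m ==> additive_on (regular F m) (log_partial F v m p)"
  and D_scale: "p : vars (ddim F) m ==> f : regular F m ==>
   log_partial F v m p (fun_scale F a f) = fun_scale F a (log_partial F v m p f)"
  and D_comm: "p : vars (ddim F) m ==> q : vars (ddim F) m ==> f : regular F m ==>
   log_partial F v m p (log_partial F v m q f) = log_partial F v m q (log_partial F v m p f)"
  and sub_reg: "valid_sub (ddim F) m m' r A ==> f : regular F m ==> sub m m' r A f : regular F m'"
  and sub_additive: "valid_sub (ddim F) m m' r A ==> additive_on (regular F m) (sub m m' r A)"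
  and sub_scale: "valid_sub (ddim F) m m' r A ==> f : regular F m ==>
   sub m m' r A (fun_scale F a f) = fun_scale F a (sub m m' r A f)"
  and sub_pull: "ALL t<m. r t < m' ==> f : regular F m ==> fun_pull F m m' r f = sub m m' r {} f"
  and sub_id: "f : regular F m ==> sub m m (%t. t) {} f = f"
  and sub_cong: "f : regular F m ==> (!!p. p : vars (ddim F) m ==> p : A <-> p : A') ==>
   (!!t s. t < m ==> s < ddim F ==> (t, s) ~: A ==> r t = r' t) ==> sub m m' r A f = sub m m' r' A' f"
  and sub_sub: "valid_sub (ddim F) m m' r A ==> valid_sub (ddim F) m' m'' r' A' ==> f : regular F m ==>
   sub m' m'' r' A' (sub m m' r A f) = sub m m'' (r' o r) (A Un {p. move r p : A'}) f"
  and D_sub: "valid_sub (ddim F) m m' r A ==> q : vars (ddim F) m' ==> f : regular F m ==>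
   log_partial F v m' q (sub m m' r A f)
    = (SUM p:{p : vars (ddim F) m. p ~: A & move r p = q}. sub m m' r A (log_partial F v m p f))"
  and D_zero: "valid_sub (ddim F) m m' r A ==> p : vars (ddim F) m ==> p : A ==> snd p < v ==>
   f : regular F m ==> sub m m' r A (log_partial F v m p f) = 0"
  and plain_primitive: "t < m ==> v <= s ==> s < ddim F ==> g : regular F m ==>
   EX f:regular F m. log_partial F v m (t, s) f = g"
  and plain_constant: "t < m ==> v <= s ==> s < ddim F ==> f : regular F m ==>
   log_partial F v m (t, s) f = 0 ==> sub m m (%t. t) {(t, s)} f = f"
  and euler_primitive: "t < m ==> g : regular F m ==> sub m m (%t. t) ({t} \<times> {..<v}) g = 0 ==>
   EX f:regular F m. (\<Sum>s<v. log_partial F v m (t, s) f) = g"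
  and euler_constant: "t < m ==> f : regular F m ==> (\<Sum>s<v. log_partial F v m (t, s) f) = 0 ==>
   sub m m (%t. t) ({t} \<times> {..<v}) f = f"
begin

abbreviation "u \<equiv> ddim F"
abbreviation "reg \<equiv> regular F"
abbreviation "D \<equiv> log_partial F v"
abbreviation "vs \<equiv> vars u"
abbreviation "LF \<equiv> log_forms F"
abbreviation "FP \<equiv> form_pull F"
abbreviation "fp \<equiv> fun_pull F"

lemma reg_closed: "add_closed (reg m)" unfolding add_closed_def
 using subspace_0[OF reg_subspace] subspace_add[OF reg_subspace] subspace_neg[OF reg_subspace] by blast

lemmas reg_ops = acD[OF reg_closed]

lemma fp_additive: "ALL t<m. r t < m' ==> additive_on (reg m) (fp m m' r)"
 using sub_additive[of m m' r "{}"] sub_pull[of m r m'] reg_ops(2)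
 unfolding additive_on_def valid_sub_def by simp

lemma fp_reg: "ALL t<m. r t < m' ==> f : reg m ==> fp m m' r f : reg m'"
 using sub_reg[of m m' r "{}"] sub_pull[of m r m'] unfolding valid_sub_def by simp

text \<open>The derivations are a parameter: one formula serves the original frame \<open>D\<close>
  and the frame \<open>E\<close> with the Euler field.\<close>

definition dform :: "(nat => nat * nat => 'f => 'f) => nat => 'f form => 'f form" where
 "dform de m W = (%J. if J <= vs m then SUM p:J. signed (sg J p) (de m p (W (J - {p}))) else 0)"

lemma ext_deriv_dform: "ext_deriv F v m W = dform D m W" unfolding ext_deriv_def dform_def sg_def ..

lemma lfD: assumes "W : LF m" shows "W I : reg m" "~ I <= vs m ==> W I = 0"
 using assms reg_ops(1)[of m] unfolding log_forms_def by (auto split: if_splits)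

lemma lfI: assumes "!!I. I <= vs m ==> W I : reg m" "!!I. ~ I <= vs m ==> W I = 0" shows "W : LF m"
 using assms unfolding log_forms_def by auto

lemma log_forms_closed: "add_closed (LF m)"
 unfolding add_closed_def log_forms_def using acD(1-3)[OF reg_closed[of m]] by auto

definition frame :: "(nat => nat * nat => 'f => 'f) => bool" where
 "frame de <-> (ALL m. ALL p:vs m. additive_on (reg m) (de m p) & de m p ` reg m <= reg m)"

lemma frame_D: "frame D" unfolding frame_def using D_additive D_reg by blast

lemma frameD: assumes "frame de" "p : vs m"
 shows "f : reg m ==> de m p f : reg m" "additive_on (reg m) (de m p)" "de m p 0 = 0"
  "f : reg m ==> g : reg m ==> de m p (f + g) = de m p f + de m p g"
  "f : reg m ==> g : reg m ==> de m p (f - g) = de m p f - de m p g"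
  "f : reg m ==> de m p (signed k f) = signed k (de m p f)"
  "(!!i. i : I ==> h i : reg m) ==> de m p (sum h I) = (SUM i:I. de m p (h i))"
proof -
 show a: "additive_on (reg m) (de m p)" and "f : reg m ==> de m p f : reg m"
  using assms unfolding frame_def by auto
 note A = addD[OF a reg_closed]
 show "de m p 0 = 0" by (rule A)
 show "f : reg m ==> g : reg m ==> de m p (f + g) = de m p f + de m p g" by (rule A)
 show "f : reg m ==> g : reg m ==> de m p (f - g) = de m p f - de m p g" by (rule A)
 show "f : reg m ==> de m p (signed k f) = signed k (de m p f)" by (rule A)
 show "(!!i. i : I ==> h i : reg m) ==> de m p (sum h I) = (SUM i:I. de m p (h i))" by (rule A)
qed

lemma dform_eps:
 assumes "frame de" "W : LF m" shows "dform de m W J = (SUM p:vs m. eps p (%I. de m p (W I)) J)"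
proof (cases "J <= vs m")
 case True have "(SUM p:vs m. eps p (%I. de m p (W I)) J) = (SUM p:J. eps p (%I. de m p (W I)) J)"
  by (rule sum.mono_neutral_right) (use True in "auto simp: eps_def")
 thus ?thesis using True by (simp add: dform_def eps_def)
next case False have "eps p (%I. de m p (W I)) J = 0" if "p : vs m" for p
  by (rule eps_support[OF that _ False]) (use lfD(2)[OF assms(2)] frameD(3)[OF assms(1) that] in simp)
 thus ?thesis using False by (simp add: dform_def)
qed

lemma frame_log_forms: "frame de ==> p : vs m ==> W : LF m ==> (%I. de m p (W I)) : LF m"
 using lfD[of W m] frameD(1,3) by (intro lfI) auto

lemma dform_log_forms: assumes "frame de" "W : LF m" shows "dform de m W : LF m"
proof (rule lfI)
 fix J assume "J <= vs m"
 thus "dform de m W J : reg m"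
  unfolding dform_def using lfD(1)[OF assms(2)] frameD(1)[OF assms(1)]
  by (auto intro!: reg_ops(5,6))
qed (simp add: dform_def)

lemma dform_add: assumes "frame de" "W : LF m" "W' : LF m"
 shows "dform de m (%I. W I + W' I) J = dform de m W J + dform de m W' J"
proof -
 have "signed (sg J p) (de m p (W (J - {p}) + W' (J - {p})))
   = signed (sg J p) (de m p (W (J - {p}))) + signed (sg J p) (de m p (W' (J - {p})))"
  if "J <= vs m" "p : J" for p
  using frameD(4)[OF assms(1)] that lfD(1)[OF assms(2)] lfD(1)[OF assms(3)]
  by (subst frameD(4)[OF assms(1)]) (auto simp: signed_add)
 thus ?thesis unfolding dform_def by (simp add: sum.distrib)
qed

definition cf :: "(nat => nat * nat => 'f => 'f) => int list => 'f form set" where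
 "cf de ns = {W : LF (length ns). mdeg ns W & dform de (length ns) W = 0}"

lemma closed_log_forms_cf: "closed_log_forms F v ns = cf D ns"
 unfolding closed_log_forms_def cf_def ext_deriv_dform ..

lemma has_multidegreeD: "mdeg ns W ==> t < length ns ==> int (card {s. (t, s) : I}) ~= ns ! t ==> W I = 0"
 unfolding has_multidegree_def by blast

lemma cf_closed: assumes "frame de" shows "add_closed (cf de ns)"
proof -
 let ?m = "length ns"
 have 0: "dform de ?m 0 = 0"
  by (auto simp: dform_def fun_eq_iff frameD(3)[OF assms] intro!: sum.neutral)
 have a: "dform de ?m (W + W') = dform de ?m W + dform de ?m W'"
  if "W : LF ?m" "W' : LF ?m" for W W' using dform_add[OF assms that] by (auto simp: plus_fun_def)
 have n: "dform de ?m (- W) = - dform de ?m W" if "W : LF ?m" for W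
 proof -
  have "- W : LF ?m" using acD(3)[OF log_forms_closed that] .
  from a[OF that this] 0 show ?thesis by (metis add.right_inverse minus_unique)
 qed
 have "0 : cf de ns"
  using 0 acD(1)[OF log_forms_closed] by (simp add: cf_def has_multidegree_def)
 moreover have "W + W' : cf de ns" if "W : cf de ns" "W' : cf de ns" for W W'
 proof -
  have "mdeg ns (W + W')"
   using that unfolding cf_def has_multidegree_def by (auto, metis add.right_neutral)
  thus ?thesis using that a acD(2)[OF log_forms_closed] by (auto simp: cf_def)
 qed
 moreover have "- W : cf de ns" if "W : cf de ns" for W
  using that n acD(3)[OF log_forms_closed] by (auto simp: cf_def has_multidegree_def)
 ultimately show ?thesis unfolding add_closed_def by blast
qed

subsection \<open>Pull-backs of forms\<close>

lemma FP_LF: assumes "ALL t<m. r t < m'" "W : LF m" shows "FP m m' r W : LF m'"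
proof (rule lfI)
 fix J
 show "FP m m' r W J : reg m'" unfolding FP_pullf pullf_def
  using fp_reg[OF assms(1)] lfD(1)[OF assms(2)] by (auto intro!: reg_ops(5,6))
 assume "~ J <= vs m'"
 hence "fibre u m r J = {}" using assms(1) by (force simp: fibre_def)
 thus "FP m m' r W J = 0" unfolding FP_pullf pullf_def by simp
qed

lemma FP_additive:
 assumes "ALL t<m. r t < m'" shows "additive_on (LF m) (FP m m' r)" unfolding additive_on_def
proof (intro ballI)
 fix W W' assume "W : LF m" "W' : LF m"
 hence "fp m m' r (W I + W' I) = fp m m' r (W I) + fp m m' r (W' I)" for I
  using addD(1)[OF fp_additive[OF assms] reg_closed] lfD(1)[of W] lfD(1)[of W'] by simp
 from pullf_add[of "fp m m' r", OF this]
 show "FP m m' r (W + W') = FP m m' r W + FP m m' r W'" unfolding FP_pullf plus_fun_def .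
qed

lemma pullf_cong: "(!!I. I <= vs m ==> h (W I) = h' (W I)) ==> pullf u m r h W = pullf u m r h' W"
 unfolding pullf_def by (auto simp: fibre_def fun_eq_iff)

text \<open>The two maps have to agree only on index sets with nonzero coefficient, so they may
  differ on a factor in whose variables the form has degree 0.\<close>

lemma pullf_cong_map: assumes "!!I. I <= vs m ==> h (W I) ~= 0 ==> ALL p:I. move r p = move r' p"
 shows "pullf u m r h W = pullf u m r' h W"
proof
 fix J
 have *: "I : fibre u m r J <-> I : fibre u m r' J" "inversions r I = inversions r' I"
  if "I <= vs m" "h (W I) ~= 0" for I
 proof -
  note e = bspec[OF assms[OF that]]
  have "p : I & q : I & lex_less p q & lex_less (move r q) (move r p)
    <-> p : I & q : I & lex_less p q & lex_less (move r' q) (move r' p)" for p q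
   using e[of p] e[of q] by auto
  thus "inversions r I = inversions r' I" unfolding inversions_def by simp
  have "inj_on (move r) I = inj_on (move r') I" "move r ` I = move r' ` I"
   by (rule inj_on_cong, erule e) (rule image_cong[OF refl], erule e)
  thus "I : fibre u m r J <-> I : fibre u m r' J" by (simp add: fibre_def)
 qed
 have v: "I <= vs m" if "I : fibre u m si J" for I si using that by (simp add: fibre_def)
 show "pullf u m r h W J = pullf u m r' h W J" unfolding pullf_def
 proof (rule sum.mono_neutral_cong[OF finite_fibre finite_fibre])
  fix I assume "I : fibre u m r' J - fibre u m r J"
  hence "h (W I) = 0" using *(1)[of I] by (metis DiffD1 DiffD2 v)
  thus "signed (inversions r' I) (h (W I)) = 0" by simp
 next fix I assume "I : fibre u m r J - fibre u m r' J"
  hence "h (W I) = 0" using *(1)[of I] by (metis DiffD1 DiffD2 v)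
  thus "signed (inversions r I) (h (W I)) = 0" by simp
 next fix I assume "I : fibre u m r J Int fibre u m r' J"
  thus "signed (inversions r I) (h (W I)) = signed (inversions r' I) (h (W I))"
   using *(2)[of I] v[of I] by (cases "h (W I) = 0") auto
 qed qed

lemma form_pull_comp: assumes "ALL t<m. r t < m'" "ALL t<m'. r' t < m''" "W : LF m"
 shows "FP m' m'' r' (FP m m' r W) = FP m m'' (r' o r) W"
proof -
 have "pullf u m' r' (fp m' m'' r') (pullf u m r (fp m m' r) W)
   = pullf u m (r' o r) (%f. fp m' m'' r' (fp m m' r f)) W"
 proof (rule pullf_pullf[where R = "reg m" and R' = "reg m'"])
  show "fp m m' r ` reg m <= reg m'" using fp_reg[OF assms(1)] by auto
 qed (use assms reg_closed lfD[OF assms(3)] fp_additive in auto)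
 also have "... = pullf u m (r' o r) (fp m m'' (r' o r)) W"
  using lfD assms fp_reg by (auto simp: sub_pull sub_reg sub_sub valid_sub_def intro!: pullf_cong)
 finally show ?thesis unfolding FP_pullf .
qed

lemma form_pull_cong:
 assumes "ALL t<m. r t < m'" "ALL t<m. r t = r' t" "W : LF m" shows "FP m m' r W = FP m m' r' W"
proof -
 have "fp m m' r (W I) = fp m m' r' (W I)" for I using assms(1,2) lfD(1)[OF assms(3)]
  by (simp add: sub_pull) (rule sub_cong, auto)
 hence "FP m m' r W = pullf u m r (fp m m' r') W"
  unfolding FP_pullf by (intro pullf_cong) blast
 also have "... = pullf u m r' (fp m m' r') W"
  by (rule pullf_cong_map) (use assms(2) in "auto simp: vars_def")
 finally show ?thesis unfolding FP_pullf .
qed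

lemma inversions_mono:
 assumes "!!p q. p : I ==> q : I ==> lex_less p q ==> ~ lex_less (move r q) (move r p)"
 shows "inversions r I = 0"
proof -
 have "{(p, q). p : I & q : I & lex_less p q & lex_less (move r q) (move r p)} = {}" using assms by auto
 thus ?thesis unfolding inversions_def by (simp only: card.empty)
qed

lemma inversions_strict_mono:
 assumes "strict_mono_on {..<m} r" "I <= vs m" shows "inversions r I = 0"
proof (rule inversions_mono)
 fix p q assume "p : I" "q : I" "lex_less p q"
 thus "~ lex_less (move r q) (move r p)"
  using assms strict_mono_onD[OF assms(1), of "fst p" "fst q"]
  by (cases p; cases q) (fastforce simp: lex_less_def)
qed

lemma pullf_inj: assumes "inj_on r {..<m}" "I <= vs m"
 shows "pullf u m r h W (move r ` I) = signed (inversions r I) (h (W I))"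
proof -
 have inj: "inj_on (move r) (vs m)" using assms(1) by (auto simp: inj_on_def)
 have "fibre u m r (move r ` I) = {I}"
  using assms(2) inj_on_subset[OF inj] inj_on_image_eq_iff[OF inj] by (auto simp: fibre_def)
 thus ?thesis by (simp add: pullf_def)
qed

lemma form_pull_id: assumes "W : LF m" "ALL t<m. r t = t" shows "FP m m r W = W"
proof -
 have "FP m m r W = FP m m (%t. t) W" by (rule form_pull_cong) (use assms in auto)
 also have "... = W"
 proof
  fix J
  have mv: "move (%t. t) p = p" for p by (cases p) simp
  hence im: "move (%t. t) ` J = J" by simp
  show "FP m m (%t. t) W J = W J"
  proof (cases "J <= vs m")
   case True
   have "FP m m (%t. t) W (move (%t. t) ` J) = signed (inversions (%t. t) J) (fp m m (%t. t) (W J))"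
    unfolding FP_pullf by (rule pullf_inj) (use True in auto)
   also have "inversions (%t. t) J = 0"
    by (rule inversions_strict_mono[OF _ True]) (simp add: strict_mono_on_def)
   finally show ?thesis unfolding im using lfD(1)[OF assms(1), of J] by (simp add: sub_pull sub_id)
  next case False thus ?thesis using FP_LF[of m "%t. t" m W, OF _ assms(1)] lfD(2) assms(1) by metis
  qed qed
 finally show ?thesis .
qed

lemma card_fibre_degree: assumes "I : fibre u m r J"
 shows "card {s. (t, s) : J} = (\<Sum>t' | t' < m & r t' = t. card {s. (t', s) : I})"
proof -
 have I: "I <= vs m" "inj_on (move r) I" "move r ` I = J" using assms by (auto simp: fibre_def)
 have "{s. (t, s) : J} = (UN t':{t'. t' < m & r t' = t}. {s. (t', s) : I})"
  unfolding I(3)[symmetric] using I(1) by force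
 moreover have "card (UN t':{t'. t' < m & r t' = t}. {s. (t', s) : I}) = (\<Sum>t' | t' < m & r t' = t. card {s. (t', s) : I})"
 proof (rule card_UN_disjoint)
  show "ALL t':{t'. t' < m & r t' = t}. finite {s. (t', s) : I}"
  proof
   fix t'
   have "{s. (t', s) : I} <= {..<u}" using I(1) by auto
   thus "finite {s. (t', s) : I}" by (rule finite_subset) simp
  qed
  show "ALL i:{t'. t' < m & r t' = t}. ALL j:{t'. t' < m & r t' = t}. i ~= j --> {s. (i, s) : I} Int {s. (j, s) : I} = {}"
   using I(2) by (fastforce simp: inj_on_def)
 qed simp
 ultimately show ?thesis by simp
qed

lemma form_pull_multidegree:
 assumes "ALL t<m. r t < m'" "W : LF m" "mdeg ns W" "length ns = m" "length ns' = m'"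
  and deg: "ALL t<m'. ns' ! t = (\<Sum>t' | t' < m & r t' = t. ns ! t')"
 shows "mdeg ns' (FP m m' r W)" unfolding has_multidegree_def
proof (intro allI impI)
 fix J t assume nz: "FP m m' r W J ~= 0" and t: "t < length ns'"
 have "EX I:fibre u m r J. W I ~= 0"
 proof (rule ccontr)
  assume "~ ?thesis"
  hence "FP m m' r W J = 0"
   unfolding FP_pullf pullf_def using addD(2)[OF fp_additive[OF assms(1)] reg_closed]
   by simp
  thus False using nz by simp
 qed
 then obtain I where I: "I : fibre u m r J" "W I ~= 0" by blast
 have "int (card {s. (t, s) : J}) = (\<Sum>t' | t' < m & r t' = t. int (card {s. (t', s) : I}))"
  unfolding card_fibre_degree[OF I(1)] by simp
 also have "... = (\<Sum>t' | t' < m & r t' = t. ns ! t')"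
  using I(2) assms(3,4) by (intro sum.cong refl) (auto simp: has_multidegree_def)
 finally show "int (card {s. (t, s) : J}) = ns' ! t" using deg t assms(5) by simp
qed

lemma D_form_pull: assumes r: "ALL t<m. r t < m'" and W: "W : LF m" and q: "q : vs m'"
 shows "D m' q (FP m m' r W J) = (\<Sum>p | p : vs m & move r p = q. FP m m' r (%I. D m p (W I)) J)"
proof -
 have vs: "valid_sub u m m' r {}" using r by (simp add: valid_sub_def)
 note w = lfD(1)[OF W]
 have "D m' q (FP m m' r W J) = (SUM I:fibre u m r J. D m' q (signed (inversions r I) (fp m m' r (W I))))"
  unfolding FP_pullf pullf_def by (intro frameD(7)[OF frame_D q] reg_ops(5) fp_reg[OF r w])
 also have "... = (SUM I:fibre u m r J. signed (inversions r I) (D m' q (fp m m' r (W I))))"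
  by (intro sum.cong refl frameD(6)[OF frame_D q] fp_reg[OF r w])
 also have "... = (SUM I:fibre u m r J. \<Sum>p | p : vs m & move r p = q. signed (inversions r I) (fp m m' r (D m p (W I))))"
  using D_sub[OF vs q w] sub_pull[OF r w] sub_pull[OF r D_reg[OF _ w]]
  by (intro sum.cong refl) (simp add: signed_sum)
 also have "... = (\<Sum>p | p : vs m & move r p = q. FP m m' r (%I. D m p (W I)) J)"
  unfolding FP_pullf pullf_def by (rule sum.swap)
 finally show ?thesis .
qed

text \<open>The differential is the sum of the \<open>eps p\<close> after the derivations along
  \<open>p\<close>. The chain rule \<open>D_form_pull\<close> distributes the derivation along
  \<open>q\<close> over the coordinates \<open>p\<close> mapped to \<open>q\<close>, and
  \<open>pullf_eps\<close> carries \<open>eps\<close> through the pull-back.\<close>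

lemma dform_form_pull: assumes r: "ALL t<m. r t < m'" and W: "W : LF m"
 shows "dform D m' (FP m m' r W) = FP m m' r (dform D m W)"
proof
 fix J
 note A = addD[OF fp_additive[OF r] reg_closed]
 have mv: "move r p : vs m'" if "p : vs m" for p using that r by (cases p) auto
 have "dform D m' (FP m m' r W) J = (SUM q:vs m'. eps q (%I. D m' q (FP m m' r W I)) J)"
  by (rule dform_eps[OF frame_D FP_LF[OF r W]])
 also have "... = (SUM q:vs m'. \<Sum>p | p : vs m & move r p = q. eps q (FP m m' r (%I. D m p (W I))) J)"
  using D_form_pull[OF r W] by (simp add: eps_sum)
 also have "... = (SUM q:vs m'. \<Sum>p | p : vs m & move r p = q. eps (move r p) (FP m m' r (%I. D m p (W I))) J)"
  by (intro sum.cong refl) auto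
 also have "... = (SUM p:vs m. eps (move r p) (FP m m' r (%I. D m p (W I))) J)"
  by (rule sum.group) (use mv in auto)
 also have "... = (SUM p:vs m. FP m m' r (eps p (%I. D m p (W I))) J)"
 proof (intro sum.cong refl)
  fix p assume p: "p : vs m"
  note l = lfD(1)[OF frame_log_forms[OF frame_D p W]]
  show "eps (move r p) (FP m m' r (%I. D m p (W I))) J = FP m m' r (eps p (%I. D m p (W I))) J"
   unfolding FP_pullf using p A(2,5) l by (simp add: pullf_eps)
 qed
 also have "... = FP m m' r (dform D m W) J"
 proof -
  have e: "eps p (%I. D m p (W I)) I : reg m" if "p : vs m" for p I
   using lfD(1)[OF frame_log_forms[OF frame_D that W]] reg_ops(1,5) by (auto simp: eps_def)
  have "FP m m' r (dform D m W) J
    = (SUM I:fibre u m r J. SUM p:vs m. signed (inversions r I) (fp m m' r (eps p (%I. D m p (W I)) I)))"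
   unfolding FP_pullf pullf_def dform_eps[OF frame_D W] signed_sum[symmetric]
   by (intro sum.cong refl arg_cong[of _ _ "signed _"] A(6) e)
  thus ?thesis unfolding FP_pullf pullf_def by (simp add: sum.swap[of _ "vs m"])
 qed
 finally show "dform D m' (FP m m' r W) J = FP m m' r (dform D m W) J" .
qed

lemma form_pull_cf: assumes r: "ALL t<length ns. r t < length ns'" and W: "W : cf D ns"
  and deg: "ALL t<length ns'. ns' ! t = (\<Sum>t' | t' < length ns & r t' = t. ns ! t')"
 shows "FP (length ns) (length ns') r W : cf D ns'"
proof -
 have w: "W : LF (length ns)" "mdeg ns W" "dform D (length ns) W = 0"
  using W by (auto simp: cf_def)
 have "FP (length ns) (length ns') r 0 = 0"
  using addD(2)[OF FP_additive[OF r] log_forms_closed] .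
 thus ?thesis using dform_form_pull[OF r w(1)] FP_LF[OF r w(1)] w(3)
   form_pull_multidegree[OF r w(1,2) refl refl deg] by (simp add: cf_def)
qed

subsection \<open>Functions that do not depend on some coordinates\<close>

text \<open>Restriction to the subspace where the coordinates in \<open>A\<close> vanish, regarded
  as a function on the whole power again.\<close>

definition rho :: "nat => (nat * nat) set => 'f => 'f" where
 "rho m A = sub m m (%t. t) A"

lemma valid_id [simp]: "valid_sub u m m (%t. t) A" by (simp add: valid_sub_def)

lemma rho_reg: "f : reg m ==> rho m A f : reg m" unfolding rho_def by (rule sub_reg) simp_all

lemma rho_additive: "additive_on (reg m) (rho m A)" unfolding rho_def by (rule sub_additive) simp

lemmas rho_ops = addD[OF rho_additive reg_closed]

lemma rho_cong: "f : reg m ==> (!!p. p : vs m ==> p : A <-> p : A') ==> rho m A f = rho m A' f"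
 unfolding rho_def by (rule sub_cong) auto

lemma rho_rho: "f : reg m ==> rho m A (rho m B f) = rho m (A Un B) f"
proof -
 assume f: "f : reg m"
 have "rho m A (rho m B f) = sub m m ((%t. t) o (%t. t)) (B Un {p. move (%t. t) p : A}) f"
  unfolding rho_def by (rule sub_sub) (simp_all add: f)
 also have "... = rho m (A Un B) f" unfolding rho_def by (rule sub_cong[OF f]) (auto simp: move_def)
 finally show ?thesis .
qed

lemma rho_empty: "f : reg m ==> (!!p. p : vs m ==> p ~: A) ==> rho m A f = f"
 using rho_cong[of f m A "{}"] sub_id[of f m] by (simp add: rho_def)

lemma sub_rho:
 assumes "valid_sub u m m' r B" "f : reg m" shows "sub m m' r B (rho m A f) = sub m m' r (A Un B) f"
  by (auto simp: assms move_def rho_def sub_sub intro!: sub_cong)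

lemma rho_sub: assumes "valid_sub u m m' r B" "f : reg m"
 shows "rho m' A (sub m m' r B f) = sub m m' r (B Un {p. move r p : A}) f"
  by (auto simp: assms rho_def sub_sub intro!: sub_cong)

text \<open>For a logarithmic coordinate in \<open>A\<close> both sides are zero, as
  \<open>z d/dz\<close> of any function vanishes on \<open>z = 0\<close>. For a plain coordinate in
  \<open>A\<close> only the left hand side is zero in general, hence the condition
  \<open>snd q < v\<close> in the last claim.\<close>

lemma D_rho:
 assumes f: "f : reg m" and q: "q : vs m" shows "q ~: A ==> D m q (rho m A f) = rho m A (D m q f)"
  "q : A ==> D m q (rho m A f) = 0" "snd q < v ==> D m q (rho m A f) = rho m A (D m q f)"
proof -
 have s: "D m q (rho m A f) = (SUM p:{p : vs m. p ~: A & move (%t. t) p = q}. rho m A (D m p f))"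
  unfolding rho_def by (rule D_sub) (simp_all add: f q)
 have e: "{p : vs m. p ~: A & move (%t. t) p = q} = (if q : A then {} else {q})" using q by auto
 show 1: "q ~: A ==> D m q (rho m A f) = rho m A (D m q f)"
  and 2: "q : A ==> D m q (rho m A f) = 0" using s unfolding e by simp_all
 show "D m q (rho m A f) = rho m A (D m q f)" if "snd q < v"
 proof (cases "q : A")
  case True
  hence "rho m A (D m q f) = 0" unfolding rho_def using D_zero[of m m "%t. t" A q f] q that f by simp
  thus ?thesis using 2 True by simp
 qed (use 1 in simp)
qed

text \<open>The plain coordinates are eliminated one by one, the logarithmic ones all at once by the
  Euler field.\<close>

lemma constant_in_group:
 assumes i: "i < m" and f: "f : reg m" and d: "!!s. s < u ==> D m (i, s) f = 0"
 shows "rho m ({i} \<times> UNIV) f = f"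
proof -
 have "rho m ({i} \<times> S) f = f" if "S <= {v..<u}" for S
  using finite_subset[OF that finite_atLeastLessThan] that
 proof (induction S rule: finite_induct)
  case empty thus ?case using rho_empty[OF f, of "{}"] by simp
 next case (insert s S)
  have "rho m ({i} \<times> insert s S) f = rho m ({(i, s)} Un {i} \<times> S) f"
   by (rule rho_cong[OF f]) auto
  also have "... = rho m {(i, s)} (rho m ({i} \<times> S) f)" by (simp add: rho_rho f)
  also have "... = f" using insert plain_constant[OF i _ _ f d, of s] by (simp add: rho_def)
  finally show ?case .
 qed
 hence 1: "rho m ({i} \<times> {v..<u}) f = f" by simp
 have "(\<Sum>s<v. D m (i, s) f) = 0" using d v_le by (intro sum.neutral) auto
 hence 2: "rho m ({i} \<times> {..<v}) f = f" unfolding rho_def by (rule euler_constant[OF i f])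
 have "rho m ({i} \<times> UNIV) f = rho m ({i} \<times> {v..<u} Un {i} \<times> {..<v}) f"
  by (rule rho_cong[OF f]) auto
 also have "... = rho m ({i} \<times> {v..<u}) (rho m ({i} \<times> {..<v}) f)" by (simp add: rho_rho f)
 finally show ?thesis using 1 2 by simp
qed

end

section \<open>The quasi-algebra of closed forms\<close>

definition diag :: "nat => nat => nat" where
 "diag i k = (if k <= i then k else k - 1)"

definition face :: "nat => nat => nat" where
 "face i k = (if k < i then k else k + 1)"

lemma length_merge: "Suc i < length ns ==> length (merge_at i ns) = length ns - 1"
 by (simp add: merge_at_def)

lemma length_zero: "i <= length ns ==> length (insert_zero i ns) = length ns + 1"
 by (simp add: insert_zero_def)

lemma merge_at_nth: assumes "Suc i < length ns" "t < length (merge_at i ns)"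
 shows "merge_at i ns ! t = (\<Sum>t' | t' < length ns & diag i t' = t. ns ! t')"
proof -
 have t: "t < length ns - 1" using assms length_merge by simp
 have "{t'. t' < length ns & diag i t' = t} = (if t < i then {t} else if t = i then {i, Suc i} else {Suc t})"
  using assms(1) t by (auto simp: diag_def)
 moreover have "merge_at i ns ! t = (if t < i then ns ! t else if t = i then ns ! i + ns ! Suc i else ns ! Suc t)"
  using t by (auto simp: merge_at_def nth_append min_def)
 ultimately show ?thesis by simp
qed

lemma insert_zero_nth: assumes "i <= length ns" "t < length (insert_zero i ns)"
 shows "insert_zero i ns ! t = (\<Sum>t' | t' < length ns & face i t' = t. ns ! t')"
proof -
 have t: "t < length ns + 1" using assms length_zero by simp
 have "{t'. t' < length ns & face i t' = t} = (if t < i then {t} else if t = i then {} else {t - 1})"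
  using assms(1) t by (auto simp: face_def)
 moreover have "insert_zero i ns ! t = (if t < i then ns ! t else if t = i then 0 else ns ! (t - 1))"
  using assms(1) t by (auto simp: insert_zero_def nth_append min_def)
 ultimately show ?thesis by simp
qed

lemma diag_into: "Suc i < m ==> ALL t<m. diag i t < m - 1" by (auto simp: diag_def)

lemma face_into: "ALL t<m. face i t < m + 1" by (auto simp: face_def)

context log_disk
begin

abbreviation "ZZ \<equiv> form_quasi_algebra F v"

lemma ZZ_sel [simp]:
 "qscale ZZ = (%a om I. fun_scale F a (om I))" "qcomp ZZ = cf D"
 "qone ZZ = (%I. if I = {} then fun_one F 0 else 0)"
 "qmult ZZ i ns = FP (length ns) (length ns - 1) (diag i)"
 "qunit ZZ i ns = FP (length ns) (length ns + 1) (face i)"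
 by (simp_all add: form_quasi_algebra_def closed_log_forms_cf fun_eq_iff diag_def[abs_def] face_def[abs_def])

lemma scale_log_forms: "om : LF m ==> (%I. fun_scale F a (om I)) : LF m"
 using lfD[of om m] subspace_scale[OF reg_subspace] by (intro lfI) auto

lemma scale_signed: "fun_scale F a (signed k f) = signed k (fun_scale F a f)"
 by (simp add: signed_def)

lemma scale_cf: "om : cf D ns ==> (%I. fun_scale F a (om I)) : cf D ns"
proof -
 assume w: "om : cf D ns"
 hence l: "om : LF (length ns)" by (simp add: cf_def)
 have "dform D (length ns) (%I. fun_scale F a (om I)) J = fun_scale F a (dform D (length ns) om J)" for J
  unfolding dform_def using lfD(1)[OF l]
  by (auto simp: scale_sum_right D_scale scale_signed intro!: sum.cong)
 thus ?thesis using w scale_log_forms[OF l] by (auto simp: cf_def has_multidegree_def)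
qed

lemma form_pull_scale: assumes "ALL t<m. p0 t < m'" "om : LF m"
 shows "FP m m' p0 (%I. fun_scale F a (om I)) = (%J. fun_scale F a (FP m m' p0 om J))"
  using assms lfD subspace_scale reg_subspace by (auto simp: sub_pull sub_scale valid_sub_def scale_sum_right scale_signed FP_pullf pullf_def)

lemma form_pull_linear: assumes "ALL t<length ns. p0 t < length ns'"
  and "ALL t<length ns'. ns' ! t = (\<Sum>t' | t' < length ns & p0 t' = t. ns ! t')"
 shows "linear_between (%a om I. fun_scale F a (om I)) (cf D ns) (cf D ns') (FP (length ns) (length ns') p0)"
 unfolding linear_between_def
proof (intro conjI ballI allI)
 show "FP (length ns) (length ns') p0 ` cf D ns <= cf D ns'"
  using form_pull_cf[OF assms(1) _ assms(2)] by blast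
 fix x y assume "x : cf D ns" "y : cf D ns"
 thus "FP (length ns) (length ns') p0 (x + y)
   = FP (length ns) (length ns') p0 x + FP (length ns) (length ns') p0 y"
  using addD(1)[OF FP_additive[OF assms(1)] log_forms_closed] by (simp add: cf_def)
next fix a x assume "x : cf D ns"
 thus "FP (length ns) (length ns') p0 (%I. fun_scale F a (x I))
   = (%I. fun_scale F a (FP (length ns) (length ns') p0 x I))"
  using form_pull_scale[OF assms(1)] by (simp add: cf_def)
qed

lemma form_pull_square:
 assumes "ALL t<m. p0 t < m1" "ALL t<m1. p0' t < m2" "ALL t<m. si t < m1'" "ALL t<m1'. si' t < m2"
  "!!t. t < m ==> p0' (p0 t) = si' (si t)" "om : LF m"
 shows "FP m1 m2 p0' (FP m m1 p0 om) = FP m1' m2 si' (FP m m1' si om)"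
 unfolding form_pull_comp[OF assms(1,2,6)] form_pull_comp[OF assms(3,4,6)]
 by (rule form_pull_cong) (use assms in auto)

lemma form_pull_retract:
 assumes "ALL t<m. p0 t < m1" "ALL t<m1. p0' t < m" "!!t. t < m ==> p0' (p0 t) = t" "om : LF m"
 shows "FP m1 m p0' (FP m m1 p0 om) = om"
 unfolding form_pull_comp[OF assms(1,2,4)] by (rule form_pull_id) (use assms in auto)

lemma forms_vector_space: "vector_space (%a om I. fun_scale F a (om I) :: 'f)"
 by (rule vector_space.intro) (simp_all add: fun_eq_iff scale_right_distrib scale_left_distrib)

lemma cf_Nil: "om : cf D [] <-> om {} : reg 0 & (ALL I. I ~= {} --> om I = 0)"
 by (auto simp: cf_def log_forms_def has_multidegree_def dform_def vars_def fun_eq_iff)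

text \<open>By functoriality of the pull-back each identity becomes an equality of two composite
  maps of factor numbers.\<close>

lemma quasi_algebra_ZZ: "quasi_algebra ZZ"
proof -
 interpret W: vector_space "qscale ZZ" using forms_vector_space by simp
 show ?thesis
 proof
  fix ns
  show "W.subspace (qcomp ZZ ns)" unfolding W.subspace_def
   using acD(1,2)[OF cf_closed[OF frame_D]] scale_cf by simp
 next show "bij_betw (%a. qscale ZZ a (qone ZZ)) UNIV (qcomp ZZ [])" unfolding bij_betw_def
  proof
   show "inj (%a. qscale ZZ a (qone ZZ))"
  using injI spec reg_0 by (auto simp: fun_eq_iff bij_betw_def inj_def)
   show "range (%a. qscale ZZ a (qone ZZ)) = qcomp ZZ []"
   proof (intro set_eqI iffI)
    fix x assume "x : range (%a. qscale ZZ a (qone ZZ))"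
    thus "x : qcomp ZZ []" using reg_0 by (auto simp: cf_Nil bij_betw_def split: if_splits)
   next fix x assume "x : qcomp ZZ []"
    hence x: "x {} : reg 0" "ALL I. I ~= {} --> x I = 0" by (auto simp: cf_Nil)
    then obtain a where "x {} = fun_scale F a (fun_one F 0)" using reg_0 by (auto simp: bij_betw_def)
    hence "x = qscale ZZ a (qone ZZ)" using x(2) by (auto simp: fun_eq_iff)
    thus "x : range (%a. qscale ZZ a (qone ZZ))" by blast
   qed qed
 next fix i and ns :: "int list" assume i: "Suc i < length ns"
  show "linear_between (qscale ZZ) (qcomp ZZ ns) (qcomp ZZ (merge_at i ns)) (qmult ZZ i ns)"
   using form_pull_linear[of ns "diag i" "merge_at i ns"] diag_into[OF i] merge_at_nth[OF i]
   by (simp add: length_merge[OF i])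
 next fix i and ns :: "int list" assume i: "i <= length ns"
  show "linear_between (qscale ZZ) (qcomp ZZ ns) (qcomp ZZ (insert_zero i ns)) (qunit ZZ i ns)"
   using form_pull_linear[of ns "face i" "insert_zero i ns"] face_into[of "length ns" i] insert_zero_nth[OF i]
   by (simp add: length_zero[OF i])
 next fix i j x and ns :: "int list" assume h: "i < j" "Suc j < length ns" "x : qcomp ZZ ns"
  hence i: "Suc i < length ns" by simp
  show "qmult ZZ i (merge_at j ns) (qmult ZZ j ns x) = qmult ZZ (j - 1) (merge_at i ns) (qmult ZZ i ns x)"
   unfolding ZZ_sel length_merge[OF h(2)] length_merge[OF i]
   by (rule form_pull_square) (use h in "auto simp: diag_def cf_def")
 next fix i j x and ns :: "int list" assume h: "i <= j" "j <= length ns" "x : qcomp ZZ ns"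
  hence i: "i <= length ns" by simp
  show "qunit ZZ i (insert_zero j ns) (qunit ZZ j ns x) = qunit ZZ (Suc j) (insert_zero i ns) (qunit ZZ i ns x)"
   unfolding ZZ_sel length_zero[OF h(2)] length_zero[OF i]
   by (rule form_pull_square) (use h in "auto simp: face_def cf_def")
 next fix i j x and ns :: "int list" assume h: "Suc i < j" "j <= length ns" "x : qcomp ZZ ns"
  hence i: "Suc i < length ns" by simp
  have l: "length (merge_at i ns) + 1 = length (insert_zero j ns) - 1"
   using h by (simp add: length_merge length_zero)
  show "qmult ZZ i (insert_zero j ns) (qunit ZZ j ns x) = qunit ZZ (j - 1) (merge_at i ns) (qmult ZZ i ns x)"
   unfolding ZZ_sel l unfolding length_merge[OF i] length_zero[OF h(2)]
   by (rule form_pull_square) (use h i in "auto simp: face_def diag_def cf_def")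
 next fix i j x and ns :: "int list" assume h: "j < i" "i < length ns" "x : qcomp ZZ ns"
  hence j: "j <= length ns" and i: "Suc (i - 1) < length ns" by simp_all
  have l: "length (merge_at (i - 1) ns) + 1 = length (insert_zero j ns) - 1"
   using i j by (simp add: length_merge length_zero)
  show "qmult ZZ i (insert_zero j ns) (qunit ZZ j ns x) = qunit ZZ j (merge_at (i - 1) ns) (qmult ZZ (i - 1) ns x)"
   unfolding ZZ_sel l unfolding length_merge[OF i] length_zero[OF j]
   by (rule form_pull_square) (use h i in "auto simp: face_def diag_def cf_def")
 next fix i x and ns :: "int list" assume h: "i < length ns" "x : qcomp ZZ ns"
  hence i: "i <= length ns" by simp
  show "qmult ZZ i (insert_zero i ns) (qunit ZZ i ns x) = x"
   unfolding ZZ_sel length_zero[OF i] add_diff_cancel_right'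
   by (rule form_pull_retract) (use h in "auto simp: face_def diag_def cf_def")
 next fix i x and ns :: "int list" assume h: "i < length ns" "x : qcomp ZZ ns"
  hence i: "Suc i <= length ns" by simp
  show "qmult ZZ i (insert_zero (Suc i) ns) (qunit ZZ (Suc i) ns x) = x"
   unfolding ZZ_sel length_zero[OF i] add_diff_cancel_right'
   by (rule form_pull_retract) (use h in "auto simp: face_def diag_def cf_def")
 qed qed

lemma degree_zero_coeff:
 assumes "om : cf D ns" "i < length ns" "ns ! i = 0" "(i, s) : J" shows "om J = 0"
proof (cases "J <= vs (length ns)")
 case True have "{s'. (i, s') : J} <= snd ` J" by force
 hence "finite {s'. (i, s') : J}" using True finite_sub_vars finite_subset by blast
 hence "card {s'. (i, s') : J} ~= 0" using assms(4) by auto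
 thus ?thesis using has_multidegreeD[of ns om i J] assms by (simp add: cf_def)
qed (use assms(1) lfD(2) in "auto simp: cf_def")

text \<open>Closedness is used at \<open>J\<close> with \<open>(i, s)\<close> added: all other terms
  have coefficients of positive degree in the group \<open>i\<close>, so the derivative along
  \<open>(i, s)\<close> vanishes.\<close>

lemma degree_zero_constant: assumes w: "om : cf D ns" and i: "i < length ns" "ns ! i = 0"
 shows "rho (length ns) ({i} \<times> UNIV) (om J) = om J"
proof (cases "J <= vs (length ns) & (ALL s. (i, s) ~: J)")
 case True let ?m = "length ns"
 have l: "om : LF ?m" "dform D ?m om = 0" using w by (auto simp: cf_def)
 have fJ: "finite J" using True finite_sub_vars by blast
 show ?thesis
 proof (rule constant_in_group[OF i(1) lfD(1)[OF l(1)]])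
  fix s assume s: "s < u"
  let ?J = "insert (i, s) J"
  have J: "?J <= vs ?m" "(i, s) ~: J" "?J - {(i, s)} = J" using True s i by auto
  have z: "om (?J - {q}) = 0" if "q : J" for q
   by (rule degree_zero_coeff[OF w i, of s]) (use that J in auto)
  have "0 = (SUM p:?J. signed (sg ?J p) (D ?m p (om (?J - {p}))))" using J(1) fun_cong[OF l(2), of ?J] by (simp add: dform_def)
  also have "... = signed (sg ?J (i, s)) (D ?m (i, s) (om J))
    + (SUM p:J. signed (sg ?J p) (D ?m p (om (?J - {p}))))" using fJ J(2,3) by auto
  also have "(SUM p:J. signed (sg ?J p) (D ?m p (om (?J - {p})))) = 0"
   using z frameD(3)[OF frame_D] J(1) by (intro sum.neutral) auto
  finally show "D ?m (i, s) (om J) = 0" by (metis add.right_neutral signed_signed_same signed_zero)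
 qed
next case False
 hence "om J = 0" using degree_zero_coeff[OF w i] w lfD(2) by (fastforce simp: cf_def)
 thus ?thesis using rho_ops(2) by simp
qed

text \<open>In degree 0 neither the coefficients nor the differentials involve the group
  \<open>i\<close>, so it does not matter where \<open>p0\<close> sends this factor.\<close>

lemma form_pull_away:
 assumes i: "i < length ns" "ns ! i = 0" and w: "om : cf D ns" and m: "length ns = m"
  and p0: "ALL t<m. p0 t < m" "!!t. t < m ==> t ~= i ==> p0 t = t" shows "FP m m p0 om = om"
proof -
 let ?A = "{i} \<times> UNIV :: (nat * nat) set"
 have l: "om : LF m" using w m by (simp add: cf_def)
 note r = lfD(1)[OF l]
 have "fp m m p0 (om I) = fp m m (%t. t) (om I)" for I
 proof -
  have *: "fp m m si (om I) = sub m m si ?A (om I)" if "ALL t<m. si t < m" for si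
   using sub_rho[of m m si "{}" "om I" ?A] that r degree_zero_constant[OF w i, of I] m
   by (simp add: sub_pull valid_sub_def)
  show ?thesis unfolding *[OF p0(1)] *[of "%t. t", simplified] by (rule sub_cong[OF r]) (use p0(2) in auto)
 qed
 moreover have "h (om I) ~= 0 ==> h 0 = 0 ==> I <= vs m ==> p : I ==> move p0 p = move (%t. t) p" for h I p
  using degree_zero_coeff[OF w i, of "snd p" I] p0(2)[of "fst p"] subsetD[of I "vs m" p]
  by (cases p; cases "fst p = i") auto
 moreover have "fp m m (%t. t) 0 = 0" using addD(2)[OF fp_additive reg_closed] by simp
 ultimately have "FP m m p0 om = FP m m (%t. t) om" unfolding FP_pullf
  by (subst pullf_cong[of m _ om "fp m m (%t. t)"], blast) (rule pullf_cong_map, blast)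
 thus ?thesis using form_pull_id[OF l] by simp
qed

text \<open>A quasi-unit is inverted by merging the new factor with a neighbour; the other composite
  is the identity by \<open>form_pull_away\<close>. For \<open>ns = []\<close> there is no
  neighbour, and the inverse is the restriction to the origin.\<close>

lemma qunit_bij:
 assumes i: "i <= length ns" shows "bij_betw (qunit ZZ i ns) (cf D ns) (cf D (insert_zero i ns))"
proof (cases "ns = []")
 case True let ?P = "fp 0 1 (face 0)" and ?L = "sub 1 0 (%t. t) UNIV"
 have v: "valid_sub u 1 0 (%t. t) UNIV" "valid_sub u 0 1 (face 0) {}" by (auto simp: valid_sub_def)
 have P0: "?P 0 = 0" using addD(2)[OF fp_additive reg_closed, of 0 "face 0" 1] by simp
 have P: "FP 0 1 (face 0) (basic {} f) = basic {} (?P f)" for f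
  unfolding FP_pullf by (rule pullf_basic_empty) (rule P0)
 have x: "x = basic {} (x {}) & x {} : reg 0" if "x : cf D []" for x
  using that by (auto simp: cf_Nil basic_def fun_eq_iff)
 have y: "y = basic {} (y {}) & y {} : reg 1 & rho 1 UNIV (y {}) = y {}" if "y : cf D [0]" for y
 proof -
  have l: "y : LF 1" using that by (simp add: cf_def)
  have "y J = 0" if J: "J ~= {}" for J
  proof (cases "J <= vs 1")
   case True then obtain s where "(0, s) : J" using J by (auto simp: vars_def)
   thus ?thesis using degree_zero_coeff[OF \<open>y : cf D [0]\<close>, of 0 s] by simp
  qed (use lfD(2)[OF l] in simp)
  moreover have "rho 1 UNIV (y {}) = rho 1 ({0} \<times> UNIV) (y {})"
   by (rule rho_cong) (use lfD(1)[OF l] in "auto simp: vars_def")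
  ultimately show ?thesis using degree_zero_constant[OF that, of 0 "{}"] lfD(1)[OF l] by (auto simp: basic_def)
 qed
 have LP: "?L (?P f) = f" if "f : reg 0" for f
 proof -
  have "?L (?P f) = sub 0 0 (%t. t) {} f"
   using that v by (simp add: sub_pull sub_sub) (rule sub_cong, auto)
  thus ?thesis using that by (simp add: sub_id)
 qed
 have PL: "?P (?L f) = rho 1 UNIV f" if "f : reg 1" for f
  using that v sub_reg[OF v(1) that] by (simp add: sub_pull sub_sub rho_def) (rule sub_cong, auto)
 have "bij_betw (FP 0 1 (face 0)) (cf D []) (cf D [0])"
 proof (rule bij_betw_byWitness[where f' = "%y. basic {} (?L (y {}))"])
  show "ALL a:cf D []. basic {} (?L (FP 0 1 (face 0) a {})) = a"
  by (smt (verit) LP basic_def P arg_cong conjunct1 x)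
  show "ALL b:cf D [0]. FP 0 1 (face 0) (basic {} (?L (b {}))) = b" unfolding P using y PL by simp
  show "FP 0 1 (face 0) ` cf D [] <= cf D [0]"
   using quasi_algebra.unit_linear[OF quasi_algebra_ZZ, of 0 "[]"] by (simp add: linear_between_def insert_zero_def)
  show "(%y. basic {} (?L (y {}))) ` cf D [0] <= cf D []"
   using y sub_reg[OF v(1)] by (auto simp: cf_Nil basic_def)
 qed
 thus ?thesis using True i by (simp add: insert_zero_def)
next case False let ?m = "length ns" and ?ns = "insert_zero i ns"
 \<comment> \<open>The new factor is merged with its right neighbour, or with its left one if it
   stands at the end.\<close>
 define j where "j = min i (?m - 1)"
 have len: "length ?ns = ?m + 1" by (rule length_zero[OF i])
 have j: "Suc j < ?m + 1" using False by (cases ns) (auto simp: j_def)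
 have mj: "merge_at j ?ns = ns"
 proof (cases "i < ?m")
  case True hence "j = i" by (simp add: j_def)
  have "?ns = take i ns @ [0, ns ! i] @ drop (Suc i) ns" using True by (simp add: insert_zero_def Cons_nth_drop_Suc)
  thus ?thesis using True merge_at_middle[of 0 "[0, ns ! i]" "take i ns"]
   by (simp add: \<open>j = i\<close> merge_at_def[of 0] id_take_nth_drop[symmetric])
 next case F: False
  hence "?ns = butlast ns @ [last ns, 0]" "j = length (butlast ns)" using False by (simp_all add: insert_zero_def j_def)
  thus ?thesis using False by (simp only: merge_at_last) simp
 qed
 have z: "?ns ! i = 0" using i by (simp add: insert_zero_def nth_append)
 have lin: "FP (?m + 1) ?m (diag j) ` cf D ?ns <= cf D ns" "FP ?m (?m + 1) (face i) ` cf D ns <= cf D ?ns"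
  using quasi_algebra.mult_linear[OF quasi_algebra_ZZ, of j ?ns] quasi_algebra.unit_linear[OF quasi_algebra_ZZ i] j mj
  by (simp_all add: linear_between_def len)
 have dj: "ALL t<?m + 1. diag j t < ?m" using diag_into[OF j] by simp
 show ?thesis unfolding ZZ_sel
 proof (rule bij_betw_byWitness[OF _ _ lin(2,1)]; intro ballI)
  fix x assume "x : cf D ns"
  thus "FP (?m + 1) ?m (diag j) (FP ?m (?m + 1) (face i) x) = x"
   using i by (intro form_pull_retract face_into dj) (auto simp: j_def face_def diag_def cf_def)
 next fix y assume y: "y : cf D ?ns"
  hence "y : LF (?m + 1)" by (simp add: cf_def len)
  moreover have "FP (?m + 1) (?m + 1) (face i o diag j) y = y"
   by (rule form_pull_away[OF _ z y len]) (use i len j in "auto simp: j_def face_def diag_def")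
  ultimately show "FP ?m (?m + 1) (face i) (FP (?m + 1) ?m (diag j) y) = y"
   using form_pull_comp[OF dj face_into] by simp
 qed qed

lemma cf_negative: "n : set ns ==> n < 0 ==> cf D ns = {0}"
proof -
 assume n: "n : set ns" "n < 0"
 then obtain t where t: "t < length ns" "ns ! t < 0" by (auto simp: in_set_conv_nth)
 have "om = 0" if "om : cf D ns" for om using that has_multidegreeD t by (force simp: cf_def)
 thus ?thesis using acD(1)[OF cf_closed[OF frame_D]] by blast
qed

theorem positive_ZZ: "positive_quasi_algebra ZZ"
proof -
 interpret Q: quasi_algebra ZZ by (rule quasi_algebra_ZZ)
 show ?thesis
 proof
  fix n :: int and ns assume "n : set ns" "n < 0"
  thus "qcomp ZZ ns = {0}" using cf_negative by simp
 next fix i and ns :: "int list" assume "i <= length ns"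
  thus "bij_betw (qunit ZZ i ns) (qcomp ZZ ns) (qcomp ZZ (insert_zero i ns))" using qunit_bij by simp
 qed qed

end

section \<open>Change of the frame\<close>

text \<open>
 The new frame replaces \<open>e (t, s)\<close>, \<open>s < v - 1\<close>, by \<open>e (t, s) - e (t, v - 1)\<close>, so that the last
 logarithmic derivation becomes the Euler field, which is invertible on the functions vanishing
 where all logarithmic coordinates do.
\<close>

definition fsupp :: "'f::zero form => bool" where
 "fsupp W <-> (ALL J. infinite J --> W J = 0)"

text \<open>Contraction with the vector dual to the basic form \<open>p\<close>. On infinite index
  sets \<open>sg\<close> is no position count, which is why \<open>fsupp\<close> accompanies the
  relations below.\<close>

definition iota :: "nat * nat => 'f::ab_group_add form => 'f form" where
 "iota p W = (%J. if p : J then 0 else signed (sg J p) (W (insert p J)))"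

lemma fsupp_eps: "fsupp W ==> fsupp (eps p W)" by (simp add: fsupp_def eps_def)

lemma fsupp_iota: "fsupp W ==> fsupp (iota p W)" by (simp add: fsupp_def iota_def)

lemma eps_anti: "fsupp W ==> eps p (eps q W) J = - eps q (eps p W) J"
 using eps_eps[of J p q W] fsupp_eps[OF fsupp_eps, of W] by (cases "finite J") (auto simp: fsupp_def)

lemma eps_square: "eps p (eps p W) = (%J. 0)" by (auto simp: eps_def)

lemma sg_insert_same: "sg (insert p J) p = sg J p"
 unfolding sg_def by (rule arg_cong[of _ _ card]) auto

text \<open>The canonical anticommutation relation of contraction and exterior
  multiplication.\<close>

lemma iota_eps:
 assumes "fsupp W" shows "iota p (eps q W) J = (if p = q then W J else 0) - eps q (iota p W) J"
proof (cases "finite J")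
 case False thus ?thesis
  using fsupp_iota[OF fsupp_eps[OF assms], of p q] fsupp_eps[OF fsupp_iota[OF assms], of q p] assms
  by (auto simp: fsupp_def)
next case fin: True show ?thesis
 proof (cases "p = q")
  case True have "p : J ==> sg (J - {p}) p = sg J p" using sg_remove[OF fin, of p p] by simp
  thus ?thesis using True sg_insert_same[of p J] by (auto simp: iota_def eps_def insert_absorb)
 next case ne: False show ?thesis
  proof (cases "p ~: J & q : J")
   case True have s1: "sg (insert p J) q = (if lex_less p q then Suc (sg J q) else sg J q)"
    using sg_remove[of "insert p J" p q] fin True by auto
   have s2: "sg J p = (if lex_less q p then Suc (sg (J - {q}) p) else sg (J - {q}) p)"
    using sg_remove[OF fin, of q p] True by auto
   have P: "even (sg J p + sg (insert p J) q) <-> odd (sg J q + sg (J - {q}) p)"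
    using s1 s2 lex_less_total[OF ne] lex_less_asym[of p q] by (cases "lex_less p q") auto
   have e: "insert p J - {q} = insert p (J - {q})" using ne by blast
   show ?thesis using True ne signed_odd[OF P] by (simp add: iota_def eps_def e signed_signed)
  qed (use ne in "auto simp: iota_def eps_def")
 qed qed

text \<open>The derivation of the exterior algebra that sends the basic forms \<open>(t, s)\<close>
  with \<open>s < v - 1\<close> to \<open>(t, v - 1)\<close> and the other basic forms to 0. The sum
  is empty for \<open>v = 0\<close> and \<open>v = 1\<close>.\<close>

definition shear :: "nat => nat => 'f::ab_group_add form => 'f form" where
 "shear v t W = (%J. \<Sum>s<v - 1. eps (t, v - 1) (iota (t, s) W) J)"

lemma fsupp_shear: "fsupp W ==> fsupp (shear v t W)" unfolding fsupp_def shear_def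
 using fsupp_eps[OF fsupp_iota, of W] by (intro allI impI sum.neutral ballI) (simp add: fsupp_def)

lemma eps_zero [simp]: "eps p (%_. 0) = (%_. 0)" and iota_zero [simp]: "iota p (%_. 0) = (%_. 0)"
 and shear_zero [simp]: "shear v t (%_. 0) = (%_. 0)"
proof -
 show e: "eps p (%_. 0) = (%_. 0)" for p by (auto simp: eps_def)
 show i: "iota p (%_. 0) = (%_. 0)" for p by (auto simp: iota_def)
 show "shear v t (%_. 0) = (%_. 0)" by (simp add: shear_def e i)
qed

lemma iota_add: "iota p (%I. W I + W' I) J = iota p W J + iota p W' J"
 by (auto simp: iota_def signed_add)

lemma iota_diff: "iota p (%I. W I - W' I) J = iota p W J - iota p W' J"
 by (auto simp: iota_def signed_diff)

lemma shear_add: "shear v t (%I. W I + W' I) = (%J. shear v t W J + shear v t W' J)"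
 unfolding shear_def iota_add eps_add by (simp add: sum.distrib)

lemma shear_diff: "shear v t (%I. W I - W' I) = (%J. shear v t W J - shear v t W' J)"
 unfolding shear_def iota_diff eps_diff by (simp add: sum_subtractf)

lemma eps_shear: "eps (t, v - 1) (shear v t W) = (%J. 0)"
  by (auto simp: eps_square fun_eq_iff shear_def eps_sum)

lemma shear_eps: assumes "fsupp W"
 shows "shear v t (eps q W) = (%J. (if fst q = t & snd q < v - 1 then eps (t, v - 1) W J else 0) + eps q (shear v t W) J)"
proof
 fix J
 let ?w = "(t, v - 1)"
 have "shear v t (eps q W) J = (\<Sum>s<v - 1. eps ?w (%I. (if (t, s) = q then W I else 0) - eps q (iota (t, s) W) I) J)"
  unfolding shear_def using iota_eps[OF assms] by (intro sum.cong refl) (simp add: eps_def)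
 also have "... = (\<Sum>s<v - 1. eps ?w (%I. if (t, s) = q then W I else 0) J) - (\<Sum>s<v - 1. eps ?w (eps q (iota (t, s) W)) J)"
  unfolding eps_diff by (simp add: sum_subtractf)
 also have "(\<Sum>s<v - 1. eps ?w (%I. if (t, s) = q then W I else 0) J) = (\<Sum>s<v - 1. if s = snd q & fst q = t then eps ?w W J else 0)"
  by (intro sum.cong refl) (auto simp: eps_def prod_eq_iff)
 also have "... = (if fst q = t & snd q < v - 1 then eps ?w W J else 0)"
  by (cases "fst q = t") (simp_all add: sum.delta)
 also have "(\<Sum>s<v - 1. eps ?w (eps q (iota (t, s) W)) J) = - eps q (shear v t W) J"
 proof -
  have "eps ?w (eps q (iota (t, s) W)) J = - eps q (eps ?w (iota (t, s) W)) J" for s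
   by (rule eps_anti[OF fsupp_iota[OF assms]])
  thus ?thesis unfolding shear_def eps_sum by (simp add: sum_negf)
 qed
 finally show "shear v t (eps q W) J = (if fst q = t & snd q < v - 1 then eps ?w W J else 0) + eps q (shear v t W) J"
  by simp
qed

text \<open>Both applications produce the same factor \<open>(t, v - 1)\<close>, whose square is 0.
  Hence \<open>twist = 1 + shear\<close> is the exponential of a derivation, and its inverse is
  \<open>1 - shear\<close>.\<close>

lemma shear_shear: assumes "fsupp W" shows "shear v t (shear v t W) = (%J. 0)"
proof
 fix J
 have s: "shear v t (%I. SUM i:A. f i I) J = (SUM i:A. shear v t (f i) J)" for A and f :: "nat => 'a form"
 proof -
  have "shear v t (%I. SUM i:A. f i I) = (%J. SUM i:A. shear v t (f i) J)"
  proof (induction A rule: infinite_finite_induct)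
   case (insert i A)
   thus ?case using shear_add[of v t "f i"] by simp
  qed simp_all
  thus ?thesis by simp
 qed
 have "shear v t (shear v t W) J = (\<Sum>r<v - 1. shear v t (eps (t, v - 1) (iota (t, r) W)) J)"
  unfolding shear_def[of v t W] s ..
 also have "... = 0" by (simp add: shear_eps[OF fsupp_iota[OF assms]] eps_shear del: One_nat_def)
 finally show "shear v t (shear v t W) J = 0" .
qed

definition twist :: "nat => nat => 'f::ab_group_add form => 'f form" where
 "twist v t W = (%J. W J + shear v t W J)"

definition untwist :: "nat => nat => 'f::ab_group_add form => 'f form" where
 "untwist v t W = (%J. W J - shear v t W J)"

lemma untwist_twist: "fsupp W ==> untwist v t (twist v t W) = W"
 unfolding untwist_def twist_def shear_add using shear_shear[of W v t] by simp

lemma twist_untwist: "fsupp W ==> twist v t (untwist v t W) = W"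
 unfolding untwist_def twist_def shear_diff using shear_shear[of W v t] by simp

lemma fsupp_twist: "fsupp W ==> fsupp (twist v t W)"
 using fsupp_shear[of W v t] by (auto simp: fsupp_def twist_def)

lemma fsupp_untwist: "fsupp W ==> fsupp (untwist v t W)"
 using fsupp_shear[of W v t] by (auto simp: fsupp_def untwist_def)

lemma twist_eps: assumes "fsupp W" shows "twist v t (eps q W) = (%J. eps q (twist v t W) J
  + (if fst q = t & snd q < v - 1 then eps (t, v - 1) (twist v t W) J else 0))"
 unfolding twist_def shear_eps[OF assms] eps_add eps_shear by auto

lemma twist_add: "twist v t (%I. W I + W' I) = (%J. twist v t W J + twist v t W' J)"
 unfolding twist_def shear_add by auto

lemma shear_map: fixes h :: "'f::ab_group_add => 'g::ab_group_add" and W :: "'f form"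
 assumes "h 0 = 0" "!!k f. f : R ==> h (signed k f) = signed k (h f)" "!!f g. f : R ==> g : R ==> h (f + g) = h f + h g"
  "add_closed R" "!!I. W I : R" shows "shear v t (%I. h (W I)) J = h (shear v t W J)"
proof -
 note R = acD[OF assms(4)]
 have 1: "iota p (%I. h (W I)) I = h (iota p W I)" "iota p W I : R" for p I
  using assms(1,2,5) R(1,5) by (auto simp: iota_def)
 have 2: "eps p (%I. h (W' I)) I = h (eps p W' I)" "eps p W' I : R" if "!!I. W' I : R" for p I and W' :: "'f form"
  using assms(1,2) R(1,5) that by (auto simp: eps_def)
 have "additive_on R h" using assms(3) by (simp add: additive_on_def)
 note A = addD[OF this assms(4)]
 show ?thesis unfolding shear_def 1(1) 2(1)[OF 1(2)]
  using A(6)[of "{..<v - 1}" "%s. eps (t, v - 1) (iota (t, s) W) J"] 2(2)[OF 1(2)] by simp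
qed

fun twists :: "nat => nat => 'f::ab_group_add form => 'f form" where
 "twists v 0 W = W"
| "twists v (Suc t) W = twist v t (twists v t W)"

fun untwists :: "nat => nat => 'f::ab_group_add form => 'f form" where
 "untwists v 0 W = W"
| "untwists v (Suc t) W = untwists v t (untwist v t W)"

lemma fsupp_twists: "fsupp W ==> fsupp (twists v m W)" by (induction m) (auto intro: fsupp_twist)

lemma untwists_twists: "fsupp W ==> untwists v m (twists v m W) = W"
 by (induction m) (auto simp: untwist_twist fsupp_twists)

lemma twists_untwists: "fsupp W ==> twists v m (untwists v m W) = W"
proof (induction m arbitrary: W)
 case (Suc m)
 thus ?case using fsupp_untwist[OF Suc.prems] by (simp add: twist_untwist)
qed simp

lemma twists_add: "twists v m (%I. W I + W' I) = (%J. twists v m W J + twists v m W' J)"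
 by (induction m) (simp_all add: twist_add)

lemma twists_eps: assumes "fsupp W" shows "twists v m (eps q W) = (%J. eps q (twists v m W) J
  + (if fst q < m & snd q < v - 1 then eps (fst q, v - 1) (twists v m W) J else 0))"
proof (induction m)
 case (Suc m)
 let ?th = "twists v m W"
 have f: "fsupp ?th" by (rule fsupp_twists[OF assms])
 have c: "twist v m (%J. if b then W' J else 0) = (%J. if b then twist v m W' J else 0)" for b and W' :: "'a form"
  by (cases b) (simp_all add: twist_def)
 have "twists v (Suc m) (eps q W) = (%J. twist v m (eps q ?th) J
   + (if fst q < m & snd q < v - 1 then twist v m (eps (fst q, v - 1) ?th) J else 0))"
  unfolding twists.simps Suc twist_add c ..
 thus ?case unfolding twist_eps[OF f] by (auto simp: fun_eq_iff)
qed simp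

lemma iota_basic_empty: "iota p (basic {} f) = (%J. 0)" by (auto simp: iota_def basic_def)

lemma twists_basic_empty: "twists v m (basic {} f) = basic {} f"
 by (induction m) (auto simp: twist_def shear_def iota_basic_empty eps_def)

lemma twists_map:
 assumes "h 0 = 0" "!!k f. f : R ==> h (signed k f) = signed k (h f)" "!!f g. f : R ==> g : R ==> h (f + g) = h f + h g"
  "add_closed R" "!!I. W I : R"
 shows "twists v m (%I. h (W I)) J = h (twists v m W J) & twists v m W J : R"
proof (induction m arbitrary: J)
 case (Suc m)
 note R = acD[OF assms(4)]
 have i: "twists v m W I : R" for I using Suc by blast
 have s: "shear v m (twists v m W) J : R" for J
  unfolding shear_def using i R(1,5) by (intro R(6)) (simp add: eps_def iota_def)
 have e: "twists v m (%I. h (W I)) = (%I. h (twists v m W I))" using Suc by blast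
 show ?case using shear_map[OF assms(1-4) i] i s R(2) assms(3)[OF i s] by (simp add: e twist_def)
qed (use assms in simp)

text \<open>\<open>P\<close> is a property of index sets that is stable under the replacements of the twist.\<close>

lemma shear_in: assumes R: "add_closed R"
  and P: "!!J s. (t, v - 1) : J ==> P J ==> s < v - 1 ==> (t, s) ~: J ==> P (insert (t, s) (J - {(t, v - 1)}))"
  and w: "!!I. W I : R & (P I --> W I = 0)" shows "shear v t W J : R & (P J --> shear v t W J = 0)"
proof
 show "shear v t W J : R"
  unfolding shear_def using w acD(1,5)[OF R] by (intro acD(6)[OF R]) (simp add: eps_def iota_def)
 show "P J --> shear v t W J = 0"
  unfolding shear_def using P[of J] w by (auto simp: eps_def iota_def intro!: sum.neutral)
qed

lemma twists_in: assumes R: "add_closed R"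
  and P: "!!t J s. t < m ==> (t, v - 1) : J ==> P J ==> s < v - 1 ==> (t, s) ~: J ==>
   P (insert (t, s) (J - {(t, v - 1)}))" and w: "!!I. W I : R & (P I --> W I = 0)"
 shows "twists v m W J : R & (P J --> twists v m W J = 0)"
  "untwists v m W J : R & (P J --> untwists v m W J = 0)"
proof -
 note R' = acD[OF R]
 have "k <= m ==> twists v k W J : R & (P J --> twists v k W J = 0)" for k
 proof (induction k arbitrary: J)
  case (Suc k)
  hence i: "twists v k W I : R & (P I --> twists v k W I = 0)" for I by simp
  show ?case using shear_in[where W = "twists v k W", OF R P[of k] i] i[of J] Suc.prems R'(2) by (simp add: twist_def)
 qed (use w in simp)
 thus "twists v m W J : R & (P J --> twists v m W J = 0)" by simp
 have "k <= m ==> (!!I. W I : R & (P I --> W I = 0)) ==> untwists v k W J : R & (P J --> untwists v k W J = 0)" for k W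
 proof (induction k arbitrary: W)
  case (Suc k)
  have "untwist v k W I : R & (P I --> untwist v k W I = 0)" for I
   using shear_in[where W = W, OF R P[of k] Suc.prems(2)] Suc.prems R'(4) by (simp add: untwist_def)
  thus ?case using Suc by simp
 qed simp
 thus "untwists v m W J : R & (P J --> untwists v m W J = 0)" using w by blast
qed

lemma card_slice_replace: assumes "finite J" "(t, w) : J" "(t, s) ~: J"
 shows "card {s'. (t', s') : insert (t, s) (J - {(t, w)})} = card {s'. (t', s') : J}"
proof (cases "t' = t")
 case True have "{s'. (t, s') : J} <= snd ` J" by force
 hence f: "finite {s'. (t, s') : J}" using assms(1) finite_subset by blast
 have "{s'. (t, s') : insert (t, s) (J - {(t, w)})} = insert s ({s'. (t, s') : J} - {w})" by auto
 moreover have "w : {s'. (t, s') : J}" "s ~: {s'. (t, s') : J}" using assms by auto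
 ultimately show ?thesis using True f by (metis card_Suc_Diff1 finite_Diff DiffD1 card.insert)
qed auto

context log_disk
begin

text \<open>Derivations change dually to forms: if \<open>e_s\<close> is written as
  \<open>(e_s - e_(v-1)) + e_(v-1)\<close> for \<open>s < v - 1\<close>, the coefficient of
  \<open>e_(v-1)\<close> in the differential becomes the sum of all logarithmic derivations.\<close>

definition E :: "nat => nat * nat => 'f => 'f" where
 "E m p f = (if Suc (snd p) = v then \<Sum>s<v. D m (fst p, s) f else D m p f)"

lemma E_euler: "Suc s = v ==> E m (t, s) f = (\<Sum>s<v. D m (t, s) f)" by (simp add: E_def)

lemma vars_log: "p : vs m ==> s < v ==> (fst p, s) : vs m" using v_le by (cases p) auto

lemma E_reg: "p : vs m ==> f : reg m ==> E m p f : reg m"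
 unfolding E_def using vars_log[of p m] D_reg by (auto intro!: reg_ops(6))

lemma E_additive: "p : vs m ==> additive_on (reg m) (E m p)"
 unfolding E_def additive_on_def using frameD(4)[OF frame_D] vars_log[of p m]
 by (auto simp: sum.distrib)

lemma frame_E: "frame E" unfolding frame_def using E_additive E_reg by blast

lemma E_D_comm: assumes "p : vs m" "q : vs m" "f : reg m" shows "E m p (D m q f) = D m q (E m p f)"
 unfolding E_def using D_comm[OF _ assms(2,3)] assms vars_log[OF assms(1)]
  frameD(7)[OF frame_D assms(2), of "{..<v}" "%s. D m (fst p, s) f"] D_reg by auto

lemma E_comm: assumes "p : vs m" "q : vs m" "f : reg m" shows "E m p (E m q f) = E m q (E m p f)"
proof (cases "Suc (snd q) = v")
 case True have "E m p (\<Sum>s<v. D m (fst q, s) f) = (\<Sum>s<v. E m p (D m (fst q, s) f))"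
  by (rule frameD(7)[OF frame_E assms(1)]) (use D_reg vars_log[OF assms(2)] assms(3) in auto)
 hence "E m p (E m q f) = (\<Sum>s<v. E m p (D m (fst q, s) f))"
  using True by (simp add: E_def[of m q])
 also have "... = (\<Sum>s<v. D m (fst q, s) (E m p f))"
  by (intro sum.cong refl E_D_comm) (use assms vars_log[OF assms(2)] in auto)
 finally show ?thesis using True by (simp add: E_def[of m q])
next case False thus ?thesis using E_D_comm[OF assms] by (simp add: E_def[of m q])
qed

text \<open>The Euler field involves all logarithmic coordinates of the group: setting some of them
  to zero commutes with it, and it annihilates a function in which all of them have been set to
  zero.\<close>

lemma E_rho: assumes f: "f : reg m" and q: "q : vs m"
 shows "snd q < v | q ~: A ==> E m q (rho m A f) = rho m A (E m q f)"
  "v <= snd q ==> q : A ==> E m q (rho m A f) = 0"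
  "snd q < v ==> {fst q} \<times> {..<v} <= A ==> E m q (rho m A f) = 0"
proof -
 have s: "rho m A (\<Sum>s<v. D m (fst q, s) f) = (\<Sum>s<v. rho m A (D m (fst q, s) f))"
  by (rule rho_ops(6)) (use D_reg f vars_log[OF q] in auto)
 show "E m q (rho m A f) = rho m A (E m q f)" if "snd q < v | q ~: A"
 proof (cases "Suc (snd q) = v")
  case True thus ?thesis using s D_rho(3)[OF f vars_log[OF q]] by (simp add: E_def)
 next case False thus ?thesis using D_rho(1,3)[OF f q, of A] that by (auto simp: E_def)
 qed
 show "E m q (rho m A f) = 0" if "v <= snd q" "q : A"
  using D_rho(2)[OF f q] that by (simp add: E_def)
 show "E m q (rho m A f) = 0" if "snd q < v" "{fst q} \<times> {..<v} <= A"
 proof -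
  have "D m (fst q, s) (rho m A f) = 0" if "s < v" for s
   using D_rho(2)[OF f vars_log[OF q that], of A] that \<open>{fst q} \<times> {..<v} <= A\<close> by blast
  moreover have "q = (fst q, snd q)" by simp
  ultimately show ?thesis using that(1) unfolding E_def by (metis (no_types, lifting) lessThan_iff sum.neutral)
 qed qed

subsection \<open>Transport to the new frame\<close>

lemma log_forms_fsupp: "om : LF m ==> fsupp om" unfolding fsupp_def
  using finite_sub_vars by (auto intro!: allI impI lfD)

lemma assumes w: "om : LF m"
 shows twists_log_forms: "twists v m om : LF m" and untwists_log_forms: "untwists v m om : LF m"
proof -
 have P: "~ insert (t, s) (J - {(t, v - 1)}) <= vs m" if "t < m" "~ J <= vs m" "s < v - 1" for t s J
  using that v_le by auto
 show "twists v m om : LF m" "untwists v m om : LF m"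
  using twists_in[of "reg m" m v "%J. ~ J <= vs m" om] P reg_closed lfD[OF w] by (auto intro!: lfI)
qed

lemma twists_sum: "finite A ==> twists v m (%I. SUM i:A. om i I) = (%J. SUM i:A. twists v m (om i) J :: 'f)"
proof (induction A rule: finite_induct)
 case empty have "twists v m (%I. 0 :: 'f) = (%J. 0)" by (induction m) (auto simp: twist_def)
 thus ?case by simp
next case (insert i A)
 thus ?case using twists_add[of v m "om i" "%I. SUM i:A. om i I"] by simp
qed

text \<open>The twist turns multiplication by \<open>e_s\<close> into multiplication by
  \<open>e_s + e_(v-1)\<close> for \<open>s < v - 1\<close>. Collecting the terms with
  \<open>e_(v-1)\<close> adds the logarithmic derivations up to the Euler field.\<close>

lemma dform_twists:
 assumes w: "om : LF m" shows "dform E m (twists v m om) = twists v m (dform D m om)"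
proof
 fix J
 let ?th = "twists v m om"
 have t: "twists v m (%I. D m q (om I)) = (%I. D m q (?th I))" if "q : vs m" for q
  using twists_map[of "D m q" "reg m" om v m] frameD[OF frame_D that] reg_closed lfD(1)[OF w] by auto
 have th: "?th I : reg m" for I using lfD(1)[OF twists_log_forms[OF w]] .
 have "twists v m (dform D m om) J = (SUM q:vs m. twists v m (eps q (%I. D m q (om I))) J)"
 proof -
  have "dform D m om = (%J. SUM q:vs m. eps q (%I. D m q (om I)) J)"
   using dform_eps[OF frame_D w] by blast
  thus ?thesis using twists_sum[OF finite_vars] by simp
 qed
 also have "... = (SUM q:vs m. eps q (%I. D m q (?th I)) J
   + (if snd q < v - 1 then eps (fst q, v - 1) (%I. D m q (?th I)) J else 0))"
 proof (intro sum.cong refl)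
  fix q assume q: "q : vs m"
  have "fsupp (%I. D m q (om I))" using log_forms_fsupp[OF frame_log_forms[OF frame_D q w]] .
  from twists_eps[OF this, of v m q] show "twists v m (eps q (%I. D m q (om I))) J
   = eps q (%I. D m q (?th I)) J + (if snd q < v - 1 then eps (fst q, v - 1) (%I. D m q (?th I)) J else 0)"
   using q unfolding t[OF q] by (cases q) auto
 qed
 also have "... = (SUM q:vs m. eps q (%I. D m q (?th I)) J)
   + (SUM q:vs m. if snd q < v - 1 then eps (fst q, v - 1) (%I. D m q (?th I)) J else 0)"
  by (rule sum.distrib)
 also have "(SUM q:vs m. if snd q < v - 1 then eps (fst q, v - 1) (%I. D m q (?th I)) J else 0)
   = (\<Sum>t<m. \<Sum>s<v - 1. eps (t, v - 1) (%I. D m (t, s) (?th I)) J)"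
 proof -
  have "(SUM q:vs m. if snd q < v - 1 then eps (fst q, v - 1) (%I. D m q (?th I)) J else 0)
   = (\<Sum>t<m. \<Sum>s<u. if s < v - 1 then eps (t, v - 1) (%I. D m (t, s) (?th I)) J else 0)"
   unfolding vars_def by (simp add: sum.cartesian_product case_prod_beta cong: if_cong)
  also have "... = (\<Sum>t<m. \<Sum>s<v - 1. eps (t, v - 1) (%I. D m (t, s) (?th I)) J)"
  proof (rule sum.cong[OF refl])
   fix t
   have "{s : {..<u}. s < v - 1} = {..<v - 1}" using v_le by auto
   thus "(\<Sum>s<u. if s < v - 1 then eps (t, v - 1) (%I. D m (t, s) (?th I)) J else 0)
    = (\<Sum>s<v - 1. eps (t, v - 1) (%I. D m (t, s) (?th I)) J)"
    by (simp add: sum.inter_filter[symmetric])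
  qed
  finally show ?thesis .
 qed
 also have "... = (\<Sum>t<m. if 0 < v then eps (t, v - 1) (%I. \<Sum>s<v - 1. D m (t, s) (?th I)) J else 0)"
  unfolding eps_sum by (intro sum.cong refl) auto
 also have "... = (SUM q:vs m. if Suc (snd q) = v then eps q (%I. \<Sum>s<v - 1. D m (fst q, s) (?th I)) J else 0)"
 proof -
  have "(SUM q:vs m. if Suc (snd q) = v then eps q (%I. \<Sum>s<v - 1. D m (fst q, s) (?th I)) J else 0)
   = (\<Sum>t<m. \<Sum>s'<u. if s' = v - 1 & 0 < v then eps (t, s') (%I. \<Sum>s<v - 1. D m (t, s) (?th I)) J else 0)"
   unfolding vars_def by (simp add: sum.cartesian_product case_prod_beta) (intro sum.cong refl, auto)
  also have "... = (\<Sum>t<m. if 0 < v then eps (t, v - 1) (%I. \<Sum>s<v - 1. D m (t, s) (?th I)) J else 0)"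
   using v_le by (intro sum.cong refl) (cases "v = 0", auto simp: sum.delta simp del: One_nat_def)
  finally show ?thesis by simp
 qed
 also have "(SUM q:vs m. eps q (%I. D m q (?th I)) J) + ... = (SUM q:vs m. eps q (%I. E m q (?th I)) J)"
  unfolding sum.distrib[symmetric]
  using One_nat_def by (auto simp: add.commute eps_add E_def intro!: sum.cong refl)
 also have "... = dform E m ?th J" using dform_eps[OF frame_E twists_log_forms[OF w]] by simp
 finally show "dform E m ?th J = twists v m (dform D m om) J" by simp
qed

lemma multidegree_vanish: assumes "om : LF m" "mdeg ns om"
 shows "mdeg ns (twists v k om)" "mdeg ns (untwists v k om)"
proof -
 let ?P = "%J. infinite J | (EX t<length ns. int (card {s. (t, s) : J}) ~= ns ! t)"
 have st: "?P (insert (t, s) (J - {(t, v - 1)}))" if "(t, v - 1) : J" "?P J" "s < v - 1" "(t, s) ~: J" for J t s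
  using that card_slice_replace[of J t "v - 1" s] by (cases "finite J") auto
 have z: "om I = 0" if "?P I" for I
  using that log_forms_fsupp[OF assms(1)] assms(2) by (auto simp: fsupp_def has_multidegree_def)
 show "mdeg ns (twists v k om)" "mdeg ns (untwists v k om)"
  unfolding has_multidegree_def using twists_in[of UNIV k v ?P om] st z by (auto simp: add_closed_def)
qed

lemma twists_cf: "om : cf D ns ==> twists v (length ns) om : cf E ns"
proof -
 assume "om : cf D ns"
 hence w: "om : LF (length ns)" "mdeg ns om" "dform D (length ns) om = 0" by (auto simp: cf_def)
 have "twists v k (%I. 0 :: 'f) = (%J. 0)" for k by (induction k) (auto simp: twist_def)
 thus ?thesis using twists_log_forms[OF w(1)] multidegree_vanish(1)[OF w(1,2)] dform_twists[OF w(1)] w(3)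
  by (simp add: cf_def zero_fun_def)
qed

lemma untwists_cf: "om : cf E ns ==> untwists v (length ns) om : cf D ns"
proof -
 let ?m = "length ns"
 assume "om : cf E ns"
 hence w: "om : LF ?m" "mdeg ns om" "dform E ?m om = 0" by (auto simp: cf_def)
 note l = untwists_log_forms[OF w(1)]
 have "twists v ?m (dform D ?m (untwists v ?m om)) = 0"
  using dform_twists[OF l] twists_untwists[OF log_forms_fsupp[OF w(1)]] w(3) by simp
 moreover have "untwists v k (%I. 0 :: 'f) = (%J. 0)" for k by (induction k) (auto simp: untwist_def)
 ultimately have "dform D ?m (untwists v ?m om) = 0"
  using untwists_twists[OF log_forms_fsupp[OF dform_log_forms[OF frame_D l]], of v ?m] by (simp add: zero_fun_def)
 thus ?thesis using l multidegree_vanish(2)[OF w(1,2)] by (simp add: cf_def)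
qed

text \<open>The frame is changed in the same way in all groups, and pull-backs along maps of factors
  keep the second index of a coordinate.\<close>

lemma form_pull_twists: assumes p0: "ALL t<m. p0 t < m'" and w: "om : LF m"
 shows "FP m m' p0 (twists v m om) = twists v m' (FP m m' p0 om)"
proof (rule form_induct[where P = "%om. FP m m' p0 (twists v m om) = twists v m' (FP m m' p0 om)",
   OF reg_closed lfD[OF w]])
 note A = addD[OF fp_additive[OF p0] reg_closed]
 fix f show "FP m m' p0 (twists v m (basic {} f)) = twists v m' (FP m m' p0 (basic {} f))"
  unfolding FP_pullf twists_basic_empty by (simp add: pullf_basic_empty A(2) twists_basic_empty)
next note A = addD[OF fp_additive[OF p0] reg_closed]
 fix p and om :: "'f form"
 assume p: "p : vs m" and r: "!!I. om I : reg m" and s: "!!I. ~ I <= vs m ==> om I = 0"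
  and IH: "FP m m' p0 (twists v m om) = twists v m' (FP m m' p0 om)"
 have l: "om : LF m" using r s by (intro lfI) auto
 let ?th = "twists v m om" and ?w = "(fst p, v - 1)" and ?b = "snd p < v - 1"
 have th: "?th I : reg m" for I using lfD(1)[OF twists_log_forms[OF l]] .
 have e: "eps q ?th I : reg m" for q I using th reg_ops(1,5) by (simp add: eps_def)
 have wv: "?w : vs m" if ?b using p v_le that by (cases p) auto
 have pe: "pullf u m p0 (fp m m' p0) (eps q ?th) = eps (move p0 q) (pullf u m p0 (fp m m' p0) ?th)"
  if "q : vs m" for q using that A(2,5) th by (intro pullf_eps) auto
 have mp: "fst (move p0 p) < m'" "snd (move p0 p) = snd p" "(fst (move p0 p), v - 1) = move p0 ?w"
  using p p0 by (cases p; auto)+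
 have "FP m m' p0 (twists v m (eps p om))
   = pullf u m p0 (fp m m' p0) (%J. eps p ?th J + (if ?b then eps ?w ?th J else 0))"
  unfolding FP_pullf twists_eps[OF log_forms_fsupp[OF l]] using p by (cases p) simp
 also have "... = (%J. pullf u m p0 (fp m m' p0) (eps p ?th) J
   + pullf u m p0 (fp m m' p0) (%J. if ?b then eps ?w ?th J else 0) J)"
  using A(1) e reg_ops(1) by (intro pullf_add) auto
 also have "... = (%J. eps (move p0 p) (pullf u m p0 (fp m m' p0) ?th) J
   + (if ?b then eps (move p0 ?w) (pullf u m p0 (fp m m' p0) ?th) J else 0))"
 proof (cases ?b)
  case True thus ?thesis using pe[OF p] pe[OF wv] by simp
 next case False have "pullf u m p0 (fp m m' p0) (%J. 0) = (%J. 0)" by (simp add: pullf_def A(2))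
  thus ?thesis using False pe[OF p] by simp
 qed
 also have "... = twists v m' (FP m m' p0 (eps p om))"
 proof -
  have "FP m m' p0 (eps p om) = eps (move p0 p) (FP m m' p0 om)"
   unfolding FP_pullf using p A(2,5) r by (intro pullf_eps) auto
  thus ?thesis
   using twists_eps[OF log_forms_fsupp[OF FP_LF[OF p0 l]], of v m' "move p0 p"] IH mp(1,2)
   unfolding FP_pullf mp(3)[symmetric] by auto
 qed
 finally show "FP m m' p0 (twists v m (eps p om)) = twists v m' (FP m m' p0 (eps p om))" .
next fix om om' :: "'f form"
 assume r: "!!I. om I : reg m" "!!I. om' I : reg m" and s: "!!I. ~ I <= vs m ==> om I = 0" "!!I. ~ I <= vs m ==> om' I = 0"
  and IH: "FP m m' p0 (twists v m om) = twists v m' (FP m m' p0 om)"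
   "FP m m' p0 (twists v m om') = twists v m' (FP m m' p0 om')"
 have l: "om : LF m" "om' : LF m"
  by (rule lfI, rule r(1), erule s(1)) (rule lfI, rule r(2), erule s(2))
 note P = addD(1)[OF FP_additive[OF p0] log_forms_closed, unfolded plus_fun_def]
 show "FP m m' p0 (twists v m (%I. om I + om' I)) = twists v m' (FP m m' p0 (%I. om I + om' I))"
  using P[OF twists_log_forms[OF l(1)] twists_log_forms[OF l(2)]] P[OF l] IH
  by (simp add: twists_add)
qed

lemma form_pull_cf_E: assumes p0: "ALL t<length ns. p0 t < length ns'" and om: "om : cf E ns"
  and deg: "ALL t<length ns'. ns' ! t = (\<Sum>t' | t' < length ns & p0 t' = t. ns ! t')"
 shows "FP (length ns) (length ns') p0 om : cf E ns'"
proof -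
 have l: "untwists v (length ns) om : cf D ns" by (rule untwists_cf[OF om])
 hence l': "untwists v (length ns) om : LF (length ns)" and w: "om : LF (length ns)"
  using om by (auto simp: cf_def)
 have "FP (length ns) (length ns') p0 om
   = twists v (length ns') (FP (length ns) (length ns') p0 (untwists v (length ns) om))"
  using form_pull_twists[OF p0 l'] twists_untwists[OF log_forms_fsupp[OF w]] by simp
 thus ?thesis using twists_cf[OF form_pull_cf[OF p0 l deg]] by simp
qed

lemma cube_E: "cube (gaps n) (%S. cf E (parts n S)) (%S g. qmult ZZ (pos S g) (parts n S))"
proof -
 interpret Q: quasi_algebra ZZ by (rule quasi_algebra_ZZ)
 interpret C: cube "gaps n" "%S. qcomp ZZ (parts n S)" "%S g. qmult ZZ (pos S g) (parts n S)"
  by (rule Q.cube_parts)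
 let ?th = "%S. twists v (length (parts n S))" and ?th' = "%S. untwists v (length (parts n S))"
 show "cube (gaps n) (%S. cf E (parts n S)) (%S g. qmult ZZ (pos S g) (parts n S))"
 proof
  fix S g x assume S: "S <= gaps n" and g: "g : gaps n - S"
  hence gn: "g ~: S" "Suc g < n" by (auto simp: gaps_def)
  note len = Suc_pos_length[OF gn]
  show "additive_on (cf E (parts n S)) (qmult ZZ (pos S g) (parts n S))"
   using addD(1)[OF FP_additive[OF diag_into[OF len]] log_forms_closed]
   unfolding additive_on_def cf_def ZZ_sel by blast
  assume x: "x : cf E (parts n S)"
  show "qmult ZZ (pos S g) (parts n S) x : cf E (parts n (insert g S))"
   using form_pull_cf_E[of "parts n S" "diag (pos S g)" "merge_at (pos S g) (parts n S)" x]
    diag_into[OF len] merge_at_nth[OF len] x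
   unfolding ZZ_sel merge_parts[OF gn] length_merge[OF len] by simp
  fix h assume h: "h : gaps n - S" "g ~= h"
  define y where "y = ?th' S x"
  have y: "y : qcomp ZZ (parts n S)" unfolding y_def using untwists_cf[OF x] by simp
  have xy: "x = ?th S y" unfolding y_def
   using x twists_untwists[OF log_forms_fsupp, of x] by (auto simp: cf_def)
  have M: "qmult ZZ (pos T k) (parts n T) (?th T z) = ?th (insert k T) (qmult ZZ (pos T k) (parts n T) z)"
   if "k ~: T" "Suc k < n" "z : cf D (parts n T)" for T k z
   using form_pull_twists[OF diag_into[OF Suc_pos_length[OF that(1,2)]]] that(3)
    length_merge[OF Suc_pos_length[OF that(1,2)]] merge_parts[OF that(1,2)] by (simp add: cf_def)
  have hn: "h ~: S" "Suc h < n" using h by (auto simp: gaps_def)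
  show "qmult ZZ (pos (insert g S) h) (parts n (insert g S)) (qmult ZZ (pos S g) (parts n S) x)
   = qmult ZZ (pos (insert h S) g) (parts n (insert h S)) (qmult ZZ (pos S h) (parts n S) x)"
   using C.mu_mu[OF S g h(1) h(2) y] C.mu_in[OF S g y] C.mu_in[OF S h(1) y] y gn hn h(2)
   unfolding xy by (simp add: M insert_commute del: ZZ_sel(4))
 qed (simp_all add: cf_closed[OF frame_E])
qed

text \<open>The twists are an isomorphism between the cubes of the two frames, the edges being the
  same pull-backs in both.\<close>

lemma exact_transport:
 assumes ex: "cube.exact_at (%S. cf E (parts n S)) (%S g. qmult ZZ (pos S g) (parts n S)) G l" and G: "G <= gaps n"
 shows "cube.exact_at (%S. qcomp ZZ (parts n S)) (%S g. qmult ZZ (pos S g) (parts n S)) G l"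
proof -
 interpret Q: quasi_algebra ZZ by (rule quasi_algebra_ZZ)
 interpret C: cube "gaps n" "%S. qcomp ZZ (parts n S)" "%S g. qmult ZZ (pos S g) (parts n S)"
  by (rule Q.cube_parts)
 let ?th = "%S. twists v (length (parts n S))" and ?th' = "%S. untwists v (length (parts n S))"
 let ?fam = "cube.fam (%S. cf E (parts n S))"
 interpret C': cube "gaps n" "%S. cf E (parts n S)" "%S g. qmult ZZ (pos S g) (parts n S)" by (rule cube_E)
 have M: "qmult ZZ (pos T k) (parts n T) (?th T z) = ?th (insert k T) (qmult ZZ (pos T k) (parts n T) z)"
  if "k ~: T" "Suc k < n" "z : cf D (parts n T)" for T k z
  using form_pull_twists[OF diag_into[OF Suc_pos_length[OF that(1,2)]]] that(3)
   length_merge[OF Suc_pos_length[OF that(1,2)]] merge_parts[OF that(1,2)] by (simp add: cf_def)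
 have tadd: "additive_on UNIV (twists v m :: 'f form => 'f form)" for m
  unfolding additive_on_def plus_fun_def using twists_add by blast
 have AU: "add_closed (UNIV :: 'f form set)" by (simp add: add_closed_def)
 note T = addD[OF tadd AU, simplified]
 have bd_th: "C.bd G (%S. ?th S (x S)) W = ?th W (C.bd G x W)"
  if x: "!!S. S <= G ==> x S : cf D (parts n S)" for x W
 proof (cases "W <= G")
  case True have "qmult ZZ (pos (W - {g}) g) (parts n (W - {g})) (?th (W - {g}) (x (W - {g})))
    = ?th W (qmult ZZ (pos (W - {g}) g) (parts n (W - {g})) (x (W - {g})))" if g: "g : W" for g
  proof -
   have "Suc g < n" "insert g (W - {g}) = W" using g True G by (auto simp: gaps_def)
   moreover have "x (W - {g}) : cf D (parts n (W - {g}))" using x True by blast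
   ultimately show ?thesis using M[of g "W - {g}" "x (W - {g})"] by simp
  qed
  thus ?thesis unfolding C.bd_def using True by (simp add: T(5) T(6))
 qed (simp add: C.bd_def T(2) del: ZZ_sel)
 show ?thesis unfolding C.exact_at_def
 proof (intro ballI impI)
  fix x assume x: "x : C.fam G (Suc l)" and b: "C.bd G x = (%_. 0)"
  have xc: "x S : cf D (parts n S)" if "S <= G" for S using C.fam_in[OF x G that] by simp
  have x': "(%S. ?th S (x S)) : ?fam G (Suc l)" unfolding C'.fam_def mem_Collect_eq
   using twists_cf[OF xc] C.fam_zero[OF x] T(2) by auto
  have "C.bd G (%S. ?th S (x S)) = (%_. 0)" using bd_th xc T b by auto
  then obtain y where y: "y : ?fam G l" "C'.bd G y = (%S. ?th S (x S))"
   using ex x' unfolding C'.exact_at_def by blast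
  let ?y = "%S. ?th' S (y S)"
  have yc: "y S : cf E (parts n S)" if "S <= G" for S using C'.fam_in[OF y(1) G that] .
  have u0: "untwists v m (0 :: 'f form) = 0" for m
   unfolding zero_fun_def by (induction m) (auto simp: untwist_def)
  have y': "?y : C.fam G l" unfolding C.fam_def mem_Collect_eq
   using untwists_cf[OF yc] C'.fam_zero[OF y(1)] u0 by auto
  have tu: "?th S (?y S) = y S" for S
  proof (cases "S <= G")
   case True
   thus ?thesis using twists_untwists[OF log_forms_fsupp] yc[OF True] by (auto simp: cf_def)
  next case False hence "y S = 0" using C'.fam_zero[OF y(1)] by blast
   thus ?thesis using u0 T(2) by simp
  qed
  have "C.bd G ?y = x"
  proof
   fix W
   have "?th W (C.bd G ?y W) = C.bd G (%S. ?th S (?y S)) W"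
    by (rule bd_th[symmetric]) (use untwists_cf[OF yc] in auto)
   also have "... = ?th W (x W)" unfolding tu using y(2) by auto
   finally have e: "?th W (C.bd G ?y W) = ?th W (x W)" .
   show "C.bd G ?y W = x W"
   proof (cases "W <= G")
    case True
    have "C.bd G ?y W : cf D (parts n W)" using C.fam_in[OF C.bd_fam[OF G y'] G True] by simp
    hence f: "fsupp (C.bd G ?y W)" "fsupp (x W)"
     using xc[OF True] log_forms_fsupp by (auto simp: cf_def)
    show ?thesis
     by (rule trans[OF untwists_twists[OF f(1), symmetric] trans[OF arg_cong[where f = "?th' W", OF e] untwists_twists[OF f(2)]]])
   next case False thus ?thesis using C.fam_zero[OF x, of W] by (simp add: C.bd_def del: ZZ_sel)
   qed qed
  thus "EX y:C.fam G l. C.bd G y = x" using y' by blast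
 qed qed

end

context log_disk
begin

subsection \<open>Normalized primitives\<close>

abbreviation grp :: "nat => (nat * nat) set" where
 "grp t \<equiv> {t} \<times> UNIV"

text \<open>The coordinates set to zero in the symbol at \<open>s\<close>. The logarithmic
  directions below the Euler one have only constant letters, so there the whole group is set to
  zero.\<close>

definition upper :: "nat => nat => (nat * nat) set" where
 "upper t s = (if v <= Suc s then {t} \<times> {s<..} else grp t)"

text \<open>Its zero set is where a primitive along \<open>s\<close> is normalized: a hyperplane for
  a plain coordinate, the common zero set of the logarithmic coordinates for the Euler
  field.\<close>

definition base :: "nat => nat => (nat * nat) set" where
 "base t s = (if v <= s then {(t, s)} else {t} \<times> {..<v})"

lemma upper_grp: "upper t s Un grp t = grp t" "grp t Un upper t s = grp t" and base_grp: "base t s <= grp t"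
 by (auto simp: upper_def base_def)

lemma base_upper: "k < s ==> v <= Suc s ==> base t s <= upper t k"
 by (auto simp: upper_def base_def)

lemma E_constant:
 assumes "t < m" "s < u" "v <= Suc s" "f : reg m" "E m (t, s) f = 0" shows "rho m (base t s) f = f"
  using plain_constant assms euler_constant E_euler by (auto simp: E_def base_def rho_def)

lemma E_grp: "t < m ==> s < u ==> f : reg m ==> E m (t, s) (rho m (grp t) f) = 0"
 using E_rho(2,3)[of f m "(t, s)" "grp t"] by (cases "v <= s") auto

lemma E_base: "t < m ==> s < u ==> v <= Suc s ==> f : reg m ==> E m (t, s) (rho m (base t s) f) = 0"
 using E_rho(2,3)[of f m "(t, s)" "base t s"] by (cases "v <= s") (auto simp: base_def)

lemma E_rho_other: assumes "q : vs m" "f : reg m" "fst q ~= t | snd q ~= s" "v <= Suc s"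
 shows "E m q (rho m (base t s) f) = rho m (base t s) (E m q f)"
 by (rule E_rho(1)) (use assms in "auto simp: base_def prod_eq_iff")

text \<open>The solvability condition of \<open>euler_primitive\<close> for the Euler direction;
  none for plain coordinates.\<close>

definition solvable :: "nat => nat => nat => 'f => bool" where
 "solvable m t s g <-> g : reg m & (s < v --> rho m (base t s) g = 0)"

definition prim :: "nat => nat => nat => 'f => 'f" where
 "prim m t s g = (THE h. h : reg m & E m (t, s) h = g & rho m (base t s) h = 0)"

lemma prim_unique:
 assumes ts: "t < m" "s < u" "v <= Suc s" and h: "h : reg m" "rho m (base t s) h = 0"
 shows "prim m t s (E m (t, s) h) = h" unfolding prim_def
proof (rule the_equality)
 fix h' assume h': "h' : reg m & E m (t, s) h' = E m (t, s) h & rho m (base t s) h' = 0"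
 have q: "(t, s) : vs m" using ts by simp
 have "E m (t, s) (h' - h) = 0" using frameD(5)[OF frame_E q] h' h by simp
 hence "rho m (base t s) (h' - h) = h' - h" using E_constant ts h h' reg_ops(4) by simp
 moreover have "rho m (base t s) (h' - h) = 0" using rho_ops(4) h h' by simp
 ultimately show "h' = h" by simp
qed (use h in simp)

lemma prim_exists: assumes ts: "t < m" "s < u" "v <= Suc s" and g: "solvable m t s g"
 shows "EX h. h : reg m & E m (t, s) h = g & rho m (base t s) h = 0"
proof -
 have "EX f:reg m. E m (t, s) f = g"
 proof (cases "v <= s")
  case True thus ?thesis using plain_primitive[of t m s g] ts g by (simp add: E_def solvable_def)
 next case False hence "Suc s = v" using ts(3) by simp
  thus ?thesis using euler_primitive[of t m g] ts g E_euler[of s m t] by (simp add: solvable_def base_def rho_def)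
 qed
 then obtain f where f: "f : reg m" "E m (t, s) f = g" by blast
 have q: "(t, s) : vs m" using ts by simp
 have r: "rho m (base t s) f : reg m" by (rule rho_reg[OF f(1)])
 have "rho m (base t s) (f - rho m (base t s) f) = 0"
  using rho_ops(4)[OF f(1) r] rho_rho[OF f(1), of "base t s" "base t s"] by simp
 moreover have "E m (t, s) (f - rho m (base t s) f) = g"
  using frameD(5)[OF frame_E q f(1) r] E_base[OF ts f(1)] f(2) by simp
 ultimately show ?thesis using reg_ops(4)[OF f(1) r] by blast
qed

lemma prim: assumes "t < m" "s < u" "v <= Suc s" "solvable m t s g"
 shows "prim m t s g : reg m" "E m (t, s) (prim m t s g) = g" "rho m (base t s) (prim m t s g) = 0"
proof -
 obtain h where "h : reg m" "E m (t, s) h = g" "rho m (base t s) h = 0" using prim_exists[OF assms] by blast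
 moreover hence "prim m t s g = h" using prim_unique[OF assms(1-3)] by blast
 ultimately show "prim m t s g : reg m" "E m (t, s) (prim m t s g) = g" "rho m (base t s) (prim m t s g) = 0"
  by simp_all
qed

text \<open>By uniqueness, as \<open>T\<close> takes the normalized primitive of \<open>g\<close> to
  a normalized primitive of \<open>T g\<close>.\<close>

lemma prim_commute: assumes ts: "t < m" "s < u" "v <= Suc s" and g: "solvable m t s g"
  and T: "!!h. h : reg m ==> T h : reg m" "!!h. h : reg m ==> E m (t, s) (T h) = T (E m (t, s) h)"
   "!!h. h : reg m ==> rho m (base t s) (T h) = T (rho m (base t s) h)" "T 0 = 0"
 shows "T (prim m t s g) = prim m t s (T g)" by (metis prim ts g prim_unique T)

lemma prim_add:
 assumes ts: "t < m" "s < u" "v <= Suc s" and g: "solvable m t s g" "solvable m t s g'"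
 shows "prim m t s (g + g') = prim m t s g + prim m t s g'"
proof -
 note p = prim[OF ts g(1)] prim[OF ts g(2)]
 have "prim m t s (E m (t, s) (prim m t s g + prim m t s g')) = prim m t s g + prim m t s g'"
  by (rule prim_unique[OF ts]) (use p rho_ops(1) reg_ops(2) in simp_all)
 moreover have "E m (t, s) (prim m t s g + prim m t s g') = g + g'"
  using frameD(4)[OF frame_E, of "(t, s)" m] p ts by simp
 ultimately show ?thesis by simp
qed

text \<open>If \<open>s\<close> is the Euler direction, then \<open>k < s\<close> is logarithmic,
  and a logarithmic derivative vanishes on the common zero set of the logarithmic
  coordinates.\<close>

lemma solvable_E:
 assumes "t < m" "s < u" "v <= Suc s" "k < s" "f : reg m" shows "solvable m t s (E m (t, k) f)"
proof -
 have k: "(t, k) : vs m" using assms by simp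
 have "rho m (base t s) (E m (t, k) f) = 0" if "s < v"
  using that E_rho assms k by (auto simp: base_def)
 thus ?thesis unfolding solvable_def using E_reg[OF k assms(5)] by blast
qed

subsection \<open>The letters\<close>

text \<open>
 A letter is a pair \<open>(s, b)\<close>. The letter \<open>(s, False)\<close> stands for the constant multiples of the
 \<open>s\<close>-th basic 1-form \<open>e s\<close> of the frame, the letter \<open>(s, True)\<close> for the closed 1-forms
 \<open>g e s + (\<Sum>k<s. g k e k)\<close> with \<open>g\<close> depending on the coordinates up to \<open>s\<close> only, with
 \<open>g\<close> vanishing at the origin, and with normalized \<open>g k\<close>. The form is determined by \<open>g\<close>.
\<close>

definition lett :: "nat => nat => nat * bool => nat => 'f => 'f" where
 "lett m t l k f = (if ~ snd l then (if k = fst l then rho m (grp t) f else 0)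
   else if k = fst l then rho m (upper t (fst l)) f - rho m (grp t) f
   else if k < fst l then prim m t (fst l) (E m (t, k) (rho m (upper t (fst l)) f - rho m (grp t) f))
   else 0)"

definition letters :: "(nat * bool) set" where
 "letters = {(s, b). s < u & (b --> v <= Suc s)}"

lemma finite_letters [simp]: "finite letters"
 by (rule finite_subset[of _ "{..<u} \<times> UNIV"]) (auto simp: letters_def)

context
 fixes m t :: nat assumes t: "t < m"
begin

abbreviation "red s f \<equiv> rho m (upper t s) f - rho m (grp t) f"

lemma red_reg: "f : reg m ==> red s f : reg m" by (intro reg_ops(4) rho_reg)

lemma red_zero: "f : reg m ==> rho m (upper t s) f = 0 ==> rho m (grp t) f = 0" "f : reg m ==> rho m (upper t s) f = 0 ==> red s f = 0"
proof -
 show "rho m (grp t) f = 0" if "f : reg m" "rho m (upper t s) f = 0"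
  using rho_rho[OF that(1), of "grp t" "upper t s"] upper_grp(2)[of t s] that(2) rho_ops(2) by simp
 thus "f : reg m ==> rho m (upper t s) f = 0 ==> red s f = 0" by simp
qed

lemma red_const: "f : reg m ==> rho m (grp t) f = f ==> red s f = 0"
 using rho_rho[of f m "upper t s" "grp t"] upper_grp(1)[of t s] by simp

lemma rho_red:
 assumes f: "f : reg m" shows "rho m (upper t s) (red s f) = red s f" "rho m (grp t) (red s f) = 0"
 using rho_ops(4)[OF rho_reg[OF f] rho_reg[OF f]] rho_rho[OF f] upper_grp[of t s] by simp_all

lemma lett_reg: assumes l: "l : letters" and f: "f : reg m" shows "lett m t l k f : reg m"
  using prim t solvable_E l by (auto simp: letters_def lett_def rho_reg f red_reg reg_ops)

lemma lett_zero: assumes l: "l : letters" and f: "f : reg m" and z: "rho m (upper t (fst l)) f = 0"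
 shows "lett m t l k f = 0"
proof -
 have "prim m t (fst l) (E m (t, k) 0) = 0" if "snd l" "k < fst l"
 proof -
  have k: "(t, k) : vs m" "(t, fst l) : vs m" using t l that by (auto simp: letters_def)
  have "prim m t (fst l) (E m (t, fst l) 0) = 0"
   by (rule prim_unique[OF t]) (use l that reg_ops(1) rho_ops(2) in "auto simp: letters_def")
  thus ?thesis using frameD(3)[OF frame_E k(1)] frameD(3)[OF frame_E k(2)] by simp
 qed
 thus ?thesis unfolding lett_def red_zero(2)[OF f z] using red_zero(1)[OF f z] by simp
qed

lemma lett_0 [simp]: "l : letters ==> lett m t l k 0 = 0"
 using lett_zero[of l 0 k] rho_ops(2) reg_ops(1) by simp

lemma lett_const: assumes l: "l : letters" "snd l" and f: "f : reg m" and z: "rho m (grp t) f = f"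
 shows "lett m t l k f = 0"
 using lett_0[OF l(1), of k] red_const[OF f z, of "fst l"] l(2) unfolding lett_def by (simp add: rho_ops(2) split: if_splits)

lemma lett_add: assumes l: "l : letters" and f: "f : reg m" "g : reg m"
 shows "lett m t l k (f + g) = lett m t l k f + lett m t l k g"
proof -
 have r: "red (fst l) (f + g) = red (fst l) f + red (fst l) g" using rho_ops(1)[OF f] by simp
 have "prim m t (fst l) (E m (t, k) (red (fst l) f + red (fst l) g))
   = prim m t (fst l) (E m (t, k) (red (fst l) f)) + prim m t (fst l) (E m (t, k) (red (fst l) g))"
  if "snd l" "k < fst l"
  using t l that prim_add solvable_E by (auto simp: letters_def frameD frame_E red_reg f)
 thus ?thesis unfolding lett_def r using rho_ops(1)[OF f] by auto
qed

text \<open>What commutes with the derivations and restrictions of the group \<open>t\<close>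
  commutes with normalized primitives too. This is applied to the derivations and restrictions of
  the other groups.\<close>

lemma lett_commute: assumes l: "l : letters" and f: "f : reg m"
  and T: "!!h. h : reg m ==> T h : reg m" "!!h h'. h : reg m ==> h' : reg m ==> T (h - h') = T h - T h'"
   "!!h s. h : reg m ==> s < u ==> E m (t, s) (T h) = T (E m (t, s) h)"
   "!!h A. h : reg m ==> A <= grp t ==> rho m A (T h) = T (rho m A h)"
 shows "T (lett m t l k f) = lett m t l k (T f)"
proof -
 have T0: "T 0 = 0" using T(2)[OF reg_ops(1) reg_ops(1)] by simp
 have U: "upper t s <= grp t" for s by (auto simp: upper_def)
 have r: "red (fst l) (T f) = T (red (fst l) f)"
  using T(2)[OF rho_reg[OF f] rho_reg[OF f]] T(4)[OF f U] T(4)[OF f order_refl] by simp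
 have "T (prim m t (fst l) (E m (t, k) (red (fst l) f))) = prim m t (fst l) (E m (t, k) (T (red (fst l) f)))"
  if "snd l" "k < fst l"
  using l that prim_commute t solvable_E T0 base_grp by (auto simp: letters_def T red_reg f)
 thus ?thesis unfolding lett_def r using T(4)[OF f order_refl] T0 by auto
qed

lemma lett_E: assumes l: "l : letters" and f: "f : reg m" and q: "q : vs m" "fst q ~= t"
 shows "E m q (lett m t l k f) = lett m t l k (E m q f)"
proof (rule lett_commute[OF l f])
 show "E m (t, s) (E m q h) = E m q (E m (t, s) h)" if "h : reg m" "s < u" for h s
  by (rule E_comm) (use that q t in simp_all)
 show "rho m A (E m q h) = E m q (rho m A h)" if "h : reg m" "A <= grp t" for h A
  by (rule E_rho(1)[symmetric]) (use that q in auto)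
qed (use q frameD(5)[OF frame_E] E_reg in auto)

lemma lett_rho: assumes l: "l : letters" and f: "f : reg m" and A: "A Int grp t = {}"
 shows "rho m A (lett m t l k f) = lett m t l k (rho m A f)"
  using l f A t rho_rho rho_reg rho_ops by (auto simp: Un_commute intro!: lett_commute E_rho)

text \<open>With \<open>g\<close> the coefficient at \<open>s = fst l\<close>, the coefficient at
  \<open>k < s\<close> is the primitive along \<open>s\<close> of \<open>E_k g\<close>. This settles
  the pair of \<open>k\<close> and \<open>s\<close>; for two indices below \<open>s\<close> one
  commutes the derivations with the primitive, and above \<open>s\<close> the function
  \<open>g\<close> has no dependence.\<close>

lemma lett_closed_aux: assumes l: "l : letters" and f: "f : reg m" and ij: "i < j" "j < u"
 shows "E m (t, i) (lett m t l j f) = E m (t, j) (lett m t l i f)"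
proof (cases "snd l")
 case False
 have z: "E m (t, k) 0 = 0" if "k < u" for k using frameD(3)[OF frame_E, of "(t, k)" m] t that by simp
 thus ?thesis using False E_grp[OF t _ f] ij unfolding lett_def by simp
next case True define s where "s = fst l"
 define g where "g = red s f"
 have s: "s < u" "v <= Suc s" using l True by (auto simp: letters_def s_def)
 have g: "g : reg m" unfolding g_def by (rule red_reg[OF f])
 have L: "lett m t l k f = (if k = s then g else if k < s then prim m t s (E m (t, k) g) else 0)" for k
  using True by (simp add: lett_def s_def g_def)
 have z: "E m (t, k) 0 = 0" if "k < u" for k using frameD(3)[OF frame_E, of "(t, k)" m] t that by simp
 have c: "E m (t, k) (prim m t s (E m (t, k') g)) = prim m t s (E m (t, k) (E m (t, k') g))"
  if k: "k < u" "k ~= s" "k' < s" for k k'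
 proof (rule prim_commute[OF t s solvable_E[OF t s k(3) g]])
  have q: "(t, k) : vs m" using t k by simp
  show "E m (t, k) h : reg m" if "h : reg m" for h by (rule E_reg[OF q that])
  show "E m (t, s) (E m (t, k) h) = E m (t, k) (E m (t, s) h)" if "h : reg m" for h
   by (rule E_comm) (use that t s k in simp_all)
  show "rho m (base t s) (E m (t, k) h) = E m (t, k) (rho m (base t s) h)" if "h : reg m" for h
   by (rule E_rho_other[symmetric]) (use that q k s in simp_all)
 qed (use z k in simp)
 have zg: "E m (t, j) g = 0" if "s < j"
 proof -
  have q: "(t, j) : vs m" using t ij by simp
  have "E m (t, j) (rho m (upper t s) f) = 0"
   by (rule E_rho(2)[OF f q]) (use that s in "auto simp: upper_def")
  thus ?thesis unfolding g_def
   using frameD(5)[OF frame_E q rho_reg[OF f] rho_reg[OF f]] E_grp[OF t ij(2) f] by simp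
 qed
 have pz: "prim m t s 0 = 0" using prim_unique[OF t s reg_ops(1)] rho_ops(2) z[OF s(1)] by simp
 consider "s < j" "s < i" | "s < j" "i = s" | "s < j" "i < s" | "j = s" | "j < s" by linarith
 thus ?thesis using E_comm t ij s g c zg z pz prim solvable_E by (auto simp: L)
qed

lemma lett_closed: assumes l: "l : letters" and f: "f : reg m" and ij: "i < u" "j < u"
 shows "E m (t, i) (lett m t l j f) = E m (t, j) (lett m t l i f)"
 using lett_closed_aux[OF l f, of i j] lett_closed_aux[OF l f, of j i] ij by (cases i j rule: linorder_cases) auto

lemma lett_greater: "fst l < k ==> lett m t l k f = 0"
 and lett_False: "~ snd l ==> k ~= fst l ==> lett m t l k f = 0" by (auto simp: lett_def)

lemma lett_False_grp: "~ snd l ==> f : reg m ==> rho m (grp t) (lett m t l k f) = lett m t l k f"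
 unfolding lett_def using rho_rho[of f m "grp t" "grp t"] rho_ops(2) by simp

lemma lett_True_same: assumes "snd l" "f : reg m"
 shows "rho m (upper t (fst l)) (lett m t l (fst l) f) = lett m t l (fst l) f"
  "rho m (grp t) (lett m t l (fst l) f) = 0" using assms rho_red by (simp_all add: lett_def)

lemma lett_base: assumes "l : letters" "snd l" "k < fst l" "f : reg m"
 shows "rho m (base t (fst l)) (lett m t l k f) = 0"
 using assms prim(3)[OF t _ _ solvable_E[OF t _ _ _ red_reg[OF assms(4)]]]
 by (auto simp: lett_def letters_def)

lemma rho_mono_zero: "f : reg m ==> rho m A f = 0 ==> A <= B ==> rho m B f = 0"
 using rho_rho[of f m B A] rho_ops(2) by (simp add: Un_absorb2)

lemma lett_upper_zero: assumes l: "l : letters" and "k <= M" "M < fst l" and f: "f : reg m"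
 shows "rho m (upper t M) (lett m t l k f) = 0"
proof (cases "snd l")
 case True hence "rho m (base t (fst l)) (lett m t l k f) = 0" using lett_base assms by simp
 thus ?thesis
  by (rule rho_mono_zero[OF lett_reg[OF l f]]) (rule base_upper, use True l assms(3) in \<open>auto simp: letters_def\<close>)
qed (use assms rho_ops(2) in "auto simp: lett_def")

text \<open>Letters below \<open>k\<close> have no coefficient there; letters above \<open>k\<close>
  have one that vanishes after restriction to the zero set of \<open>upper t k\<close>. The letters
  at \<open>k\<close> supply the constant part of the symbol and, where nonconstant letters exist,
  the rest of it.\<close>

lemma lett_upper_sum: assumes k: "k < u" and f: "!!s. f s : reg m"
 shows "rho m (upper t k) (SUM l:letters. lett m t l k (f (fst l))) = rho m (upper t k) (f k)"
proof -
 have r: "lett m t l k (f (fst l)) : reg m" if "l : letters" for l using lett_reg[OF that f] .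
 have "rho m (upper t k) (SUM l:letters. lett m t l k (f (fst l)))
   = (SUM l:letters. rho m (upper t k) (lett m t l k (f (fst l))))" by (rule rho_ops(6)) (rule r)
 also have "... = (SUM l:{l:letters. fst l = k}. rho m (upper t k) (lett m t l k (f k)))"
 proof (rule sum.mono_neutral_cong_right)
  show "ALL l:letters - {l : letters. fst l = k}. rho m (upper t k) (lett m t l k (f (fst l))) = 0"
  proof
   fix l assume l: "l : letters - {l : letters. fst l = k}"
   show "rho m (upper t k) (lett m t l k (f (fst l))) = 0"
   proof (cases "k < fst l")
    case True thus ?thesis using l by (intro lett_upper_zero f) auto
   next case False hence "fst l < k" using l by auto
    thus ?thesis using lett_greater rho_ops(2) by simp
   qed qed qed auto
 also have "... = rho m (upper t k) (f k)"
 proof (cases "v <= Suc k")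
  case True
  hence "{l:letters. fst l = k} = {(k, False), (k, True)}" using k by (auto simp: letters_def)
  thus ?thesis
   using rho_red(1)[OF f, of k k] rho_rho[OF f, of "upper t k" "grp t"] upper_grp by (simp add: lett_def)
 next case False hence "{l:letters. fst l = k} = {(k, False)}" "upper t k = grp t"
   using k by (auto simp: letters_def upper_def)
  thus ?thesis using rho_rho[OF f, of "grp t" "grp t"] by (simp add: lett_def)
 qed
 finally show ?thesis .
qed

end

end

definition slice :: "nat => (nat * nat) set => nat set" where
 "slice t J = {s. (t, s) : J}"

lemma in_slice [simp]: "s : slice t J <-> (t, s) : J" by (simp add: slice_def)

lemma finite_slice: "J <= vars u m ==> finite (slice t J)"
 by (rule finite_subset[of _ "{..<u}"]) auto

lemma slice_Diff: "slice t (J - {(q, s)}) = (if q = t then slice t J - {s} else slice t J)" by auto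

definition put :: "nat => (nat * nat) set => nat => (nat * nat) set" where
 "put t J s = insert (t, s) {p : J. fst p ~= t}"

lemma slice_put [simp]: "slice t (put t J s) = {s}" "q ~= t ==> slice q (put t J s) = slice q J"
 by (auto simp: put_def)

lemma put_slice: "slice t J = {k} ==> put t J k = J" unfolding put_def by (auto simp: set_eq_iff)

lemma put_vars: "J <= vars u m ==> t < m ==> s < u ==> put t J s <= vars u m"
 by (auto simp: put_def)

lemma put_Diff: "q ~= t ==> put t (J - {(q, r)}) s = put t J s - {(q, r)}" by (auto simp: put_def)

lemma put_Diff_same: "put t (J - {(t, r)}) s = put t J s" by (auto simp: put_def)

text \<open>An index of another group lies before or after the group \<open>t\<close> as a whole, so
  the value of the single index in that group does not affect its position.\<close>

lemma sg_put: assumes "slice t J = {k}" "q ~= t" shows "sg (put t J s) (q, r) = sg J (q, r)"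
proof -
 have J: "J = put t J k" using put_slice[OF assms(1)] by simp
 have 1: "{p : put t J s'. lex_less p (q, r)} = {p : J. fst p ~= t & lex_less p (q, r)} Un (if t < q then {(t, s')} else {})" for s'
  using assms(2) by (auto simp: put_def lex_less_def)
 have "{p : J. lex_less p (q, r)} = {p : J. fst p ~= t & lex_less p (q, r)} Un (if t < q then {(t, k)} else {})"
  using 1[of k] J by simp
 moreover have "card ({p : J. fst p ~= t & lex_less p (q, r)} Un (if t < q then {(t, s')} else {}))
   = card ({p : J. fst p ~= t & lex_less p (q, r)} Un (if t < q then {(t, k)} else {}))" for s'
 proof (cases "finite {p : J. fst p ~= t & lex_less p (q, r)}")
  case True thus ?thesis by auto
 qed auto
 ultimately show ?thesis unfolding sg_def 1[of s] by simp
qed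

context log_disk
begin

subsection \<open>Forms closed in one group of variables\<close>

text \<open>The part of the differential that raises the degree in the group
  \<open>q\<close>.\<close>

definition gd :: "nat => nat => 'f form => 'f form" where
 "gd m q W J = (SUM s:slice q J. signed (sg J (q, s)) (E m (q, s) (W (J - {(q, s)}))))"

definition gc :: "nat => nat => 'f form => bool" where
 "gc m q W <-> (ALL J. J <= vs m --> gd m q W J = 0)"

lemma dform_gd: assumes "J <= vs m" shows "dform E m W J = (\<Sum>q<m. gd m q W J)"
proof -
 have "J = (SIGMA q:{..<m}. slice q J)" using assms by auto
 hence "dform E m W J = (SUM p:(SIGMA q:{..<m}. slice q J). signed (sg J p) (E m p (W (J - {p}))))"
  unfolding dform_def using assms by simp
 also have "... = (\<Sum>q<m. gd m q W J)"
  unfolding gd_def using finite_slice[OF assms] by (subst sum.Sigma) auto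
 finally show ?thesis .
qed

lemma E_0 [simp]: "p : vs m ==> E m p 0 = 0" by (rule frameD(3)[OF frame_E])

lemma gd_zero: assumes "J <= vs m" "!!s. (q, s) : J ==> W (J - {(q, s)}) = 0" shows "gd m q W J = 0"
 unfolding gd_def by (rule sum.neutral) (use assms in auto)

text \<open>For a homogeneous form the parts \<open>gd\<close> of the differential have pairwise
  different multidegrees and cannot cancel each other.\<close>

lemma cf_gc:
 "W : cf E ns <-> W : LF (length ns) & mdeg ns W & (ALL q<length ns. gc (length ns) q W)"
 (is "_ <-> ?R")
proof
 assume ?R
 hence "dform E (length ns) W J = 0" for J
  using dform_gd[of J "length ns" W] unfolding gc_def by (cases "J <= vs (length ns)") (auto simp: dform_def)
 thus "W : cf E ns" using \<open>?R\<close> by (simp add: cf_def fun_eq_iff)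
next let ?m = "length ns"
 assume w: "W : cf E ns"
 have "gc ?m q W" if q: "q < ?m" for q unfolding gc_def
 proof (intro allI impI)
  fix J assume J: "J <= vs ?m"
  show "gd ?m q W J = 0"
  proof (rule ccontr)
   assume ne: "gd ?m q W J ~= 0"
   have md: "mdeg ns W" using w by (simp add: cf_def)
   obtain s where s: "(q, s) : J" "W (J - {(q, s)}) ~= 0" using gd_zero[OF J] ne by blast
   have "gd ?m q' W J = 0" if q': "q' ~= q" for q'
   proof (rule gd_zero[OF J])
    fix s' assume s': "(q', s') : J"
    have 1: "int (card (slice q (J - {(q, s)}))) = ns ! q"
     using md s(2) q unfolding has_multidegree_def slice_def by blast
    have 2: "slice q (J - {(q', s')}) = insert s (slice q (J - {(q, s)}))" "s ~: slice q (J - {(q, s)})"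
     using q' s by auto
    have "finite (slice q (J - {(q, s)}))" by (rule finite_slice[of _ u ?m]) (use J in blast)
    hence "int (card (slice q (J - {(q', s')}))) = ns ! q + 1" using 1 2 by simp
    thus "W (J - {(q', s')}) = 0"
     using has_multidegreeD[OF md q, of "J - {(q', s')}"] unfolding slice_def by simp
   qed
   hence "(\<Sum>q'<?m. gd ?m q' W J) = gd ?m q W J" using q by (subst sum.remove[of _ q]) auto
   moreover have "dform E ?m W J = 0" using w by (simp add: cf_def)
   ultimately show False using ne dform_gd[OF J, of W] by simp
  qed qed
 thus ?R using w by (simp add: cf_def)
qed

lemma signed_eq_0 [simp]: "signed k x = 0 <-> x = (0::'f)" by (simp add: signed_def)

text \<open>
 A closed form of positive degree in the variables of one group is determined by its symbol:
 the coefficients at \<open>J\<close>, restricted to the subspace where the coordinates after the greatest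
 element of \<open>J\<close> vanish (respectively all coordinates, in the logarithmic directions other
 than the Euler one).
\<close>

lemma zero_symbol_step: assumes t: "t < m" and M: "M < u" "v <= Suc M" and W: "W : LF m" "gc m t W"
  and sym: "!!J. J <= vs m ==> slice t J ~= {} ==> rho m (upper t (Max (slice t J))) (W J) = 0"
  and C: "!!J. W J ~= 0 ==> slice t J <= {..M} & rho m (upper t M) (W J) = W J" and ne: "W J ~= 0"
 shows "slice t J <= {..<M} & rho m (base t M) (W J) = W J"
proof -
 have V: "J <= vs m" if "W J ~= 0" for J using lfD(2)[OF W(1)] that by blast
 have 1: "M ~: slice t J" if "W J ~= 0" for J
 proof
  assume "M : slice t J"
  hence "Max (slice t J) = M" using C[OF that] finite_slice[OF V[OF that]] by (intro Max_eqI) auto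
  moreover have "slice t J ~= {}" using \<open>M : slice t J\<close> by blast
  ultimately show False using sym[OF V[OF that]] C[OF that] that by simp
 qed
 have 2: "slice t J <= {..<M}" if "W J ~= 0" for J
  using 1[OF that] C[OF that] by (metis atMost_iff lessThan_iff order_le_less subset_eq)
 \<comment> \<open>Closedness is tested at \<open>J\<close> with \<open>M\<close> added: every other
   term has \<open>M\<close> in its index set and vanishes by the first part.\<close>
 let ?K = "insert (t, M) J"
 have K: "?K <= vs m" using V[OF ne] t M by auto
 have nM: "(t, M) ~: J" using 1[OF ne] by simp
 have z: "W (?K - {(t, s)}) = 0" if "s : slice t ?K" "s ~= M" for s
  using 1[of "?K - {(t, s)}"] that by auto
 have "gd m t W ?K = (SUM s:slice t ?K. if s = M then signed (sg ?K (t, M)) (E m (t, M) (W J)) else 0)"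
  unfolding gd_def
 proof (rule sum.cong[OF refl])
  fix s assume s: "s : slice t ?K"
  show "signed (sg ?K (t, s)) (E m (t, s) (W (?K - {(t, s)})))
    = (if s = M then signed (sg ?K (t, M)) (E m (t, M) (W J)) else 0)" using nM z s K by auto
 qed
 also have "... = signed (sg ?K (t, M)) (E m (t, M) (W J))" using finite_slice[OF K] by simp
 finally have "E m (t, M) (W J) = 0" using W(2) K by (simp add: gc_def)
 thus ?thesis using 2[OF ne] E_constant[OF t M lfD(1)[OF W(1)]] by blast
qed

text \<open>Descending induction on the greatest possible index: plain coordinates disappear one by
  one from the index sets and from the arguments of the coefficients. The Euler direction comes
  last; afterwards the coefficients are constant in the group, hence equal to their symbols.\<close>

lemma zero_symbol: assumes t: "t < m" and W: "W : LF m" "gc m t W"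
  and sym: "!!J. J <= vs m ==> slice t J ~= {} ==> rho m (upper t (Max (slice t J))) (W J) = 0"
  and deg: "!!J. slice t J = {} ==> W J = 0" shows "W = 0"
proof -
 have V: "J <= vs m" if "W J ~= 0" for J using lfD(2)[OF W(1)] that by blast
 note r = lfD(1)[OF W(1)]
 have C: "W J ~= 0 --> slice t J <= {..<M} & rho m ({t} \<times> {M..}) (W J) = W J" if "v <= M" "M <= u" for M J
  using that(2,1)
 proof (induction M arbitrary: J rule: inc_induct)
  case base show ?case using V rho_empty r by force
 next case (step M)
  have up: "upper t M = {t} \<times> {Suc M..}" using step.prems by (auto simp: upper_def)
  have ba: "base t M = {(t, M)}" using step.prems by (auto simp: base_def)
  show ?case
  proof
   assume ne: "W J ~= 0"
   have "slice t J <= {..<M} & rho m (base t M) (W J) = W J"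
   proof (rule zero_symbol_step[OF t step.hyps(2) _ W sym _ ne])
    fix J assume "W J ~= 0"
    thus "slice t J <= {..M} & rho m (upper t M) (W J) = W J"
     using step.IH[of J] step.prems up by auto
   qed (use step in simp)
   moreover have "{t} \<times> {M..} = {(t, M)} Un {t} \<times> {Suc M..}" by auto
   moreover have "rho m ({(t, M)} Un {t} \<times> {Suc M..}) (W J) = rho m {(t, M)} (rho m ({t} \<times> {Suc M..}) (W J))"
    using rho_rho[OF r] by simp
   ultimately show "slice t J <= {..<M} & rho m ({t} \<times> {M..}) (W J) = W J"
    using step.IH[of J] step.prems ne ba by simp
  qed qed
 have "W J = 0" for J
 proof (rule ccontr)
  assume ne: "W J ~= 0"
  hence J: "slice t J ~= {}" using deg by blast
  hence v: "0 < v" using C[of v J] ne by auto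
  define M where "M = v - 1"
  have M: "Suc M = v" "M < u" "upper t M = {t} \<times> {v..}" "base t M = {t} \<times> {..<v}"
   using v v_le by (auto simp: M_def upper_def base_def)
  have "slice t J <= {..<M} & rho m (base t M) (W J) = W J"
  proof (rule zero_symbol_step[OF t M(2) _ W sym _ ne])
   fix J assume "W J ~= 0"
   thus "slice t J <= {..M} & rho m (upper t M) (W J) = W J"
    using C[of v J] v_le M(3) unfolding lessThan_Suc_atMost[symmetric] M(1) by simp
  qed (use M in simp)
  moreover have "rho m ({t} \<times> {v..}) (W J) = W J" using C[of v J] ne v_le by simp
  moreover have "rho m (grp t) (W J) = rho m ({t} \<times> {..<v}) (rho m ({t} \<times> {v..}) (W J))"
   unfolding rho_rho[OF r] by (rule rho_cong[OF r]) auto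
  ultimately have "slice t J <= {..<M}" "rho m (grp t) (W J) = W J" using M(4) by simp_all
  moreover have "Max (slice t J) : slice t J" using Max_in[OF finite_slice[OF V[OF ne]] J] .
  ultimately have "upper t (Max (slice t J)) = grp t" using M(1) by (auto simp: upper_def)
  thus False using sym[OF V[OF ne] J] \<open>rho m (grp t) (W J) = W J\<close> ne by simp
 qed
 thus ?thesis by auto
qed

subsection \<open>Decomposition of closed 1-forms by letters\<close>

text \<open>The letter reads only the coefficient with the index \<open>fst l\<close> in the group
  \<open>t\<close> and extends it by \<open>lett\<close> to all indices of this group.\<close>

definition lpart :: "nat => nat => nat * bool => 'f form => 'f form" where
 "lpart m t l W J = (if J <= vs m & is_singleton (slice t J)
   then lett m t l (the_elem (slice t J)) (W (put t J (fst l))) else 0)"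

lemma lpart_at: "J <= vs m ==> slice t J = {k} ==> lpart m t l W J = lett m t l k (W (put t J (fst l)))"
 by (simp add: lpart_def)

lemma lpart_nonzero: "lpart m t l W J ~= 0 ==> J <= vs m & (EX k. slice t J = {k})"
 by (auto simp: lpart_def is_singleton_def split: if_splits)

context
 fixes m t :: nat and l :: "nat * bool" assumes t: "t < m" and l: "l : letters"
begin

lemma lpart_0: "lpart m t l 0 = 0" using lett_0[OF t l] by (auto simp: lpart_def)

lemma lpart_add:
 assumes "W : LF m" "W' : LF m" shows "lpart m t l (W + W') = lpart m t l W + lpart m t l W'"
 using lett_add[OF t l] lfD(1)[OF assms(1)] lfD(1)[OF assms(2)] by (auto simp: lpart_def)

lemma lpart_log_forms: assumes "W : LF m" shows "lpart m t l W : LF m"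
 by (rule lfI) (use lett_reg[OF t l] lfD(1)[OF assms] reg_ops(1) in "auto simp: lpart_def")

lemma lpart_multidegree: assumes "mdeg ns W" "ns ! t = 1" shows "mdeg ns (lpart m t l W)"
 unfolding has_multidegree_def
proof (intro allI impI)
 fix J q assume ne: "lpart m t l W J ~= 0" and q: "q < length ns"
 obtain k where k: "slice t J = {k}" "J <= vs m" using lpart_nonzero[OF ne] by blast
 have "W (put t J (fst l)) ~= 0" using ne lpart_at[OF k(2,1)] lett_0[OF t l] by auto
 hence "int (card (slice q (put t J (fst l)))) = ns ! q"
  using assms(1) q unfolding has_multidegree_def slice_def by blast
 thus "int (card {s. (q, s) : J}) = ns ! q"
  using k(1) assms(2) by (cases "q = t") (auto simp: slice_def[symmetric])
qed

text \<open>At two indices of the group the equation is \<open>lett_closed\<close>, for every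
  \<open>W\<close>. Letter parts thus produce closedness in the group \<open>t\<close>, which is how
  \<open>sect\<close> repairs \<open>lift\<close>.\<close>

lemma lpart_gc_same: assumes "W : LF m" shows "gc m t (lpart m t l W)" unfolding gc_def
proof (intro allI impI)
 fix J assume J: "J <= vs m"
 show "gd m t (lpart m t l W) J = 0"
 proof (cases "EX i j. i < j & slice t J = {i, j}")
  case False show ?thesis
  proof (rule gd_zero[OF J], rule ccontr)
   fix s assume s: "(t, s) : J" and "lpart m t l W (J - {(t, s)}) ~= 0"
   then obtain k where "slice t (J - {(t, s)}) = {k}" using lpart_nonzero by blast
   hence "slice t J - {s} = {k}" unfolding slice_Diff by simp
   moreover have "s : slice t J" using s by simp
   ultimately have "slice t J = {s, k}" "s ~= k" by blast+
   thus False using False by (metis insert_commute nat_neq_iff)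
  qed
 next case True then obtain i j where ij: "i < j" "slice t J = {i, j}" by blast
  hence mem: "(t, i) : J" "(t, j) : J" by auto
  hence u: "i < u" "j < u" using J by auto
  have sl: "slice t (J - {(t, i)}) = {j}" "slice t (J - {(t, j)}) = {i}" unfolding slice_Diff using ij by auto
  define f where "f = W (put t J (fst l))"
  have f: "f : reg m" unfolding f_def by (rule lfD(1)[OF assms])
  have c: "lpart m t l W (J - {(t, i)}) = lett m t l j f" "lpart m t l W (J - {(t, j)}) = lett m t l i f"
   using J sl by (simp_all add: lpart_at f_def put_Diff_same Diff_subset[THEN subset_trans])
  have "{q : J. lex_less q (t, j)} = insert (t, i) {q : J. lex_less q (t, i)}"
   using mem ij by (auto simp: lex_less_def slice_def)
  hence "sg J (t, j) = Suc (sg J (t, i))" unfolding sg_def using finite_sub_vars[OF J] by simp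
  hence "gd m t (lpart m t l W) J = signed (sg J (t, i)) (E m (t, i) (lett m t l j f))
    - signed (sg J (t, i)) (E m (t, j) (lett m t l i f))"
   unfolding gd_def ij(2) using ij(1) c by (simp add: signed_Suc)
  thus ?thesis using lett_closed[OF t l f u] by simp
 qed qed

text \<open>\<open>lett\<close> is additive and commutes with the derivations of the other groups,
  whose signs are unaffected by the index in the group \<open>t\<close>.\<close>

lemma lpart_gc_other:
 assumes W: "W : LF m" "gc m q W" and q: "q ~= t" "q < m" shows "gc m q (lpart m t l W)"
 unfolding gc_def
proof (intro allI impI)
 fix J assume J: "J <= vs m"
 show "gd m q (lpart m t l W) J = 0"
 proof (cases "EX k. slice t J = {k}")
  case False show ?thesis by (metis gd_zero J lpart_nonzero False q slice_Diff)
 next case True then obtain k where k: "slice t J = {k}" by blast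
  let ?J = "put t J (fst l)"
  note r = lfD(1)[OF W(1)]
  have lu: "fst l < u" using l by (auto simp: letters_def)
  have A: "additive_on (reg m) (lett m t l k)" unfolding additive_on_def using lett_add[OF t l] by blast
  note A = addD[OF A reg_closed]
  have "gd m q (lpart m t l W) J
    = (SUM s:slice q J. signed (sg J (q, s)) (E m (q, s) (lett m t l k (W (put t (J - {(q, s)}) (fst l))))))"
   unfolding gd_def
  proof (rule sum.cong[OF refl])
   fix s assume "s : slice q J"
   have "lpart m t l W (J - {(q, s)}) = lett m t l k (W (put t (J - {(q, s)}) (fst l)))"
    by (rule lpart_at) (use J k q(1) in "auto simp: slice_Diff")
   thus "signed (sg J (q, s)) (E m (q, s) (lpart m t l W (J - {(q, s)})))
    = signed (sg J (q, s)) (E m (q, s) (lett m t l k (W (put t (J - {(q, s)}) (fst l)))))" by simp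
  qed
  also have "... = (SUM s:slice q J. lett m t l k (signed (sg ?J (q, s)) (E m (q, s) (W (?J - {(q, s)})))))"
  proof (rule sum.cong[OF refl])
   fix s assume s: "s : slice q J"
   hence qs: "(q, s) : vs m" using J by auto
   show "signed (sg J (q, s)) (E m (q, s) (lett m t l k (W (put t (J - {(q, s)}) (fst l)))))
    = lett m t l k (signed (sg ?J (q, s)) (E m (q, s) (W (?J - {(q, s)}))))"
    using lett_E[OF t l r qs] q(1) A(5)[OF E_reg[OF qs r]] put_Diff[OF q(1), of J s "fst l"]
     sg_put[OF k q(1), of "fst l" s] by simp
  qed
  also have "... = lett m t l k (gd m q W ?J)"
  proof -
   have "lett m t l k (SUM s:slice q J. signed (sg ?J (q, s)) (E m (q, s) (W (?J - {(q, s)}))))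
    = (SUM s:slice q J. lett m t l k (signed (sg ?J (q, s)) (E m (q, s) (W (?J - {(q, s)})))))"
    by (rule A(6)) (use J r q in "auto intro!: reg_ops(5) E_reg")
   thus ?thesis unfolding gd_def slice_put(2)[OF q(1)] by simp
  qed
  also have "... = 0" using W(2) put_vars[OF J t lu] lett_0[OF t l] by (simp add: gc_def)
  finally show ?thesis .
 qed qed

end

lemma lpart_cf: assumes "W : LF (length ns)" "mdeg ns W" "t < length ns" "ns ! t = 1" "l : letters"
  and "!!q. q < length ns ==> q ~= t ==> gc (length ns) q W"
 shows "lpart (length ns) t l W : cf E ns" unfolding cf_gc
  by (metis lpart_gc_same assms lpart_gc_other lpart_log_forms lpart_multidegree)

lemma degree_one_slice: assumes "mdeg ns W" "t < length ns" "ns ! t = 1" "W J ~= 0"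
 shows "EX k. slice t J = {k}"
  using assms by (force simp: card_1_singleton_iff has_multidegree_def slice_def)

lemma lpart_upper_sum: assumes W: "W : LF m" and t: "t < m" and J: "J <= vs m" "slice t J = {k}"
 shows "rho m (upper t k) (SUM l:letters. lpart m t l W J) = rho m (upper t k) (W J)"
proof -
 have "(t, k) : J" using J(2) by auto
 hence "k < u" using J(1) by auto
 have "rho m (upper t k) (SUM l:letters. lpart m t l W J)
   = rho m (upper t k) (SUM l:letters. lett m t l k ((%s. W (put t J s)) (fst l)))"
  using lpart_at[OF J] by simp
 also have "... = rho m (upper t k) (W (put t J k))"
  by (rule lett_upper_sum[OF t \<open>k < u\<close>]) (rule lfD(1)[OF W])
 finally show ?thesis using put_slice[OF J(2)] by simp
qed

text \<open>Both sides are closed and have the same symbol in the group \<open>t\<close> by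
  \<open>lpart_upper_sum\<close>, so \<open>zero_symbol\<close> applies to the difference.\<close>

lemma lpart_sum: assumes w: "W : cf E ns" and t: "t < length ns" "ns ! t = 1"
 shows "(SUM l:letters. lpart (length ns) t l W) = W"
proof -
 let ?m = "length ns" and ?x = "SUM l:letters. lpart (length ns) t l W"
 have w': "W : LF ?m" "mdeg ns W" using w by (auto simp: cf_def)
 have "lpart ?m t l W : cf E ns" if "l : letters" for l
  by (rule lpart_cf[OF w' t that]) (use w in "simp add: cf_gc")
 hence x: "?x : cf E ns" by (rule acD(6)[OF cf_closed[OF frame_E]])
 hence d: "?x - W : cf E ns" using w acD(4)[OF cf_closed[OF frame_E]] by blast
 hence d': "?x - W : LF ?m" "mdeg ns (?x - W)" "gc ?m t (?x - W)"
  using t by (auto simp: cf_gc)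
 have "?x - W = 0"
 proof (rule zero_symbol[OF t(1) d'(1,3)])
  fix J assume J: "J <= vs ?m" "slice t J ~= {}"
  show "rho ?m (upper t (Max (slice t J))) ((?x - W) J) = 0"
  proof (cases "(?x - W) J = 0")
   case False then obtain k where k: "slice t J = {k}" using degree_one_slice[OF d'(2) t] by blast
   have s: "?x J = (SUM l:letters. lpart ?m t l W J)" by (induction rule: infinite_finite_induct) simp_all
   have "?x J : reg ?m" using x lfD(1) by (auto simp: cf_def)
   thus ?thesis
    using k lpart_upper_sum[OF w'(1) t(1) J(1) k] rho_ops(4)[OF _ lfD(1)[OF w'(1)]] s by simp
  qed (simp add: rho_ops(2))
 next fix J assume "slice t J = {}"
  thus "(?x - W) J = 0" using degree_one_slice[OF d'(2) t, of J] by auto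
 qed
 thus ?thesis by simp
qed

text \<open>Conditions, additive in \<open>f\<close>, that hold for the coefficient at
  \<open>k\<close> of a form with the letter \<open>l\<close>. They can be checked without knowing
  the function from which the letter is built.\<close>

definition lett_typ :: "nat => nat => nat * bool => nat => 'f => bool" where
 "lett_typ m t l k f <-> (if ~ snd l then (k ~= fst l --> f = 0) & rho m (grp t) f = f
   else (fst l < k --> f = 0) & (k = fst l --> rho m (upper t k) f = f & rho m (grp t) f = 0)
    & (k < fst l --> rho m (base t (fst l)) f = 0))"

lemma lett_typ_0 [simp]: "lett_typ m t l k 0" by (simp add: lett_typ_def rho_ops(2))

lemma lett_typ_add: "f : reg m ==> g : reg m ==> lett_typ m t l k f ==> lett_typ m t l k g ==> lett_typ m t l k (f + g)"
 unfolding lett_typ_def using rho_ops(1)[of f m g] by auto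

lemma lett_typ_uminus: "f : reg m ==> lett_typ m t l k f ==> lett_typ m t l k (- f)"
 unfolding lett_typ_def using rho_ops(3)[of f m] by auto

lemma lett_typ_lett: "t < m ==> l : letters ==> f : reg m ==> lett_typ m t l k (lett m t l k f)"
 unfolding lett_typ_def
 using lett_False lett_False_grp[of t m l f k] lett_greater[of t m l k f] lett_True_same[of t m l f] lett_base[of t m l k f] by auto

definition has_letter :: "nat => nat => nat * bool => 'f form => bool" where
 "has_letter m t l W <-> (ALL J k. slice t J = {k} --> lett_typ m t l k (W J))"

text \<open>At the index of \<open>l\<close>, a coefficient of type \<open>l'\<close> is zero, or is
  constant where \<open>l\<close> reads the nonconstant part, or vanishes at the origin of the group
  where \<open>l\<close> reads the constant part, or vanishes on the zero set of
  \<open>upper\<close>.\<close>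

lemma lett_orthogonal:
 assumes t: "t < m" and l: "l : letters" "l' : letters" "l ~= l'" and f: "f : reg m" "lett_typ m t l' (fst l) f"
 shows "lett m t l k f = 0"
proof (cases "snd l'")
 case False
 hence c: "fst l ~= fst l' --> f = 0" "rho m (grp t) f = f" using f(2) by (auto simp: lett_typ_def)
 show ?thesis using l False lett_const t f c lett_0 prod_eq_iff by blast
next case True
 hence c: "fst l' < fst l --> f = 0" "fst l = fst l' --> rho m (grp t) f = 0" "fst l < fst l' --> rho m (base t (fst l')) f = 0"
  using f(2) by (auto simp: lett_typ_def)
 consider "fst l' < fst l" | "fst l = fst l'" | "fst l < fst l'" by linarith
 thus ?thesis
 proof cases
  case 2 hence "~ snd l" using l(3) True by (auto simp: prod_eq_iff)
  thus ?thesis using c(2) 2 by (simp add: lett_def)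
 next case 3 have "base t (fst l') <= upper t (fst l)"
   by (rule base_upper[OF 3]) (use l(2) True in "auto simp: letters_def")
  hence "rho m (upper t (fst l)) f = 0" by (rule rho_mono_zero[OF t f(1) c(3)[rule_format, OF 3]])
  thus ?thesis by (rule lett_zero[OF t l(1) f(1)])
 qed (use c(1) lett_0[OF t l(1)] in simp)
qed

lemma lpart_orthogonal:
 assumes "t < m" "l : letters" "l' : letters" "l ~= l'" "W : LF m" "has_letter m t l' W"
 shows "lpart m t l W = 0"
proof
 fix J
 have "lett_typ m t l' (fst l) (W (put t J (fst l)))" using assms(6) slice_put(1) unfolding has_letter_def by blast
 thus "lpart m t l W J = 0 J"
  using lett_orthogonal[OF assms(1-4) lfD(1)[OF assms(5)]] by (simp add: lpart_def)
qed

lemma lpart_same: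
 assumes w: "W : cf E ns" and t: "t < length ns" "ns ! t = 1" and l: "l : letters" "has_letter (length ns) t l W"
 shows "lpart (length ns) t l W = W"
proof -
 have wl: "W : LF (length ns)" using w by (simp add: cf_def)
 have "W = (SUM l':letters. lpart (length ns) t l' W)" using lpart_sum[OF w t] by simp
 also have "... = (SUM l':letters. if l' = l then lpart (length ns) t l W else 0)"
  by (rule sum.cong[OF refl]) (use lpart_orthogonal[OF t(1) _ l(1) _ wl l(2)] in auto)
 finally show ?thesis using l(1) by simp
qed

lemma has_letter_part: "t < m ==> l : letters ==> W : LF m ==> has_letter m t l (lpart m t l W)"
 unfolding has_letter_def lpart_def using lett_typ_lett lfD(1) by auto

lemma has_letter_part_other:
 assumes t: "t ~= t'" "t' < m" and l: "l' : letters" and W: "W : LF m" "has_letter m t l W"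
 shows "has_letter m t l (lpart m t' l' W)" unfolding has_letter_def
proof (intro allI impI)
 fix J k assume k: "slice t J = {k}"
 show "lett_typ m t l k (lpart m t' l' W J)"
 proof (cases "lpart m t' l' W J = 0")
  case False
  then obtain k' where J: "J <= vs m" "slice t' J = {k'}" using lpart_nonzero[of m t' l' W J] by auto
  define f where "f = W (put t' J (fst l'))"
  have f: "f : reg m" unfolding f_def by (rule lfD(1)[OF W(1)])
  have "slice t (put t' J (fst l')) = {k}" using k t(1) by simp
  hence ty: "lett_typ m t l k f" using W(2) unfolding f_def has_letter_def by blast
  have c: "rho m A (lett m t' l' k' f) = lett m t' l' k' (rho m A f)" if "A <= grp t" for A
   by (rule lett_rho[OF t(2) l f]) (use that t(1) in auto)
  have U: "upper t s <= grp t" for s by (auto simp: upper_def)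
  show ?thesis unfolding lpart_at[OF J] f_def[symmetric]
   using ty lett_0[OF t(2) l] c[OF order_refl] c[OF U] c[OF base_grp] unfolding lett_typ_def by auto
 qed simp
qed

end

section \<open>Splitting the greatest index off a group of variables\<close>

definition good :: "nat => nat => (nat * nat) set => bool" where
 "good t k J <-> slice (Suc t) J = {k} & slice t J <= {..<k}"

definition split_at :: "nat => nat => nat * nat => nat * nat" where
 "split_at t k p = (if fst p < t | fst p = t & snd p < k then p else (Suc (fst p), snd p))"

text \<open>The index in the factor \<open>t + 1\<close> exceeds all those in the factor
  \<open>t\<close>, so identifying the two factors keeps the lexicographic order. Hence no signs
  arise on good index sets.\<close>

lemma good_order: assumes g: "good t k J" and p: "p : J" "q : J"
 shows "lex_less (move (diag t) p) (move (diag t) q) <-> lex_less p q"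
proof -
 obtain a r b s where e: "p = (a, r)" "q = (b, s)" by (cases p, cases q)
 have 1: "c = Suc t ==> (c, r) : J ==> r = k" and 2: "c = t ==> (c, r) : J ==> r < k" for c r
  using g unfolding good_def by auto
 have "a = Suc t ==> r = k" "a = t ==> r < k" "b = Suc t ==> s = k" "b = t ==> s < k"
  using 1 2 p unfolding e by blast+
 moreover have "diag t a < diag t b <-> a < b & ~ (a = t & b = Suc t)"
  "diag t a = diag t b <-> a = b | a = t & b = Suc t | a = Suc t & b = t" by (auto simp: diag_def)
 ultimately show ?thesis unfolding e by (auto simp: lex_less_def)
qed

lemma good_inj: assumes "good t k J" shows "inj_on (move (diag t)) J"
proof (rule inj_onI, rule ccontr)
 fix p q assume p: "p : J" "q : J" "move (diag t) p = move (diag t) q" "p ~= q"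
 hence "lex_less p q | lex_less q p" using lex_less_total by blast
 thus False using good_order[OF assms p(1,2)] good_order[OF assms p(2,1)] p(3) by simp
qed

lemma good_sg:
 assumes "good t k J" "p : J" shows "sg (move (diag t) ` J) (move (diag t) p) = sg J p"
proof -
 have "{q : move (diag t) ` J. lex_less q (move (diag t) p)} = move (diag t) ` {q : J. lex_less q p}"
  using good_order[OF assms(1) _ assms(2)] by auto
 moreover have "inj_on (move (diag t)) {q : J. lex_less q p}"
  by (rule inj_on_subset[OF good_inj[OF assms(1)]]) auto
 ultimately show ?thesis unfolding sg_def by (simp add: card_image)
qed

lemma move_diag_split: "move (diag t) (split_at t k p) = p"
 by (cases p) (auto simp: split_at_def diag_def)

lemma split_move_diag: assumes "good t k J" "p : J" shows "split_at t k (move (diag t) p) = p"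
proof -
 obtain a r where e: "p = (a, r)" by (cases p)
 have "a = Suc t ==> r = k" "a = t ==> r < k" using assms unfolding good_def e by auto
 thus ?thesis unfolding e by (auto simp: split_at_def diag_def)
qed

lemma good_split: "good t k J ==> split_at t k ` move (diag t) ` J = J"
 using split_move_diag by force

lemma slice_move_diag:
 "slice q (move (diag t) ` J) = (if q < t then slice q J else if q = t then slice t J Un slice (Suc t) J else slice (Suc q) J)"
 by (force simp: diag_def split: if_splits)

lemma split_good: "(t, k) : J ==> slice t J <= {..k} ==> good t k (split_at t k ` J)"
 unfolding good_def by (force simp: split_at_def slice_def)

lemma move_split_image: "move (diag t) ` split_at t k ` J = J"
 by (simp add: image_image move_diag_split)

lemma split_vars: "J <= vars u (m - 1) ==> Suc t < m ==> split_at t k ` J <= vars u m"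
 by (auto simp: split_at_def vars_def)

lemma good_remove: "q ~= t ==> q ~= Suc t ==> good t k (J - {(q, s)}) <-> good t k J"
 unfolding good_def slice_Diff by simp

lemma move_diag_Diff: assumes "good t k J" "p : J"
 shows "move (diag t) ` (J - {p}) = move (diag t) ` J - {move (diag t) p}"
 using inj_on_image_set_diff[OF good_inj[OF assms(1)], of J "{p}"] assms(2) by simp

context log_disk
begin

lemma good_inversions: "good t k J ==> inversions (diag t) J = 0"
 by (rule inversions_mono) (use good_order lex_less_asym in blast)


text \<open>The chain rule sum over the factors mapped to \<open>q\<close> is empty in the first
  case and has one term in the second.\<close>

lemma D_fun_pull_inj: assumes h: "ALL t<m. h t < m'" and q: "q < m'" "s < u" and f: "f : reg m"
 shows "(!!t. t < m ==> h t ~= q) ==> D m' (q, s) (fp m m' h f) = 0"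
  "t < m ==> (!!t'. t' < m ==> h t' = q <-> t' = t) ==>
   D m' (q, s) (fp m m' h f) = fp m m' h (D m (t, s) f)"
proof -
 have vs: "valid_sub u m m' h {}" using h by (simp add: valid_sub_def)
 have e: "D m' (q, s) (fp m m' h f)
   = (SUM p:{p : vs m. p ~: {} & move h p = (q, s)}. sub m m' h {} (D m p f))"
  unfolding sub_pull[OF h f] by (rule D_sub[OF vs _ f]) (use q in simp)
 show "D m' (q, s) (fp m m' h f) = 0" if "!!t. t < m ==> h t ~= q"
 proof -
  have n: "{p : vs m. p ~: {} & move h p = (q, s)} = {}" using that by auto
  show ?thesis unfolding e n by simp
 qed
 show "D m' (q, s) (fp m m' h f) = fp m m' h (D m (t, s) f)"
  if t: "t < m" "!!t'. t' < m ==> h t' = q <-> t' = t"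
 proof -
  have n: "{p : vs m. p ~: {} & move h p = (q, s)} = {(t, s)}" using t q by auto
  show ?thesis unfolding e n using sub_pull[OF h D_reg[OF _ f, of "(t, s)"]] t q by simp
 qed qed

lemma E_fun_pull_inj: assumes h: "ALL t<m. h t < m'" and q: "q < m'" "s < u" and f: "f : reg m"
 shows "(!!t. t < m ==> h t ~= q) ==> E m' (q, s) (fp m m' h f) = 0"
  "t < m ==> (!!t'. t' < m ==> h t' = q <-> t' = t) ==>
   E m' (q, s) (fp m m' h f) = fp m m' h (E m (t, s) f)"
proof -
 have su: "s' < u" if "s' < v" for s' using that v_le by simp
 show "E m' (q, s) (fp m m' h f) = 0" if "!!t. t < m ==> h t ~= q"
  using D_fun_pull_inj(1)[OF h q(1) _ f that] q by (simp add: E_def)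
 assume t: "t < m" and tt: "!!t'. t' < m ==> h t' = q <-> t' = t"
 have "fp m m' h (\<Sum>s<v. D m (t, s) f) = (\<Sum>s<v. fp m m' h (D m (t, s) f))"
  by (rule addD(6)[OF fp_additive[OF h] reg_closed]) (use t su f in "auto intro: D_reg")
 thus "E m' (q, s) (fp m m' h f) = fp m m' h (E m (t, s) f)"
  using D_fun_pull_inj(2)[OF h q(1) _ f t tt] q by (simp add: E_def)
qed

subsection \<open>A section of the quasi-multiplication\<close>

text \<open>
 \<open>sect m t\<close> splits the last factor off the group \<open>t\<close>. It is a right inverse of the merge at the gap
 \<open>t\<close>, and a left inverse on the forms of the words that are normal there.
\<close>

definition lift :: "nat => nat => 'f form => 'f form" where
 "lift m t W J = (if J <= vs m & (EX k. good t k J)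
   then fp (m - 1) m (face t) (W (move (diag t) ` J)) else 0)"

definition sect :: "nat => nat => 'f form => 'f form" where
 "sect m t W = (SUM l:letters. lpart m (Suc t) l (lift m t W))"

context
 fixes ns :: "int list" and t m :: nat assumes t: "Suc t < length ns" "m = length ns"
begin

lemma face_pull: "ALL k<m - 1. face t k < m" by (auto simp: face_def)

lemma lift_good: "J <= vs m ==> good t k J ==>
  lift m t W J = fp (m - 1) m (face t) (W (move (diag t) ` J))" unfolding lift_def by auto

lemma lift_nonzero: "lift m t W J ~= 0 ==> J <= vs m & (EX k. good t k J)"
 unfolding lift_def by (auto split: if_splits)

lemma fun_pull_0: "fp (m - 1) m (face t) 0 = 0"
 by (rule addD(2)[OF fp_additive[OF face_pull] reg_closed])

lemma merge_eq: "length (merge_at t ns) = m - 1"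
 "merge_at t ns ! q = (if q < t then ns ! q else if q = t then ns ! t + ns ! Suc t else ns ! Suc q)" if "q < m - 1" for q
 using t that by (auto simp: merge_at_def nth_append)

lemma lift_log_forms: "W : LF (m - 1) ==> lift m t W : LF m"
 by (rule lfI) (use fp_reg[OF face_pull] lfD(1) reg_ops(1) in "auto simp: lift_def")

lemma lift_multidegree: assumes "mdeg (merge_at t ns) W" "ns ! Suc t = 1"
 shows "mdeg ns (lift m t W)" unfolding has_multidegree_def
proof (intro allI impI)
 fix J q assume ne: "lift m t W J ~= 0" and q: "q < length ns"
 obtain k where J: "J <= vs m" "good t k J" using lift_nonzero[OF ne] by blast
 have len: "length (merge_at t ns) = m - 1" using length_merge t by simp
 have "W (move (diag t) ` J) ~= 0" using ne lift_good[OF J] fun_pull_0 by auto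
 hence d: "int (card (slice q' (move (diag t) ` J))) = merge_at t ns ! q'" if "q' < m - 1" for q'
  using assms(1) that len unfolding has_multidegree_def slice_def by auto
 have g: "slice (Suc t) J = {k}" "slice t J <= {..<k}" using J(2) by (auto simp: good_def)
 have f: "finite (slice t J)" by (rule finite_slice[OF J(1)])
 have kn: "k ~: slice t J" using g(2) by auto
 have "int (card (slice q J)) = ns ! q"
 proof -
  consider "q < t" | "q = t" | "q = Suc t" | "Suc t < q" by linarith
  thus ?thesis
  proof cases
   case 1 thus ?thesis using d[of q] merge_eq(2)[of q] t by (simp add: slice_move_diag)
  next case 2
   have "slice t (move (diag t) ` J) = insert k (slice t J)" using g by (simp add: slice_move_diag)
   thus ?thesis using d[of t] merge_eq(2)[of t] t 2 f kn assms(2) by simp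
  next case 3 thus ?thesis using g assms(2) by simp
  next case 4 then obtain q' where q': "q = Suc q'" "t < q'" by (cases q) auto
   thus ?thesis using d[of q'] merge_eq(2)[of q'] t q by (simp add: slice_move_diag)
  qed qed
 thus "int (card {s. (q, s) : J}) = ns ! q" by (simp add: slice_def)
qed

text \<open>In the group \<open>t\<close> the coefficients are constant, since \<open>face t\<close>
  misses the factor \<open>t\<close>; the other groups are carried over unchanged. In the remaining
  group \<open>Suc t\<close> closedness is obtained by passing to letter parts.\<close>

lemma lift_gc:
 assumes W: "W : LF (m - 1)" "!!q. q < m - 1 ==> gc (m - 1) q W" and q: "q < m" "q ~= Suc t"
 shows "gc m q (lift m t W)" unfolding gc_def
proof (intro allI impI)
 fix J assume J: "J <= vs m"
 note r = lfD(1)[OF W(1)]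
 show "gd m q (lift m t W) J = 0"
 proof (cases "q = t")
  case True have "E m (q, s) (lift m t W (J - {(q, s)})) = 0" if "(q, s) : J" for s
  using that J E_fun_pull_inj face_pull True r by (auto simp: face_def lift_def)
  thus ?thesis unfolding gd_def by simp
 next case False show ?thesis
  proof (cases "EX k. good t k J")
   case False show ?thesis
    by (rule gd_zero[OF J]) (use False \<open>q ~= t\<close> q good_remove[of q t] in "auto simp: lift_def")
  next case True then obtain k where k: "good t k J" by blast
   define q' where "q' = diag t q"
   let ?J = "move (diag t) ` J" and ?fp = "fp (m - 1) m (face t)"
   have q': "q' < m - 1" "face t q' = q" "!!t'. face t t' = q <-> t' = q'"
    using q \<open>q ~= t\<close> t by (auto simp: q'_def diag_def face_def)
   have sl: "slice q ?J = slice q ?J" by simp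
   have slq: "slice q' ?J = slice q J"
    using q \<open>q ~= t\<close> by (auto simp: slice_move_diag q'_def diag_def)
   note A = addD[OF fp_additive[OF face_pull] reg_closed]
   have JV: "?J <= vs (m - 1)" using J diag_into[OF t(1)] t(2) by auto
   have "gd m q (lift m t W) J = (SUM s:slice q J. ?fp (signed (sg ?J (q', s)) (E (m - 1) (q', s) (W (?J - {(q', s)})))))"
    unfolding gd_def
   proof (rule sum.cong[OF refl])
    fix s assume "s : slice q J"
    hence s: "(q, s) : J" "s < u" using J by auto
    have "good t k (J - {(q, s)})" using k good_remove[of q t k J s] q \<open>q ~= t\<close> by simp
    hence "lift m t W (J - {(q, s)}) = ?fp (W (?J - {(q', s)}))"
     using lift_good[of "J - {(q, s)}" k] J move_diag_Diff[OF k s(1)] by (simp add: q'_def Diff_subset[THEN subset_trans])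
    moreover have "E m (q, s) (?fp (W (?J - {(q', s)}))) = ?fp (E (m - 1) (q', s) (W (?J - {(q', s)})))"
     by (rule E_fun_pull_inj(2)[OF face_pull q(1) s(2) r q'(1,3)])
    moreover have "sg ?J (q', s) = sg J (q, s)" using good_sg[OF k s(1)] by (simp add: q'_def)
    moreover have "E (m - 1) (q', s) (W (?J - {(q', s)})) : reg (m - 1)"
     by (rule E_reg[OF _ r]) (use q' s in simp)
    ultimately show "signed (sg J (q, s)) (E m (q, s) (lift m t W (J - {(q, s)})))
     = ?fp (signed (sg ?J (q', s)) (E (m - 1) (q', s) (W (?J - {(q', s)}))))" using A(5) by simp
   qed
   also have "... = ?fp (gd (m - 1) q' W ?J)" unfolding gd_def slq
    by (rule A(6)[symmetric]) (use q' J r in "auto intro!: reg_ops(5) E_reg")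
   also have "... = 0" using W(2)[OF q'(1)] JV fun_pull_0 by (simp add: gc_def)
   finally show ?thesis .
  qed qed qed

lemma lift_lpart_cf: assumes "W : cf E (merge_at t ns)" "ns ! Suc t = 1" "l : letters"
 shows "lpart m (Suc t) l (lift m t W) : cf E ns"
  using length_merge assms lpart_cf lift_log_forms lift_multidegree lift_gc by (auto simp: cf_gc t)

lemma sect_cf: "W : cf E (merge_at t ns) ==> ns ! Suc t = 1 ==> sect m t W : cf E ns"
 unfolding sect_def by (rule acD(6)[OF cf_closed[OF frame_E]]) (rule lift_lpart_cf)

lemma sect_at: "sect m t W J = (SUM l:letters. lpart m (Suc t) l (lift m t W) J)"
 unfolding sect_def by (induction rule: infinite_finite_induct) simp_all

lemma sect_upper: assumes "W : LF (m - 1)" "J <= vs m" "slice (Suc t) J = {k}"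
 shows "rho m (upper (Suc t) k) (sect m t W J) = rho m (upper (Suc t) k) (lift m t W J)"
 unfolding sect_at by (rule lpart_upper_sum[OF lift_log_forms[OF assms(1)] _ assms(2,3)]) (use t in simp)

text \<open>As \<open>M\<close> lies in the group \<open>t\<close>, the lift is zero at the index of
  any letter not above \<open>M\<close>, and the letters above \<open>M\<close> vanish on the zero
  set of \<open>upper\<close> at \<open>M\<close>.\<close>

lemma sect_upper_zero:
 assumes W: "W : LF (m - 1)" and J: "J <= vs m" "slice (Suc t) J = {k}" and M: "M : slice t J" "k <= M"
 shows "rho m (upper (Suc t) M) (sect m t W J) = 0"
proof -
 have T: "Suc t < m" using t by simp
 note L = lift_log_forms[OF W]
 have "rho m (upper (Suc t) M) (lpart m (Suc t) l (lift m t W) J) = 0" if l: "l : letters" for l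
 proof (cases "M < fst l")
  case True
  thus ?thesis unfolding lpart_at[OF J] by (rule lett_upper_zero[OF T l M(2) _ lfD(1)[OF L]])
 next case False
  have "~ good t k' (put (Suc t) J (fst l))" for k' using False M(1) unfolding good_def by auto
  hence "lift m t W (put (Suc t) J (fst l)) = 0" by (simp add: lift_def)
  thus ?thesis unfolding lpart_at[OF J] using lett_0[OF T l] by (simp add: rho_ops(2))
 qed
 moreover have "rho m (upper (Suc t) M) (SUM l:letters. lpart m (Suc t) l (lift m t W) J)
   = (SUM l:letters. rho m (upper (Suc t) M) (lpart m (Suc t) l (lift m t W) J))"
  by (rule rho_ops(6)) (rule lfD(1)[OF lpart_log_forms[OF T _ L]])
 ultimately show ?thesis unfolding sect_at by simp
qed

lemma upper_preimage: "{p. move (diag t) p : upper t M} = upper t M Un upper (Suc t) M"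
 by (auto simp: upper_def diag_def split: if_splits)

lemma rho_pull_diag: assumes "f : reg m" shows "rho (m - 1) (upper t M) (fp m (m - 1) (diag t) f)
   = fp m (m - 1) (diag t) (rho m (upper t M Un upper (Suc t) M) f)"
proof -
 have into: "ALL k<m. diag t k < m - 1" using diag_into[OF t(1)] t(2) by simp
 have vs: "valid_sub u m (m - 1) (diag t) {}" using into by (simp add: valid_sub_def)
 show ?thesis unfolding sub_pull[OF into assms] sub_pull[OF into rho_reg[OF assms]]
   rho_sub[OF vs assms] sub_rho[OF vs assms] upper_preimage by auto
qed

lemma pull_face_diag:
 assumes "f : reg (m - 1)" shows "fp m (m - 1) (diag t) (fp (m - 1) m (face t) f) = f"
proof -
 have into: "ALL k<m. diag t k < m - 1" using diag_into[OF t(1)] t(2) by simp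
 have "fp m (m - 1) (diag t) (fp (m - 1) m (face t) f) = sub (m - 1) (m - 1) (diag t o face t) {} f"
  using sub_sub[of "m - 1" m "face t" "{}" "m - 1" "diag t" "{}" f] assms face_pull into
   sub_pull[OF face_pull assms] sub_pull[OF into fp_reg[OF face_pull assms]] by (simp add: valid_sub_def)
 also have "... = sub (m - 1) (m - 1) (%k. k) {} f"
  by (rule sub_cong[OF assms]) (auto simp: diag_def face_def)
 finally show ?thesis using sub_id[OF assms] by simp
qed

lemma pull_diag_face: assumes f: "f : reg m" and c: "rho m (grp t) f = f"
 shows "fp (m - 1) m (face t) (fp m (m - 1) (diag t) f) = f"
proof -
 have into: "ALL k<m. diag t k < m - 1" using diag_into[OF t(1)] t(2) by simp
 have "fp (m - 1) m (face t) (fp m (m - 1) (diag t) f) = sub m m (face t o diag t) {} f"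
  using sub_sub[of m "m - 1" "diag t" "{}" m "face t" "{}" f] f face_pull into
   sub_pull[OF into f] sub_pull[OF face_pull fp_reg[OF into f]] by (simp add: valid_sub_def)
 also have "... = sub m m (face t o diag t) {} (rho m (grp t) f)" using c by simp
 also have "... = sub m m (face t o diag t) (grp t) f"
  using sub_rho[of m m "face t o diag t" "{}" f "grp t"] f face_pull into by (simp add: valid_sub_def)
 also have "... = sub m m (%k. k) (grp t) f" by (rule sub_cong[OF f]) (auto simp: diag_def face_def)
 finally show ?thesis using c by (simp add: rho_def)
qed

text \<open>The merge is injective on \<open>I\<close>, which keeps \<open>k\<close> out of the
  group \<open>t\<close>; the other indices there are then smaller than \<open>k\<close>.\<close>

lemma fibre_good:
 assumes I: "I : fibre u m (diag t) J" and k: "slice (Suc t) I = {k}" and J: "slice t J <= {..k}"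
 shows "good t k I & I = split_at t k ` J"
proof -
 have "slice t I <= {..<k}"
 proof
  fix s assume s: "s : slice t I"
  have IJ: "inj_on (move (diag t)) I" "move (diag t) ` I = J" using I by (auto simp: fibre_def)
  have "(Suc t, k) : I" using k by auto
  hence "s ~= k" using inj_onD[OF IJ(1), of "(t, s)" "(Suc t, k)"] s by (auto simp: diag_def)
  moreover have "s : slice t J" using s IJ(2) slice_move_diag[of t t I] by auto
  ultimately show "s : {..<k}" using J by force
 qed
 hence "good t k I" using k by (simp add: good_def)
 thus ?thesis using good_split[of t k I] I by (auto simp: fibre_def)
qed

text \<open>Both sides are closed, so it suffices to compare symbols in the group \<open>t\<close>.
  At an index set with the greatest index \<open>M\<close> only the preimage with \<open>M\<close>
  split off contributes; in any other preimage \<open>M\<close> stays in the group \<open>t\<close>,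
  and \<open>sect_upper_zero\<close> applies.\<close>

lemma sect_right_inverse:
 assumes w: "W : cf E (merge_at t ns)" and d: "ns ! Suc t = 1" "0 <= ns ! t"
 shows "FP m (m - 1) (diag t) (sect m t W) = W"
proof -
 let ?mu0 = "FP m (m - 1) (diag t) (sect m t W)"
 have len: "length (merge_at t ns) = m - 1" using length_merge t by simp
 have into: "ALL k<m. diag t k < m - 1" using diag_into[OF t(1)] t(2) by simp
 have wl: "W : LF (m - 1)" using w by (simp add: cf_def len)
 note sc = sect_cf[OF w d(1)]
 hence sl: "sect m t W : LF m" "mdeg ns (sect m t W)" using t by (auto simp: cf_def)
 have "?mu0 : cf E (merge_at t ns)"
  using form_pull_cf_E[of ns "diag t" "merge_at t ns" "sect m t W"] into sc merge_at_nth[OF t(1)] len t(2) by simp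
 hence "?mu0 - W : cf E (merge_at t ns)" using w acD(4)[OF cf_closed[OF frame_E]] by blast
 hence D: "?mu0 - W : LF (m - 1)" "mdeg (merge_at t ns) (?mu0 - W)" "gc (m - 1) t (?mu0 - W)"
  using t by (auto simp: cf_gc len)
 have mr: "?mu0 J : reg (m - 1)" for J by (rule lfD(1)[OF FP_LF[OF into sl(1)]])
 have "?mu0 - W = 0"
 proof (rule zero_symbol[OF _ D(1,3)])
  show "t < m - 1" using t by simp
  show "(?mu0 - W) J = 0" if "slice t J = {}" for J
  proof (rule ccontr)
   assume "(?mu0 - W) J ~= 0"
   hence "int (card (slice t J)) = merge_at t ns ! t"
    using D(2) t len unfolding has_multidegree_def slice_def by auto
   thus False using that merge_eq(2)[of t] t d by simp
  qed
  fix J assume J: "J <= vs (m - 1)" "slice t J ~= {}"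
  define M where "M = Max (slice t J)"
  have M: "(t, M) : J" "slice t J <= {..M}"
   using Max_in[OF finite_slice[OF J(1)] J(2)] Max_ge[OF finite_slice[OF J(1)]] by (auto simp: M_def)
  let ?I = "split_at t M ` J" and ?f = "%I. rho (m - 1) (upper t M) (signed (inversions (diag t) I) (fp m (m - 1) (diag t) (sect m t W I)))"
  have I: "good t M ?I" "move (diag t) ` ?I = J" "?I <= vs m"
   using split_good[OF M] move_split_image split_vars[OF J(1)] t by auto
  have fI: "?I : fibre u m (diag t) J" using I good_inj[OF I(1)] by (simp add: fibre_def)
  note sr = lfD(1)[OF sl(1)]
  have pr: "fp m (m - 1) (diag t) (sect m t W I) : reg (m - 1)" for I by (rule fp_reg[OF into sr])
  have up: "rho m (upper t M Un upper (Suc t) M) f = rho m (upper t M) (rho m (upper (Suc t) M) f)" if "f : reg m" for f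
   using rho_rho[OF that] by simp
  have p0: "fp m (m - 1) (diag t) 0 = 0"
   by (rule addD(2)[OF fp_additive[OF into] reg_closed])
  have z: "?f K = 0" if K: "K : fibre u m (diag t) J" "K ~= ?I" for K
  proof (cases "sect m t W K = 0")
   case False
   then obtain k where k: "slice (Suc t) K = {k}" using degree_one_slice[OF sl(2) t(1) d(1)] by blast
   have KV: "K <= vs m" "move (diag t) ` K = J" using K(1) by (auto simp: fibre_def)
   have "M : slice t J" using M(1) by simp
   hence "M : slice t K Un slice (Suc t) K" unfolding KV(2)[symmetric] slice_move_diag by simp
   moreover have "k ~= M" using fibre_good[OF K(1) k] M(2) K(2) by blast
   moreover have "k : slice t J" unfolding KV(2)[symmetric] slice_move_diag using k by simp
   hence "k <= M" using subsetD[OF M(2)] by auto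
   ultimately have "rho m (upper (Suc t) M) (sect m t W K) = 0"
    using sect_upper_zero[OF wl KV(1) k] k by auto
   thus ?thesis using rho_ops(5)[OF pr] rho_pull_diag[OF sr] up[OF sr] rho_ops(2) p0 by simp
  qed (simp add: rho_ops(2) p0 del: One_nat_def)
  have "rho (m - 1) (upper t M) (?mu0 J) = (SUM K:fibre u m (diag t) J. ?f K)"
   unfolding FP_pullf pullf_def by (rule rho_ops(6)) (rule reg_ops(5)[OF pr])
  also have "... = ?f ?I" using fI z by (subst sum.remove[OF finite_fibre fI]) simp
  also have "... = fp m (m - 1) (diag t) (rho m (upper t M) (rho m (upper (Suc t) M) (sect m t W ?I)))"
   using good_inversions[OF I(1)] rho_pull_diag[OF sr] up[OF sr] by simp
  also have "rho m (upper (Suc t) M) (sect m t W ?I) = rho m (upper (Suc t) M) (lift m t W ?I)"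
   by (rule sect_upper[OF wl I(3)]) (use I(1) in "simp add: good_def")
  also have "fp m (m - 1) (diag t) (rho m (upper t M) (rho m (upper (Suc t) M) (lift m t W ?I)))
   = rho (m - 1) (upper t M) (fp m (m - 1) (diag t) (lift m t W ?I))"
   using rho_pull_diag up lfD(1)[OF lift_log_forms[OF wl]] by simp
  also have "... = rho (m - 1) (upper t M) (W J)"
   using lift_good[OF I(3,1)] I(2) pull_face_diag[OF lfD(1)[OF wl]] by simp
  finally show "rho (m - 1) (upper t (Max (slice t J))) ((?mu0 - W) J) = 0"
   using rho_ops(4)[OF mr lfD(1)[OF wl]] by (simp add: M_def)
 qed
 thus ?thesis by simp
qed

text \<open>Symbols in the group \<open>Suc t\<close> are compared. On the zero set of
  \<open>upper\<close> at an index \<open>k < fst l\<close> the coefficients of \<open>ze\<close>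
  with index at most \<open>k\<close> vanish, so only preimages with the greatest index split off
  matter; constancy in the group \<open>t\<close> ensures that \<open>face t\<close> recovers their
  coefficients after the merge.\<close>

lemma sect_left_inverse:
 assumes z: "ze : cf E ns" and d: "ns ! Suc t = 1" and l: "l : letters" "has_letter m (Suc t) l ze"
  and c: "!!J. rho m (grp t) (ze J) = ze J" "!!J. ze J ~= 0 ==> slice t J <= {..<fst l}"
 shows "sect m t (FP m (m - 1) (diag t) ze) = ze"
proof -
 let ?W = "FP m (m - 1) (diag t) ze"
 have len: "length (merge_at t ns) = m - 1" using length_merge t by simp
 have T: "Suc t < m" using t by simp
 have into: "ALL k<m. diag t k < m - 1" using diag_into[OF t(1)] t(2) by simp
 have w: "?W : cf E (merge_at t ns)"
  using form_pull_cf_E[of ns "diag t" "merge_at t ns" ze] into z merge_at_nth[OF t(1)] len t(2) by simp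
 hence wl: "?W : LF (m - 1)" by (simp add: cf_def len)
 have zl: "ze : LF m" "mdeg ns ze" using z t by (auto simp: cf_def)
 note zr = lfD(1)[OF zl(1)]
 have "sect m t ?W - ze : cf E ns" using sect_cf[OF w d] z acD(4)[OF cf_closed[OF frame_E]] by blast
 hence D: "sect m t ?W - ze : LF m" "mdeg ns (sect m t ?W - ze)" "gc m (Suc t) (sect m t ?W - ze)"
  using t by (auto simp: cf_gc)
 have sr: "sect m t ?W J : reg m" for J using sect_cf[OF w d] lfD(1) t by (auto simp: cf_def)
 have small: "rho m (upper (Suc t) k) (ze J) = 0" if J: "slice (Suc t) J = {k'}" "k' <= k" "k < fst l" for J k k'
 proof (cases "snd l")
  case False hence "ze J = 0" using l(2) J unfolding has_letter_def lett_typ_def by auto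
  thus ?thesis by (simp add: rho_ops(2))
 next case True hence "rho m (base (Suc t) (fst l)) (ze J) = 0"
   using l(2) J unfolding has_letter_def lett_typ_def by auto
  moreover have "base (Suc t) (fst l) <= upper (Suc t) k"
   by (rule base_upper[OF J(3)]) (use l(1) True in "auto simp: letters_def")
  ultimately show ?thesis by (rule rho_mono_zero[OF T zr])
 qed
 have key: "rho m (upper (Suc t) k) (lift m t ?W J) = rho m (upper (Suc t) k) (ze J)"
  if J: "J <= vs m" "slice (Suc t) J = {k}" for J k
 proof (cases "good t k J")
  case False hence "lift m t ?W J = 0" unfolding lift_def using J(2) by (auto simp: good_def)
  moreover have "rho m (upper (Suc t) k) (ze J) = 0"
  proof (cases "ze J = 0")
   case nz: False obtain s where "s : slice t J" "k <= s" using False J(2) by (force simp: good_def)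
   hence "k < fst l" using c(2)[OF nz] by auto
   thus ?thesis using small[OF J(2)] by simp
  qed (simp add: rho_ops(2))
  ultimately show ?thesis by (simp add: rho_ops(2))
 next case True let ?J = "move (diag t) ` J"
  let ?f = "%I. rho m (upper (Suc t) k) (signed (inversions (diag t) I) (ze I))"
  note A = addD[OF fp_additive[OF face_pull] reg_closed]
  have pr: "fp m (m - 1) (diag t) (ze I) : reg (m - 1)" for I by (rule fp_reg[OF into zr])
  have "lift m t ?W J = (SUM I:fibre u m (diag t) ?J. signed (inversions (diag t) I) (ze I))"
   unfolding lift_good[OF J(1) True] FP_pullf pullf_def
   using A(6)[of "fibre u m (diag t) ?J"] A(5)[OF pr] reg_ops(5)[OF pr] pull_diag_face[OF zr c(1)] by simp
  hence "rho m (upper (Suc t) k) (lift m t ?W J) = (SUM I:fibre u m (diag t) ?J. ?f I)"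
   using rho_ops(6)[of "fibre u m (diag t) ?J" "%I. signed (inversions (diag t) I) (ze I)" m] reg_ops(5)[OF zr] by simp
  also have "... = ?f J"
  proof -
   have fJ: "J : fibre u m (diag t) ?J" using J(1) good_inj[OF True] by (simp add: fibre_def)
   have "?f I = 0" if I: "I : fibre u m (diag t) ?J" "I ~= J" for I
   proof (cases "ze I = 0")
    case False
    then obtain k' where k': "slice (Suc t) I = {k'}" using degree_one_slice[OF zl(2) t(1) d] by blast
    have IJ: "move (diag t) ` I = ?J" using I(1) by (auto simp: fibre_def)
    have sJ: "slice t ?J <= {..k}" "k : slice t ?J"
     using True unfolding good_def by (auto simp: slice_move_diag)
    have "k' ~= k" using fibre_good[OF I(1) k'] sJ(1) good_split[OF True] I(2) by auto
    moreover have "k' : slice t ?J" unfolding IJ[symmetric] slice_move_diag using k' by simp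
    hence "k' <= k" using subsetD[OF sJ(1)] by auto
    moreover have "k : slice t I Un slice (Suc t) I" using sJ(2) unfolding IJ[symmetric] slice_move_diag by simp
    ultimately have "k < fst l" "k' <= k" using k' c(2)[OF False] by auto
    thus ?thesis using small[OF k'] rho_ops(5)[OF zr] by simp
   qed (simp add: rho_ops(2))
   thus ?thesis by (subst sum.remove[OF finite_fibre fJ]) simp
  qed
  also have "... = rho m (upper (Suc t) k) (ze J)" using good_inversions[OF True] by simp
  finally show ?thesis .
 qed
 have "sect m t ?W - ze = 0"
 proof (rule zero_symbol[OF T D(1,3)])
  fix J assume J: "J <= vs m" "slice (Suc t) J ~= {}"
  show "rho m (upper (Suc t) (Max (slice (Suc t) J))) ((sect m t ?W - ze) J) = 0"
  proof (cases "(sect m t ?W - ze) J = 0")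
   case False
   then obtain k where k: "slice (Suc t) J = {k}" using degree_one_slice[OF D(2) t(1) d] by blast
   thus ?thesis using sect_upper[OF wl J(1) k] key[OF J(1) k] rho_ops(4)[OF sr zr] by simp
  qed (simp add: rho_ops(2))
 next show "(sect m t ?W - ze) J = 0" if "slice (Suc t) J = {}" for J
   using degree_one_slice[OF D(2) t(1) d, of J] that by auto
 qed
 thus ?thesis by simp
qed

end

end

section \<open>Units, partially merged words and pull-backs of letters\<close>

lemma parts_empty: "parts n {} = replicate n 1"
proof (induction n "{} :: nat set" rule: parts.induct)
 case (3 n)
 thus ?case by (simp add: replicate_append_same[symmetric])
qed auto

lemma pos_empty [simp]: "pos {} g = g" by (simp add: pos_def)

lemma pos_into: "t < n ==> pos S t < length (parts n S)"
proof -
 assume t: "t < n"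
 then obtain k where k: "n = Suc k" by (cases n) auto
 thus ?thesis using t pos_mono[of t k S] length_parts[of k S] by simp
qed

lemma diag_pos: "g ~: S ==> diag (pos S g) (pos S t) = pos (insert g S) t"
proof (cases "t <= g")
 case True assume "g ~: S"
 thus ?thesis using pos_mono[OF True, of S] pos_insert_ge[OF True, of S] by (simp add: diag_def)
next case False assume g: "g ~: S"
 have "pos S (Suc g) <= pos S t" using False by (intro pos_mono) simp
 hence "pos S g < pos S t" using g by (simp add: pos_Suc)
 thus ?thesis using pos_insert_less[of g t S] False g by (simp add: diag_def)
qed

text \<open>No gap from \<open>g\<close> on is filled, so the unit after \<open>g\<close> is still
  an entry by itself; this is the degree 1 that \<open>sect\<close> requires.\<close>

lemma parts_unit:
 assumes S: "!!h. g <= h ==> h ~: S" and g: "Suc g < n" shows "parts n S ! Suc (pos S g) = 1"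
proof -
 have "g <= k ==> parts (Suc (Suc k)) S ! Suc (pos S g) = 1" for k
 proof (induction k)
  case 0 thus ?case using S[of 0] by simp
 next case (Suc k)
  show ?case
  proof (cases "g = Suc k")
   case True
   thus ?thesis using S[of "Suc k"] length_parts[of "Suc k" S] by (simp add: nth_append del: parts.simps) (simp add: nth_append length_parts)
  next case False hence "g <= k" using Suc.prems by simp
   moreover have "Suc (pos S g) < length (parts (Suc (Suc k)) S)"
    by (rule Suc_pos_length) (use S[of g] \<open>g <= k\<close> in auto)
   moreover have "parts (Suc (Suc (Suc k))) S = parts (Suc (Suc k)) S @ [1]" using S[of "Suc k"] Suc.prems by simp
   ultimately show ?thesis using Suc.IH by (simp add: nth_append)
  qed qed
 moreover obtain k where "n = Suc (Suc k)" "g <= k" using g by (cases n; cases "n - 1") auto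
 ultimately show ?thesis by simp
qed

lemma pos_beyond:
 assumes "!!h. g <= h ==> h ~: S" "g <= h" shows "pos S h = pos S g + (h - g)" using assms(2)
proof (induction h rule: dec_induct)
 case (step h)
 thus ?case using assms(1)[of h] by (simp add: pos_Suc)
qed simp

lemma pos_eq_between: assumes "pos S h = pos S g" "h <= k" "k < g" shows "k : S"
proof (rule ccontr)
 assume "k ~: S"
 hence "pos S k < pos S (Suc k)" by (simp add: pos_Suc)
 moreover have "pos S h <= pos S k" by (rule pos_mono) (use assms in simp)
 moreover have "pos S (Suc k) <= pos S g" by (rule pos_mono) (use assms in simp)
 ultimately show False using assms(1) by simp
qed

context log_disk
begin

lemma rho_fun_pull: assumes pp: "ALL t<m. pp t < m'" and f: "f : reg m"
 shows "rho m' B (fp m m' pp f) = fp m m' pp (rho m {p. move pp p : B} f)"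
proof -
 have vs: "valid_sub u m m' pp {}" using pp by (simp add: valid_sub_def)
 show ?thesis
  unfolding sub_pull[OF pp f] sub_pull[OF pp rho_reg[OF f]] rho_sub[OF vs f] sub_rho[OF vs f] by simp
qed

lemma rho_fun_pull_grp: assumes pp: "ALL t<m. pp t < m'" and f: "f : reg m" and A: "A <= UNIV"
  and t: "!!h. h < m ==> pp h = t' <-> h = t"
 shows "rho m' ({t'} \<times> A) (fp m m' pp f) = fp m m' pp (rho m ({t} \<times> A) f)"
proof -
 have "rho m {p. move pp p : {t'} \<times> A} f = rho m ({t} \<times> A) f"
  using f t by (auto intro!: rho_cong)
 thus ?thesis using rho_fun_pull[OF pp f] by simp
qed

lemma lett_typ_pull:
 assumes pp: "ALL t<m. pp t < m'" and f: "f : reg m" and t: "!!h. h < m ==> pp h = t' <-> h = t"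
  and ty: "lett_typ m t l k f" shows "lett_typ m' t' l k (fp m m' pp f)"
proof -
 have "EX A. upper t s = {t} \<times> A & upper t' s = {t'} \<times> A" for s by (auto simp: upper_def)
 hence U: "rho m' (upper t' s) (fp m m' pp f) = fp m m' pp (rho m (upper t s) f)" for s
  using rho_fun_pull_grp[OF pp f _ t] by (metis subset_UNIV)
 have "EX A. base t s = {t} \<times> A & base t' s = {t'} \<times> A" for s by (auto simp: base_def)
 hence B: "rho m' (base t' s) (fp m m' pp f) = fp m m' pp (rho m (base t s) f)" for s
  using rho_fun_pull_grp[OF pp f _ t] by (metis subset_UNIV)
 have G: "rho m' (grp t') (fp m m' pp f) = fp m m' pp (rho m (grp t) f)"
  by (rule rho_fun_pull_grp[OF pp f subset_UNIV t])
 have Z: "fp m m' pp 0 = 0" by (rule addD(2)[OF fp_additive[OF pp] reg_closed])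
 show ?thesis using ty unfolding lett_typ_def U B G by (auto simp: Z)
qed

lemma lett_typ_closed: "add_closed {f : reg m. lett_typ m t l k f}"
 unfolding add_closed_def using lett_typ_add lett_typ_uminus reg_ops(1-3) by auto

text \<open>Only the factor \<open>t\<close> is sent to \<open>t'\<close>, so the indices of this
  group are the same before and after, and restrictions in it commute with the pull-back.\<close>

lemma has_letter_pull:
 assumes pp: "ALL t<m. pp t < m'" and W: "W : LF m" "has_letter m t l W" and t: "t < m" "!!h. h < m ==> pp h = t' <-> h = t"
 shows "has_letter m' t' l (FP m m' pp W)" unfolding has_letter_def
proof (intro allI impI)
 fix J k assume k: "slice t' J = {k}"
 note C = acD[OF lett_typ_closed[of m' t' l k]]
 note r = lfD(1)[OF W(1)]
 have "signed (inversions pp I) (fp m m' pp (W I)) : {f : reg m'. lett_typ m' t' l k f}" if I: "I : fibre u m pp J" for I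
 proof -
  have IJ: "I <= vs m" "move pp ` I = J" using I by (auto simp: fibre_def)
  have "slice t I = slice t' J"
  proof (intro set_eqI iffI)
   fix s assume "s : slice t I"
   hence "move pp (t, s) : J" using IJ(2) imageI[of "(t, s)" I "move pp"] by simp
   thus "s : slice t' J" using t(2)[OF t(1)] by simp
  next fix s assume "s : slice t' J"
   then obtain h where "(h, s) : I" "pp h = t'" using IJ(2) by auto
   thus "s : slice t I" using t(2)[of h] IJ(1) by auto
  qed
  hence "lett_typ m t l k (W I)" using W(2) k unfolding has_letter_def by simp
  thus ?thesis using lett_typ_pull[OF pp r t(2)] fp_reg[OF pp r] by (intro C(5)) simp
 qed
 hence "FP m m' pp W J : {f : reg m'. lett_typ m' t' l k f}"
  unfolding FP_pullf pullf_def by (rule C(6))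
 thus "lett_typ m' t' l k (FP m m' pp W J)" by simp
qed

subsection \<open>Words\<close>

definition words :: "nat => (nat * bool) list set" where
 "words n = {ta. set ta <= letters & length ta = n}"

definition word_forms :: "nat => (nat * bool) list => 'f form set" where
 "word_forms n ta = {W : cf E (parts n {}). ALL t<n. has_letter n t (ta ! t) W}"

text \<open>With a constant left letter of smaller index, the right letter carries the greatest
  index of the product, at which \<open>sect\<close> splits it again.\<close>

definition normal_gaps :: "nat => (nat * bool) list => nat set" where
 "normal_gaps n ta = {g. Suc g < n & ~ snd (ta ! g) & fst (ta ! g) < fst (ta ! Suc g)}"

text \<open>
 A pair that is not normal is rewritten as the section of its merge; its expansion in the letters
 has only words of smaller weight.
\<close>

definition key :: "nat * bool => nat" where
 "key l = (if snd l then u else fst l)"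

text \<open>The larger factors on the left make the weight drop when two constant letters are
  swapped into increasing order; the value \<open>u\<close> of \<open>key\<close> places nonconstant
  letters above all constant ones.\<close>

definition weight :: "nat => (nat * bool) list => nat" where
 "weight n ta = (\<Sum>t<n. (n - t) * key (ta ! t))"

definition merge_all :: "nat => nat set => 'f form => 'f form" where
 "merge_all n S = FP n (length (parts n S)) (pos S)"

lemma finite_words [simp]: "finite (words n)"
 unfolding words_def by (rule finite_lists_length_eq) simp

lemma words_nth: "ta : words n ==> t < n ==> ta ! t : letters"
 unfolding words_def using nth_mem by auto

lemma parts_0_nth [simp]: "t < n ==> parts n {} ! t = 1" "length (parts n {}) = n"
 by (simp_all add: parts_empty)

lemma cf_log: "W : cf E ns ==> length ns = m ==> W : LF m" by (auto simp: cf_def)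

lemma cf_degree: "W : cf E ns ==> mdeg ns W" by (auto simp: cf_def)

lemma merge_empty: "W : cf E (parts n {}) ==> merge_all n {} W = W"
 unfolding merge_all_def using form_pull_id[OF cf_log[of W "parts n {}" n], of "pos {}"] by simp

lemma has_letter_closed: "add_closed {W : LF m. has_letter m t l W}"
  using lett_typ_add lfD lett_typ_uminus acD log_forms_closed by (auto simp: has_letter_def add_closed_def)

lemma add_closed_Int: "add_closed A ==> add_closed B ==> add_closed (A Int B)"
 by (simp add: add_closed_def)

lemma add_closed_INT: "(!!i. add_closed (A i)) ==> add_closed (INT i:I. A i)"
 by (simp add: add_closed_def)

lemma word_forms_closed: "add_closed (word_forms n ta)"
proof -
 have e: "word_forms n ta = cf E (parts n {}) Int (INT t:{..<n}. {W : LF n. has_letter n t (ta ! t) W})"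
  unfolding word_forms_def using cf_log[of _ "parts n {}" n] by auto
 show ?thesis unfolding e
  by (rule add_closed_Int[OF cf_closed[OF frame_E] add_closed_INT]) (rule has_letter_closed)
qed

text \<open>The letters are split off group by group, and \<open>has_letter_part_other\<close>
  preserves those already obtained.\<close>

lemma decompose_words: assumes w: "w : cf E (parts n {})" and "k <= n"
 shows "EX y. (ALL ta:words k. y ta : cf E (parts n {}) & (ALL t<k. has_letter n t (ta ! t) (y ta))) & w = (SUM ta:words k. y ta)"
 using assms(2)
proof (induction k)
 case 0 have "words 0 = {[]}" by (auto simp: words_def)
 thus ?case using w by (intro exI[of _ "%_. w"]) simp
next case (Suc k)
 then obtain y where y: "ALL ta:words k. y ta : cf E (parts n {}) & (ALL t<k. has_letter n t (ta ! t) (y ta))"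
  and ws: "w = (SUM ta:words k. y ta)" by auto
 let ?y = "%ta. lpart n k (last ta) (y (butlast ta))"
 have bij: "bij_betw (%(ta, l). ta @ [l]) (words k \<times> letters) (words (Suc k))"
  unfolding bij_betw_def
 proof
  show "inj_on (%(ta, l). ta @ [l]) (words k \<times> letters)" by (auto simp: inj_on_def)
  have "ta : (%(ta, l). ta @ [l]) ` (words k \<times> letters)" if "ta : words (Suc k)" for ta
   using that by (cases ta rule: rev_cases) (auto simp: words_def)
  thus "(%(ta, l). ta @ [l]) ` (words k \<times> letters) = words (Suc k)" by (auto simp: words_def)
 qed
 have "w = (SUM ta:words k. SUM l:letters. lpart n k l (y ta))" unfolding ws
 proof (rule sum.cong[OF refl])
  fix ta assume "ta : words k"
  hence "y ta : cf E (parts n {})" using y by blast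
  thus "y ta = (SUM l:letters. lpart n k l (y ta))" using lpart_sum[of "y ta" "parts n {}" k] Suc.prems by simp
 qed
 also have "... = (SUM (ta, l):words k \<times> letters. lpart n k l (y ta))" by (rule sum.cartesian_product)
 also have "... = (SUM ta:words (Suc k). ?y ta)"
  unfolding sum.reindex_bij_betw[OF bij, symmetric] by (rule sum.cong) auto
 finally have sum: "w = (SUM ta:words (Suc k). ?y ta)" .
 have y': "?y ta : cf E (parts n {}) & (ALL t<Suc k. has_letter n t (ta ! t) (?y ta))" if ta: "ta : words (Suc k)" for ta
 proof -
  obtain si l where s: "ta = si @ [l]" "si : words k" "l : letters"
   using ta by (cases ta rule: rev_cases) (auto simp: words_def)
  have ys: "y si : cf E (parts n {})" "ALL t<k. has_letter n t (si ! t) (y si)" using y s(2) by auto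
  have len: "length si = k" using s(2) by (simp add: words_def)
  note yl = cf_log[OF ys(1), of n, simplified]
  have "lpart n k l (y si) : cf E (parts n {})"
   using lpart_cf[of "y si" "parts n {}" k l] yl Suc.prems s(3) ys(1) by (simp add: cf_gc)
  moreover have "has_letter n t (ta ! t) (lpart n k l (y si))" if "t < Suc k" for t
  proof (cases "t = k")
   case True thus ?thesis using has_letter_part[OF _ s(3) yl, of k] Suc.prems len s(1) by auto
  next case False
   thus ?thesis using has_letter_part_other[of t k n l "y si" "ta ! t"] that Suc.prems s yl ys(2) len
    by (simp add: nth_append)
  qed
  ultimately show ?thesis using s(1) by simp
 qed
 show ?case by (intro exI[of _ ?y] conjI[OF ballI sum] y')
qed

text \<open>The projections \<open>lpart\<close> for the letters of \<open>ta\<close>, applied group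
  by group, remove every word different from \<open>ta\<close>.\<close>

lemma word_forms_independent:
 assumes T: "T <= words n" and y: "!!ta. ta : T ==> y ta : word_forms n ta" and z: "(SUM ta:T. y ta) = 0" and ta: "ta : T"
 shows "y ta = 0"
proof -
 have fT: "finite T" using T by (rule finite_subset) simp
 have cl: "y si : cf E (parts n {})" if "si : T" for si using y[OF that] by (simp add: word_forms_def)
 have lg: "y si : LF n" if "si : T" for si using cf_log[OF cl[OF that]] by simp
 have "(SUM si:{si : T. take k si = take k ta}. y si) = 0" if "k <= n" for k using that
 proof (induction k)
  case 0 thus ?case using z by simp
 next case (Suc k)
  let ?T = "{si : T. take k si = take k ta}" and ?l = "ta ! k"
  have k: "k < n" and l: "?l : letters" using Suc.prems words_nth T ta by auto
  have A: "additive_on (LF n) (lpart n k ?l)"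
   unfolding additive_on_def using lpart_add[OF k l] by blast
  have "(SUM si:?T. lpart n k ?l (y si)) = lpart n k ?l (SUM si:?T. y si)"
   by (rule addD(6)[OF A log_forms_closed, symmetric]) (use lg in auto)
  also have "... = 0" unfolding Suc.IH[OF Suc_leD[OF Suc.prems]] by (rule lpart_0[OF k l])
  finally have 0: "(SUM si:?T. lpart n k ?l (y si)) = 0" .
  have e: "lpart n k ?l (y si) = (if si ! k = ?l then y si else 0)" if s: "si : T" for si
  proof -
   have h: "has_letter n k (si ! k) (y si)" using y[OF s] k by (simp add: word_forms_def)
   have sl: "si ! k : letters" using words_nth k T s by auto
   show ?thesis
   proof (cases "si ! k = ?l")
    case True thus ?thesis using lpart_same[OF cl[OF s], of k ?l] h l k by simp
   next case False thus ?thesis using lpart_orthogonal[OF k l sl _ lg[OF s] h] by simp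
   qed qed
  have "(SUM si:?T. lpart n k ?l (y si)) = (SUM si:{si : ?T. si ! k = ?l}. y si)"
   using e fT by (subst sum.inter_filter) (auto intro!: sum.cong)
  also have "{si : ?T. si ! k = ?l} = {si : T. take (Suc k) si = take (Suc k) ta}"
  proof -
   have "length si = n" if "si : T" for si using that T by (auto simp: words_def)
   thus ?thesis using k ta by (auto simp: take_Suc_conv_app_nth)
  qed
  finally show ?case using 0 by simp
 qed
 from this[of n] have "(SUM si:{si : T. take n si = take n ta}. y si) = 0" by simp
 moreover have "length si = n" if "si : T" for si using that T by (auto simp: words_def)
 hence "{si : T. take n si = take n ta} = {ta}" using ta by auto
 ultimately show ?thesis by simp
qed

lemma normal_less: assumes "!!h. a <= h ==> h <= g ==> h : normal_gaps n ta" "a <= g"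
 shows "fst (ta ! a) < fst (ta ! Suc g)" using assms(2) assms(1)
proof (induction g rule: dec_induct)
 case base thus ?case by (simp add: normal_gaps_def)
next case (step g)
 hence "fst (ta ! a) < fst (ta ! Suc g)" "Suc g : normal_gaps n ta" by simp_all
 thus ?case by (simp add: normal_gaps_def)
qed

lemma rho_groups: assumes "finite H" "f : reg m" "!!h. h : H ==> rho m (grp h) f = f"
 shows "rho m (H \<times> UNIV) f = f" using assms
proof (induction H rule: finite_induct)
 case empty thus ?case using rho_empty[of f m "{}"] by simp
next case (insert h H)
 have "insert h H \<times> (UNIV :: nat set) = grp h Un H \<times> UNIV" by auto
 thus ?case using insert rho_rho[of f m "grp h" "H \<times> UNIV"] by simp
qed

text \<open>The units merged into the entry of \<open>g\<close> have constant letters with indices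
  below that of the letter at \<open>g + 1\<close>. This yields the hypotheses of
  \<open>sect_left_inverse\<close> for the merge at \<open>g\<close>.\<close>

lemma merge_all_concentrated:
 assumes A: "!!h. g <= h ==> h ~: A" and g: "Suc g < n" and ta: "ta : words n" "insert g A <= normal_gaps n ta"
  and y: "y : word_forms n ta"
 defines "m \<equiv> length (parts n A)" and "t \<equiv> pos A g" and "ze \<equiv> merge_all n A y"
 shows "has_letter m (Suc t) (ta ! Suc g) ze" "rho m (grp t) (ze J) = ze J"
  "ze J ~= 0 ==> slice t J <= {..<fst (ta ! Suc g)}"
proof -
 have into: "ALL h<n. pos A h < m" unfolding m_def using pos_into by blast
 have yc: "y : cf E (parts n {})" and yt: "h < n ==> has_letter n h (ta ! h) y" for h using y by (auto simp: word_forms_def)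
 have yl: "y : LF n" using cf_log[OF yc] by simp
 note yr = lfD(1)[OF yl]
 have S: "pos A h = Suc t <-> h = Suc g" for h
 proof (cases "g <= h")
  case True thus ?thesis using pos_beyond[of g A h] A unfolding t_def by auto
 next case False thus ?thesis using pos_mono[of h g A] unfolding t_def by auto
 qed
 show "has_letter m (Suc t) (ta ! Suc g) ze" unfolding ze_def merge_all_def m_def[symmetric]
  by (rule has_letter_pull[OF into yl yt[OF g] g S])
 have H: "h <= g & (ALL k. h <= k --> k <= g --> k : normal_gaps n ta)" if "pos A h = t" for h
 proof -
  have "h <= g" using S[of h] pos_beyond[of g A h] A that unfolding t_def by (cases "g <= h") auto
  moreover have "k : normal_gaps n ta" if "h <= k" "k <= g" for k
   using pos_eq_between[of A h g k] \<open>pos A h = t\<close> that ta(2) unfolding t_def by (cases "k = g") auto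
  ultimately show ?thesis by blast
 qed
 have Hn: "h < n & ~ snd (ta ! h) & fst (ta ! h) < fst (ta ! Suc g)" if "pos A h = t" for h
  using H[OF that] normal_less[of h g n ta] by (auto simp: normal_gaps_def)
 have ys: "slice h I = {fst (ta ! h)} & rho n (grp h) (y I) = y I" if h: "pos A h = t" and ne: "y I ~= 0" for h I
 proof -
  have hn: "h < n" "~ snd (ta ! h)" using Hn[OF h] by auto
  obtain k where k: "slice h I = {k}" using degree_one_slice[OF cf_degree[OF yc], of h I] hn ne by auto
  hence "lett_typ n h (ta ! h) k (y I)" using yt[OF hn(1)] by (simp add: has_letter_def)
  thus ?thesis using k hn(2) ne by (auto simp: lett_typ_def)
 qed
 have c: "rho n {p. move (pos A) p : grp t} (y I) = y I" for I
 proof (cases "y I = 0")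
  case False have "{p. move (pos A) p : grp t} = {h. pos A h = t} \<times> UNIV" by auto
  moreover have "finite {h. pos A h = t}" by (rule finite_subset[of _ "{..<n}"]) (use Hn in auto)
  ultimately show ?thesis using rho_groups[of "{h. pos A h = t}" "y I" n] ys[OF _ False] yr by auto
 qed (simp add: rho_ops(2))
 have pr: "fp n m (pos A) (y I) : reg m" for I by (rule fp_reg[OF into yr])
 have z: "ze J = (SUM I:fibre u n (pos A) J. signed (inversions (pos A) I) (fp n m (pos A) (y I)))"
  unfolding ze_def merge_all_def m_def[symmetric] FP_pullf pullf_def ..
 have "rho m (grp t) (ze J) = (SUM I:fibre u n (pos A) J. rho m (grp t) (signed (inversions (pos A) I) (fp n m (pos A) (y I))))"
  unfolding z by (rule rho_ops(6)) (rule reg_ops(5)[OF pr])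
 thus "rho m (grp t) (ze J) = ze J"
  unfolding z using rho_ops(5)[OF pr] rho_fun_pull[OF into yr] c by simp
 assume ne: "ze J ~= 0"
 have p0: "fp n m (pos A) 0 = 0" by (rule addD(2)[OF fp_additive[OF into] reg_closed])
 have "EX I:fibre u n (pos A) J. y I ~= 0"
 proof (rule ccontr)
  assume "~ ?thesis"
  hence "ze J = 0" unfolding z using p0 by (intro sum.neutral) auto
  thus False using ne by simp
 qed
 then obtain I where I: "I : fibre u n (pos A) J" "y I ~= 0" by blast
 show "slice t J <= {..<fst (ta ! Suc g)}"
 proof
  fix s assume "s : slice t J"
  then obtain h where h: "(h, s) : I" "pos A h = t" using I(1) by (auto simp: fibre_def)
  hence "s : slice h I" by simp
  hence "s = fst (ta ! h)" using ys[OF h(2) I(2)] by auto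
  thus "s : {..<fst (ta ! Suc g)}" using Hn[OF h(2)] by simp
 qed qed

lemma merge_insert: assumes g: "g ~: S" "Suc g < n" and w: "w : LF n"
 shows "FP (length (parts n S)) (length (parts n S) - 1) (diag (pos S g)) (merge_all n S w) = merge_all n (insert g S) w"
proof -
 note len = Suc_pos_length[OF g]
 have l: "length (parts n (insert g S)) = length (parts n S) - 1"
  unfolding merge_parts[OF g] by (rule length_merge[OF len])
 have 1: "ALL t<n. pos S t < length (parts n S)" using pos_into by blast
 have "FP n (length (parts n S) - 1) (diag (pos S g) o pos S) w
  = FP n (length (parts n S) - 1) (pos (insert g S)) w"
  by (rule form_pull_cong[OF _ _ w]) (use diag_pos[OF g(1)] diag_into[OF len] 1 in auto)
 thus ?thesis unfolding merge_all_def l using form_pull_comp[OF 1 diag_into[OF len] w] by simp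
qed

lemma merge_in:
 assumes "S <= gaps n" "w : cf E (parts n {})" shows "merge_all n S w : cf E (parts n S)"
proof -
 interpret C: cube "gaps n" "%S. cf E (parts n S)" "%S g. qmult ZZ (pos S g) (parts n S)" by (rule cube_E)
 have "finite S" using assms(1) finite_gaps by (rule finite_subset)
 thus ?thesis using assms(1)
 proof (induction S rule: finite_induct)
  case empty thus ?case using merge_empty[OF assms(2)] assms(2) by simp
 next case (insert g S)
  hence g: "g ~: S" "Suc g < n" by (auto simp: gaps_def)
  have "qmult ZZ (pos S g) (parts n S) (merge_all n S w) : cf E (parts n (insert g S))"
   by (rule C.mu_in) (use insert in auto)
  thus ?case using merge_insert[OF g cf_log[OF assms(2), of n]] by simp
 qed qed

lemma sect_additive: "Suc t < m ==> additive_on (LF (m - 1)) (sect m t)" unfolding additive_on_def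
proof (intro ballI)
 fix W W' assume t: "Suc t < m" and w: "W : LF (m - 1)" "W' : LF (m - 1)"
 \<comment> \<open>Any index sequence of length \<open>m\<close> gives access to the facts about
   \<open>lift\<close>.\<close>
 let ?ns = "replicate m (0::int)"
 have tm: "Suc t < length ?ns" "m = length ?ns" using t by simp_all
 have "lift m t (W + W') J = lift m t W J + lift m t W' J" for J unfolding lift_def
  using addD(1)[OF fp_additive[OF face_pull[OF tm]] reg_closed lfD(1)[OF w(1)] lfD(1)[OF w(2)]]
  by auto
 hence "lift m t (W + W') = lift m t W + lift m t W'" by auto
 thus "sect m t (W + W') = sect m t W + sect m t W'" unfolding sect_def sum.distrib[symmetric]
  using lpart_add[OF t _ lift_log_forms[OF tm w(1)] lift_log_forms[OF tm w(2)]] by (intro sum.cong) auto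
qed

text \<open>The greatest gap is reopened first: there the right entry is a unit, and
  \<open>sect\<close> gives a preimage under the last merge.\<close>

lemma merge_generates:
 assumes "S <= gaps n" "z : cf E (parts n S)" shows "EX w:cf E (parts n {}). z = merge_all n S w"
proof -
 have "finite S" using assms(1) finite_gaps by (rule finite_subset)
 thus ?thesis using assms
 proof (induction S arbitrary: z rule: finite_linorder_max_induct)
  case empty thus ?case using merge_empty by (intro bexI[of _ z]) auto
 next case (insert g S)
  have S: "h ~: S" if "g <= h" for h using insert.hyps(2) that by auto
  have g: "g ~: S" "Suc g < n" using S insert.prems by (auto simp: gaps_def)
  note len = Suc_pos_length[OF g]
  have z: "z : cf E (merge_at (pos S g) (parts n S))" using insert.prems(2) unfolding merge_parts[OF g] .
  have one: "parts n S ! Suc (pos S g) = 1" by (rule parts_unit[OF S g(2)])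
  have nn: "0 <= parts n S ! pos S g" using parts_pos[of "parts n S ! pos S g" n S] len by simp
  have "sect (length (parts n S)) (pos S g) z : cf E (parts n S)" by (rule sect_cf[OF len refl z one])
  then obtain w where w: "w : cf E (parts n {})" "sect (length (parts n S)) (pos S g) z = merge_all n S w"
   using insert.IH insert.prems by blast
  have "z = merge_all n (insert g S) w"
   using sect_right_inverse[OF len refl z one nn] merge_insert[OF g cf_log[OF w(1), of n]] w(2) by simp
  thus ?case using w(1) by blast
 qed qed

text \<open>The additive map \<open>sect\<close> undoes the last merge on all normal words
  simultaneously, so a vanishing sum remains zero when the greatest gap is reopened.\<close>

lemma merge_normal_injective:
 assumes S: "S <= gaps n" and T: "T <= words n" and N: "!!ta. ta : T ==> S <= normal_gaps n ta"
  and y: "!!ta. ta : T ==> y ta : word_forms n ta" and z: "(SUM ta:T. merge_all n S (y ta)) = 0"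
 shows "(SUM ta:T. y ta) = 0"
proof -
 have "finite S" using S finite_gaps by (rule finite_subset)
 have yc: "y ta : cf E (parts n {})" if "ta : T" for ta using y[OF that] by (simp add: word_forms_def)
 from \<open>finite S\<close> show ?thesis using S N z
 proof (induction S rule: finite_linorder_max_induct)
  case empty thus ?case using merge_empty[OF yc] by simp
 next case (insert g S)
  let ?ns = "parts n S" and ?t = "pos S g"
  let ?m = "length ?ns"
  have S: "h ~: S" if "g <= h" for h using insert.hyps(2) that by auto
  have g: "g ~: S" "Suc g < n" using S insert.prems(1) by (auto simp: gaps_def)
  have Sg: "S <= gaps n" using insert.prems(1) by blast
  note len = Suc_pos_length[OF g]
  have one: "?ns ! Suc ?t = 1" by (rule parts_unit[OF S g(2)])
  have l: "length (parts n (insert g S)) = ?m - 1"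
   unfolding merge_parts[OF g] by (rule length_merge[OF len])
  have s: "sect ?m ?t (merge_all n (insert g S) (y ta)) = merge_all n S (y ta)" if ta: "ta : T" for ta
  proof -
   have tw: "ta : words n" using T ta by blast
   note c = merge_all_concentrated[OF S g(2) tw insert.prems(2)[OF ta] y[OF ta]]
   show ?thesis
    using sect_left_inverse[OF len refl merge_in[OF Sg yc[OF ta]] one words_nth[OF tw g(2)] c]
     merge_insert[OF g cf_log[OF yc[OF ta], of n]] by simp
  qed
  have ml: "merge_all n (insert g S) (y ta) : LF (?m - 1)" if "ta : T" for ta
   by (rule cf_log[OF merge_in[OF insert.prems(1) yc[OF that]] l])
  note A = addD[OF sect_additive[OF len] log_forms_closed]
  have "(SUM ta:T. merge_all n S (y ta)) = (SUM ta:T. sect ?m ?t (merge_all n (insert g S) (y ta)))"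
   using s by simp
  also have "... = sect ?m ?t (SUM ta:T. merge_all n (insert g S) (y ta))" by (rule A(6)[symmetric]) (rule ml)
  also have "... = 0" unfolding insert.prems(3) by (rule A(2))
  finally show ?case using insert.IH[OF Sg] insert.prems(2) by simp
 qed qed

end

section \<open>Rewriting a pair of letters that is not normal\<close>

context log_disk
begin

lemma lpart_witness:
 assumes t: "t < m" and l: "l : letters" and W: "W : LF m" and ne: "lpart m t l W J ~= 0"
 shows "EX k. slice t J = {k} & J <= vs m & lett m t l k (W (put t J (fst l))) ~= 0 & W (put t J (fst l)) ~= 0"
  by (metis lpart_nonzero ne lpart_at lett_0 t l)

lemma weight_less:
 assumes g: "Suc g < n" and eq: "!!t. t < n ==> t ~= g ==> t ~= Suc g ==> si ! t = ta ! t"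
  and le: "(n - g) * key (si ! g) + (n - Suc g) * key (si ! Suc g) < (n - g) * key (ta ! g) + (n - Suc g) * key (ta ! Suc g)"
 shows "weight n si < weight n ta"
proof -
 have w: "weight n rh = (n - g) * key (rh ! g) + ((n - Suc g) * key (rh ! Suc g)
   + (SUM t:{..<n} - {g} - {Suc g}. (n - t) * key (rh ! t)))" for rh
  unfolding weight_def using g by (subst sum.remove[of _ g]; simp) (subst sum.remove[of _ "Suc g"]; simp)
 have "(SUM t:{..<n} - {g} - {Suc g}. (n - t) * key (si ! t)) = (SUM t:{..<n} - {g} - {Suc g}. (n - t) * key (ta ! t))"
  by (rule sum.cong) (use eq in auto)
 thus ?thesis unfolding w using le by simp
qed

text \<open>The old pair is \<open>l, l'\<close>, the new one \<open>(a, False), (b, c)\<close>;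
  \<open>i\<close> and \<open>j\<close> are indices of the old pair at some nonzero coefficient, so
  \<open>{i, j} = {a, b}\<close>. If \<open>l\<close> is nonconstant, the left key drops from
  \<open>u\<close> to \<open>a\<close>, which outweighs the change on the right. If \<open>l\<close>
  is constant, its index drops: the pair is swapped, or the right letter was nonconstant and cannot
  get heavier.\<close>

lemma key_less: assumes y: "Suc g < n" and a: "a < b" "i : {a, b}" "j : {a, b}" "i ~= j"
  and x: "l : letters" "l' : letters" "snd l | fst l' <= fst l" and b: "b < u" "c --> ~ (~ snd l & ~ snd l')"
  and i: "i <= fst l" "~ snd l --> i = fst l" and j: "j <= fst l'" "~ snd l' --> j = fst l'"
 shows "(n - g) * key (a, False) + (n - Suc g) * key (b, c) < (n - g) * key l + (n - Suc g) * key l'"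
proof -
 obtain z where z: "n - Suc g = z" "n - g = Suc z" using y by auto
 have k: "key (a, False) = a" "key (b, c) <= u" "key l <= u" "fst l < u" "fst l' < u"
  using x b by (auto simp: key_def letters_def)
 show ?thesis unfolding z
 proof (cases "snd l"; cases "snd l'")
  assume s: "snd l" "snd l'"
  have "a < u" using a b by simp
  hence "a + z * a < u + z * u" using mult_le_mono2[of a u z] by linarith
  moreover have "z * key (b, c) <= z * u" using k by simp
  ultimately show "Suc z * key (a, False) + z * key (b, c) < Suc z * key l + z * key l'"
   unfolding k(1) mult_Suc using s by (simp only: key_def[of l] key_def[of l'] if_True)
 next assume s: "snd l" "~ snd l'"
  have "a <= fst l'" using j s a by auto
  hence "Suc z * a <= Suc z * fst l'" by (rule mult_le_mono2)
  moreover have "z * key (b, c) <= z * u" using k by simp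
  ultimately show "Suc z * key (a, False) + z * key (b, c) < Suc z * key l + z * key l'"
   unfolding k(1) mult_Suc using s k(5) by (simp only: key_def[of l] key_def[of l'] if_True if_False)
 next assume s: "~ snd l" "snd l'"
  have "a < fst l" using i j s a x(3) by auto
  hence "Suc z * a < Suc z * fst l" by (rule mult_less_mono2) simp
  moreover have "z * key (b, c) <= z * u" using k by simp
  ultimately show "Suc z * key (a, False) + z * key (b, c) < Suc z * key l + z * key l'"
   unfolding k(1) mult_Suc using s by (simp only: key_def[of l] key_def[of l'] if_True if_False)
 next assume s: "~ snd l" "~ snd l'"
  have "a = fst l'" "b = fst l" "~ c" using i j s a x(3) b(2) by auto
  thus "Suc z * key (a, False) + z * key (b, c) < Suc z * key l + z * key l'"
   using s a by (simp add: key_def)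
 qed qed

context
 fixes n g :: nat and ta :: "(nat * bool) list" and w :: "'f form"
 assumes g: "Suc g < n" and ta: "ta : words n" and w: "w : word_forms n ta"
begin

abbreviation "merged \<equiv> FP n (n - 1) (diag g) w"

lemma n_unit: "Suc g < length (parts n {})" "n = length (parts n {})" using g by simp_all

lemma into: "ALL t<n. diag g t < n - 1" by (rule diag_into[OF g])

lemma w_cf: "w : cf E (parts n {})" and w_letter: "t < n ==> has_letter n t (ta ! t) w"
 using w by (auto simp: word_forms_def)

lemma w_log: "w : LF n" using cf_log[OF w_cf] by simp

lemma merged_cf: "merged : cf E (merge_at g (parts n {}))"
 using form_pull_cf_E[of "parts n {}" "diag g" "merge_at g (parts n {})" w] into w_cf merge_at_nth[OF n_unit(1)]
  length_merge[OF n_unit(1)] by simp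

lemma merged_log: "merged : LF (n - 1)"
 by (rule cf_log[OF merged_cf]) (use length_merge[OF n_unit(1)] in simp)

lemma lift_log: "lift n g merged : LF n" by (rule lift_log_forms[OF n_unit merged_log])

lemma face_into': "ALL t<n - 1. face g t < n" by (auto simp: face_def)

text \<open>\<open>face\<close> puts all functions on the factor \<open>g + 1\<close>, so the left
  letter of a rewritten pair is constant.\<close>

lemma lift_const: "rho n (grp g) (lift n g merged J) = lift n g merged J"
proof -
 have "rho n (grp g) (fp (n - 1) n (face g) f) = fp (n - 1) n (face g) f" if f: "f : reg (n - 1)" for f
 proof -
  have e: "{p. move (face g) p : grp g} = {}" by (auto simp: face_def)
  show ?thesis unfolding rho_fun_pull[OF face_into' f] e using rho_empty[OF f, of "{}"] by simp
 qed
 thus ?thesis using lfD(1)[OF merged_log] by (simp add: lift_def rho_ops(2))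
qed

lemma lift_letter:
 assumes t: "t < n" "t ~= g" "t ~= Suc g" shows "has_letter n t (ta ! t) (lift n g merged)"
 unfolding has_letter_def
proof (intro allI impI)
 fix J k assume k: "slice t J = {k}"
 define q where "q = diag g t"
 have q: "q < n - 1" "!!h. diag g h = q <-> h = t" "!!h. face g h = t <-> h = q"
  using t g by (auto simp: q_def diag_def face_def)
 have "slice q (move (diag g) ` J) = {k}" using t k by (force simp: slice_move_diag q_def diag_def)
 hence ty: "lett_typ (n - 1) q (ta ! t) k (merged (move (diag g) ` J))"
  using has_letter_pull[OF into w_log w_letter[OF t(1)] t(1) q(2)] unfolding has_letter_def by blast
 have "lett_typ n t (ta ! t) k (fp (n - 1) n (face g) (merged (move (diag g) ` J)))"
  by (rule lett_typ_pull[OF face_into' lfD(1)[OF merged_log] q(3) ty])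
 thus "lett_typ n t (ta ! t) k (lift n g merged J)" by (simp add: lift_def)
qed

text \<open>The product of two constant letters is constant in the merged variables, so its
  rewriting contains no nonconstant letter in the pair.\<close>

lemma merged_const: assumes "~ snd (ta ! g)" "~ snd (ta ! Suc g)"
 shows "rho n (grp (Suc g)) (lift n g merged J) = lift n g merged J"
proof -
 note wr = lfD(1)[OF w_log]
 have c: "rho n {p. move (diag g) p : grp g} (w I) = w I" for I
 proof (cases "w I = 0")
  case False have "rho n (grp h) (w I) = w I" if h: "h : {g, Suc g}" for h
  proof -
   have hn: "h < n" using h g by auto
   obtain k where "slice h I = {k}" using degree_one_slice[OF cf_degree[OF w_cf], of h I] hn False by auto
   hence "lett_typ n h (ta ! h) k (w I)" using w_letter[OF hn] by (simp add: has_letter_def)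
   thus ?thesis using assms h by (auto simp: lett_typ_def)
  qed
  moreover have "{p. move (diag g) p : grp g} = {g, Suc g} \<times> UNIV" by (auto simp: diag_def split: if_splits)
  ultimately show ?thesis using rho_groups[of "{g, Suc g}" "w I" n] wr by simp
 qed (simp add: rho_ops(2))
 have pr: "fp n (n - 1) (diag g) (w I) : reg (n - 1)" for I by (rule fp_reg[OF into wr])
 have m: "rho (n - 1) (grp g) (merged K) = merged K" for K
 proof -
  have "rho (n - 1) (grp g) (merged K) = (SUM I:fibre u n (diag g) K. rho (n - 1) (grp g) (signed (inversions (diag g) I) (fp n (n - 1) (diag g) (w I))))"
   unfolding FP_pullf pullf_def by (rule rho_ops(6)) (rule reg_ops(5)[OF pr])
  thus ?thesis using rho_ops(5)[OF pr] rho_fun_pull[OF into wr] c unfolding FP_pullf pullf_def by simp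
 qed
 have "rho n (grp (Suc g)) (fp (n - 1) n (face g) (merged K)) = fp (n - 1) n (face g) (rho (n - 1) (grp g) (merged K))" for K
  by (rule rho_fun_pull_grp[OF face_into' lfD(1)[OF merged_log] subset_UNIV]) (auto simp: face_def)
 thus ?thesis using m by (simp add: lift_def rho_ops(2))
qed

text \<open>A nonzero coefficient of the lift comes from a coefficient of \<open>w\<close> with
  indices \<open>i\<close> and \<open>j\<close> in the two groups, which the merge unites into
  \<open>{a, b}\<close>. The types of the two old letters bound \<open>i\<close> and
  \<open>j\<close>.\<close>

lemma lift_support: assumes "lift n g merged J ~= 0" "slice g J = {a}" "slice (Suc g) J = {b}"
 shows "a < b & b < u & (EX i j. i : {a, b} & j : {a, b} & i ~= j & i <= fst (ta ! g) & (~ snd (ta ! g) --> i = fst (ta ! g))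
  & j <= fst (ta ! Suc g) & (~ snd (ta ! Suc g) --> j = fst (ta ! Suc g)))"
proof -
 obtain k where J: "J <= vs n" "good g k J" using lift_nonzero[OF n_unit(1,2)] assms(1) by blast
 hence k: "k = b" "a < b" using assms(2,3) by (auto simp: good_def)
 have "(Suc g, b) : J" using assms(3) by auto
 hence bu: "b < u" using J(1) by auto
 have "merged (move (diag g) ` J) ~= 0"
  using assms(1) lift_good[OF n_unit J] fun_pull_0[OF n_unit] by auto
 hence "EX I:fibre u n (diag g) (move (diag g) ` J). w I ~= 0" unfolding FP_pullf pullf_def
  using addD(2)[OF fp_additive[OF into] reg_closed] by (metis (no_types, lifting) signed_zero sum.neutral)
 then obtain I where I: "I : fibre u n (diag g) (move (diag g) ` J)" "w I ~= 0" by blast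
 have ij: "EX i. slice h I = {i}" if "h < n" for h
  using degree_one_slice[OF cf_degree[OF w_cf], of h I] that I(2) by auto
 obtain i j where i: "slice g I = {i}" and j: "slice (Suc g) I = {j}" using ij[of g] ij[of "Suc g"] g by auto
 have IJ: "move (diag g) ` I = move (diag g) ` J" "inj_on (move (diag g)) I" using I(1) by (auto simp: fibre_def)
 have "slice g (move (diag g) ` I) = slice g (move (diag g) ` J)" using IJ(1) by simp
 hence s: "{i, j} = {a, b}" using assms(2,3) i j by (simp add: slice_move_diag insert_commute)
 have "(g, i) : I" "(Suc g, j) : I" using i j by auto
 hence ne: "i ~= j" using inj_onD[OF IJ(2), of "(g, i)" "(Suc g, j)"] by (auto simp: diag_def)
 have "lett_typ n g (ta ! g) i (w I)" "lett_typ n (Suc g) (ta ! Suc g) j (w I)"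
  using w_letter[of g] w_letter[of "Suc g"] g i j unfolding has_letter_def by auto
 hence "i <= fst (ta ! g) & (~ snd (ta ! g) --> i = fst (ta ! g))"
  "j <= fst (ta ! Suc g) & (~ snd (ta ! Suc g) --> j = fst (ta ! Suc g))"
  using I(2) unfolding lett_typ_def by (auto split: if_splits)
 moreover have "i : {a, b}" "j : {a, b}" using s by auto
 ultimately show ?thesis using k(2) bu ne by blast
qed

text \<open>The component at the word \<open>si\<close> of the section of the merge. Outside the
  pair the letters of \<open>ta\<close> persist, so all other words get 0.\<close>

definition rewritten :: "(nat * bool) list => 'f form" where
 "rewritten si = (if ALL t<n. t ~= g & t ~= Suc g --> si ! t = ta ! t
   then lpart n g (si ! g) (lpart n (Suc g) (si ! Suc g) (lift n g merged)) else 0)"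

lemma rewritten_in: assumes si: "si : words n" shows "rewritten si : word_forms n si"
proof (cases "ALL t<n. t ~= g & t ~= Suc g --> si ! t = ta ! t")
 case True
 have gl: "g < n" "si ! g : letters" "si ! Suc g : letters" using g words_nth[OF si] by auto
 let ?z = "lpart n (Suc g) (si ! Suc g) (lift n g merged)"
 have z: "?z : cf E (parts n {})" using lift_lpart_cf[OF n_unit merged_cf _ gl(3)] g by simp
 have zl: "?z : LF n" using cf_log[OF z] by simp
 have y: "lpart n g (si ! g) ?z : cf E (parts n {})"
  using lpart_cf[of ?z "parts n {}" g "si ! g"] zl gl z by (simp add: cf_gc)
 have "has_letter n t (si ! t) (lpart n g (si ! g) ?z)" if t: "t < n" for t
  by (metis has_letter_part gl zl has_letter_part_other g lift_log lift_letter t True)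
 thus ?thesis using y True by (simp add: rewritten_def word_forms_def)
next case False thus ?thesis using acD(1)[OF word_forms_closed] by (auto simp: rewritten_def)
qed

lemma rewritten_sum: "(SUM si:words n. rewritten si) = sect n g merged"
proof -
 let ?h = "%(l, l'). ta[g := l, Suc g := l']"
 have len: "length ta = n" "set ta <= letters" using ta by (auto simp: words_def)
 have inj: "inj_on ?h (letters \<times> letters)"
 proof (rule inj_onI)
  fix p q assume "p : letters \<times> letters" "q : letters \<times> letters" "?h p = ?h q"
  moreover obtain a b c d where "p = (a, b)" "q = (c, d)" by (cases p, cases q)
  ultimately have "ta[g := a, Suc g := b] ! g = ta[g := c, Suc g := d] ! g" "ta[g := a, Suc g := b] ! Suc g = ta[g := c, Suc g := d] ! Suc g" by auto
  thus "p = q" using \<open>p = (a, b)\<close> \<open>q = (c, d)\<close> len g by simp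
 qed
 have im: "?h ` (letters \<times> letters) = {si : words n. ALL t<n. t ~= g & t ~= Suc g --> si ! t = ta ! t}"
 proof (intro set_eqI iffI)
  fix si assume "si : ?h ` (letters \<times> letters)"
  then obtain l l' where "si = ta[g := l, Suc g := l']" "l : letters" "l' : letters" by auto
  moreover have "set (ta[g := l, Suc g := l']) <= letters"
   using set_update_subset_insert[of "ta[g := l]" "Suc g" l'] set_update_subset_insert[of ta g l] len calculation by blast
  ultimately show "si : {si : words n. ALL t<n. t ~= g & t ~= Suc g --> si ! t = ta ! t}"
   using len by (simp add: words_def)
 next fix si assume s: "si : {si : words n. ALL t<n. t ~= g & t ~= Suc g --> si ! t = ta ! t}"
  hence "si = ?h (si ! g, si ! Suc g)"
  proof (intro nth_equalityI)
   fix i assume "i < length si"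
   thus "si ! i = ?h (si ! g, si ! Suc g) ! i"
    using s len by (cases "i = g"; cases "i = Suc g") (auto simp: words_def)
  qed (use s len in "simp add: words_def")
  moreover have "(si ! g, si ! Suc g) : letters \<times> letters" using words_nth s g by auto
  ultimately show "si : ?h ` (letters \<times> letters)" by (rule image_eqI)
 qed
 have "(SUM si:words n. rewritten si)
   = (SUM si:?h ` (letters \<times> letters). lpart n g (si ! g) (lpart n (Suc g) (si ! Suc g) (lift n g merged)))"
  unfolding im by (rule sum.mono_neutral_cong_right) (auto simp: rewritten_def)
 also have "... = (SUM (l, l'):letters \<times> letters. lpart n g l (lpart n (Suc g) l' (lift n g merged)))"
  unfolding sum.reindex[OF inj] by (rule sum.cong) (use len g in auto)
 also have "... = (SUM l':letters. SUM l:letters. lpart n g l (lpart n (Suc g) l' (lift n g merged)))"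
  unfolding sum.cartesian_product[symmetric] by (rule sum.swap)
 also have "... = (SUM l':letters. lpart n (Suc g) l' (lift n g merged))"
 proof (rule sum.cong[OF refl])
  fix l' assume l': "l' : letters"
  have z: "lpart n (Suc g) l' (lift n g merged) : cf E (parts n {})"
   using lift_lpart_cf[OF n_unit merged_cf _ l'] g by simp
  show "(SUM l:letters. lpart n g l (lpart n (Suc g) l' (lift n g merged))) = lpart n (Suc g) l' (lift n g merged)"
   using lpart_sum[OF z, of g] g by simp
 qed
 finally show ?thesis unfolding sect_def .
qed

text \<open>A nonzero component leads to a nonzero coefficient of the lift at the indices of the new
  pair. Its left letter is constant by \<open>lift_const\<close>, and \<open>lift_support\<close>
  provides the indices \<open>i\<close>, \<open>j\<close> for \<open>key_less\<close>.\<close>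

lemma rewritten_less:
 assumes N: "g ~: normal_gaps n ta" and si: "si : words n" and ne: "rewritten si ~= 0"
 shows "weight n si < weight n ta"
proof -
 have eq: "si ! t = ta ! t" if "t < n" "t ~= g" "t ~= Suc g" for t
  using ne that unfolding rewritten_def by (auto split: if_splits)
 have gl: "g < n" "si ! g : letters" "si ! Suc g : letters" using g words_nth[OF si] by auto
 let ?l = "si ! g" and ?l' = "si ! Suc g"
 let ?z = "lpart n (Suc g) ?l' (lift n g merged)"
 have zl: "?z : LF n" by (rule lpart_log_forms[OF g gl(3) lift_log])
 have "lpart n g ?l ?z ~= 0" using ne by (auto simp: rewritten_def)
 then obtain J where "lpart n g ?l ?z J ~= 0" by (auto simp: fun_eq_iff)
 from lpart_witness[OF gl(1,2) zl this] obtain k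
  where J: "J <= vs n" "lett n g ?l k (?z (put g J (fst ?l))) ~= 0" "?z (put g J (fst ?l)) ~= 0" by blast
 define K where "K = put g J (fst ?l)"
 from lpart_witness[OF g gl(3) lift_log J(3)] obtain k'
  where K: "K <= vs n" "slice (Suc g) K = {k'}" "lett n (Suc g) ?l' k' (lift n g merged (put (Suc g) K (fst ?l'))) ~= 0"
   "lift n g merged (put (Suc g) K (fst ?l')) ~= 0" unfolding K_def by blast
 note lr = lfD(1)[OF lift_log]
 have "grp g Int grp (Suc g) = {}" by auto
 hence "rho n (grp g) (?z K) = ?z K"
  unfolding lpart_at[OF K(1,2)] using lett_rho[OF g gl(3) lr, of "grp g"] lift_const by simp
 hence c: "~ snd ?l" using lett_const[OF gl(1,2) _ lfD(1)[OF zl]] J(2) unfolding K_def by blast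
 have c': "snd ?l' --> ~ (~ snd (ta ! g) & ~ snd (ta ! Suc g))"
  using lett_const[OF g gl(3) _ lr merged_const] K(3) by blast
 have "slice g (put (Suc g) K (fst ?l')) = {fst ?l}" "slice (Suc g) (put (Suc g) K (fst ?l')) = {fst ?l'}"
  unfolding K_def by simp_all
 from lift_support[OF K(4) this] obtain i j where ij: "fst ?l < fst ?l'" "fst ?l' < u"
  "i : {fst ?l, fst ?l'}" "j : {fst ?l, fst ?l'}" "i ~= j" "i <= fst (ta ! g)" "~ snd (ta ! g) --> i = fst (ta ! g)"
  "j <= fst (ta ! Suc g)" "~ snd (ta ! Suc g) --> j = fst (ta ! Suc g)" by blast
 have tl: "ta ! g : letters" "ta ! Suc g : letters" using words_nth[OF ta] g by auto
 have nn: "snd (ta ! g) | fst (ta ! Suc g) <= fst (ta ! g)" using N g by (auto simp: normal_gaps_def)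
 have "?l = (fst ?l, False)" "?l' = (fst ?l', snd ?l')" using c by (auto simp: prod_eq_iff)
 thus ?thesis using key_less[OF g ij(1,3,4,5) tl nn ij(2) c' ij(6-9)] weight_less[OF g eq] by auto
qed

lemma merged_rewrite: "FP n (n - 1) (diag g) (SUM si:words n. rewritten si) = merged"
 unfolding rewritten_sum by (rule sect_right_inverse[OF n_unit merged_cf]) (use g in simp_all)

end

theorem exact_E: "G <= gaps n ==> cube.exact_at (%S. cf E (parts n S)) (%S g. qmult ZZ (pos S g) (parts n S)) G l"
proof -
 interpret C: cube "gaps n" "%S. cf E (parts n S)" "%S g. qmult ZZ (pos S g) (parts n S)" by (rule cube_E)
 interpret P: pbw_cube "gaps n" "%S. cf E (parts n S)" "%S g. qmult ZZ (pos S g) (parts n S)"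
  "words n" "word_forms n" "normal_gaps n" "weight n" "merge_all n"
 proof
  show "word_forms n ta <= cf E (parts n {})" for ta by (auto simp: word_forms_def)
  show "S <= gaps n ==> w : cf E (parts n {}) ==> merge_all n S w : cf E (parts n S)" for S w by (rule merge_in)
  show "additive_on (cf E (parts n {})) (merge_all n S)" for S
  proof -
   have "additive_on (LF n) (merge_all n S)"
    unfolding merge_all_def by (rule FP_additive) (use pos_into in blast)
   thus ?thesis using cf_log[of _ "parts n {}" n] unfolding additive_on_def by simp
  qed
  show "qmult ZZ (pos S g) (parts n S) (merge_all n S w) = merge_all n (insert g S) w"
   if "g : gaps n - S" "w : cf E (parts n {})" for S g w
   using merge_insert[of g S n w] cf_log[OF that(2), of n] that(1) by (auto simp: gaps_def)
  show "EX y. (ALL ta:words n. y ta : word_forms n ta) & z = merge_all n S (SUM ta:words n. y ta)"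
   if z: "S <= gaps n" "z : cf E (parts n S)" for S z
  proof -
   obtain w where w: "w : cf E (parts n {})" "z = merge_all n S w" using merge_generates[OF z] by blast
   obtain y where "ALL ta:words n. y ta : cf E (parts n {}) & (ALL t<n. has_letter n t (ta ! t) (y ta))" "w = (SUM ta:words n. y ta)"
    using decompose_words[OF w(1) order_refl] by blast
   thus ?thesis using w(2) by (intro exI[of _ y]) (auto simp: word_forms_def)
  qed
  show "y ta = 0" if S: "S <= gaps n" and y: "!!ta. ta : words n ==> S <= normal_gaps n ta ==> y ta : word_forms n ta"
   and z: "(SUM ta:{ta:words n. S <= normal_gaps n ta}. merge_all n S (y ta)) = 0" and ta: "ta : words n" "S <= normal_gaps n ta" for S y ta
  proof -
   let ?T = "{ta:words n. S <= normal_gaps n ta}"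
   have "(SUM ta:?T. y ta) = 0" by (rule merge_normal_injective[OF S _ _ _ z]) (use y in auto)
   thus ?thesis by (rule word_forms_independent[rotated 2]) (use y ta in auto)
  qed
  show "EX y. (ALL si:words n. y si : word_forms n si & (y si ~= 0 --> weight n si < weight n ta))
    & qmult ZZ (pos {} g) (parts n {}) w = qmult ZZ (pos {} g) (parts n {}) (SUM si:words n. y si)"
   if h: "ta : words n" "g : gaps n - normal_gaps n ta" "w : word_forms n ta" for ta g w
  proof -
   have g: "Suc g < n" "g ~: normal_gaps n ta" using h(2) by (auto simp: gaps_def)
   show ?thesis
    using rewritten_in[OF g(1) h(1,3)] rewritten_less[OF g(1) h(1,3) g(2)] merged_rewrite[OF g(1) h(1,3)]
    by (intro exI[of _ "rewritten n g ta w"]) simp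
  qed qed (use merge_empty word_forms_closed in auto)
 show "G <= gaps n ==> C.exact_at G l" by (rule P.bar_exact)
qed

theorem koszul_ZZ: "koszul_quasi_algebra ZZ & koszul_quasi_coalgebra (quadratic_dual ZZ)"
proof -
 interpret Q: positive_quasi_algebra ZZ by (rule positive_ZZ)
 show ?thesis by (rule Q.koszul_of_exact) (rule exact_transport[OF exact_E])
qed

end

section \<open>The formal disk\<close>

abbreviation "mexp \<equiv> move_exponent"
abbreviation "lkp \<equiv> Poly_Mapping.lookup"
abbreviation "kys \<equiv> Poly_Mapping.keys"
abbreviation "sgl p \<equiv> Poly_Mapping.single p (1::nat)"

lemma sum_fun_at: "(SUM a:A. f a) x = (SUM a:A. f a x)" for f :: "'a => 'b => 'c::comm_monoid_add"
 by (induction A rule: infinite_finite_induct) auto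

lemma lookup_sum_pm: "lkp (sum f A) q = (SUM x:A. lkp (f x) q)"
 by (induction A rule: infinite_finite_induct) (auto simp: lookup_add)

lemma keys_zero_iff: "p ~: kys e <-> lkp e p = 0" by (simp add: in_keys_iff)

lemma lookup_mexp: assumes "finite K" "kys e <= K"
 shows "lkp (mexp h e) q = (SUM p:{p : K. move h p = q}. lkp e p)"
  using assms by (auto simp: lookup_single when_def in_keys_iff sum.inter_filter move_exponent_def lookup_sum_pm intro!: sum.mono_neutral_left)

lemma move_exponent_add: "mexp h (e + e') = mexp h e + mexp h e'"
proof (rule poly_mapping_eqI)
 fix q
 let ?K = "kys e Un kys e'"
 have "finite ?K" "kys (e + e') <= ?K" using keys_add[of e e'] by auto
 thus "lkp (mexp h (e + e')) q = lkp (mexp h e + mexp h e') q"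
  using lookup_mexp[of ?K "e + e'"] lookup_mexp[of ?K e] lookup_mexp[of ?K e']
  by (simp add: lookup_add sum.distrib)
qed

lemma move_exponent_single: "mexp h (Poly_Mapping.single p k) = Poly_Mapping.single (move h p) k"
 by (simp add: move_exponent_def)

lemma keys_move_exponent: "kys (mexp h e) = move h ` kys e"
proof (intro set_eqI)
 fix q
 have "q : kys (mexp h e) <-> (SUM p:{p : kys e. move h p = q}. lkp e p) ~= 0"
  using lookup_mexp[of "kys e" e h q] by (simp add: in_keys_iff)
 also have "... <-> (EX p:kys e. move h p = q)"
  by (simp add: Bex_def in_keys_iff conj_commute del: split_paired_All)
 finally show "q : kys (mexp h e) <-> q : move h ` kys e" by blast
qed

lemma move_exponent_comp: "mexp h' (mexp h e) = mexp (h' o h) e"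
proof (rule poly_mapping_eqI)
 fix q
 let ?K = "kys e"
 have "lkp (mexp h' (mexp h e)) q
   = (SUM r:{r : move h ` ?K. move h' r = q}. SUM p:{p : ?K. move h p = r}. lkp e p)"
  using lookup_mexp[of "move h ` ?K" "mexp h e" h' q] lookup_mexp[of ?K e h]
  by (simp add: keys_move_exponent)
 also have "... = (SUM r:{r : move h ` ?K. move h' r = q}. SUM p:{p : {p : ?K. move (h' o h) p = q}. move h p = r}. lkp e p)"
  by (intro sum.cong refl) (auto simp: move_def)
 also have "... = (SUM p:{p : ?K. move (h' o h) p = q}. lkp e p)"
  by (rule sum.group) (auto simp: move_def)
 also have "... = lkp (mexp (h' o h) e) q" using lookup_mexp[of ?K e "h' o h" q] by simp
 finally show "lkp (mexp h' (mexp h e)) q = lkp (mexp (h' o h) e) q" .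
qed

lemma move_exponent_cong: "(!!p. p : kys e ==> move h p = move h' p) ==> mexp h e = mexp h' e"
 unfolding move_exponent_def by (rule sum.cong) auto

lemma move_exponent_id: "mexp (%t. t) e = e"
proof (rule poly_mapping_eqI)
 fix q
 have "{p : insert q (kys e). move (%t. t) p = q} = {q}" by auto
 thus "lkp (mexp (%t. t) e) q = lkp e q"
  using lookup_mexp[of "insert q (kys e)" e "%t. t" q] by auto
qed

definition exps :: "(nat * nat) set => (nat => nat) => (nat * nat \<Rightarrow>\<^sub>0 nat) => (nat * nat \<Rightarrow>\<^sub>0 nat) set" where
 "exps P h e = {e'. kys e' <= P & mexp h e' = e}"

text \<open>No exponent of a preimage exceeds the exponent of its image coordinate in
  \<open>e\<close>. Thus each coefficient of a pulled-back power series is a finite sum.\<close>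

lemma finite_exps: assumes "finite P" shows "finite (exps P h e)"
proof -
 let ?N = "Max (insert 0 (lkp e ` kys e))"
 have le: "lkp e q <= ?N" for q by (cases "q : kys e") (auto simp: in_keys_iff intro!: Max_ge)
 have "lkp ` exps P h e <= {f. ALL p. (p : P --> f p : {..?N}) & (p ~: P --> f p = 0)}"
 proof
  fix f assume "f : lkp ` exps P h e"
  then obtain e' where e': "kys e' <= P" "mexp h e' = e" "f = lkp e'" by (auto simp: exps_def)
  have "lkp e' p <= ?N" if "p : P" for p
  proof -
   have "lkp e' p <= (SUM p:{p' : P. move h p' = move h p}. lkp e' p)"
    by (rule member_le_sum) (use that assms in auto)
   also have "... = lkp e (move h p)" using lookup_mexp[OF assms e'(1), of h] e'(2) by simp
   also have "... <= ?N" by (rule le)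
   finally show ?thesis .
  qed
  thus "f : {f. ALL p. (p : P --> f p : {..?N}) & (p ~: P --> f p = 0)}"
   using e' by (auto simp: keys_zero_iff[symmetric])
 qed
 hence "finite (lkp ` exps P h e)"
  by (rule finite_subset) (rule finite_set_of_finite_funs, use assms in auto)
 thus ?thesis by (rule finite_imageD) (auto simp: inj_on_def lookup_inject)
qed

definition fsub :: "nat => nat => nat => (nat => nat) => (nat * nat) set => 'k::field_char_0 mfps => 'k mfps" where
 "fsub u m m' h A f e = (SUM e':exps (vars u m - A) h e. f e')"

lemma formal_sub_id: "fsub u m m (%t. t) A f e = (if kys e <= vars u m - A then f e else 0)"
proof -
 have "exps (vars u m - A) (%t. t) e = (if kys e <= vars u m - A then {e} else {})"
  by (auto simp: exps_def move_exponent_id)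
 thus ?thesis by (simp add: fsub_def)
qed

lemma formal_LP:
 "log_partial (formal_disk u) v m p f e =
   (if snd p < v then of_nat (lkp e p) * f e else of_nat (Suc (lkp e p)) * f (e + sgl p))"
proof -
 have "e - sgl p + sgl p = e" if "lkp e p ~= 0"
  by (rule poly_mapping_eqI) (use that in "auto simp: lookup_add lookup_minus lookup_single when_def")
 thus ?thesis by (auto simp: log_partial_def formal_disk_def lookup_minus)
qed

lemma formal_sel: "ddim (formal_disk u) = u" "fun_scale (formal_disk u) = (%a f e. a * f e)"
 "regular (formal_disk u) m = {f. ALL e. f e ~= 0 --> kys e <= vars u m}"
 "fun_one (formal_disk u) m e = (if e = 0 then 1 else 0)"
 "fun_pull (formal_disk u) m m' h f = fsub u m m' h {} f"
 by (auto simp: formal_disk_def fsub_def exps_def)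

lemma lookup_exps: assumes "e' : exps (vars u m - A) h e"
 shows "lkp e q = (SUM p:{p : vars u m. p ~: A & move h p = q}. lkp e' p)"
proof -
 have "lkp e q = (SUM p:{p : vars u m - A. move h p = q}. lkp e' p)"
  using lookup_mexp[of "vars u m - A" e' h q] assms by (auto simp: exps_def)
 also have "{p : vars u m - A. move h p = q} = {p : vars u m. p ~: A & move h p = q}" by auto
 finally show ?thesis .
qed

text \<open>Shifting the exponent at \<open>p\<close> brings the plain derivation into the shape of
  the logarithmic one, multiplication by the exponent; the terms with exponent 0 missed by the shift
  are zero.\<close>

lemma formal_sub_D_plain: fixes f :: "'k::field_char_0 mfps"
 assumes q: "q = move h p" "p : vars u m - A"
 shows "(SUM e':exps (vars u m - A) h e. of_nat (Suc (lkp e' p)) * f (e' + sgl p))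
  = (SUM e':exps (vars u m - A) h (e + sgl q). of_nat (lkp e' p) * f e')"
proof -
 let ?X = "exps (vars u m - A) h"
 have r: "e' - sgl p + sgl p = e'" if "lkp e' p ~= 0" for e' :: "nat * nat \<Rightarrow>\<^sub>0 nat"
  by (rule poly_mapping_eqI) (use that in "auto simp: lookup_add lookup_minus lookup_single when_def")
 have bij: "bij_betw (%e'. e' + sgl p) (?X e) {e' : ?X (e + sgl q). lkp e' p ~= 0}"
 proof (rule bij_betw_byWitness[where f' = "%e'. e' - sgl p"])
  show "(%e'. e' + sgl p) ` ?X e <= {e' : ?X (e + sgl q). lkp e' p ~= 0}"
  using keys_add q by (force simp: exps_def move_exponent_add move_exponent_single lookup_add)
  show "(%e'. e' - sgl p) ` {e' : ?X (e + sgl q). lkp e' p ~= 0} <= ?X e"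
  proof
   fix e'' assume "e'' : (%e'. e' - sgl p) ` {e' : ?X (e + sgl q). lkp e' p ~= 0}"
   then obtain e' where e': "e'' = e' - sgl p" "kys e' <= vars u m - A" "mexp h e' = e + sgl q" "lkp e' p ~= 0"
    by (auto simp: exps_def)
   have "kys e'' <= kys e'" unfolding e'(1) by (auto simp: in_keys_iff lookup_minus)
   moreover have "mexp h e'' + sgl q = e + sgl q"
    using r[OF e'(4)] e'(3) move_exponent_add[of h e'' "sgl p"] move_exponent_single[of h p] q(1) e'(1) by simp
   ultimately show "e'' : ?X e" using e'(2) by (auto simp: exps_def)
  qed qed (use r in auto)
 have fin: "finite (?X (e + sgl q))" by (rule finite_exps) simp
 have "(SUM e':?X e. of_nat (Suc (lkp e' p)) * f (e' + sgl p)) = (SUM e':?X e. of_nat (lkp (e' + sgl p) p) * f (e' + sgl p))"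
  by (rule sum.cong) (auto simp: lookup_add)
 also have "... = (SUM e':{e' : ?X (e + sgl q). lkp e' p ~= 0}. of_nat (lkp e' p) * f e')"
  by (rule sum.reindex_bij_betw[OF bij])
 also have "... = (SUM e':?X (e + sgl q). of_nat (lkp e' p) * f e')"
  by (rule sum.mono_neutral_left) (use fin in auto)
 finally show ?thesis .
qed

text \<open>On monomials the Euler field is multiplication by the total degree in the logarithmic
  coordinates of the group. In characteristic 0 it can be divided out as soon as no monomial of
  degree 0 occurs.\<close>

theorem formal_log_disk: assumes "v <= u"
 shows "log_disk (formal_disk u :: ('k::field_char_0, 'k mfps) disk_functions) v (fsub u)"
proof -
 let ?F = "formal_disk u :: ('k, 'k mfps) disk_functions"
 let ?D = "log_partial ?F v"
 interpret V: vector_space "fun_scale ?F"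
  by standard (auto simp: formal_sel algebra_simps fun_eq_iff)
 have plus: "(f + g) e = f e + g e" for f g :: "'k mfps" and e by simp
 have vk: "kys e <= vars u m" if "f : regular ?F m" "f e ~= 0" for f m e using that by (auto simp: formal_sel)
 have ss: "fsub u m' m'' h' A' (fsub u m m' h A f) = fsub u m m'' (h' o h) (A Un {p. move h p : A'}) f"
  if vs: "valid_sub u m m' h A" for m m' m'' h h' A A' and f :: "'k mfps"
 proof
  fix e
  let ?B = "A Un {p. move h p : A'}"
  have mv: "move h ` K <= vars u m' - A' <-> K <= vars u m - ?B" if "K <= vars u m - A" for K
   using vs that by (auto simp: valid_sub_def vars_def)
  have "fsub u m' m'' h' A' (fsub u m m' h A f) e
    = (SUM e'':exps (vars u m' - A') h' e. SUM e':{e' : exps (vars u m - ?B) (h' o h) e. mexp h e' = e''}. f e')"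
   unfolding fsub_def
  proof (rule sum.cong[OF refl])
   fix e'' assume "e'' : exps (vars u m' - A') h' e"
   hence "exps (vars u m - A) h e'' = {e' : exps (vars u m - ?B) (h' o h) e. mexp h e' = e''}"
    using keys_move_exponent[of h] by (auto simp: exps_def move_exponent_comp[symmetric])
   thus "(SUM e':exps (vars u m - A) h e''. f e') = (SUM e':{e' : exps (vars u m - ?B) (h' o h) e. mexp h e' = e''}. f e')"
    by simp
  qed
  also have "... = (SUM e':exps (vars u m - ?B) (h' o h) e. f e')"
  proof (rule sum.group)
   show "mexp h ` exps (vars u m - ?B) (h' o h) e <= exps (vars u m' - A') h' e"
   proof (rule image_subsetI)
    fix e' assume "e' : exps (vars u m - ?B) (h' o h) e"
    hence e': "kys e' <= vars u m - ?B" "mexp h' (mexp h e') = e"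
     by (auto simp: exps_def move_exponent_comp)
    hence "kys e' <= vars u m - A" by blast
    thus "mexp h e' : exps (vars u m' - A') h' e"
     using mv[of "kys e'"] e' by (simp add: exps_def keys_move_exponent)
   qed qed (simp_all add: finite_exps)
  finally show "fsub u m' m'' h' A' (fsub u m m' h A f) e = fsub u m m'' (h' o h) ?B f e"
   by (simp add: fsub_def)
 qed
 have eul: "(\<Sum>s<v. ?D m (t, s) f) e = of_nat (\<Sum>s<v. lkp e (t, s)) * f e" for m t f e
  unfolding sum_fun_at by (simp add: formal_LP sum_distrib_right)
 show ?thesis
 proof
  show "v <= ddim ?F" using assms by (simp add: formal_sel)
  show "V.subspace (regular ?F m)" for m
  proof -
   have "f + g : regular ?F m" if fg: "f : regular ?F m" "g : regular ?F m" for f g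
    unfolding formal_sel(3) mem_Collect_eq
   proof (intro allI impI)
    fix e assume "(f + g) e ~= 0"
    thus "kys e <= vars u m" using vk[OF fg(1), of e] vk[OF fg(2), of e] by (cases "f e = 0") simp_all
   qed
   moreover have "fun_scale ?F a f : regular ?F m" if f: "f : regular ?F m" for a f
    unfolding formal_sel(3) mem_Collect_eq using vk[OF f] by (simp add: formal_sel(2))
   moreover have "0 : regular ?F m" by (simp add: formal_sel(3))
   ultimately show ?thesis unfolding V.subspace_def by blast
  qed
  show "bij_betw (%a. fun_scale ?F a (fun_one ?F 0)) UNIV (regular ?F 0)"
  proof (rule bij_betw_byWitness[where f' = "%f. f 0"])
   show "ALL f:regular ?F 0. fun_scale ?F (f 0) (fun_one ?F 0) = f"
    by (auto simp: formal_sel fun_eq_iff vars_def)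
  qed (auto simp: formal_sel split: if_splits)
 next fix p m and f :: "'k mfps" assume p: "p : vars (ddim ?F) m" and f: "f : regular ?F m"
  have "kys e <= kys (e + sgl p)" for e by (auto simp: in_keys_iff lookup_add)
  thus "?D m p f : regular ?F m" using f by (auto simp: formal_sel formal_LP)
  show "?D m p (fun_scale ?F a f) = fun_scale ?F a (?D m p f)" for a
   by (auto simp: formal_sel formal_LP)
  fix q assume q: "q : vars (ddim ?F) m"
  show "?D m p (?D m q f) = ?D m q (?D m p f)"
   by (cases "p = q") (auto simp: formal_LP fun_eq_iff lookup_add lookup_single when_def add.commute add.left_commute)
 next show "additive_on (regular ?F m) (?D m p)" for m p
   by (auto simp: additive_on_def formal_LP algebra_simps)
  show "additive_on (regular ?F m) (fsub u m m' h A)" for m m' h A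
   by (auto simp: additive_on_def fsub_def sum.distrib)
  show "fsub u m m' h A (fun_scale ?F a f) = fun_scale ?F a (fsub u m m' h A f)" for m m' h A a f
   by (auto simp: fsub_def formal_sel sum_distrib_left)
  show "fun_pull ?F m m' h f = fsub u m m' h {} f" for m m' h f by (simp add: formal_sel)
 next
  fix m m' h A and f :: "'k mfps" assume vs: "valid_sub (ddim ?F) m m' h A" and f: "f : regular ?F m"
  have "kys e <= vars u m'" if ne: "fsub u m m' h A f e ~= 0" for e
  proof -
   obtain e' where "e' : exps (vars u m - A) h e" using ne by (force simp: fsub_def)
   hence "kys e = move h ` kys e'" "kys e' <= vars u m - A"
    unfolding exps_def using keys_move_exponent[of h e'] by simp_all
   thus ?thesis using vs by (auto simp: formal_sel valid_sub_def vars_def)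
  qed
  thus "fsub u m m' h A f : regular ?F m'" by (simp add: formal_sel)
  show "fsub u m' m'' h' A' (fsub u m m' h A f) = fsub u m m'' (h' o h) (A Un {p. move h p : A'}) f" for m'' h' A'
   using ss vs by (simp add: formal_sel)
  show "fsub u m m' h A (?D m p f) = 0" if "p : A" "snd p < v" for p
  proof
   fix e
   have "lkp e' p = 0" if "e' : exps (vars u m - A) h e" for e'
    using that \<open>p : A\<close> by (auto simp: exps_def keys_zero_iff[symmetric])
   thus "fsub u m m' h A (?D m p f) e = 0 e"
    using that by (simp add: fsub_def formal_LP)
  qed
  fix q assume q: "q : vars (ddim ?F) m'"
  show "?D m' q (fsub u m m' h A f)
    = (SUM p:{p : vars (ddim ?F) m. p ~: A & move h p = q}. fsub u m m' h A (?D m p f))"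
  proof
   fix e
   let ?P = "{p : vars u m. p ~: A & move h p = q}" and ?X = "exps (vars u m - A) h"
   have sq: "snd p = snd q" if "p : ?P" for p using that move_snd[of h p] by auto
   have s: "(SUM p:?P. fsub u m m' h A (?D m p f)) e = (SUM p:?P. fsub u m m' h A (?D m p f) e)"
    by (rule sum_fun_at)
   have c: "(SUM p:?P. SUM e':?X e. of_nat (lkp e' p) * f e') = of_nat (lkp e q) * (SUM e':?X e. f e')" for e
   proof -
    have "(SUM p:?P. SUM e':?X e. of_nat (lkp e' p) * f e') = (SUM e':?X e. SUM p:?P. of_nat (lkp e' p) * f e')"
     by (rule sum.swap)
    also have "... = (SUM e':?X e. of_nat (lkp e q) * f e')"
     by (rule sum.cong[OF refl]) (simp add: lookup_exps[of _ u m A h e q] sum_distrib_right)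
    finally show ?thesis by (simp add: sum_distrib_left)
   qed
   have "?D m' q (fsub u m m' h A f) e = (SUM p:?P. fsub u m m' h A (?D m p f) e)"
   proof (cases "snd q < v")
    case True thus ?thesis using c[of e] sq by (simp add: formal_LP fsub_def)
   next case False have "(SUM p:?P. fsub u m m' h A (?D m p f) e)
     = (SUM p:?P. SUM e':?X e. of_nat (Suc (lkp e' p)) * f (e' + sgl p))"
     using False sq by (intro sum.cong refl) (simp add: formal_LP fsub_def)
    also have "... = (SUM p:?P. SUM e':?X (e + sgl q). of_nat (lkp e' p) * f e')"
     by (rule sum.cong[OF refl], rule formal_sub_D_plain) auto
    also have "... = of_nat (lkp (e + sgl q) q) * (SUM e':?X (e + sgl q). f e')" by (rule c)
    finally show ?thesis using False by (simp add: formal_LP fsub_def lookup_add)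
   qed
   thus "?D m' q (fsub u m m' h A f) e
     = (SUM p:{p : vars (ddim ?F) m. p ~: A & move h p = q}. fsub u m m' h A (?D m p f)) e"
    using s by (simp add: formal_sel)
  qed
 next show "fsub u m m (%t. t) {} f = f" if "f : regular ?F m" for m f
   using that by (auto simp: formal_sub_id formal_sel fun_eq_iff)
  show "fsub u m m' h A f = fsub u m m' h' A' f"
   if "f : regular ?F m" "!!p. p : vars (ddim ?F) m ==> p : A <-> p : A'"
    "!!t s. t < m ==> s < ddim ?F ==> (t, s) ~: A ==> h t = h' t" for m m' h h' A A' f
  proof
   fix e
   have "vars u m - A = vars u m - A'" using that(2) by (auto simp: formal_sel)
   moreover have "mexp h e' = mexp h' e'" if "kys e' <= vars u m - A" for e'
    by (rule move_exponent_cong) (use that \<open>!!t s. t < m ==> s < ddim ?F ==> (t, s) ~: A ==> h t = h' t\<close> in "auto simp: formal_sel vars_def")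
   ultimately have "exps (vars u m - A) h e = exps (vars u m - A') h' e" by (auto simp: exps_def)
   thus "fsub u m m' h A f e = fsub u m m' h' A' f e" by (simp add: fsub_def)
  qed
 next
  fix t m s and g :: "'k mfps" assume a: "t < m" "v <= s" "s < ddim ?F" and g: "g : regular ?F m"
  let ?p = "(t, s)"
  \<comment> \<open>Termwise integration, with the part free of \<open>?p\<close> chosen to be
    zero.\<close>
  let ?f = "%e. if lkp e ?p = 0 then 0 else g (e - sgl ?p) / of_nat (lkp e ?p)"
  have "kys e <= insert ?p (kys (e - sgl ?p))" for e by (auto simp: in_keys_iff lookup_minus lookup_single when_def split: if_splits)
  hence "?f : regular ?F m" using g a by (fastforce simp: formal_sel)
  moreover have "?D m ?p ?f = g"
   using a by (auto simp: formal_LP fun_eq_iff lookup_add simp del: of_nat_Suc)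
  ultimately show "EX f:regular ?F m. ?D m ?p f = g" by blast
 next
  fix t m s and f :: "'k mfps" assume a: "t < m" "v <= s" "s < ddim ?F" and f: "f : regular ?F m" and d: "?D m (t, s) f = 0"
  let ?p = "(t, s)"
  have "f e = 0" if "lkp e ?p ~= 0" for e
  proof -
   have "e - sgl ?p + sgl ?p = e"
    by (rule poly_mapping_eqI) (use that in "auto simp: lookup_add lookup_minus lookup_single when_def")
   moreover have "?D m ?p f (e - sgl ?p) = 0" using d by simp
   ultimately show ?thesis using a by (simp add: formal_LP del: of_nat_Suc)
  qed
  thus "fsub u m m (%t. t) {?p} f = f" using vk[OF f] by (auto simp: formal_sub_id fun_eq_iff)
 next
  fix t m and g :: "'k mfps" assume t: "t < m" and g: "g : regular ?F m" and z: "fsub u m m (%t. t) ({t} \<times> {..<v}) g = 0"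
  let ?N = "%e. \<Sum>s<v. lkp e (t, s)"
  \<comment> \<open>Where \<open>?N e = 0\<close> the quotient is 0 by convention, in agreement with
    \<open>g e = 0\<close> there.\<close>
  let ?f = "%e. g e / of_nat (?N e)"
  have "?f : regular ?F m" using g by (auto simp: formal_sel)
  moreover have "(\<Sum>s<v. ?D m (t, s) ?f) = g"
  proof
   fix e
   show "(\<Sum>s<v. ?D m (t, s) ?f) e = g e" unfolding eul
   proof (cases "?N e = 0")
    case True hence "kys e Int {t} \<times> {..<v} = {}" by auto
    hence "g e = 0" using fun_cong[OF z, of e] vk[OF g, of e] by (auto simp: formal_sub_id split: if_splits)
    thus "of_nat (?N e) * ?f e = g e" by simp
   qed (simp del: of_nat_sum)
  qed
  ultimately show "EX f:regular ?F m. (\<Sum>s<v. ?D m (t, s) f) = g" by blast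
 next
  fix t m and f :: "'k mfps" assume t: "t < m" and f: "f : regular ?F m" and z: "(\<Sum>s<v. ?D m (t, s) f) = 0"
  have "(\<Sum>s<v. lkp e (t, s)) = 0" if "f e ~= 0" for e
   using fun_cong[OF z, of e] that unfolding eul by (simp del: of_nat_sum)
  hence "kys e Int {t} \<times> {..<v} = {}" if "f e ~= 0" for e using that by auto
  thus "fsub u m m (%t. t) ({t} \<times> {..<v}) f = f"
   using vk[OF f] by (auto simp: formal_sub_id fun_eq_iff)
 qed qed

abbreviation "int01 \<equiv> integral (cbox (0::real) 1)"

section \<open>Functions on complete Reinhardt domains\<close>

type_synonym 'k point = "nat * nat => 'k"

text \<open>\<open>C_k_on\<close> over an arbitrary real normed field, so that the smooth and the
  analytic disk are treated together.\<close>

fun Ck :: "nat => ('k::real_normed_field) point set => (nat * nat) set => ('k point => 'k) => bool" where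
 "Ck 0 X V f <-> continuous_on X f"
| "Ck (Suc k) X V f <-> continuous_on X f & has_partials_on X V f & (ALL p:V. Ck k X V (partial_on X p f))"

lemma Ck_C_k_on: "Ck k X V f <-> C_k_on k X V f" by (induction k arbitrary: f) auto

definition has_partial :: "('k point => 'k::real_normed_field) => nat * nat => 'k point => 'k => bool" where
 "has_partial f p x d <-> ((%w. f (x(p := w))) has_field_derivative d) (at (x p))"

lemma has_partial_partial_on: "x : X ==> has_partial f p x d ==> partial_on X p f x = d"
 unfolding has_partial_def partial_on_def by (auto dest: DERIV_imp_deriv)

lemma has_partials_onD: "has_partials_on X V f ==> x : X ==> p : V ==> has_partial f p x (partial_on X p f x)"
 unfolding has_partials_on_def has_partial_def partial_on_def by (auto intro: field_differentiable_derivI)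

lemma has_partials_onI: "(!!x p. x : X ==> p : V ==> has_partial f p x (d x p)) ==> has_partials_on X V f"
 unfolding has_partials_on_def has_partial_def field_differentiable_def by blast

lemma Ck_continuous: "Ck k X V f ==> continuous_on X f" by (cases k) auto

text \<open>Solidity keeps the segments from a point to its projections onto coordinate subspaces
  inside the domain. Openness refers to the finitely many coordinates in \<open>V\<close> only, the
  others being zero.\<close>

locale solid_domain =
 fixes X :: "('k::{real_normed_field, banach}) point set" and V :: "(nat * nat) set"
 assumes finite_V: "finite V" and X_zero: "x : X ==> p ~: V ==> x p = 0" and zero_X: "(%_. 0) : X"
  and X_solid: "x : X ==> (!!p. norm (y p) <= norm (x p)) ==> y : X"
  and X_open: "x : X ==> EX e>0. ALL y. (ALL p:V. norm (y p - x p) < e) --> (ALL p. p ~: V --> y p = 0) --> y : X"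
begin

abbreviation "pd \<equiv> partial_on X"
abbreviation "C k \<equiv> Ck k X V"

lemma X_upd: assumes "x : X" "p : V" shows "EX e>0. ALL w:ball (x p) e. x(p := w) : X"
  using X_open assms X_zero by (force simp: dist_norm norm_minus_commute)

lemma has_partial_cong: assumes "x : X" "p : V" "!!y. y : X ==> f y = g y" "has_partial g p x d"
 shows "has_partial f p x d"
proof -
 obtain e where "e > 0" "ALL w:ball (x p) e. x(p := w) : X" using X_upd assms(1,2) by blast
 thus ?thesis unfolding has_partial_def
  by (intro has_field_derivative_transform_within_open[OF assms(4)[unfolded has_partial_def] open_ball[of "x p" e]])
   (simp_all add: assms(3))
qed

lemma pd_outside: "x ~: X ==> pd p f x = 0" by (simp add: partial_on_def)

lemma pd_eq:
 assumes "!!x. x : X ==> has_partial f p x (g x)" shows "pd p f = (%x. if x : X then g x else 0)"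
 using has_partial_partial_on[OF _ assms] pd_outside by (auto simp: fun_eq_iff)

text \<open>The cutoff is that of \<open>partial_on\<close>, which is zero outside \<open>X\<close>,
  so the partial derivatives are identified as total functions.\<close>

lemma Ck_SucI: assumes "continuous_on X f" "!!x p. x : X ==> p : V ==> has_partial f p x (g p x)"
  "!!p. p : V ==> C k (%x. if x : X then g p x else 0)" shows "C (Suc k) f"
proof -
 have "C k (pd p f)" if p: "p : V" for p
 proof -
  have "pd p f = (%x. if x : X then g p x else 0)" by (rule pd_eq) (rule assms(2)[OF _ p])
  thus ?thesis using assms(3)[OF p] by simp
 qed
 moreover have "has_partials_on X V f" by (rule has_partials_onI[OF assms(2)])
 ultimately show ?thesis using assms(1) by simp
qed

lemma Ck_SucD:
 assumes "C (Suc k) f" "p : V" shows "C k (pd p f)" "x : X ==> has_partial f p x (pd p f x)" "C k f"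
proof -
 show "C k (pd p f)" using assms by simp
 have "has_partials_on X V f" using assms(1) by simp
 thus "x : X ==> has_partial f p x (pd p f x)" using has_partials_onD assms(2) by blast
 have "C (Suc k) f ==> C k f" for f k by (induction k arbitrary: f) auto
 thus "C k f" using assms(1) by blast
qed

lemma Ck_cong: "(!!x. x : X ==> f x = g x) ==> C k f <-> C k g"
proof -
 have "C k f" if "C k g" "!!x. x : X ==> f x = g x" for f g
 proof (cases k)
  case 0 thus ?thesis using that by simp
 next case (Suc j)
  have h: "has_partial f p x (pd p g x)" if "x : X" "p : V" for x p
   by (rule has_partial_cong[OF that _ Ck_SucD(2)[OF \<open>C k g\<close>[unfolded Suc] that(2,1)]])
    (rule \<open>!!x. x : X ==> f x = g x\<close>)
  have "(%x. if x : X then pd p g x else 0) = pd p g" for p using pd_outside by (auto simp: fun_eq_iff)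
  thus ?thesis unfolding Suc by (intro Ck_SucI[where g = "%p. pd p g"] h)
    (use that Suc continuous_on_cong[OF refl that(2)] in auto)
 qed
 thus "(!!x. x : X ==> f x = g x) ==> C k f <-> C k g" by metis
qed

lemma Ck_const: "C k (%x. a)"
proof (induction k arbitrary: a)
 case (Suc k)
 show ?case by (rule Ck_SucI[where g = "%p x. 0"]) (use Suc[of 0] in "auto simp: has_partial_def")
qed simp

lemma has_partial_add: "has_partial f p x d ==> has_partial g p x d' ==> has_partial (%x. f x + g x) p x (d + d')"
 unfolding has_partial_def by (rule DERIV_add)

lemma has_partial_cmult: "has_partial f p x d ==> has_partial (%x. a * f x) p x (a * d)"
 unfolding has_partial_def by (rule DERIV_cmult)

lemma Ck_add: "C k f ==> C k g ==> C k (%x. f x + g x)"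
proof (induction k arbitrary: f g)
 case 0 thus ?case by (simp add: continuous_on_add)
next case (Suc k)
 show ?case
 proof (rule Ck_SucI[where g = "%p x. pd p f x + pd p g x"])
  show "continuous_on X (%x. f x + g x)" using Suc.prems by (auto intro: continuous_on_add)
  show "x : X ==> p : V ==> has_partial (%x. f x + g x) p x (pd p f x + pd p g x)" for x p
   by (intro has_partial_add Ck_SucD(2)[OF Suc.prems(1)] Ck_SucD(2)[OF Suc.prems(2)])
  fix p assume p: "p : V"
  have "C k (%x. pd p f x + pd p g x)" using Ck_SucD(1) Suc.prems p by (intro Suc.IH) auto
  thus "C k (%x. if x : X then pd p f x + pd p g x else 0)" by (subst Ck_cong) auto
 qed qed

lemma Ck_cmult: "C k f ==> C k (%x. a * f x)"
proof (induction k arbitrary: f)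
 case 0 thus ?case by (simp add: continuous_on_mult_left)
next case (Suc k)
 show ?case
 proof (rule Ck_SucI[where g = "%p x. a * pd p f x"])
  show "continuous_on X (%x. a * f x)" using Suc.prems by (auto intro: continuous_on_mult_left)
  show "x : X ==> p : V ==> has_partial (%x. a * f x) p x (a * pd p f x)" for x p
   by (intro has_partial_cmult Ck_SucD(2)[OF Suc.prems])
  fix p assume p: "p : V"
  have "C k (%x. a * pd p f x)" using Ck_SucD(1) Suc.prems p by (intro Suc.IH) auto
  thus "C k (%x. if x : X then a * pd p f x else 0)" by (subst Ck_cong) auto
 qed qed

lemma Ck_sum: "finite A ==> (!!i. i : A ==> C k (f i)) ==> C k (%x. SUM i:A. f i x)"
 by (induction A rule: finite_induct) (auto intro: Ck_const Ck_add)

lemma coord_continuous: "continuous_on S (%x :: 'k point. x p)"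
 by (rule continuous_on_subset[OF continuous_on_product_coordinates]) simp

lemma has_partial_coord: "has_partial f q x d ==> has_partial (%x. x p * f x) q x ((if q = p then f x else 0) + x p * d)"
 unfolding has_partial_def by (cases "q = p") (auto intro!: derivative_eq_intros simp: fun_upd_idem)

lemma Ck_coord: "C k f ==> C k (%x. x p * f x)"
proof (induction k arbitrary: f)
 case 0 thus ?case by (auto intro: continuous_on_mult coord_continuous)
next case (Suc k)
 show ?case
 proof (rule Ck_SucI[where g = "%q x. (if q = p then f x else 0) + x p * pd q f x"])
  show "continuous_on X (%x. x p * f x)" using Suc.prems by (auto intro: continuous_on_mult coord_continuous)
  show "x : X ==> q : V ==> has_partial (%x. x p * f x) q x ((if q = p then f x else 0) + x p * pd q f x)" for x q
   by (intro has_partial_coord Ck_SucD(2)[OF Suc.prems])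
  fix q assume q: "q : V"
  have "C k (%x. x p * pd q f x)" using Ck_SucD(1) Suc.prems q by (intro Suc.IH) auto
  hence "C k (%x. (if q = p then f x else 0) + x p * pd q f x)"
   by (rule Ck_add[rotated]) (use Ck_SucD(3)[OF Suc.prems q] Ck_const[of k 0] in \<open>cases "q = p"; simp\<close>)
  thus "C k (%x. if x : X then (if q = p then f x else 0) + x p * pd q f x else 0)" by (subst Ck_cong) auto
 qed qed

subsection \<open>The chain rule\<close>

text \<open>Coordinates join the direction one at a time. With one parameter \<open>w\<close> for
  those already treated and another one \<open>z\<close> for the new one, differentiability in
  \<open>w\<close> and a continuous derivative in \<open>z\<close> give a total derivative, which is
  then restricted to \<open>w = z\<close>.\<close>

lemma chain_rule: assumes f: "C (Suc 0) f" and x: "x : X" and B: "B <= V"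
 shows "((%w. f (%p. if p : B then x p + w * c p else x p)) has_field_derivative (SUM p:B. c p * pd p f x)) (at 0)"
proof -
 have "finite B" using B finite_V by (rule finite_subset)
 thus ?thesis using B
 proof (induction B rule: finite_induct)
  case (insert b B)
  let ?pt = "%w z p. if p : B then x p + w * c p else if p = b then x b + z * c b else x p"
  obtain e where e: "e > 0" "!!y. (ALL p:V. norm (y p - x p) < e) ==> (ALL p. p ~: V --> y p = 0) ==> y : X"
   using X_open[OF x] by blast
  \<comment> \<open>\<open>N\<close> exceeds the norms of all \<open>c p\<close> involved, so
    parameters below \<open>e / N\<close> move every coordinate by less than
    \<open>e\<close>.\<close>
  define N where "N = 1 + (SUM p:insert b B. norm (c p))"
  have cN: "norm (c p) < N" if "p : insert b B" for p
   using member_le_sum[OF that, of "%p. norm (c p)"] insert.hyps(1) unfolding N_def by force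
  have N: "N > 0" using cN[of b] norm_ge_zero[of "c b"] by (meson insertI1 le_less_trans)
  define W where "W = (ball 0 (e / N) :: 'k set)"
  have W: "0 : W" "open W" "convex W" using e(1) N by (auto simp: W_def)
  have sm: "norm (w * c p) < e" if "w : W" "p : insert b B" for w p
  proof -
   have "norm w * norm (c p) <= norm w * N" using cN[OF that(2)] by (intro mult_left_mono) auto
   also have "... < e" using that(1) N by (simp add: W_def field_simps)
   finally show ?thesis by (simp add: norm_mult)
  qed
  have ptX: "?pt w z : X" if "w : W" "z : W" for w z
   by (rule e(2)) (use sm that e(1) X_zero[OF x] insert.prems in auto)
  have pt_cont: "continuous_on S (%(w, z). ?pt w z)" for S :: "('k \<times> 'k) set"
   unfolding split_beta
  proof (rule continuous_on_coordinatewise_then_product)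
   show "continuous_on S (%wz. ?pt (fst wz) (snd wz) i)" for i
    by (cases "i : B"; cases "i = b") (auto intro!: continuous_intros)
  qed
  have pdc: "continuous_on X (pd b f)" using f insert.prems by auto
  have "((%(w, z). f (?pt w z)) has_derivative (%(tx, ty). (SUM p:B. c p * pd p f x) * tx
    + blinfun_apply (blinfun_mult_right (c b * pd b f (?pt 0 0))) ty)) (at (0, 0) within W \<times> W)"
  proof (rule has_derivative_partialsI[where f = "%w z. f (?pt w z)" and fx = "(*) (SUM p:B. c p * pd p f x)"
     and fy = "%w z. blinfun_mult_right (c b * pd b f (?pt w z))"])
   have e0: "?pt w 0 = (%p. if p : B then x p + w * c p else x p)" for w by auto
   have "((%w. f (?pt w 0)) has_field_derivative (SUM p:B. c p * pd p f x)) (at 0)"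
    unfolding e0 using insert.IH insert.prems by simp
   thus "((%w. f (?pt w 0)) has_derivative (*) (SUM p:B. c p * pd p f x)) (at 0 within W)"
    unfolding has_field_derivative_def by (rule has_derivative_at_withinI)
   fix w z assume wz: "w : W" "z : W"
   let ?y = "?pt w z"
   have "has_partial f b ?y (pd b f ?y)" using Ck_SucD(2)[OF f] insert.prems ptX[OF wz] by simp
   hence "((%u. f (?y(b := u))) has_field_derivative pd b f ?y) (at (x b + z * c b))"
    unfolding has_partial_def using insert.hyps(2) by simp
   hence "((%z. f (?y(b := x b + z * c b))) has_field_derivative pd b f ?y * c b) (at z)"
    by (rule DERIV_chain2) (auto intro!: derivative_eq_intros)
   moreover have "?y(b := x b + z' * c b) = ?pt w z'" for z' using insert.hyps(2) by auto
   ultimately have "((%z. f (?pt w z)) has_field_derivative pd b f ?y * c b) (at z)" by simp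
   thus "((%z. f (?pt w z)) has_derivative blinfun_apply (blinfun_mult_right (c b * pd b f (?pt w z)))) (at z within W)"
    unfolding has_field_derivative_def blinfun_mult_right.rep_eq mult.commute[of "c b"]
    by (rule has_derivative_at_withinI)
  next have "continuous_on (W \<times> W) (%wz. pd b f (case wz of (w, z) => ?pt w z))"
    by (rule continuous_on_compose2[OF pdc pt_cont]) (use ptX in auto)
   hence "continuous_on (W \<times> W) (%wz. blinfun_mult_right (c b * pd b f (case wz of (w, z) => ?pt w z)))"
    by (intro bounded_linear.continuous_on[OF bounded_linear_blinfun_mult_right] continuous_intros)
   thus "continuous (at (0, 0) within W \<times> W) (%(w, z). blinfun_mult_right (c b * pd b f (?pt w z)))"
    unfolding continuous_on_eq_continuous_within split_beta using W(1) by auto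
  qed (use W in auto)
  moreover have "?pt 0 0 = x" by auto
  ultimately have 1: "((%(w, z). f (?pt w z)) has_derivative (%(tx, ty). (SUM p:B. c p * pd p f x) * tx + c b * pd b f x * ty)) (at (0, 0) within W \<times> W)"
   by simp
  have 2: "((%w::'k. (w, w)) has_derivative (%t. (t, t))) (at 0 within W)"
   by (intro has_derivative_Pair has_derivative_ident)
  have "((%w. (%(w, z). f (?pt w z)) (w, w)) has_derivative (%t. (%(tx, ty). (SUM p:B. c p * pd p f x) * tx + c b * pd b f x * ty) (t, t))) (at 0 within W)"
   by (rule has_derivative_in_compose[OF 2 has_derivative_subset[OF 1]]) auto
  hence "((%w. f (?pt w w)) has_derivative (%t. (SUM p:insert b B. c p * pd p f x) * t)) (at 0 within W)"
   using insert.hyps by (simp add: algebra_simps)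
  moreover have "?pt w w = (%p. if p : insert b B then x p + w * c p else x p)" for w by auto
  ultimately show ?case unfolding has_field_derivative_def using at_within_open[OF W(1,2)] by simp
 qed simp
qed

end

context solid_domain
begin

subsection \<open>Averages along lines through the coordinate subspaces\<close>

definition sc :: "(nat * nat) set => real => 'k point => 'k point" where
 "sc P r x = (%p. if p : P then of_real r * x p else x p)"

text \<open>The integral operator behind the Poincare lemma, taken along the coordinates in
  \<open>P\<close> only. Every derivative along \<open>P\<close> brings out a factor
  \<open>r\<close>, hence the weight \<open>r ^ j\<close>.\<close>

definition avg :: "(nat * nat) set => nat => ('k point => 'k) => 'k point => 'k" where
 "avg P j f x = (if x : X then int01 (%r. of_real r ^ j * f (sc P r x)) else 0)"

lemma sc_in: "x : X ==> r : cbox 0 1 ==> sc P r x : X"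
 by (erule X_solid) (auto simp: sc_def norm_mult intro: mult_left_le_one_le)

lemma sc_1 [simp]: "sc P 1 x = x" by (auto simp: sc_def)

lemma sc_upd: "sc P r (x(q := w)) = (sc P r x)(q := (if q : P then of_real r else 1) * w)"
 by (auto simp: sc_def)

lemma sc_continuous: assumes h: "continuous_on X h" and g: "continuous_on S g" "continuous_on S r"
  "!!s. s : S ==> g s : X" "!!s. s : S ==> r s : cbox 0 1"
 shows "continuous_on S (%s. h (sc P (r s) (g s)))"
proof (rule continuous_on_compose2[OF h])
 have c: "continuous_on S (%s. g s p)" for p
  by (rule continuous_on_compose2[OF coord_continuous[of UNIV] g(1)]) simp
 have "continuous_on S (%s. of_real (r s) * g s p)" for p
  by (intro continuous_on_mult continuous_on_of_real g(2) c)
 hence "continuous_on S (%s. sc P (r s) (g s) p)" for p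
  using c by (cases "p : P") (simp_all add: sc_def)
 thus "continuous_on S (%s. sc P (r s) (g s))" by (rule continuous_on_coordinatewise_then_product)
qed (use sc_in g in auto)

lemma sc_integrable: fixes h :: "'k point => 'k" assumes "continuous_on X h" "x : X"
 shows "(%r. of_real r ^ j * h (sc P r x)) integrable_on cbox 0 1"
 by (intro integrable_continuous continuous_on_mult continuous_on_power continuous_on_of_real continuous_on_id
   sc_continuous[OF assms(1)]) (use assms in auto)

lemma avg_continuous: assumes "continuous_on X f" shows "continuous_on X (avg P j f)"
proof -
 have "continuous_on (X \<times> cbox 0 1) (%z. of_real (snd z) ^ j * f (sc P (snd z) (fst z)))"
  by (intro continuous_on_mult continuous_on_power continuous_on_of_real sc_continuous[OF assms] continuous_intros) auto
 hence "continuous_on X (%x. int01 (%r. of_real r ^ j * f (sc P r x)))"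
  using integral_continuous_on_param[of X 0 "1::real" "%x r. of_real r ^ j * f (sc P r x)"] by (simp add: split_beta)
 thus ?thesis by (rule continuous_on_eq) (simp add: avg_def)
qed

lemma upd_continuous: "continuous_on S (%w. (x :: 'k point)(q := w))"
proof (rule continuous_on_coordinatewise_then_product)
 show "continuous_on S (%w. (x(q := w)) i)" for i by (cases "i = q") (simp_all add: continuous_on_id)
qed

lemma has_partial_avg: assumes f: "C (Suc 0) f" and x: "x : X" and q: "q : V"
 shows "has_partial (avg P j f) q x (avg P (if q : P then Suc j else j) (pd q f) x)"
proof -
 obtain e where e: "e > 0" "!!w. w : ball (x q) e ==> x(q := w) : X" using X_upd[OF x q] by blast
 let ?U = "ball (x q) e" and ?j = "if q : P then Suc j else j"
 let ?c = "%r::real. if q : P then of_real r else (1::'k)"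
 have pdc: "continuous_on X (pd q f)" using f q by auto
 have fc: "continuous_on X f" by (rule Ck_continuous[OF f])
 have "((%w. int01 (%r. of_real r ^ j * f (sc P r (x(q := w))))) has_field_derivative
   int01 (%r. of_real r ^ ?j * pd q f (sc P r (x(q := x q))))) (at (x q) within ?U)"
 proof (rule leibniz_rule_field_derivative)
  fix w and r :: real assume w: "w : ?U" and r: "r : cbox 0 1"
  let ?y = "sc P r (x(q := w))"
  have y: "?y : X" using sc_in[OF e(2)[OF w] r] .
  have "has_partial f q ?y (pd q f ?y)" by (rule Ck_SucD(2)[OF f q y])
  moreover have "?y q = ?c r * w" by (simp add: sc_def)
  ultimately have "((%z. f (?y(q := z))) has_field_derivative pd q f ?y) (at (?c r * w))"
   unfolding has_partial_def by simp
  hence "((%w'. f (?y(q := ?c r * w'))) has_field_derivative pd q f ?y * ?c r) (at w)"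
   by (rule DERIV_chain2) (auto intro!: derivative_eq_intros)
  moreover have "?y(q := ?c r * w') = sc P r (x(q := w'))" for w' by (auto simp: sc_def)
  ultimately have "((%w'. f (sc P r (x(q := w')))) has_field_derivative pd q f ?y * ?c r) (at w)" by simp
  hence d: "((%w'. of_real r ^ j * f (sc P r (x(q := w')))) has_field_derivative of_real r ^ j * (pd q f ?y * ?c r)) (at w)"
   by (rule DERIV_cmult)
  have eq: "of_real r ^ j * (pd q f ?y * ?c r) = of_real r ^ ?j * pd q f ?y" by simp
  show "((%w'. of_real r ^ j * f (sc P r (x(q := w')))) has_field_derivative of_real r ^ ?j * pd q f ?y) (at w within ?U)"
   using has_field_derivative_at_within[OF d, of ?U] unfolding eq .
 next fix w assume "w : ?U"
  thus "(%r. of_real r ^ j * f (sc P r (x(q := w)))) integrable_on cbox 0 1"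
   using sc_integrable[OF fc] e(2) by blast
 next
  have "continuous_on (?U \<times> cbox 0 1) (%z. of_real (snd z) ^ ?j * pd q f (sc P (snd z) (x(q := fst z))))"
   by (intro continuous_on_mult continuous_on_power continuous_on_of_real sc_continuous[OF pdc]
     continuous_on_compose2[OF upd_continuous[of UNIV]] continuous_intros) (use e in auto)
  thus "continuous_on (?U \<times> cbox 0 1) (%(w, r). of_real r ^ ?j * pd q f (sc P r (x(q := w))))"
   by (simp add: split_beta)
 qed (use e in auto)
 hence "((%w. int01 (%r. of_real r ^ j * f (sc P r (x(q := w))))) has_field_derivative avg P ?j (pd q f) x) (at (x q))"
  using at_within_open[of "x q" ?U] e(1) x by (simp add: avg_def)
 thus ?thesis unfolding has_partial_def
  by (rule has_field_derivative_transform_within_open[OF _ open_ball[of "x q" e]]) (use e in "auto simp: avg_def")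
qed

lemma Ck_one: "C (Suc k) f ==> C (Suc 0) f"
proof -
 assume f: "C (Suc k) f"
 have "continuous_on X (pd p f)" if "p : V" for p by (rule Ck_continuous[OF Ck_SucD(1)[OF f that]])
 thus ?thesis using f by simp
qed

lemma Ck_avg: "C k f ==> C k (avg P j f)"
proof (induction k arbitrary: f j)
 case 0 thus ?case by (simp add: avg_continuous)
next case (Suc k)
 show ?case
 proof (rule Ck_SucI[where g = "%q x. avg P (if q : P then Suc j else j) (pd q f) x"])
  show "continuous_on X (avg P j f)" by (rule avg_continuous[OF Ck_continuous[OF Suc.prems]])
  show "x : X ==> q : V ==> has_partial (avg P j f) q x (avg P (if q : P then Suc j else j) (pd q f) x)" for x q
   by (rule has_partial_avg[OF Ck_one[OF Suc.prems]])
  fix q assume q: "q : V"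
  have "C k (avg P (if q : P then Suc j else j) (pd q f))" using Suc.IH Ck_SucD(1)[OF Suc.prems q] .
  thus "C k (%x. if x : X then avg P (if q : P then Suc j else j) (pd q f) x else 0)" by (subst Ck_cong) auto
 qed qed

lemma line_derivative: assumes f: "C (Suc 0) f" and x: "x : X" and P: "P <= V" and r: "r : cbox 0 1"
 shows "((%r. f (sc P r x)) has_vector_derivative (SUM p:P. x p * pd p f (sc P r x))) (at r within S)"
proof -
 let ?y = "sc P r x" and ?g = "%z. f (%p. if p : P then z * x p else x p)"
 have "((%w. f (%p. if p : P then ?y p + w * x p else ?y p)) has_field_derivative (SUM p:P. x p * pd p f ?y)) (at 0)"
  by (rule chain_rule[OF f sc_in[OF x r] P])
 moreover have "(%p. if p : P then ?y p + w * x p else ?y p) = (%p. if p : P then (w + of_real r) * x p else x p)" for w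
  by (auto simp: sc_def algebra_simps)
 ultimately have "((%w. ?g (w + of_real r)) has_field_derivative (SUM p:P. x p * pd p f ?y)) (at 0)" by simp
 hence "(?g has_field_derivative (SUM p:P. x p * pd p f ?y)) (at (0 + of_real r))" by (subst DERIV_shift)
 hence "((%r. ?g (of_real r)) has_vector_derivative (SUM p:P. x p * pd p f ?y)) (at r within S)"
  by (intro has_vector_derivative_real_field) simp
 thus ?thesis by (simp add: sc_def)
qed

lemma line_continuous: "continuous_on X h ==> x : X ==> continuous_on (cbox 0 1) (%r. h (sc P r x))"
 by (rule sc_continuous) auto

text \<open>Hadamard's lemma: the fundamental theorem of calculus on the segment from
  \<open>sc P 0 x\<close> to \<open>x\<close>.\<close>

lemma avg_increment: assumes f: "C (Suc 0) f" and x: "x : X" and P: "P <= V"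
 shows "f x - f (sc P 0 x) = (SUM p:P. x p * avg P 0 (pd p f) x)"
proof -
 have fP: "finite P" using P finite_V by (rule finite_subset)
 have "((%r. SUM p:P. x p * pd p f (sc P r x)) has_integral (f (sc P 1 x) - f (sc P 0 x))) {0..1}"
  by (rule fundamental_theorem_of_calculus) (use line_derivative[OF f x P] in auto)
 hence "f x - f (sc P 0 x) = int01 (%r. SUM p:P. x p * pd p f (sc P r x))"
  by (simp add: integral_unique)
 also have "... = (SUM p:P. int01 (%r. x p * pd p f (sc P r x)))"
 proof (rule integral_sum[OF fP])
  fix p assume "p : P"
  hence "continuous_on X (pd p f)" by (intro Ck_continuous[OF Ck_SucD(1)[OF f]] subsetD[OF P])
  thus "(%r. x p * pd p f (sc P r x)) integrable_on cbox 0 1"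
   by (intro integrable_continuous continuous_on_mult_left line_continuous[OF _ x])
 qed
 also have "... = (SUM p:P. x p * avg P 0 (pd p f) x)" using x by (simp add: avg_def)
 finally show ?thesis .
qed

text \<open>The derivative of \<open>r * f (sc P r x)\<close> is integrated from 0 to 1. The result
  says that 1 plus the Euler field of \<open>P\<close> is inverted by
  \<open>avg P 0\<close>.\<close>

lemma avg_euler: assumes f: "C (Suc 0) f" and x: "x : X" and P: "P <= V"
 shows "avg P 0 f x + (SUM p:P. x p * avg P 1 (pd p f) x) = f x"
proof -
 have fP: "finite P" using P finite_V by (rule finite_subset)
 have "((%r. r *\<^sub>R f (sc P r x)) has_vector_derivative
   r *\<^sub>R (SUM p:P. x p * pd p f (sc P r x)) + 1 *\<^sub>R f (sc P r x)) (at r within {0..1})" if "r : {0..1}" for r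
  by (rule has_vector_derivative_scaleR) (use line_derivative[OF f x P] that in "auto intro!: derivative_eq_intros")
 hence "((%r. r *\<^sub>R (SUM p:P. x p * pd p f (sc P r x)) + 1 *\<^sub>R f (sc P r x)) has_integral
   (1 *\<^sub>R f (sc P 1 x) - 0 *\<^sub>R f (sc P 0 x))) {0..1}"
  by (intro fundamental_theorem_of_calculus) auto
 hence "f x = int01 (%r. f (sc P r x) + (SUM p:P. x p * (of_real r * pd p f (sc P r x))))"
  by (simp add: integral_unique scaleR_conv_of_real sum_distrib_left mult_ac add.commute)
 also have "... = int01 (%r. f (sc P r x))
   + (SUM p:P. int01 (%r. x p * (of_real r * pd p f (sc P r x))))"
 proof -
  have i: "(%r. x p * (of_real r * pd p f (sc P r x))) integrable_on cbox 0 1" if "p : P" for p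
  proof (rule integrable_on_mult_right)
   have "continuous_on X (pd p f)" by (intro Ck_continuous[OF Ck_SucD(1)[OF f]] subsetD[OF P that])
   thus "(%r. of_real r * pd p f (sc P r x)) integrable_on cbox 0 1" using sc_integrable[OF _ x, of "pd p f" 1 P] by simp
  qed
  have "(%r. f (sc P r x)) integrable_on cbox 0 1" using sc_integrable[OF Ck_continuous[OF f] x, of 0 P] by simp
  thus ?thesis using integral_sum[OF fP i] integrable_sum[OF fP i] by (subst integral_add) auto
 qed
 finally show ?thesis using x by (simp add: avg_def)
qed

text \<open>For \<open>r > 0\<close> the derivative along the segment is \<open>1 / r\<close> times
  the Euler field and so vanishes; the end point \<open>r = 0\<close> is reached by
  continuity.\<close>

lemma euler_constant_line:
 assumes f: "C (Suc 0) f" and x: "x : X" and P: "P <= V" and z: "!!y. y : X ==> (SUM p:P. y p * pd p f y) = 0"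
 shows "f (sc P 0 x) = f x"
proof -
 have "((%r::real. 0) has_integral (f (sc P 1 x) - f (sc P 0 x))) {0..1}"
 proof (rule fundamental_theorem_of_calculus_interior[where f = "%r. f (sc P r x)"])
  show "continuous_on {0..1} (%r. f (sc P r x))" using line_continuous[OF Ck_continuous[OF f] x] by simp
  fix r :: real assume r: "r : {0<..<1}"
  have "of_real r * (SUM p:P. x p * pd p f (sc P r x)) = (SUM p:P. sc P r x p * pd p f (sc P r x))"
   by (simp add: sum_distrib_left sc_def mult_ac)
  also have "... = 0" using z sc_in[OF x, of r P] r by simp
  finally have "(SUM p:P. x p * pd p f (sc P r x)) = 0" using r by simp
  thus "((%r. f (sc P r x)) has_vector_derivative 0) (at r)"
   using line_derivative[OF f x P, of r UNIV] r by simp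
 qed simp
 from has_integral_unique[OF this has_integral_0] show ?thesis by simp
qed

text \<open>By Hadamard's lemma \<open>f\<close> is its restriction to \<open>x q = 0\<close> plus
  \<open>x q\<close> times the average of \<open>pd q f\<close>. This expression can be
  differentiated along \<open>p\<close> and then along \<open>q\<close>, and
  \<open>avg_euler\<close> for \<open>pd p (pd q f)\<close> evaluates the result.\<close>

lemma pd_commute: assumes f: "C 3 f" and pq: "p : V" "q : V" shows "pd p (pd q f) = pd q (pd p f)"
proof
 fix x
 have f3: "C (Suc (Suc (Suc 0))) f" using f by (simp add: numeral_3_eq_3)
 note fq = Ck_SucD(1)[OF f3 pq(2)] and fp = Ck_SucD(1)[OF f3 pq(1)]
 note fqp = Ck_SucD(1)[OF fq pq(1)]
 have f1: "C (Suc 0) f" "C (Suc 0) (pd q f)" using Ck_SucD(3)[OF f3 pq(1)] Ck_SucD(3)[OF _ pq(1)] Ck_SucD(3)[OF fq pq(1)] by blast+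
 let ?G = "pd p (pd q f)"
 show "pd p (pd q f) x = pd q (pd p f) x"
 proof (cases "x : X & p ~= q")
  case True hence x: "x : X" and ne: "p ~= q" by auto
  have P: "{q} <= V" using pq by simp
  have z: "sc {q} 0 y : X" if "y : X" for y using sc_in[OF that, of 0] by simp
  have 1: "pd p f y = pd p f (sc {q} 0 y) + y q * avg {q} 0 ?G y" if y: "y : X" for y
  proof (rule has_partial_partial_on[OF y])
   have r: "has_partial (%y. f (sc {q} 0 y)) p y (pd p f (sc {q} 0 y))"
    using Ck_SucD(2)[OF f1(1) pq(1) z[OF y]] ne unfolding has_partial_def sc_upd by (simp add: sc_def)
   have "has_partial (avg {q} 0 (pd q f)) p y (avg {q} 0 ?G y)"
    using has_partial_avg[OF f1(2) y pq(1), of "{q}" 0] ne by simp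
   from has_partial_add[OF r has_partial_coord[OF this, of q]]
   have "has_partial (%y. f (sc {q} 0 y) + y q * avg {q} 0 (pd q f) y) p y (pd p f (sc {q} 0 y) + y q * avg {q} 0 ?G y)"
    using ne by simp
   thus "has_partial f p y (pd p f (sc {q} 0 y) + y q * avg {q} 0 ?G y)"
   proof (rule has_partial_cong[OF y pq(1), rotated])
    fix y assume "y : X"
    from avg_increment[OF f1(1) this P]
    show "f y = f (sc {q} 0 y) + y q * avg {q} 0 (pd q f) y" by (simp add: algebra_simps)
   qed qed
  have "has_partial (pd p f) q x (0 + (avg {q} 0 ?G x + x q * avg {q} 1 (pd q ?G) x))"
  proof (rule has_partial_cong[OF x pq(2) 1])
   have "sc {q} 0 (x(q := w)) = sc {q} 0 x" for w by (auto simp: sc_def)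
   hence "has_partial (%y. pd p f (sc {q} 0 y)) q x 0" by (simp add: has_partial_def)
   moreover have "has_partial (%y. y q * avg {q} 0 ?G y) q x (avg {q} 0 ?G x + x q * avg {q} 1 (pd q ?G) x)"
    using has_partial_coord[OF has_partial_avg[OF fqp x pq(2), of "{q}" 0], of q] by simp
   ultimately show "has_partial (%y. pd p f (sc {q} 0 y) + y q * avg {q} 0 ?G y) q x
     (0 + (avg {q} 0 ?G x + x q * avg {q} 1 (pd q ?G) x))" by (rule has_partial_add)
  qed
  hence "pd q (pd p f) x = avg {q} 0 ?G x + x q * avg {q} 1 (pd q ?G) x"
   using has_partial_partial_on[OF x] by simp
  thus ?thesis using avg_euler[OF fqp x P] by simp
 qed (auto simp: pd_outside)
qed

subsection \<open>Pull-back along coordinate maps\<close>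

context
 fixes X' V' A ka assumes X': "solid_domain X' V'"
  and into: "!!x. x : X' ==> (%p. if p : V - A then x (ka p) else 0) : X"
begin

abbreviation "pt x \<equiv> (%p. if p : V - A then x (ka p) else 0 :: 'k)"

text \<open>Varying the coordinate \<open>q\<close> moves all its copies \<open>p\<close> at the
  same speed: the chain rule with all \<open>c p\<close> equal to 1.\<close>

lemma has_partial_pullback: assumes f: "C (Suc 0) f" and x: "x : X'"
 shows "has_partial (%x. f (pt x)) q x (SUM p:{p : V. p ~: A & ka p = q}. pd p f (pt x))"
proof -
 let ?B = "{p : V. p ~: A & ka p = q}"
 let ?F = "%w. f (%p. if p : ?B then pt x p + w * 1 else pt x p)"
 have "(?F has_field_derivative (SUM p:?B. 1 * pd p f (pt x))) (at 0)"
  by (rule chain_rule[OF f into[OF x]]) auto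
 hence "((%w. ?F (w + - x q)) has_field_derivative (SUM p:?B. 1 * pd p f (pt x))) (at (x q))"
  by (subst DERIV_shift[symmetric]) simp
 moreover have "(%p. if p : ?B then pt x p + (w + - x q) * 1 else pt x p) = pt (x(q := w))" for w
  by auto
 ultimately show ?thesis unfolding has_partial_def by simp
qed

lemma Ck_pullback: "C k f ==> Ck k X' V' (%x. if x : X' then f (pt x) else 0)"
proof (induction k arbitrary: f)
 interpret Q: solid_domain X' V' by (rule X')
 have cont: "continuous_on X' (%x. f (pt x))" if "continuous_on X f" for f
 proof (rule continuous_on_compose2[OF that])
  show "continuous_on X' pt"
  proof (rule continuous_on_coordinatewise_then_product)
   show "continuous_on X' (%x. pt x i)" for i
    using coord_continuous[of X' "ka i"] by (cases "i : V"; cases "i : A") simp_all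
  qed qed (use into in auto)
 {
  case 0
  show ?case unfolding Ck.simps by (rule continuous_on_eq[OF cont[OF Ck_continuous[OF 0]]]) simp
 next case (Suc k)
  have "Ck (Suc k) X' V' (%x. f (pt x))"
  proof (rule Q.Ck_SucI[OF _ has_partial_pullback])
   show "continuous_on X' (%x. f (pt x))" by (rule cont[OF Ck_continuous[OF Suc.prems]])
   show "C (Suc 0) f" by (rule Ck_one[OF Suc.prems])
   fix q assume "q : V'"
   have "Ck k X' V' (%x. SUM p:{p : V. p ~: A & ka p = q}. (if x : X' then pd p f (pt x) else 0))"
    using finite_V Suc.IH Ck_SucD(1)[OF Suc.prems] by (intro Q.Ck_sum) auto
   thus "Ck k X' V' (%x. if x : X' then SUM p:{p : V. p ~: A & ka p = q}. pd p f (pt x) else 0)"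
    by (subst Q.Ck_cong) auto
  qed
  thus ?case by (subst Q.Ck_cong) auto
 }
qed

end

end

section \<open>Analytic and smooth disks\<close>

text \<open>The filter in \<open>D_near\<close> lets finitely many factors of a power share one
  radius. Both polydisks and round disks are covered.\<close>

locale reinhardt_disk =
 fixes u :: nat and D :: "(nat => 'k::{real_normed_field, banach}) set"
 assumes D_outside: "y : D ==> u <= s ==> y s = 0" and D_zero: "(%_. 0) : D"
  and D_near: "y : D ==> \<forall>\<^sub>F e in at_right 0. ALL y'. (ALL s<u. norm (y' s) <= norm (y s) + e) --> (ALL s>=u. y' s = 0) --> y' : D"

lemma reinhardt_disk: "is_disk u D ==> reinhardt_disk u D"
 for D :: "(nat => 'k::{real_normed_field, banach}) set"
proof -
 have lim: "((%e. a + e) \<longlongrightarrow> a) (at_right 0)" for a :: real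
  using tendsto_add[OF tendsto_const tendsto_ident_at, of a 0 "{0<..}"] by simp
 assume "is_disk u D"
 then consider rh where "ALL s<u. 0 < rh s" "D = polydisk u rh" | rh where "rh > 0" "D = round_disk u rh"
  by (auto simp: is_disk_def)
 thus ?thesis
 proof cases
  case 1 show ?thesis
  proof
   fix y assume y: "y : D"
   have "\<forall>\<^sub>F e in at_right 0. norm (y s) + e < rh s" if "s < u" for s
    using order_tendstoD(2)[OF lim, of "norm (y s)" "rh s"] y that 1 by (simp add: polydisk_def)
   hence "\<forall>\<^sub>F e in at_right 0. ALL s:{..<u}. norm (y s) + e < rh s"
    by (intro eventually_ball_finite) auto
   thus "\<forall>\<^sub>F e in at_right 0. ALL y'. (ALL s<u. norm (y' s) <= norm (y s) + e) --> (ALL s>=u. y' s = 0) --> y' : D"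
    by eventually_elim (auto simp: 1 polydisk_def intro: le_less_trans)
  qed (use 1 in "auto simp: polydisk_def")
 next case 2 show ?thesis
  proof
   fix y assume y: "y : D"
   have "((%e. \<Sum>s<u. (norm (y s) + e)\<^sup>2) \<longlongrightarrow> (\<Sum>s<u. (norm (y s))\<^sup>2)) (at_right 0)"
    by (intro tendsto_sum tendsto_power lim)
   hence "\<forall>\<^sub>F e in at_right 0. (\<Sum>s<u. (norm (y s) + e)\<^sup>2) < rh\<^sup>2"
    by (rule order_tendstoD(2)) (use y 2 in "simp add: round_disk_def")
   thus "\<forall>\<^sub>F e in at_right 0. ALL y'. (ALL s<u. norm (y' s) <= norm (y s) + e) --> (ALL s>=u. y' s = 0) --> y' : D"
   proof eventually_elim
    case (elim e)
    have "y' : D" if "ALL s<u. norm (y' s) <= norm (y s) + e" "ALL s>=u. y' s = 0" for y'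
    proof -
     have "(\<Sum>s<u. (norm (y' s))\<^sup>2) <= (\<Sum>s<u. (norm (y s) + e)\<^sup>2)"
      by (intro sum_mono power_mono) (use that in auto)
     thus ?thesis using elim that(2) by (simp add: 2 round_disk_def)
    qed
    thus ?case by blast
   qed qed (use 2 in "auto simp: round_disk_def")
 qed qed

context reinhardt_disk
begin

abbreviation "Dp \<equiv> disk_power D"
abbreviation "pD m \<equiv> partial_on (Dp m)"

lemma D_ex: "y : D ==> EX e>0. ALL y'. (ALL s<u. norm (y' s) <= norm (y s) + e) --> (ALL s>=u. y' s = 0) --> y' : D"
 using eventually_happens'[OF _ eventually_conj[OF eventually_at_right_less[of "0::real"] D_near]] by simp

lemma D_solid: "y : D ==> (!!s. norm (y' s) <= norm (y s)) ==> y' : D"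
  by (smt (verit) D_ex D_outside norm_le_zero_iff norm_zero)

lemma disk_power_iff: "x : Dp m <-> (ALL t<m. (%s. x (t, s)) : D) & (ALL p. p ~: vars u m --> x p = 0)"
proof -
 have "x (t, s) = 0" if "ALL t<m. (%s. x (t, s)) : D" "ALL t>=m. ALL s. x (t, s) = 0" "(t, s) ~: vars u m" for t s
  using that D_outside[of "%s. x (t, s)" s] by (cases "t < m") auto
 thus ?thesis by (auto simp: disk_power_def)
qed

lemma solid_power: "solid_domain (Dp m) (vars u m)"
proof
 show "finite (vars u m)" by simp
 show "(%_. 0) : Dp m" using D_zero by (simp add: disk_power_def)
next fix x :: "'k point" assume x: "x : Dp m"
 show "x p = 0" if "p ~: vars u m" for p using x that unfolding disk_power_iff by blast
 show "y : Dp m" if le: "!!p. norm (y p) <= norm (x p)" for y unfolding disk_power_iff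
 proof (intro conjI allI impI)
  show "(%s. y (t, s)) : D" if "t < m" for t
   by (rule D_solid[of "%s. x (t, s)"]) (use le x that in "auto simp: disk_power_iff")
  show "y p = 0" if "p ~: vars u m" for p using le[of p] x that unfolding disk_power_iff by force
 qed
 have "\<forall>\<^sub>F e in at_right 0. ALL t:{..<m}. ALL y'. (ALL s<u. norm (y' s) <= norm (x (t, s)) + e) --> (ALL s>=u. y' s = 0) --> y' : D"
  by (intro eventually_ball_finite ballI D_near) (use x in "auto simp: disk_power_iff")
 hence "EX e. e > 0 & (ALL t:{..<m}. ALL y'. (ALL s<u. norm (y' s) <= norm (x (t, s)) + e) --> (ALL s>=u. y' s = 0) --> y' : D)"
  using eventually_conj[OF eventually_at_right_less[of "0::real"]] eventually_happens' trivial_limit_at_right_real by blast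
 then obtain e where e: "e > 0"
  "!!t y'. t < m ==> (ALL s<u. norm (y' s) <= norm (x (t, s)) + e) ==> (ALL s>=u. y' s = 0) ==> y' : D" by blast
 have "y : Dp m" if y: "ALL p:vars u m. norm (y p - x p) < e" "ALL p. p ~: vars u m --> y p = 0" for y
  unfolding disk_power_iff
 proof (intro conjI allI impI)
  fix t assume t: "t < m"
  show "(%s. y (t, s)) : D"
  proof (rule e(2)[OF t]; intro allI impI)
   fix s assume "s < u"
   hence "norm (y (t, s) - x (t, s)) < e" using y(1) t by simp
   thus "norm (y (t, s)) <= norm (x (t, s)) + e" using norm_triangle_sub[of "y (t, s)" "x (t, s)"] by simp
  qed (use y(2) in simp)
 qed (use y(2) in blast)
 thus "EX e>0. ALL y. (ALL p:vars u m. norm (y p - x p) < e) --> (ALL p. p ~: vars u m --> y p = 0) --> y : Dp m"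
  using e(1) by blast
qed

definition smooth :: "nat => ('k point => 'k) set" where
 "smooth m = {f. (ALL k. Ck k (Dp m) (vars u m) f) & (ALL x. x ~: Dp m --> f x = 0)}"

abbreviation "coord_pull m r A x \<equiv> (%p. if p : vars u m - A then x (move r p) else (0::'k))"

definition disk_sub :: "nat => nat => (nat => nat) => (nat * nat) set => ('k point => 'k) => 'k point => 'k" where
 "disk_sub m m' r A f x = (if x : Dp m' then f (coord_pull m r A x) else 0)"

lemma coord_pull_in: "x : Dp m' ==> coord_pull m r A x : Dp m"
 unfolding disk_power_iff[of "coord_pull m r A x"]
proof (intro conjI allI impI)
 fix t assume x: "x : Dp m'" and t: "t < m"
 show "(%s. coord_pull m r A x (t, s)) : D"
 proof (cases "r t < m'")
  case True hence "(%s. x (r t, s)) : D" using x by (simp add: disk_power_def)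
  thus ?thesis by (rule D_solid) simp
 next case False hence "x (r t, s) = 0" for s using x by (simp add: disk_power_def)
  hence "(%s. coord_pull m r A x (t, s)) = (%s. 0)" by auto
  thus ?thesis using D_zero by simp
 qed qed simp

abbreviation "FF \<equiv> disk_with u D smooth"
abbreviation "LP \<equiv> log_partial FF"

lemma sel: "ddim FF = u" "fun_scale FF = (%a f x. a * f x)" "regular FF m = smooth m"
 "fun_one FF m = (%x. if x : Dp m then 1 else 0)"
 "LP v m p f = (if snd p < v then (%x. x p * pD m p f x) else pD m p f)"
 "fun_pull FF m m' r f = (%x. if x : Dp m'
    then f (%(t, s). if t < m then x (r t, s) else 0) else 0)"
 by (auto simp: disk_with_def log_partial_def)

context
 fixes m :: nat
begin

interpretation X: solid_domain "Dp m" "vars u m" by (rule solid_power)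

lemma smoothD: assumes "f : smooth m" shows "Ck k (Dp m) (vars u m) f" "x ~: Dp m ==> f x = 0"
 using assms by (auto simp: smooth_def)

lemma smooth_partial: "f : smooth m ==> p : vars u m ==> pD m p f : smooth m"
 using X.Ck_SucD(1)[OF smoothD(1)] X.pd_outside by (simp add: smooth_def)

lemma smooth_coord: "f : smooth m ==> (%x. x p * f x) : smooth m"
 using X.Ck_coord by (simp add: smooth_def)

lemma smooth_add: "f : smooth m ==> g : smooth m ==> (%x. f x + g x) : smooth m"
 using X.Ck_add by (simp add: smooth_def)

lemma smooth_scale: "f : smooth m ==> (%x. a * f x) : smooth m"
 using X.Ck_cmult by (simp add: smooth_def)

lemma smooth_zero: "(%x. 0) : smooth m" using X.Ck_const by (simp add: smooth_def)

lemma smooth_sum: "finite A ==> (!!i. i : A ==> f i : smooth m) ==> (%x. SUM i:A. f i x) : smooth m"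
 by (induction A rule: finite_induct) (simp_all add: smooth_zero smooth_add)

lemma smooth_avg: "f : smooth m ==> X.avg P j f : smooth m"
 using X.Ck_avg by (simp add: smooth_def X.avg_def)

lemma partial_coord: assumes "f : smooth m" "q : vars u m" shows "pD m q (%x. x p * f x)
  = (%x. (if q = p then f x else 0) + x p * pD m q f x)"
proof -
 have "pD m q (%x. x p * f x)
  = (%x. if x : Dp m then (if q = p then f x else 0) + x p * pD m q f x else 0)"
  by (rule X.pd_eq) (rule X.has_partial_coord[OF X.Ck_SucD(2)[OF smoothD(1)[OF assms(1)] assms(2)]])
 thus ?thesis using smoothD(2)[OF assms(1)] X.pd_outside by (auto simp: fun_eq_iff)
qed

lemma partial_sum: assumes "finite A" "!!i. i : A ==> f i : smooth m" "q : vars u m"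
 shows "pD m q (%x. SUM i:A. f i x) x = (SUM i:A. pD m q (f i) x)"
proof (cases "x : Dp m")
 case True
 have "has_partial (%x. SUM i:A. f i x) q x (SUM i:A. pD m q (f i) x)" unfolding has_partial_def
  by (rule DERIV_sum) (use X.Ck_SucD(2)[OF smoothD(1)[OF assms(2)] assms(3) True] in "simp add: has_partial_def")
 thus ?thesis by (rule has_partial_partial_on[OF True])
qed (simp add: X.pd_outside)

lemma euler_avg: assumes f: "f : smooth m" and P: "P <= vars u m"
 shows "X.avg P 0 f x + (SUM q:P. x q * pD m q (X.avg P 0 f) x) = f x"
proof (cases "x : Dp m")
 case True have "pD m q (X.avg P 0 f) x = X.avg P 1 (pD m q f) x" if "q : P" for q
  using has_partial_partial_on[OF True X.has_partial_avg[OF smoothD(1)[OF f] True, of q P 0]] that P by auto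
 thus ?thesis using X.avg_euler[OF smoothD(1)[OF f] True P] by simp
qed (simp add: smoothD(2)[OF f] X.avg_def X.pd_outside)

text \<open>Since \<open>g\<close> vanishes where the coordinates in \<open>P\<close> do, it is the
  sum of the \<open>x p * h p\<close> by Hadamard's lemma. On a product \<open>x p * k\<close> the
  Euler field acts as \<open>x p\<close> times 1 plus the Euler field of \<open>k\<close>, so
  \<open>k\<close> is taken to be the average of \<open>h p\<close>.\<close>

lemma euler_solution:
 assumes g: "g : smooth m" and P: "P <= vars u m" and z: "!!x. x : Dp m ==> g (X.sc P 0 x) = 0"
 shows "EX f:smooth m. ALL x. (SUM q:P. x q * pD m q f x) = g x"
proof -
 let ?pd = "pD m"
 have fP: "finite P" using P finite_vars by (rule finite_subset)
 have gp: "?pd p g : smooth m" if "p : P" for p by (rule smooth_partial[OF g subsetD[OF P that]])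
 define h where "h p = X.avg P 0 (?pd p g)" for p
 have h: "h p : smooth m" if "p : P" for p unfolding h_def by (rule smooth_avg[OF gp[OF that]])
 let ?f = "%x. SUM p:P. x p * X.avg P 0 (h p) x"
 have a: "X.avg P 0 (h p) : smooth m" if "p : P" for p by (rule smooth_avg[OF h[OF that]])
 have "?f : smooth m" by (rule smooth_sum[OF fP]) (rule smooth_coord[OF a])
 moreover have "(SUM q:P. x q * ?pd q ?f x) = g x" for x
 proof -
  have "?pd q ?f x = (SUM p:P. (if q = p then X.avg P 0 (h p) x else 0) + x p * ?pd q (X.avg P 0 (h p)) x)" if "q : P" for q
   using partial_sum[OF fP, of "%p x. x p * X.avg P 0 (h p) x" q x] smooth_coord[OF a] partial_coord[OF a, of _ q] P that by auto
  hence "(SUM q:P. x q * ?pd q ?f x)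
    = (SUM q:P. SUM p:P. x q * ((if q = p then X.avg P 0 (h p) x else 0) + x p * ?pd q (X.avg P 0 (h p)) x))"
   by (simp add: sum_distrib_left)
  also have "... = (SUM p:P. SUM q:P. x q * ((if q = p then X.avg P 0 (h p) x else 0) + x p * ?pd q (X.avg P 0 (h p)) x))"
   by (rule sum.swap)
  also have "... = (SUM p:P. x p * (X.avg P 0 (h p) x + (SUM q:P. x q * ?pd q (X.avg P 0 (h p)) x)))"
  proof (rule sum.cong[OF refl])
   fix p assume p: "p : P"
   have "(SUM q:P. x q * ((if q = p then X.avg P 0 (h p) x else 0) + x p * ?pd q (X.avg P 0 (h p)) x))
    = (SUM q:P. (if q = p then x p * X.avg P 0 (h p) x else 0) + x p * (x q * ?pd q (X.avg P 0 (h p)) x))"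
    by (rule sum.cong) (auto simp: algebra_simps)
   thus "(SUM q:P. x q * ((if q = p then X.avg P 0 (h p) x else 0) + x p * ?pd q (X.avg P 0 (h p)) x))
    = x p * (X.avg P 0 (h p) x + (SUM q:P. x q * ?pd q (X.avg P 0 (h p)) x))"
    using p fP by (simp add: sum.distrib sum_distrib_left[symmetric] distrib_left)
  qed
  also have "... = (SUM p:P. x p * h p x)" by (rule sum.cong[OF refl]) (simp add: euler_avg[OF h P])
  also have "... = g x"
  proof (cases "x : Dp m")
   case True
   thus ?thesis using X.avg_increment[OF smoothD(1)[OF g] True P] z[OF True] by (simp add: h_def)
  qed (simp add: h_def X.avg_def smoothD(2)[OF g])
  finally show ?thesis .
 qed
 ultimately show ?thesis by blast
qed

lemma coord_pull_sc: "x : Dp m ==> coord_pull m (%t. t) A x = X.sc (A Int vars u m) 0 x"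
  using X.X_zero by (auto simp: move_def X.sc_def fun_eq_iff)

lemma disk_sub_sc: "A <= vars u m ==> x : Dp m ==> disk_sub m m (%t. t) A f x = f (X.sc A 0 x)"
 by (simp only: disk_sub_def coord_pull_sc if_True Int_absorb2)

lemma euler_constant_sub:
 assumes f: "f : smooth m" and P: "P <= vars u m" and z: "!!x. (SUM q:P. x q * pD m q f x) = 0"
 shows "disk_sub m m (%t. t) P f = f"
proof
 fix x
 show "disk_sub m m (%t. t) P f x = f x"
 proof (cases "x : Dp m")
  case True
  thus ?thesis using disk_sub_sc[OF P True] X.euler_constant_line[OF smoothD(1)[OF f] True P z] by simp
 qed (simp add: disk_sub_def smoothD(2)[OF f])
qed

end

lemma smooth_sub: assumes f: "f : smooth m" shows "disk_sub m m' r A f : smooth m'"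
proof -
 have e: "disk_sub m m' r A f = (%x. if x : Dp m' then f (coord_pull m r A x) else 0)"
  by (rule ext) (simp only: disk_sub_def)
 have "Ck k (Dp m') (vars u m') (disk_sub m m' r A f)" for k
  unfolding e by (rule solid_domain.Ck_pullback[OF solid_power solid_power coord_pull_in smoothD(1)[OF f]])
 thus ?thesis by (simp add: smooth_def disk_sub_def)
qed

lemma partial_sub: assumes f: "f : smooth m" and q: "q : vars u m'" and x: "x : Dp m'"
 shows "pD m' q (disk_sub m m' r A f) x
  = (SUM p:{p : vars u m. p ~: A & move r p = q}. pD m p f (coord_pull m r A x))"
proof (rule has_partial_partial_on[OF x])
 have "has_partial (%x. f (coord_pull m r A x)) q x
  (SUM p:{p : vars u m. p ~: A & move r p = q}. pD m p f (coord_pull m r A x))"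
  by (rule solid_domain.has_partial_pullback[OF solid_power solid_power coord_pull_in smoothD(1)[OF f] x])
 thus "has_partial (disk_sub m m' r A f) q x
  (SUM p:{p : vars u m. p ~: A & move r p = q}. pD m p f (coord_pull m r A x))"
  by (rule solid_domain.has_partial_cong[OF solid_power x q, rotated]) (simp add: disk_sub_def)
qed

lemma smooth_plus: "f : smooth m ==> g : smooth m ==> f + g : smooth m"
 using smooth_add by (simp add: plus_fun_def)

lemma partial_add: assumes "f : smooth m" "g : smooth m" "p : vars u m"
 shows "pD m p (f + g) x = pD m p f x + pD m p g x"
 using partial_sum[of "{False, True}" "%b. if b then g else f" m p x] assms by (simp add: plus_fun_def)

lemma partial_scale:
 assumes "f : smooth m" "p : vars u m" shows "pD m p (%x. a * f x) x = a * pD m p f x"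
proof (cases "x : Dp m")
 case True interpret X: solid_domain "Dp m" "vars u m" by (rule solid_power)
 show ?thesis
  by (rule has_partial_partial_on[OF True X.has_partial_cmult[OF X.Ck_SucD(2)[OF smoothD(1)[OF assms(1)] assms(2) True]]])
qed (simp add: partial_on_def)

lemma log_partial_smooth: "f : smooth m ==> p : vars u m ==> LP v m p f : smooth m"
 using smooth_partial smooth_coord by (simp add: sel)

lemma log_partial_commute: assumes f: "f : smooth m" and p: "p : vars u m" and q: "q : vars u m"
 shows "LP v m p (LP v m q f) = LP v m q (LP v m p f)"
proof (cases "p = q")
 case False interpret X: solid_domain "Dp m" "vars u m" by (rule solid_power)
 have c: "pD m p (pD m q f) = pD m q (pD m p f)" by (rule X.pd_commute[OF smoothD(1)[OF f] p q])
 show ?thesis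
  using False partial_coord[OF smooth_partial[OF f q] p, of q] partial_coord[OF smooth_partial[OF f p] q, of p] c by (auto simp: sel)
qed simp

lemma disk_sub_sub: assumes "valid_sub u m m' r A"
 shows "disk_sub m' m'' r' A' (disk_sub m m' r A f) = disk_sub m m'' (r' o r) (A Un {p. move r p : A'}) f"
proof
 fix x
 have "move r p : vars u m'" if "p : vars u m - A" for p
  using assms that by (cases p) (auto simp: valid_sub_def)
 moreover have "move r' (move r p) = move (r' o r) p" for p by (cases p) simp
 ultimately have e: "coord_pull m r A (coord_pull m' r' A' x) = coord_pull m (r' o r) (A Un {p. move r p : A'}) x"
  by (intro ext) (simp del: split_paired_All)
 show "disk_sub m' m'' r' A' (disk_sub m m' r A f) x = disk_sub m m'' (r' o r) (A Un {p. move r p : A'}) f x"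
 proof (cases "x : Dp m''")
  case True thus ?thesis unfolding disk_sub_def using coord_pull_in[OF True] e by simp
 qed (simp add: disk_sub_def)
qed

lemma log_partial_sub:
 assumes f: "f : smooth m" and q: "q : vars u m'" shows "LP v m' q (disk_sub m m' r A f)
  = (SUM p:{p : vars u m. p ~: A & move r p = q}. disk_sub m m' r A (LP v m p f))"
proof
 fix x
 let ?P = "{p : vars u m. p ~: A & move r p = q}"
 show "LP v m' q (disk_sub m m' r A f) x = (SUM p:?P. disk_sub m m' r A (LP v m p f)) x"
  using move_snd partial_sub f q by (auto simp: disk_sub_def sel sum_distrib_left sum_fun_at partial_on_def intro!: sum.cong refl)
qed

lemma log_partial_vanish:
 assumes "p : vars u m" "p : A" "snd p < v" shows "disk_sub m m' r A (LP v m p f) = 0"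
 using assms by (simp add: disk_sub_def sel fun_eq_iff)

theorem disk_log_disk: assumes v: "v <= u" shows "log_disk FF v disk_sub"
proof -
 have FV: "vector_space (fun_scale FF)" by standard (auto simp: sel algebra_simps fun_eq_iff)
 interpret V: vector_space "fun_scale FF" by (rule FV)
 have P: "{t} \<times> {..<v} <= vars u m" if "t < m" for t m using that v by auto
 have es: "(\<Sum>s<v. LP v m (t, s) f) x = (SUM q:{t} \<times> {..<v}. x q * pD m q f x)" for m t f x
 proof -
  have "(\<Sum>s<v. LP v m (t, s) f) x = (\<Sum>s<v. x (t, s) * pD m (t, s) f x)"
   unfolding sum_fun_at by (intro sum.cong) (auto simp: sel)
  also have "... = (SUM q:Pair t ` {..<v}. x q * pD m q f x)"
   by (subst sum.reindex) (auto simp: inj_on_def)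
  also have "Pair t ` {..<v} = {t} \<times> {..<v}" by auto
  finally show ?thesis .
 qed
 show ?thesis
 proof (unfold_locales, unfold sel(1,3))
  show "v <= u" by (rule v)
  show "V.subspace (smooth m)" for m
   unfolding V.subspace_def using smooth_plus smooth_scale smooth_zero[of m] by (simp add: sel zero_fun_def)
  show "bij_betw (%a. fun_scale FF a (fun_one FF 0)) UNIV (smooth 0)"
  proof (rule bij_betw_byWitness[where f' = "%f. f (%_. 0)"])
   have X0: "x : Dp 0 <-> x = (%_. 0)" for x by (auto simp: disk_power_def)
   show "ALL f:smooth 0. fun_scale FF (f (%_. 0)) (fun_one FF 0) = f"
    by (auto simp: sel X0 smoothD(2))
   interpret X: solid_domain "Dp 0" "vars u 0" by (rule solid_power)
   have "fun_scale FF a (fun_one FF 0) : smooth 0" for a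
   proof -
    have "Ck k (Dp 0) (vars u 0) (%x. if x : Dp 0 then a else 0)" for k
     using X.Ck_cong[of "%x. if x : Dp 0 then a else 0" "%_. a" k] X.Ck_const by simp
    moreover have "(%x. a * (if x : Dp 0 then 1 else 0)) = (%x. if x : Dp 0 then a else 0)" by auto
    ultimately show ?thesis by (simp add: sel smooth_def)
   qed
   thus "(%a. fun_scale FF a (fun_one FF 0)) ` UNIV <= smooth 0" by blast
   show "ALL a:UNIV. fun_scale FF a (fun_one FF 0) (%_. 0) = a" by (simp add: sel X0)
  qed simp
 next fix p m f assume p: "p : vars u m" and f: "f : smooth m"
  show "LP v m p f : smooth m" by (rule log_partial_smooth[OF f p])
  show "LP v m p (fun_scale FF a f) = fun_scale FF a (LP v m p f)" for a
   using partial_scale[OF f p, of a] by (simp add: sel fun_eq_iff)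
  show "LP v m p (LP v m q f) = LP v m q (LP v m p f)" if "q : vars u m" for q
   by (rule log_partial_commute[OF f p that])
 next show "additive_on (smooth m) (LP v m p)" if "p : vars u m" for p m
   unfolding additive_on_def using partial_add that by (simp add: sel fun_eq_iff distrib_left)
  show "additive_on (smooth m) (disk_sub m m' r A)" for m m' r A
   by (simp add: additive_on_def disk_sub_def fun_eq_iff)
  show "disk_sub m m' r A (fun_scale FF a f) = fun_scale FF a (disk_sub m m' r A f)" for m m' r A a f
   by (simp add: disk_sub_def sel fun_eq_iff)
  show "disk_sub m m' r A f : smooth m'" if "f : smooth m" for m m' r A f by (rule smooth_sub[OF that])
  show "fun_pull FF m m' r f = disk_sub m m' r {} f" for m m' r f
  proof
   fix x
   have "(%(t, s). if t < m then x (r t, s) else 0) = coord_pull m r {} x" if "x : Dp m'"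
  using that by (auto simp: disk_power_iff)
   thus "fun_pull FF m m' r f x = disk_sub m m' r {} f x" by (simp add: sel disk_sub_def)
  qed
  show "disk_sub m m (%t. t) {} f = f" if "f : smooth m" for m f
  proof
   fix x
   interpret X: solid_domain "Dp m" "vars u m" by (rule solid_power)
   have "X.sc {} 0 x = x" by (simp add: X.sc_def)
   thus "disk_sub m m (%t. t) {} f x = f x"
    using disk_sub_sc[of "{}" m x f] smoothD(2)[OF that] by (cases "x : Dp m") (simp_all add: disk_sub_def)
  qed
  show "disk_sub m m' r A f = disk_sub m m' r' A' f"
   if "!!p. p : vars u m ==> p : A <-> p : A'" "!!t s. t < m ==> s < u ==> (t, s) ~: A ==> r t = r' t" for m m' r r' A A' f
  proof
   fix x
   have "coord_pull m r A x p = coord_pull m r' A' x p" for p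
    using that(1)[of p] that(2)[of "fst p" "snd p"] by (cases p) auto
   thus "disk_sub m m' r A f x = disk_sub m m' r' A' f x" unfolding disk_sub_def by presburger
  qed
  show "disk_sub m' m'' r' A' (disk_sub m m' r A f) = disk_sub m m'' (r' o r) (A Un {p. move r p : A'}) f"
   if "valid_sub u m m' r A" for m m' m'' r r' A A' f by (rule disk_sub_sub[OF that])
  show "LP v m' q (disk_sub m m' r A f)
    = (SUM p:{p : vars u m. p ~: A & move r p = q}. disk_sub m m' r A (LP v m p f))"
   if "q : vars u m'" "f : smooth m" for m m' r A q f by (rule log_partial_sub[OF that(2,1)])
  show "disk_sub m m' r A (LP v m p f) = 0" if "p : vars u m" "p : A" "snd p < v" for m m' r A p f
   by (rule log_partial_vanish[OF that])
 next fix t m s :: nat assume t: "t < m" and s: "v <= s" "s < u"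
  have P: "{(t, s)} <= vars u m" using t s by simp
  interpret X: solid_domain "Dp m" "vars u m" by (rule solid_power)
  show "EX f:smooth m. LP v m (t, s) f = g" if g: "g : smooth m" for g
  proof
   \<comment> \<open>The primitive vanishing at \<open>x (t, s) = 0\<close>; its derivative is 1
     plus the Euler field of one coordinate, applied to the average.\<close>
   note a = smooth_avg[OF g, of "{(t, s)}" 0]
   show "(%x. x (t, s) * X.avg {(t, s)} 0 g x) : smooth m" by (rule smooth_coord[OF a])
   show "LP v m (t, s) (%x. x (t, s) * X.avg {(t, s)} 0 g x) = g"
    using partial_coord[OF a, of "(t, s)" "(t, s)"] euler_avg[OF g P] t s by (simp add: sel)
  qed
  show "disk_sub m m (%t. t) {(t, s)} f = f" if "f : smooth m" "LP v m (t, s) f = 0" for f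
   by (rule euler_constant_sub[OF that(1) P]) (use that(2) s in "simp add: sel fun_eq_iff del: split_paired_All")
 next fix t m :: nat assume t: "t < m"
  show "EX f:smooth m. (\<Sum>s<v. LP v m (t, s) f) = g"
   if g: "g : smooth m" "disk_sub m m (%t. t) ({t} \<times> {..<v}) g = 0" for g
  proof -
   have "EX f:smooth m. ALL x. (SUM q:{t} \<times> {..<v}. x q * pD m q f x) = g x"
   proof (rule euler_solution[OF g(1) P[OF t]])
    fix x assume "x : Dp m"
    from disk_sub_sc[OF P[OF t] this, of g] g(2)
    show "g (solid_domain.sc ({t} \<times> {..<v}) 0 x) = 0" by simp
   qed
   then obtain f where f: "f : smooth m" "!!x. (SUM q:{t} \<times> {..<v}. x q * pD m q f x) = g x" by blast
   have "(\<Sum>s<v. LP v m (t, s) f) = g" by (rule ext) (simp only: es f(2))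
   thus ?thesis using f(1) by blast
  qed
  show "disk_sub m m (%t. t) ({t} \<times> {..<v}) f = f"
   if "f : smooth m" "(\<Sum>s<v. LP v m (t, s) f) = 0" for f
   by (rule euler_constant_sub[OF that(1) P[OF t]]) (use es[of m t f] that(2) in simp)
 qed qed

end

subsection \<open>Holomorphic functions have continuous partial derivatives of all orders\<close>

text \<open>Cauchy's formula for the derivative, with the contour integral written over the unit
  interval, where continuity and differentiability in parameters are available.\<close>

lemma cauchy_derivative:
 assumes "0 < r" "r < e" and g: "!!w. w : ball z e ==> g field_differentiable (at w)"
 shows "deriv g z = int01 (%th. g (z + of_real r * exp (2 * of_real pi * \<i> * of_real th))
  / (of_real r * exp (2 * of_real pi * \<i> * of_real th)))"
proof -
 let ?E = "%th::real. of_real r * exp (2 * of_real pi * \<i> * of_real th)"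
 have hol: "g holomorphic_on ball z e"
  unfolding holomorphic_on_def using g field_differentiable_at_within by blast
 have sub: "cball z r <= ball z e" using assms(2) by auto
 have "contour_integral (circlepath z r) (%w. g w / (w - z)^2) = (2 * pi * \<i>) * deriv g z"
  using holomorphic_on_subset[OF hol order_trans[OF ball_subset_cball sub]] holomorphic_on_imp_continuous_on[OF holomorphic_on_subset[OF hol sub]] assms(1)
  by (intro Cauchy_contour_integral_circlepath_2) auto
 moreover have "contour_integral (circlepath z r) (%w. g w / (w - z)^2)
   = int01 (%th. (2 * pi * \<i>) * (g (z + ?E th) / ?E th))"
  unfolding contour_integral_integral cbox_interval
 proof (rule integral_cong)
  fix th :: real
  have c: "circlepath z r th = z + ?E th" by (simp add: circlepath)
  have d: "vector_derivative (circlepath z r) (at th) = 2 * pi * \<i> * ?E th"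
   by (simp add: vector_derivative_circlepath)
  have "?E th ~= 0" using assms(1) by simp
  thus "g (circlepath z r th) / (circlepath z r th - z)\<^sup>2 * vector_derivative (circlepath z r) (at th)
    = (2 * pi * \<i>) * (g (z + ?E th) / ?E th)" unfolding c d by (simp add: power2_eq_square)
 qed
 moreover have "... = (2 * pi * \<i>) * int01 (%th. g (z + ?E th) / ?E th)"
  by (rule integral_mult_right)
 ultimately have "(2 * pi * \<i>) * deriv g z = (2 * pi * \<i>) * int01 (%th. g (z + ?E th) / ?E th)"
  by (simp only:)
 thus ?thesis by (simp only: mult_cancel_left) simp
qed

text \<open>Near a given point the partial derivatives are Cauchy integrals of \<open>f\<close> over
  circles of one fixed radius. Such integrals are continuous in the centre and can be differentiated
  along another coordinate under the integral sign; along \<open>p\<close> itself the theory of one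
  variable applies.\<close>

lemma holomorphic_partials: fixes X :: "complex point set"
 assumes dom: "solid_domain X V" and f: "continuous_on X f" "has_partials_on X V f" and p: "p : V"
 shows "continuous_on X (partial_on X p f)" "has_partials_on X V (partial_on X p f)"
proof -
 interpret solid_domain X V by (rule dom)
 define ee :: "real => real => complex" where "ee r th = of_real r * exp (2 * of_real pi * \<i> * of_real th)" for r th
 have ee: "norm (ee r th) = r" "ee r th ~= 0" if "r > 0" for r th using that by (auto simp: ee_def norm_mult)
 have ee_cont: "continuous_on S (%s. ee r (th s))" if "continuous_on S th" for S :: "'s::topological_space set" and r th
  unfolding ee_def by (intro continuous_intros that)
 have nbhd: "EX e>0. (ALL x p. (ALL q:V. norm (x q - x0 q) < e) --> (ALL q. q ~: V --> x q = 0) --> p : V -->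
   (ALL w:ball (x p) e. x(p := w) : X) & pd p f x = int01 (%th. f (x(p := x p + ee (e / 2) th)) / ee (e / 2) th))"
  if x0: "x0 : X" for x0
 proof -
  obtain e where e: "e > 0" "!!y. (ALL p:V. norm (y p - x0 p) < e) ==> (ALL p. p ~: V --> y p = 0) ==> y : X"
   using X_open[OF x0] by blast
  have "(ALL w:ball (x p) (e / 2). x(p := w) : X) &
    pd p f x = int01 (%th. f (x(p := x p + ee (e / 2 / 2) th)) / ee (e / 2 / 2) th)"
   if x: "ALL q:V. norm (x q - x0 q) < e / 2" "ALL q. q ~: V --> x q = 0" and p: "p : V" for x p
  proof
   have upd: "x(p := w) : X" if "w : ball (x p) (e / 2)" for w
   proof (rule e(2))
    have "norm (w - x0 p) < e"
     using that x(1) p norm_triangle_ineq[of "w - x p" "x p - x0 p"] by (force simp: dist_norm norm_minus_commute)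
    thus "ALL q:V. norm ((x(p := w)) q - x0 q) < e" using x(1) e(1) by auto
   qed (use x p in auto)
   thus "ALL w:ball (x p) (e / 2). x(p := w) : X" by blast
   have xX: "x : X" using upd[of "x p"] e(1) by simp
   have "pd p f x = deriv (%w. f (x(p := w))) (x p)" using xX by (simp add: partial_on_def)
   also have "... = int01 (%th. f (x(p := x p + ee (e / 2 / 2) th)) / ee (e / 2 / 2) th)"
    unfolding ee_def
   proof (rule cauchy_derivative[where e = "e / 2"])
    fix w assume "w : ball (x p) (e / 2)"
    from upd[OF this] have "(%w'. f ((x(p := w))(p := w'))) field_differentiable (at ((x(p := w)) p))"
     using f(2) p unfolding has_partials_on_def by blast
    thus "(%w. f (x(p := w))) field_differentiable (at w)" by simp
   qed (use e(1) in auto)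
   finally show "pd p f x = int01 (%th. f (x(p := x p + ee (e / 2 / 2) th)) / ee (e / 2 / 2) th)" .
  qed
  moreover have "e / 2 > 0" using e(1) by simp
  ultimately show ?thesis by blast
 qed
 have cont: "continuous_on X (pd p f)" if p: "p : V" for p
  unfolding continuous_on_eq_continuous_within
 proof
  fix x0 assume x0: "x0 : X"
  from nbhd[OF x0] obtain e where e: "e > 0"
   "!!x p w. ALL q:V. norm (x q - x0 q) < e ==> ALL q. q ~: V --> x q = 0 ==> p : V ==> w : ball (x p) e ==> x(p := w) : X"
   "!!x p. ALL q:V. norm (x q - x0 q) < e ==> ALL q. q ~: V --> x q = 0 ==> p : V ==>
    pd p f x = int01 (%th. f (x(p := x p + ee (e / 2) th)) / ee (e / 2) th)" by blast
  \<comment> \<open>Only finitely many coordinates are restricted, so this set is open in the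
    product topology; on its intersection with \<open>X\<close> one radius serves for all
    centres.\<close>
  define O' where "O' = (INT q:V. {x :: complex point. norm (x q - x0 q) < e})"
  have oO: "open O'" unfolding O'_def
  proof (rule open_INT[OF finite_V], rule ballI)
   fix q
   have "continuous_on UNIV (%x :: complex point. norm (x q - x0 q))"
    by (intro continuous_intros continuous_on_product_coordinates)
   hence "open ((%x :: complex point. norm (x q - x0 q)) -` {..<e})"
    by (rule open_vimage[OF open_lessThan])
   thus "open {x :: complex point. norm (x q - x0 q) < e}" by (simp add: vimage_def)
  qed
  let ?N = "X Int O'"
  have N: "ALL q:V. norm (x q - x0 q) < e" "ALL q. q ~: V --> x q = 0" if "x : ?N" for x
   using that X_zero unfolding O'_def by blast+
  have r: "e / 2 > 0" using e(1) by simp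
  have "continuous_on (?N \<times> cbox 0 1) (%z. f ((fst z)(p := fst z p + ee (e / 2) (snd z))) / ee (e / 2) (snd z))"
  proof (rule continuous_on_divide)
   show "continuous_on (?N \<times> cbox 0 1) (%z. f ((fst z)(p := fst z p + ee (e / 2) (snd z))))"
   proof (rule continuous_on_compose2[OF f(1)])
    have c: "continuous_on (?N \<times> cbox (0::real) 1) (%z. fst z i)" for i
     by (rule continuous_on_compose2[OF coord_continuous[of UNIV] continuous_on_fst[OF continuous_on_id]]) simp
    show "continuous_on (?N \<times> cbox 0 1) (%z. (fst z)(p := fst z p + ee (e / 2) (snd z)))"
    proof (rule continuous_on_coordinatewise_then_product)
     fix i show "continuous_on (?N \<times> cbox 0 1) (%z. ((fst z)(p := fst z p + ee (e / 2) (snd z))) i)"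
      using c[of i] continuous_on_add[OF c[of p] ee_cont[OF continuous_on_snd[OF continuous_on_id]]] by (cases "i = p") simp_all
    qed
    show "(%z. (fst z)(p := fst z p + ee (e / 2) (snd z))) ` (?N \<times> cbox 0 1) <= X"
  using ee r N p by (auto simp: dist_norm intro!: image_subsetI e)
   qed
   show "continuous_on (?N \<times> cbox 0 1) (%z. ee (e / 2) (snd z))" by (rule ee_cont[OF continuous_on_snd[OF continuous_on_id]])
  qed (use ee(2)[OF r] in blast)
  hence "continuous_on ?N (%x. int01 (%th. f (x(p := x p + ee (e / 2) th)) / ee (e / 2) th))"
   by (intro integral_continuous_on_param) (simp add: split_beta)
  hence "continuous_on ?N (pd p f)" by (rule continuous_on_eq) (use e(3)[OF N p] in simp)
  moreover have x0N: "x0 : O'" using e(1) by (simp add: O'_def)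
  moreover have "at x0 within X = at x0 within ?N" by (rule at_within_nhd[OF x0N oO]) auto
  ultimately show "continuous (at x0 within X) (pd p f)"
   unfolding continuous_on_eq_continuous_within using x0 by simp
 qed
 show "continuous_on X (pd p f)" by (rule cont[OF p])
 show "has_partials_on X V (pd p f)" unfolding has_partials_on_def
 proof (intro ballI)
  fix x q assume x: "x : X" and q: "q : V"
  from nbhd[OF x] obtain e where e: "e > 0"
   "!!y p w. ALL q:V. norm (y q - x q) < e ==> ALL q. q ~: V --> y q = 0 ==> p : V ==> w : ball (y p) e ==> y(p := w) : X"
   "!!y p. ALL q:V. norm (y q - x q) < e ==> ALL q. q ~: V --> y q = 0 ==> p : V ==>
    pd p f y = int01 (%th. f (y(p := y p + ee (e / 2) th)) / ee (e / 2) th)" by blast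
  have upd: "x(q := w) : X" if "w : ball (x q) e" for w
   by (rule e(2)) (use that e(1) X_zero[OF x] q in auto)
  let ?U = "ball (x q) e"
  show "(%w. pd p f (x(q := w))) field_differentiable (at (x q))"
  proof (cases "q = p")
   case True let ?g = "%w. f (x(p := w))"
   have "?g field_differentiable (at w)" if "w : ?U" for w
  using f p upd that True by (force simp: has_partials_on_def)
   hence "?g holomorphic_on ?U" unfolding holomorphic_on_def using field_differentiable_at_within by blast
   hence "deriv ?g holomorphic_on ?U" by (rule holomorphic_deriv) simp
   hence "(deriv ?g has_field_derivative deriv (deriv ?g) (x q)) (at (x q))"
    using e(1) by (intro holomorphic_derivI[of _ ?U]) auto
   hence "((%w. pd p f (x(q := w))) has_field_derivative deriv (deriv ?g) (x q)) (at (x q))"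
    by (rule has_field_derivative_transform_within_open[OF _ open_ball[of "x q" e]])
     (use e(1) upd True in "auto simp: partial_on_def")
   thus ?thesis unfolding field_differentiable_def by blast
  next case False have r: "e / 2 > 0" using e(1) by simp
   have near: "ALL q':V. norm ((x(q := w)) q' - x q') < e" "ALL q'. q' ~: V --> (x(q := w)) q' = 0" if "w : ?U" for w
    using that e(1) X_zero[OF x] q by (auto simp: dist_norm norm_minus_commute)
   let ?y = "%w th. (x(q := w))(p := x p + ee (e / 2) th)"
   have yX: "?y w th : X" if "w : ?U" for w th
  using e near that p ee r False by (auto simp: dist_norm)
   have ycont: "continuous_on S (%s. ?y (g s) (th s))" if "continuous_on S g" "continuous_on S th"
    for S :: "'s::topological_space set" and g th
   proof (rule continuous_on_coordinatewise_then_product)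
    fix i
    show "continuous_on S (%s. ?y (g s) (th s) i)"
     using that(1) continuous_on_add[OF continuous_on_const ee_cont[OF that(2)]] by (cases "i = p"; cases "i = q") simp_all
   qed
   have "((%w. int01 (%th. f (?y w th) / ee (e / 2) th)) has_field_derivative
     int01 (%th. pd q f (?y (x q) th) / ee (e / 2) th)) (at (x q) within ?U)"
   proof (rule leibniz_rule_field_derivative)
    fix w and th :: real assume w: "w : ?U"
    have "has_partial f q (?y w th) (pd q f (?y w th))" by (rule has_partials_onD[OF f(2) yX[OF w] q])
    moreover have "(?y w th)(q := w') = ?y w' th" for w' using False by auto
    ultimately have "((%w. f (?y w th)) has_field_derivative pd q f (?y w th)) (at w)"
     unfolding has_partial_def using False by simp
    hence "((%w. f (?y w th) / ee (e / 2) th) has_field_derivative pd q f (?y w th) / ee (e / 2) th) (at w)"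
     by (rule DERIV_cdivide)
    thus "((%w. f (?y w th) / ee (e / 2) th) has_field_derivative pd q f (?y w th) / ee (e / 2) th) (at w within ?U)"
     by (rule has_field_derivative_at_within)
   next fix w assume w: "w : ?U"
    have "continuous_on (cbox 0 1) (%th. f (?y w th))"
     by (rule continuous_on_compose2[OF f(1) ycont[OF continuous_on_const continuous_on_id]]) (use yX[OF w] in auto)
    thus "(%th. f (?y w th) / ee (e / 2) th) integrable_on cbox 0 1"
     using ee(2)[OF r] by (intro integrable_continuous continuous_on_divide ee_cont continuous_on_id) auto
   next have "continuous_on (?U \<times> cbox 0 1) (%z. pd q f (?y (fst z) (snd z)))"
     by (rule continuous_on_compose2[OF cont[OF q] ycont[OF continuous_on_fst[OF continuous_on_id] continuous_on_snd[OF continuous_on_id]]])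
      (use yX in auto)
    hence "continuous_on (?U \<times> cbox 0 1) (%z. pd q f (?y (fst z) (snd z)) / ee (e / 2) (snd z))"
     using ee(2)[OF r] by (intro continuous_on_divide ee_cont continuous_on_snd continuous_on_id) auto
    thus "continuous_on (?U \<times> cbox 0 1) (%(w, th). pd q f (?y w th) / ee (e / 2) th)" by (simp add: split_beta)
   qed (use e(1) in auto)
   hence d: "((%w. int01 (%th. f (?y w th) / ee (e / 2) th)) has_field_derivative
     int01 (%th. pd q f (?y (x q) th) / ee (e / 2) th)) (at (x q))"
    using at_within_open[of "x q" ?U] e(1) by simp
   have eq: "int01 (%th. f (?y w th) / ee (e / 2) th) = pd p f (x(q := w))" if "w : ?U" for w
    using e(3)[of "x(q := w)" p, OF near[OF that] p] False by simp
   have "((%w. pd p f (x(q := w))) has_field_derivative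
     int01 (%th. pd q f (?y (x q) th) / ee (e / 2) th)) (at (x q))"
    by (rule has_field_derivative_transform_within_open[OF d open_ball[of "x q" e] _ eq]) (use e(1) in simp_all)
   thus ?thesis unfolding field_differentiable_def by blast
  qed qed qed

lemma holomorphic_Ck: fixes X :: "complex point set"
 assumes "solid_domain X V" "continuous_on X f" "has_partials_on X V f" shows "Ck k X V f"
 using assms(2,3)
proof (induction k arbitrary: f)
 case (Suc k)
 thus ?case using holomorphic_partials[OF assms(1) Suc.prems] by auto
qed simp

lemma smooth_eq_holomorphic: "is_disk u D ==> reinhardt_disk.smooth u D m = holomorphic_functions u D m"
proof -
 assume "is_disk u D"
 then interpret reinhardt_disk u D by (rule reinhardt_disk)
 have "continuous_on (disk_power D m) f & has_partials_on (disk_power D m) (vars u m) f"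
  if "Ck (Suc 0) (disk_power D m) (vars u m) f" for f using that by simp
 thus ?thesis
  unfolding smooth_def holomorphic_functions_def using holomorphic_Ck[OF solid_power] by blast
qed

lemma smooth_eq_smooth_functions: "is_disk u D ==> reinhardt_disk.smooth u D m = smooth_functions u D m"
proof -
 assume "is_disk u D"
 then interpret reinhardt_disk u D by (rule reinhardt_disk)
 show ?thesis unfolding smooth_def smooth_functions_def Ck_C_k_on ..
qed

theorem mainTheorem2:
  fixes u v :: nat
  assumes "v \<le> u"
  shows
    "(let Z = form_quasi_algebra (formal_disk u :: ('k::field_char_0, 'k mfps) disk_functions) v
      in koszul_quasi_algebra Z \<and> koszul_quasi_coalgebra (quadratic_dual Z)) \<and>
     (\<forall>D. is_disk u D \<longrightarrow>
       (let Z = form_quasi_algebra (analytic_disk u D) v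
        in koszul_quasi_algebra Z \<and> koszul_quasi_coalgebra (quadratic_dual Z))) \<and>
     (\<forall>D. is_disk u D \<longrightarrow>
       (let Z = form_quasi_algebra (smooth_disk u D) v
        in koszul_quasi_algebra Z \<and> koszul_quasi_coalgebra (quadratic_dual Z)))"
  unfolding Let_def
proof (intro conjI[OF _ conjI] allI impI)
 show "koszul_quasi_algebra (form_quasi_algebra (formal_disk u :: ('k, 'k mfps) disk_functions) v) &
   koszul_quasi_coalgebra (quadratic_dual (form_quasi_algebra (formal_disk u :: ('k, 'k mfps) disk_functions) v))"
  by (rule log_disk.koszul_ZZ[OF formal_log_disk[OF assms]])
next
 fix D :: "(nat => complex) set" assume D: "is_disk u D"
 have "analytic_disk u D = disk_with u D (reinhardt_disk.smooth u D)"
  unfolding analytic_disk_def using smooth_eq_holomorphic[OF D] by presburger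
 thus "koszul_quasi_algebra (form_quasi_algebra (analytic_disk u D) v) &
   koszul_quasi_coalgebra (quadratic_dual (form_quasi_algebra (analytic_disk u D) v))"
  using log_disk.koszul_ZZ[OF reinhardt_disk.disk_log_disk[OF reinhardt_disk[OF D] assms]] by simp
next
 fix D :: "(nat => real) set" assume D: "is_disk u D"
 have "smooth_disk u D = disk_with u D (reinhardt_disk.smooth u D)"
  unfolding smooth_disk_def using smooth_eq_smooth_functions[OF D] by presburger
 thus "koszul_quasi_algebra (form_quasi_algebra (smooth_disk u D) v) &
   koszul_quasi_coalgebra (quadratic_dual (form_quasi_algebra (smooth_disk u D) v))"
  using log_disk.koszul_ZZ[OF reinhardt_disk.disk_log_disk[OF reinhardt_disk[OF D] assms]] by simp
qed

end
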